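(* Let $f\colon(X,Z_X)\to(Y,Z_Y)$ be a $b$-map between compact connected $b$-oriented $b$-manifolds (of even dimension), $J$ a $b$-almost-complex structure on $(X,Z_X)$, $\omega_Y$ a $b$-symplectic form on $(Y,Z_Y)$, and $c\in H^2(X;\mathbb{R})$. Assume that (i) $J$ is $(\omega_Y,f)$-tame; (ii) for each $y\in Y$, the fiber $F_y=f^{-1}(y)$ has a neighbourhood $W_y$ with a closed two-form $\eta_y\in\Omega^2(W_y)$ such that $[\eta_y]=c|_{W_y}\in H^2(W_y;\mathbb{R})$ and $\rho_X^*\eta_y$ tames $J|_{\ker{}^bdf_x}$ for all $x\in W_y$. Then $(X,Z_X)$ admits a log-symplectic structure.
   Context: All manifolds are smooth, compact and without boundary (except open neighbourhoods), not necessarily orientable; maps are smooth. A hypersurface is a smooth embedded closed codimension-one submanifold (possibly empty or disconnected). A log-symplectic structure on a $2n$-dimensional manifold $X$ is a Poisson bivector $\pi$ such that $\bigwedge^n\pi$ is transverse to the zero section of $\bigwedge^{2n}TX$; put $Z_\pi=(\bigwedge^n\pi)^{-1}(0)$. A pair $(X,Z_X)$ (manifold and hypersurface) admits a log-symplectic structure if there is one with $Z_\pi=Z_X$. A $b$-manifold is a pair $(X,Z_X)$ of a manifold and a hypersurface, with its $b$-tangent bundle ${}^bTX\to X$, the vector bundle whose sections are the vector fields on $X$ tangent to $Z_X$; it is a Lie algebroid with anchor $\rho_X\colon{}^bTX\to TX$ the natural map, an isomorphism away from $Z_X$. Sections of $\bigwedge^k({}^bTX)^*$ are $b$-$k$-forms,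 with space ${}^b\Omega^k(X)$ and Lie algebroid differential; ordinary forms pull back to $b$-forms via $\rho_X^*\colon\Omega^k(X)\to{}^b\Omega^k(X)$. A $b$-orientation is an orientation of ${}^bTX$. A $b$-almost-complex structure is a (continuous) vector bundle complex structure on ${}^bTX$. A $b$-symplectic form is a closed nondegenerate $b$-two-form. Both induce $b$-orientations, and only those inducing the given $b$-orientations are considered. A $b$-map $f\colon(X,Z_X)\to(Y,Z_Y)$ is a map $f\colon X\to Y$ with $f^{-1}(Z_Y)=Z_X$ and $f$ transverse to $Z_Y$; it induces a bundle map ${}^bdf\colon{}^bTX\to{}^bTY$ covering $f$ with $\rho_Y\circ{}^bdf=df\circ\rho_X$, and pulls back $b$-forms to $b$-forms. $J$ is $(\omega_Y,f)$-tame if $f^*\omega_Y(v,Jv)>0$ for all $v\in{}^bTX\setminus\ker{}^bdf$; in this case $\ker{}^bdf_x$ is $J$-invariant for all $x$. A $b$-two-form $\eta$ tames $J|_{\ker{}^bdf_x}$ if $\eta(v,Jv)>0$ for all nonzero $v\in\ker{}^bdf_x$. *)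

theory Defs
  imports "HOL-Analysis.Analysis"
begin

section \<open>Smooth manifolds\<close>

text \<open>
  A manifold is a whole (Hausdorff) type \<open>'x\<close> together with an atlas of charts into a
  finite-dimensional inner product space \<open>'e\<close>.  The sort \<open>real_inner\<close> is used instead of
  \<open>euclidean_space\<close> because the latter excludes dimension 0.  Compactness is imposed separately;
  together with the atlas it implies second countability.
\<close>

fun C_on :: "nat \<Rightarrow> 'a::real_normed_vector set \<Rightarrow> ('a \<Rightarrow> 'b::real_normed_vector) \<Rightarrow> bool" where
  "C_on 0 S f \<longleftrightarrow> continuous_on S f"
| "C_on (Suc k) S f \<longleftrightarrow> continuous_on S f \<and> (\<forall>p\<in>S. f differentiable (at p)) \<and>
     (\<forall>v. C_on k S (\<lambda>p. frechet_derivative f (at p) v))"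

text \<open>Only used for open sets in finite-dimensional spaces, where this is the usual notion.\<close>
definition smooth_on :: "'a::real_normed_vector set \<Rightarrow> ('a \<Rightarrow> 'b::real_normed_vector) \<Rightarrow> bool" where
  "smooth_on S f \<longleftrightarrow> (\<forall>k. C_on k S f)"

type_synonym ('x, 'e) chart = "'x set \<times> ('x \<Rightarrow> 'e)"
type_synonym ('x, 'e) atlas = "('x, 'e) chart set"

definition is_chart :: "('x::t2_space, 'e::real_inner) chart \<Rightarrow> bool" where
  "is_chart = (\<lambda>(U, \<phi>). open U \<and> open (\<phi> ` U) \<and> homeomorphism U (\<phi> ` U) \<phi> (inv_into U \<phi>))"

definition compatible :: "('x::t2_space, 'e::real_inner) chart \<Rightarrow> ('x, 'e) chart \<Rightarrow> bool" where
  "compatible = (\<lambda>(U, \<phi>) (V, \<psi>).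
     smooth_on (\<phi> ` (U \<inter> V)) (\<lambda>p. \<psi> (inv_into U \<phi> p)) \<and>
     smooth_on (\<psi> ` (U \<inter> V)) (\<lambda>p. \<phi> (inv_into V \<psi> p)))"

definition manifold :: "('x::t2_space, 'e::real_inner) atlas \<Rightarrow> bool" where
  "manifold A \<longleftrightarrow>
     (\<exists>B::'e set. finite B \<and> span B = UNIV) \<and>
     (\<forall>C\<in>A. is_chart C) \<and> (\<Union>C\<in>A. fst C) = UNIV \<and>
     (\<forall>C\<in>A. \<forall>D\<in>A. compatible C D)"

definition mdim :: "('x::t2_space, 'e::real_inner) atlas \<Rightarrow> nat" where
  "mdim A = dim (UNIV :: 'e set)"

text \<open>Charts of the maximal atlas.\<close>
definition smooth_chart :: "('x::t2_space, 'e::real_inner) atlas \<Rightarrow> ('x, 'e) chart \<Rightarrow> bool" where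
  "smooth_chart A C \<longleftrightarrow> is_chart C \<and> (\<forall>D\<in>A. compatible C D)"

definition smooth_fun :: "('x::t2_space, 'e::real_inner) atlas \<Rightarrow> 'x set \<Rightarrow> ('x \<Rightarrow> real) \<Rightarrow> bool" where
  "smooth_fun A W g \<longleftrightarrow>
     (\<forall>(U, \<phi>)\<in>A. smooth_on (\<phi> ` (U \<inter> W)) (\<lambda>p. g (inv_into U \<phi> p)))"

definition smooth_near :: "('x::t2_space, 'e::real_inner) atlas \<Rightarrow> 'x \<Rightarrow> ('x \<Rightarrow> real) \<Rightarrow> bool" where
  "smooth_near A x g \<longleftrightarrow> (\<exists>W. open W \<and> x \<in> W \<and> smooth_fun A W g)"

definition smooth_map ::
  "('x::t2_space, 'e::real_inner) atlas \<Rightarrow> ('y::t2_space, 'h::real_inner) atlas \<Rightarrow> ('x \<Rightarrow> 'y) \<Rightarrow> bool" where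
  "smooth_map A B f \<longleftrightarrow> continuous_on UNIV f \<and>
     (\<forall>(U, \<phi>)\<in>A. \<forall>(V, \<psi>)\<in>B. smooth_on (\<phi> ` (U \<inter> f -` V)) (\<lambda>p. \<psi> (f (inv_into U \<phi> p))))"

definition hypersurface :: "('x::t2_space, 'e::real_inner) atlas \<Rightarrow> 'x set \<Rightarrow> bool" where
  "hypersurface A Z \<longleftrightarrow> closed Z \<and>
     (\<forall>x\<in>Z. \<exists>U \<phi> e. smooth_chart A (U, \<phi>) \<and> x \<in> U \<and> e \<noteq> 0 \<and>
        \<phi> ` (U \<inter> Z) = {p \<in> \<phi> ` U. inner e p = 0})"


section \<open>Tangent vectors and vector fields\<close>

text \<open>
  Tangent vectors at \<open>x\<close> are derivations of the algebra of germs at \<open>x\<close> of smooth functions.  They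
  are represented as functionals on all functions, with the value 0 on functions that are not
  smooth near \<open>x\<close>, so that the representation is unique.
\<close>

type_synonym 'x tvec = "('x \<Rightarrow> real) \<Rightarrow> real"
type_synonym 'x vfield = "'x \<Rightarrow> 'x tvec"

definition tangent_space :: "('x::t2_space, 'e::real_inner) atlas \<Rightarrow> 'x \<Rightarrow> 'x tvec set" where
  "tangent_space A x = {v.
     (\<forall>g h a b. smooth_near A x g \<longrightarrow> smooth_near A x h \<longrightarrow>
        v (\<lambda>p. a * g p + b * h p) = a * v g + b * v h) \<and>
     (\<forall>g h. smooth_near A x g \<longrightarrow> smooth_near A x h \<longrightarrow>
        v (\<lambda>p. g p * h p) = v g * h x + g x * v h) \<and>
     (\<forall>g h. smooth_near A x g \<longrightarrow> smooth_near A x h \<longrightarrow>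
        (\<forall>\<^sub>F p in nhds x. g p = h p) \<longrightarrow> v g = v h) \<and>
     (\<forall>g. \<not> smooth_near A x g \<longrightarrow> v g = 0)}"

text \<open>The image of the tangent space of the submanifold \<open>Z\<close> at \<open>x \<in> Z\<close>.\<close>
definition tangent_space_sub ::
  "('x::t2_space, 'e::real_inner) atlas \<Rightarrow> 'x set \<Rightarrow> 'x \<Rightarrow> 'x tvec set" where
  "tangent_space_sub A Z x = {v \<in> tangent_space A x.
     \<forall>g. smooth_near A x g \<longrightarrow> (\<forall>\<^sub>F p in nhds x. p \<in> Z \<longrightarrow> g p = 0) \<longrightarrow> v g = 0}"

definition differential ::
  "('y::t2_space, 'h::real_inner) atlas \<Rightarrow> ('x \<Rightarrow> 'y) \<Rightarrow> 'x \<Rightarrow> 'x tvec \<Rightarrow> 'y tvec" where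
  "differential B f x v = (\<lambda>g. if smooth_near B (f x) g then v (\<lambda>p. g (f p)) else 0)"

text \<open>Smooth vector fields on the open set \<open>W\<close>; values outside \<open>W\<close> are irrelevant.\<close>
definition vector_fields :: "('x::t2_space, 'e::real_inner) atlas \<Rightarrow> 'x set \<Rightarrow> 'x vfield set" where
  "vector_fields A W = {V. (\<forall>x\<in>W. V x \<in> tangent_space A x) \<and>
     (\<forall>W' g. open W' \<longrightarrow> W' \<subseteq> W \<longrightarrow> smooth_fun A W' g \<longrightarrow> smooth_fun A W' (\<lambda>p. V p g))}"

definition lie_bracket ::
  "('x::t2_space, 'e::real_inner) atlas \<Rightarrow> 'x vfield \<Rightarrow> 'x vfield \<Rightarrow> 'x vfield" where
  "lie_bracket A V W = (\<lambda>x g. if smooth_near A x g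
     then V x (\<lambda>p. W p g) - W x (\<lambda>p. V p g) else 0)"

text \<open>
  The Koszul formulas for the Lie algebroid differential in degrees 1 and 2.  A form is given by
  its action on sections; sections are vector fields (for the b-tangent bundle, those tangent to
  the hypersurface) and act on functions through the anchor.
\<close>

definition koszul1 :: "('x::t2_space, 'e::real_inner) atlas \<Rightarrow> ('x vfield \<Rightarrow> 'x \<Rightarrow> real) \<Rightarrow>
    'x vfield \<Rightarrow> 'x vfield \<Rightarrow> 'x \<Rightarrow> real" where
  "koszul1 A F U V x = U x (F V) - V x (F U) - F (lie_bracket A U V) x"

definition koszul2 :: "('x::t2_space, 'e::real_inner) atlas \<Rightarrow> ('x vfield \<Rightarrow> 'x vfield \<Rightarrow> 'x \<Rightarrow> real) \<Rightarrow>
    'x vfield \<Rightarrow> 'x vfield \<Rightarrow> 'x vfield \<Rightarrow> 'x \<Rightarrow> real" where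
  "koszul2 A F U V W x =
     U x (F V W) - V x (F U W) + W x (F U V)
     - F (lie_bracket A U V) W x + F (lie_bracket A U W) V x - F (lie_bracket A V W) U x"


section \<open>Differential forms on open sets and de Rham cohomology\<close>

type_synonym 'x form1 = "'x \<Rightarrow> 'x tvec \<Rightarrow> real"
type_synonym 'x form2 = "'x \<Rightarrow> 'x tvec \<Rightarrow> 'x tvec \<Rightarrow> real"

definition linear_on_tangent ::
  "('x::t2_space, 'e::real_inner) atlas \<Rightarrow> 'x \<Rightarrow> ('x tvec \<Rightarrow> real) \<Rightarrow> bool" where
  "linear_on_tangent A x h \<longleftrightarrow> (\<forall>v\<in>tangent_space A x. \<forall>w\<in>tangent_space A x. \<forall>a b.
     h (\<lambda>g. a * v g + b * w g) = a * h v + b * h w)"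

definition one_form :: "('x::t2_space, 'e::real_inner) atlas \<Rightarrow> 'x set \<Rightarrow> 'x form1 \<Rightarrow> bool" where
  "one_form A W \<alpha> \<longleftrightarrow> (\<forall>x\<in>W. linear_on_tangent A x (\<alpha> x)) \<and>
     (\<forall>V\<in>vector_fields A W. smooth_fun A W (\<lambda>p. \<alpha> p (V p)))"

definition two_form :: "('x::t2_space, 'e::real_inner) atlas \<Rightarrow> 'x set \<Rightarrow> 'x form2 \<Rightarrow> bool" where
  "two_form A W \<eta> \<longleftrightarrow>
     (\<forall>x\<in>W. \<forall>u\<in>tangent_space A x. linear_on_tangent A x (\<eta> x u) \<and>
        (\<forall>v\<in>tangent_space A x. \<eta> x u v = - \<eta> x v u)) \<and>
     (\<forall>U\<in>vector_fields A W. \<forall>V\<in>vector_fields A W. smooth_fun A W (\<lambda>p. \<eta> p (U p) (V p)))"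

definition closed_two_form :: "('x::t2_space, 'e::real_inner) atlas \<Rightarrow> 'x set \<Rightarrow> 'x form2 \<Rightarrow> bool" where
  "closed_two_form A W \<eta> \<longleftrightarrow> two_form A W \<eta> \<and>
     (\<forall>U\<in>vector_fields A W. \<forall>V\<in>vector_fields A W. \<forall>V'\<in>vector_fields A W. \<forall>x\<in>W.
        koszul2 A (\<lambda>V V' p. \<eta> p (V p) (V' p)) U V V' x = 0)"

definition cohomologous ::
  "('x::t2_space, 'e::real_inner) atlas \<Rightarrow> 'x set \<Rightarrow> 'x form2 \<Rightarrow> 'x form2 \<Rightarrow> bool" where
  "cohomologous A W \<eta> \<gamma> \<longleftrightarrow> (\<exists>\<alpha>. one_form A W \<alpha> \<and>
     (\<forall>U\<in>vector_fields A W. \<forall>V\<in>vector_fields A W. \<forall>x\<in>W.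
        \<eta> x (U x) (V x) - \<gamma> x (U x) (V x) = koszul1 A (\<lambda>V p. \<alpha> p (V p)) U V x))"

text \<open>
  Real cohomology in degree 2 is de Rham cohomology; a class on \<open>W\<close> is the set of all closed
  two-forms on \<open>W\<close> representing it.
\<close>

definition dR_class ::
  "('x::t2_space, 'e::real_inner) atlas \<Rightarrow> 'x set \<Rightarrow> 'x form2 \<Rightarrow> 'x form2 set" where
  "dR_class A W \<gamma> = {\<eta>. closed_two_form A W \<eta> \<and> cohomologous A W \<eta> \<gamma>}"

definition dR_H2 :: "('x::t2_space, 'e::real_inner) atlas \<Rightarrow> 'x set \<Rightarrow> 'x form2 set set" where
  "dR_H2 A W = dR_class A W ` {\<gamma>. closed_two_form A W \<gamma>}"

definition dR_restrict ::
  "('x::t2_space, 'e::real_inner) atlas \<Rightarrow> 'x set \<Rightarrow> 'x form2 set \<Rightarrow> 'x form2 set" where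
  "dR_restrict A W c = (\<Union>\<gamma>\<in>c. dR_class A W \<gamma>)"


section \<open>Linear algebra\<close>

text \<open>
  The Leibniz formula; the library determinant is indexed by types, whereas the dimension here
  is a term.
\<close>
definition det_nat :: "nat \<Rightarrow> (nat \<Rightarrow> nat \<Rightarrow> real) \<Rightarrow> real" where
  "det_nat m a = (\<Sum>s | s permutes {..<m}. of_int (sign s) * (\<Prod>i<m. a i (s i)))"

text \<open>
  The \<open>n\<close>-th exterior power of an alternating bilinear form, evaluated on \<open>2 * n\<close> arguments.
\<close>
definition wedge_power :: "nat \<Rightarrow> ('v \<Rightarrow> 'v \<Rightarrow> real) \<Rightarrow> 'v list \<Rightarrow> real" where
  "wedge_power n \<beta> vs = (\<Sum>s | s permutes {..<2 * n}.
     of_int (sign s) * (\<Prod>i<n. \<beta> (vs ! s (2 * i)) (vs ! s (2 * i + 1)))) / 2 ^ n"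


section \<open>Log-symplectic structures\<close>

definition cotangent_space :: "('x::t2_space, 'e::real_inner) atlas \<Rightarrow> 'x \<Rightarrow> ('x tvec \<Rightarrow> real) set" where
  "cotangent_space A x = {\<alpha>. linear_on_tangent A x \<alpha> \<and> (\<forall>v. v \<notin> tangent_space A x \<longrightarrow> \<alpha> v = 0)}"

definition d_fun :: "('x::t2_space, 'e::real_inner) atlas \<Rightarrow> ('x \<Rightarrow> real) \<Rightarrow> 'x \<Rightarrow> 'x tvec \<Rightarrow> real" where
  "d_fun A g x = (\<lambda>v. if v \<in> tangent_space A x then v g else 0)"

text \<open>A bivector at \<open>x\<close> is an alternating bilinear form on the cotangent space.\<close>
type_synonym 'x bivector = "'x \<Rightarrow> ('x tvec \<Rightarrow> real) \<Rightarrow> ('x tvec \<Rightarrow> real) \<Rightarrow> real"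

definition bivector_field :: "('x::t2_space, 'e::real_inner) atlas \<Rightarrow> 'x bivector \<Rightarrow> bool" where
  "bivector_field A \<pi> \<longleftrightarrow>
     (\<forall>x. \<forall>\<alpha>\<in>cotangent_space A x. \<forall>\<beta>\<in>cotangent_space A x.
        \<pi> x \<alpha> \<beta> = - \<pi> x \<beta> \<alpha> \<and>
        (\<forall>\<gamma>\<in>cotangent_space A x. \<forall>a b.
           \<pi> x \<alpha> (\<lambda>v. a * \<beta> v + b * \<gamma> v) = a * \<pi> x \<alpha> \<beta> + b * \<pi> x \<alpha> \<gamma>)) \<and>
     (\<forall>g h. smooth_fun A UNIV g \<longrightarrow> smooth_fun A UNIV h \<longrightarrow>
        smooth_fun A UNIV (\<lambda>x. \<pi> x (d_fun A g x) (d_fun A h x)))"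

definition poisson_bracket :: "('x::t2_space, 'e::real_inner) atlas \<Rightarrow> 'x bivector \<Rightarrow>
    ('x \<Rightarrow> real) \<Rightarrow> ('x \<Rightarrow> real) \<Rightarrow> 'x \<Rightarrow> real" where
  "poisson_bracket A \<pi> g h = (\<lambda>x. \<pi> x (d_fun A g x) (d_fun A h x))"

definition poisson_bivector :: "('x::t2_space, 'e::real_inner) atlas \<Rightarrow> 'x bivector \<Rightarrow> bool" where
  "poisson_bivector A \<pi> \<longleftrightarrow> bivector_field A \<pi> \<and>
     (\<forall>g h k. smooth_fun A UNIV g \<longrightarrow> smooth_fun A UNIV h \<longrightarrow> smooth_fun A UNIV k \<longrightarrow>
        (\<forall>x. poisson_bracket A \<pi> g (poisson_bracket A \<pi> h k) x
           + poisson_bracket A \<pi> h (poisson_bracket A \<pi> k g) x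
           + poisson_bracket A \<pi> k (poisson_bracket A \<pi> g h) x = 0))"

definition top_power_zeros :: "('x::t2_space, 'e::real_inner) atlas \<Rightarrow> nat \<Rightarrow> 'x bivector \<Rightarrow> 'x set" where
  "top_power_zeros A n \<pi> = {x. \<forall>\<alpha>s. length \<alpha>s = 2 * n \<longrightarrow> set \<alpha>s \<subseteq> cotangent_space A x \<longrightarrow>
     wedge_power n (\<pi> x) \<alpha>s = 0}"

definition cotangent_basis ::
  "('x::t2_space, 'e::real_inner) atlas \<Rightarrow> 'x \<Rightarrow> ('x tvec \<Rightarrow> real) list \<Rightarrow> bool" where
  "cotangent_basis A x \<alpha>s \<longleftrightarrow> set \<alpha>s \<subseteq> cotangent_space A x \<and>
     (\<forall>\<alpha>\<in>cotangent_space A x. \<exists>!cs. length cs = length \<alpha>s \<and>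
        \<alpha> = (\<lambda>v. \<Sum>i<length \<alpha>s. cs ! i * (\<alpha>s ! i) v))"

text \<open>
  Functions \<open>g\<^sub>1, \<dots>, g\<^sub>2\<^sub>n\<close> whose differentials form a basis at \<open>x\<close> trivialise the top exterior power
  of the tangent bundle near \<open>x\<close> by evaluation on \<open>dg\<^sub>1, \<dots>, dg\<^sub>2\<^sub>n\<close>.  Transversality of a section
  of a line bundle to the zero section means that in such trivialisations the differential of the
  section is nonzero at each zero.
\<close>
definition log_symplectic :: "('x::t2_space, 'e::real_inner) atlas \<Rightarrow> 'x bivector \<Rightarrow> bool" where
  "log_symplectic A \<pi> \<longleftrightarrow> poisson_bivector A \<pi> \<and> (\<exists>n. mdim A = 2 * n \<and>
     (\<forall>x\<in>top_power_zeros A n \<pi>. \<forall>gs. length gs = 2 * n \<longrightarrow> (\<forall>g\<in>set gs. smooth_near A x g) \<longrightarrow>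
        cotangent_basis A x (map (\<lambda>g. d_fun A g x) gs) \<longrightarrow>
        (\<exists>v\<in>tangent_space A x. v (\<lambda>p. wedge_power n (\<pi> p) (map (\<lambda>g. d_fun A g p) gs)) \<noteq> 0)))"

definition admits_log_symplectic :: "('x::t2_space, 'e::real_inner) atlas \<Rightarrow> 'x set \<Rightarrow> bool" where
  "admits_log_symplectic A Z \<longleftrightarrow>
     (\<exists>\<pi>. log_symplectic A \<pi> \<and> top_power_zeros A (mdim A div 2) \<pi> = Z)"


section \<open>The b-tangent bundle\<close>

definition b_manifold :: "('x::t2_space, 'e::real_inner) atlas \<Rightarrow> 'x set \<Rightarrow> bool" where
  "b_manifold A Z \<longleftrightarrow> manifold A \<and> hypersurface A Z"

text \<open>
  The vector bundle with module of sections \<open>b_fields A Z\<close>: its fibre at \<open>x\<close> is the quotient of this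
  module by the submodule generated by products \<open>h * B\<close> with \<open>h x = 0\<close> and \<open>B\<close> in the module.
  Elements of the fibre are equivalence classes of sections.
\<close>

definition b_fields :: "('x::t2_space, 'e::real_inner) atlas \<Rightarrow> 'x set \<Rightarrow> 'x vfield set" where
  "b_fields A Z = {V \<in> vector_fields A UNIV. \<forall>x\<in>Z. V x \<in> tangent_space_sub A Z x}"

type_synonym 'x bvec = "'x vfield set"

definition b_class :: "('x::t2_space, 'e::real_inner) atlas \<Rightarrow> 'x set \<Rightarrow> 'x \<Rightarrow> 'x vfield \<Rightarrow> 'x bvec" where
  "b_class A Z x V = {W \<in> b_fields A Z. \<exists>(k::nat) h B.
     (\<forall>i<k. smooth_fun A UNIV (h i) \<and> h i x = 0 \<and> B i \<in> b_fields A Z) \<and>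
     (\<forall>p g. V p g - W p g = (\<Sum>i<k. h i p * B i p g))}"

definition b_fibre :: "('x::t2_space, 'e::real_inner) atlas \<Rightarrow> 'x set \<Rightarrow> 'x \<Rightarrow> 'x bvec set" where
  "b_fibre A Z x = b_class A Z x ` b_fields A Z"

definition b_rep :: "'x bvec \<Rightarrow> 'x vfield" where
  "b_rep u = (SOME V. V \<in> u)"

text \<open>The anchor; all representatives of a class at \<open>x\<close> have the same value at \<open>x\<close>.\<close>
definition anchor :: "'x \<Rightarrow> 'x bvec \<Rightarrow> 'x tvec" where
  "anchor x u = b_rep u x"

text \<open>Linear combinations in the fibre at \<open>x\<close>; the empty one is the zero vector.\<close>
definition b_lincomb :: "('x::t2_space, 'e::real_inner) atlas \<Rightarrow> 'x set \<Rightarrow> 'x \<Rightarrow>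
    real list \<Rightarrow> 'x bvec list \<Rightarrow> 'x bvec" where
  "b_lincomb A Z x cs us = b_class A Z x (\<lambda>p g. \<Sum>i<length us. cs ! i * b_rep (us ! i) p g)"

abbreviation b_zero :: "('x::t2_space, 'e::real_inner) atlas \<Rightarrow> 'x set \<Rightarrow> 'x \<Rightarrow> 'x bvec" where
  "b_zero A Z x \<equiv> b_lincomb A Z x [] []"

definition b_basis :: "('x::t2_space, 'e::real_inner) atlas \<Rightarrow> 'x set \<Rightarrow> 'x \<Rightarrow> 'x bvec list \<Rightarrow> bool" where
  "b_basis A Z x us \<longleftrightarrow> set us \<subseteq> b_fibre A Z x \<and>
     (\<forall>u\<in>b_fibre A Z x. \<exists>!cs. length cs = length us \<and> u = b_lincomb A Z x cs us)"

text \<open>Global sections restricting to a frame over the open set \<open>U\<close>; such frames exist near every point.\<close>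
definition b_frame :: "('x::t2_space, 'e::real_inner) atlas \<Rightarrow> 'x set \<Rightarrow> 'x set \<Rightarrow> 'x vfield list \<Rightarrow> bool" where
  "b_frame A Z U Es \<longleftrightarrow> open U \<and> length Es = mdim A \<and> set Es \<subseteq> b_fields A Z \<and>
     (\<forall>x\<in>U. b_basis A Z x (map (b_class A Z x) Es))"


section \<open>Structures on the b-tangent bundle\<close>

text \<open>A \<open>b\<close>-\<open>k\<close>-form is needed only for \<open>k = 2\<close>.\<close>

type_synonym 'x bform2 = "'x \<Rightarrow> 'x bvec \<Rightarrow> 'x bvec \<Rightarrow> real"

definition b_two_form :: "('x::t2_space, 'e::real_inner) atlas \<Rightarrow> 'x set \<Rightarrow> 'x bform2 \<Rightarrow> bool" where
  "b_two_form A Z \<omega> \<longleftrightarrow>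
     (\<forall>x. \<forall>u\<in>b_fibre A Z x. \<forall>v\<in>b_fibre A Z x.
        \<omega> x u v = - \<omega> x v u \<and>
        (\<forall>w\<in>b_fibre A Z x. \<forall>a b. \<omega> x u (b_lincomb A Z x [a, b] [v, w]) = a * \<omega> x u v + b * \<omega> x u w)) \<and>
     (\<forall>U\<in>b_fields A Z. \<forall>V\<in>b_fields A Z.
        smooth_fun A UNIV (\<lambda>p. \<omega> p (b_class A Z p U) (b_class A Z p V)))"

definition b_closed :: "('x::t2_space, 'e::real_inner) atlas \<Rightarrow> 'x set \<Rightarrow> 'x bform2 \<Rightarrow> bool" where
  "b_closed A Z \<omega> \<longleftrightarrow> (\<forall>U\<in>b_fields A Z. \<forall>V\<in>b_fields A Z. \<forall>W\<in>b_fields A Z. \<forall>x.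
     koszul2 A (\<lambda>V W p. \<omega> p (b_class A Z p V) (b_class A Z p W)) U V W x = 0)"

definition b_symplectic :: "('x::t2_space, 'e::real_inner) atlas \<Rightarrow> 'x set \<Rightarrow> 'x bform2 \<Rightarrow> bool" where
  "b_symplectic A Z \<omega> \<longleftrightarrow> b_two_form A Z \<omega> \<and> b_closed A Z \<omega> \<and>
     (\<forall>x. \<forall>u\<in>b_fibre A Z x. (\<forall>v\<in>b_fibre A Z x. \<omega> x u v = 0) \<longrightarrow> u = b_zero A Z x)"

definition b_almost_complex ::
  "('x::t2_space, 'e::real_inner) atlas \<Rightarrow> 'x set \<Rightarrow> ('x \<Rightarrow> 'x bvec \<Rightarrow> 'x bvec) \<Rightarrow> bool" where
  "b_almost_complex A Z J \<longleftrightarrow>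
     (\<forall>x. \<forall>u\<in>b_fibre A Z x. J x u \<in> b_fibre A Z x \<and>
        J x (J x u) = b_lincomb A Z x [-1] [u] \<and>
        (\<forall>v\<in>b_fibre A Z x. \<forall>a b.
           J x (b_lincomb A Z x [a, b] [u, v]) = b_lincomb A Z x [a, b] [J x u, J x v])) \<and>
     (\<forall>U Es. b_frame A Z U Es \<longrightarrow> (\<forall>V\<in>b_fields A Z. \<exists>a.
        (\<forall>i<mdim A. continuous_on U (a i)) \<and>
        (\<forall>x\<in>U. J x (b_class A Z x V) =
           b_lincomb A Z x (map (\<lambda>i. a i x) [0..<mdim A]) (map (b_class A Z x) Es))))"

text \<open>
  An orientation is given by the set of positively oriented ordered bases of each fibre; near each
  point there has to be a frame that is positively oriented throughout.
\<close>
definition same_orientation :: "('x::t2_space, 'e::real_inner) atlas \<Rightarrow> 'x set \<Rightarrow> 'x \<Rightarrow>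
    'x bvec list \<Rightarrow> 'x bvec list \<Rightarrow> bool" where
  "same_orientation A Z x us vs \<longleftrightarrow> (\<exists>a. det_nat (mdim A) a > 0 \<and>
     (\<forall>j<mdim A. vs ! j = b_lincomb A Z x (map (a j) [0..<mdim A]) us))"

definition b_orientation ::
  "('x::t2_space, 'e::real_inner) atlas \<Rightarrow> 'x set \<Rightarrow> ('x \<Rightarrow> 'x bvec list set) \<Rightarrow> bool" where
  "b_orientation A Z Or \<longleftrightarrow>
     (\<forall>x. \<exists>us. b_basis A Z x us \<and> Or x = {vs. b_basis A Z x vs \<and> same_orientation A Z x us vs}) \<and>
     (\<forall>x. \<exists>U Es. x \<in> U \<and> b_frame A Z U Es \<and> (\<forall>p\<in>U. map (b_class A Z p) Es \<in> Or p))"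

text \<open>The complex orientation: bases \<open>v\<^sub>1, J v\<^sub>1, \<dots>, v\<^sub>n, J v\<^sub>n\<close> are positive.\<close>
definition J_induces_orientation :: "('x::t2_space, 'e::real_inner) atlas \<Rightarrow> 'x set \<Rightarrow>
    ('x \<Rightarrow> 'x bvec \<Rightarrow> 'x bvec) \<Rightarrow> ('x \<Rightarrow> 'x bvec list set) \<Rightarrow> bool" where
  "J_induces_orientation A Z J Or \<longleftrightarrow> (\<forall>x us. set us \<subseteq> b_fibre A Z x \<longrightarrow>
     b_basis A Z x (concat (map (\<lambda>u. [u, J x u]) us)) \<longrightarrow>
     concat (map (\<lambda>u. [u, J x u]) us) \<in> Or x)"

text \<open>The symplectic orientation: the top exterior power of \<open>\<omega>\<close> is a positive volume form.\<close>
definition form_induces_orientation :: "('x::t2_space, 'e::real_inner) atlas \<Rightarrow> 'x set \<Rightarrow>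
    'x bform2 \<Rightarrow> ('x \<Rightarrow> 'x bvec list set) \<Rightarrow> bool" where
  "form_induces_orientation A Z \<omega> Or \<longleftrightarrow>
     (\<forall>x. \<forall>us\<in>Or x. wedge_power (mdim A div 2) (\<omega> x) us > 0)"


section \<open>b-maps\<close>

definition transverse_to :: "('x::t2_space, 'e::real_inner) atlas \<Rightarrow> ('y::t2_space, 'h::real_inner) atlas \<Rightarrow>
    'y set \<Rightarrow> ('x \<Rightarrow> 'y) \<Rightarrow> bool" where
  "transverse_to A B ZY f \<longleftrightarrow> (\<forall>x. f x \<in> ZY \<longrightarrow>
     tangent_space B (f x) =
       {(\<lambda>g. differential B f x v g + w g) | v w.
          v \<in> tangent_space A x \<and> w \<in> tangent_space_sub B ZY (f x)})"

definition b_map :: "('x::t2_space, 'e::real_inner) atlas \<Rightarrow> 'x set \<Rightarrow> ('y::t2_space, 'h::real_inner) atlas \<Rightarrow>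
    'y set \<Rightarrow> ('x \<Rightarrow> 'y) \<Rightarrow> bool" where
  "b_map A ZX B ZY f \<longleftrightarrow> smooth_map A B f \<and> f -` ZY = ZX \<and> transverse_to A B ZY f"

text \<open>Smooth bundle maps between b-tangent bundles covering \<open>f\<close>, with the value \<open>{}\<close> (which is not a
  b-tangent vector) outside the fibres.\<close>
definition b_bundle_map :: "('x::t2_space, 'e::real_inner) atlas \<Rightarrow> 'x set \<Rightarrow> ('y::t2_space, 'h::real_inner) atlas \<Rightarrow>
    'y set \<Rightarrow> ('x \<Rightarrow> 'y) \<Rightarrow> ('x \<Rightarrow> 'x bvec \<Rightarrow> 'y bvec) \<Rightarrow> bool" where
  "b_bundle_map A ZX B ZY f D \<longleftrightarrow>
     (\<forall>x. \<forall>u. u \<notin> b_fibre A ZX x \<longrightarrow> D x u = {}) \<and>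
     (\<forall>x. \<forall>u\<in>b_fibre A ZX x. D x u \<in> b_fibre B ZY (f x) \<and>
        (\<forall>v\<in>b_fibre A ZX x. \<forall>a b.
           D x (b_lincomb A ZX x [a, b] [u, v]) = b_lincomb B ZY (f x) [a, b] [D x u, D x v])) \<and>
     (\<forall>U Es. b_frame B ZY U Es \<longrightarrow> (\<forall>V\<in>b_fields A ZX. \<exists>a.
        (\<forall>i<mdim B. smooth_fun A (f -` U) (a i)) \<and>
        (\<forall>x\<in>f -` U. D x (b_class A ZX x V) =
           b_lincomb B ZY (f x) (map (\<lambda>i. a i x) [0..<mdim B]) (map (b_class B ZY (f x)) Es))))"

text \<open>The map induced by a b-map \<open>f\<close> is the unique smooth bundle map lifting the differential of \<open>f\<close>
  through the anchors.\<close>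
definition b_differential :: "('x::t2_space, 'e::real_inner) atlas \<Rightarrow> 'x set \<Rightarrow> ('y::t2_space, 'h::real_inner) atlas \<Rightarrow>
    'y set \<Rightarrow> ('x \<Rightarrow> 'y) \<Rightarrow> 'x \<Rightarrow> 'x bvec \<Rightarrow> 'y bvec" where
  "b_differential A ZX B ZY f = (THE D. b_bundle_map A ZX B ZY f D \<and>
     (\<forall>x. \<forall>u\<in>b_fibre A ZX x. anchor (f x) (D x u) = differential B f x (anchor x u)))"

definition b_kernel :: "('x::t2_space, 'e::real_inner) atlas \<Rightarrow> 'x set \<Rightarrow> ('y::t2_space, 'h::real_inner) atlas \<Rightarrow>
    'y set \<Rightarrow> ('x \<Rightarrow> 'y) \<Rightarrow> 'x \<Rightarrow> 'x bvec set" where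
  "b_kernel A ZX B ZY f x =
     {u \<in> b_fibre A ZX x. b_differential A ZX B ZY f x u = b_zero B ZY (f x)}"

definition b_pullback :: "('x::t2_space, 'e::real_inner) atlas \<Rightarrow> 'x set \<Rightarrow> ('y::t2_space, 'h::real_inner) atlas \<Rightarrow>
    'y set \<Rightarrow> ('x \<Rightarrow> 'y) \<Rightarrow> 'y bform2 \<Rightarrow> 'x bform2" where
  "b_pullback A ZX B ZY f \<omega> = (\<lambda>x u v.
     \<omega> (f x) (b_differential A ZX B ZY f x u) (b_differential A ZX B ZY f x v))"

definition anchor_pullback :: "'x form2 \<Rightarrow> 'x bform2" where
  "anchor_pullback \<eta> = (\<lambda>x u v. \<eta> x (anchor x u) (anchor x v))"

definition form_map_tame :: "('x::t2_space, 'e::real_inner) atlas \<Rightarrow> 'x set \<Rightarrow> ('y::t2_space, 'h::real_inner) atlas \<Rightarrow>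
    'y set \<Rightarrow> 'y bform2 \<Rightarrow> ('x \<Rightarrow> 'y) \<Rightarrow> ('x \<Rightarrow> 'x bvec \<Rightarrow> 'x bvec) \<Rightarrow> bool" where
  "form_map_tame A ZX B ZY \<omega> f J \<longleftrightarrow>
     (\<forall>x. \<forall>v\<in>b_fibre A ZX x - b_kernel A ZX B ZY f x. b_pullback A ZX B ZY f \<omega> x v (J x v) > 0)"

definition tames_on_kernel :: "('x::t2_space, 'e::real_inner) atlas \<Rightarrow> 'x set \<Rightarrow> ('y::t2_space, 'h::real_inner) atlas \<Rightarrow>
    'y set \<Rightarrow> ('x \<Rightarrow> 'y) \<Rightarrow> 'x bform2 \<Rightarrow> ('x \<Rightarrow> 'x bvec \<Rightarrow> 'x bvec) \<Rightarrow> 'x \<Rightarrow> bool" where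
  "tames_on_kernel A ZX B ZY f \<eta> J x \<longleftrightarrow>
     (\<forall>v\<in>b_kernel A ZX B ZY f x. v \<noteq> b_zero A ZX x \<longrightarrow> \<eta> x v (J x v) > 0)"

end

theory Submission
  imports Defs "Jordan_Normal_Form.Determinant"
begin

text \<open>
  This is Thurston's construction of symplectic forms on total spaces. Let \<open>\<gamma>\<close> represent \<open>c\<close>. By
  compactness of \<open>X\<close>, the sets \<open>W\<^sub>y\<close> contain preimages of neighbourhoods of the points \<open>y\<close>, and finitely
  many of these neighbourhoods cover \<open>Y\<close>. With \<open>\<eta>\<^sub>i - \<gamma> = d\<alpha>\<^sub>i\<close> and a subordinate partition of unity \<open>\<sigma>\<^sub>i\<close> of \<open>Y\<close>,
  the form \<open>\<eta> = \<gamma> + \<Sum>\<^sub>i d((\<sigma>\<^sub>i \<circ> f) \<alpha>\<^sub>i)\<close> is closed. Since \<open>d(\<sigma>\<^sub>i \<circ> f)\<close> vanishes on the kernel of the b-differential,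
  \<open>\<eta>\<close> restricts there to the convex combination \<open>\<Sum>\<^sub>i (\<sigma>\<^sub>i \<circ> f) \<eta>\<^sub>i\<close>, which tames \<open>J\<close>. The pullback of \<open>\<omega>\<^sub>Y\<close> is
  nonnegative on all pairs \<open>(v, J v)\<close> and positive off the kernel, so by compactness \<open>f\<^sup>*\<omega>\<^sub>Y + t \<eta>\<close> tames \<open>J\<close>
  for small \<open>t > 0\<close> and is therefore b-symplectic.

  The inverse of a b-symplectic form, pushed forward by the anchor, is a Poisson bivector. In coordinates
  whose first one, \<open>r\<close>, defines \<open>Z\<close>, the b-tangent bundle has the frame \<open>r \<partial>\<^sub>0, \<partial>\<^sub>1, \<dots>\<close>, so the top power of
  the bivector is \<open>r\<close> times a nonvanishing Pfaffian and vanishes transversely on \<open>Z\<close>.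
\<close>

text \<open>On the hypersurface the anchor is not injective: \<open>r \<partial>\<^sub>0\<close> has
  the value 0 there although its class in the fibre is not zero. So b-vectors cannot be handled as
  tangent vectors. Identities between them are proved for continuous coefficients in local frames,
  first off \<open>Z\<close>, where coordinates determine the coefficients, and then on
  \<open>Z\<close> by continuity, since \<open>Z\<close> has no interior. The analytic core is
  division: a smooth function vanishing on \<open>Z\<close> is \<open>r\<close> times a smooth
  function, by Hadamard's lemma. It yields the frames of the b-tangent bundle. Because
  transversality turns \<open>r \<circ> f\<close> into a defining function of the preimage, it also
  yields the b-differential, which is specified only as the unique smooth lift of the differential.
  \<open>J\<close> is merely continuous, so applying it to a section need not give a smooth section.
  Taming is therefore stated fibrewise, for pairs of sections \<open>V\<close>, \<open>V'\<close>
  such that \<open>J\<close> maps the class of \<open>V\<close> at one point to the class of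
  \<open>V'\<close>. The Jacobi identity of the bivector is the closedness of the form, evaluated on
  three Hamiltonian fields.\<close>

no_notation scalar_prod (infix "\<bullet>" 70)
hide_const (open) Matrix.orthogonal

section \<open>Calculus of smooth functions on open sets\<close>

lemma frechet_derivative_cong_open:
  assumes "open S" "p \<in> S" "\<And>q. q \<in> S \<Longrightarrow> f q = g q"
  shows "frechet_derivative f (at p) = frechet_derivative g (at p)"
proof -
  have "(f has_derivative D) (at p) \<longleftrightarrow> (g has_derivative D) (at p)" for D
    using has_derivative_transform_within_open[of f D p UNIV S g]
      has_derivative_transform_within_open[of g D p UNIV S f] assms by auto
  then show ?thesis by (simp add: frechet_derivative_def)
qed

lemma C_on_cong:
  assumes "open S" "\<And>q. q \<in> S \<Longrightarrow> f q = g q" "C_on k S f"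
  shows "C_on k S g"
  using assms(2,3)
proof (induction k arbitrary: f g)
  case 0
  then show ?case using continuous_on_cong by fastforce
next
  case (Suc k)
  have c: "continuous_on S g" using Suc.prems continuous_on_cong by fastforce
  have d: "g differentiable (at p)" if "p \<in> S" for p
    using Suc.prems that has_derivative_transform_within_open[of f _ p UNIV S g] assms(1)
    unfolding C_on.simps differentiable_def by blast
  have "C_on k S (\<lambda>p. frechet_derivative g (at p) v)" for v
  proof (rule Suc.IH[of "\<lambda>p. frechet_derivative f (at p) v"])
    show "frechet_derivative f (at q) v = frechet_derivative g (at q) v" if "q \<in> S" for q
      using frechet_derivative_cong_open[OF assms(1) that, of f g] Suc.prems(1) by simp
  qed (use Suc.prems in simp)
  with c d show ?case by simp
qed

lemma C_on_continuous: "C_on k S f \<Longrightarrow> continuous_on S f"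
  by (cases k) auto

lemma C_on_subset: "C_on k S f \<Longrightarrow> T \<subseteq> S \<Longrightarrow> C_on k T f"
  by (induction k arbitrary: f) (auto intro: continuous_on_subset)

lemma C_on_local:
  assumes "\<And>p. p \<in> S \<Longrightarrow> \<exists>N. open N \<and> p \<in> N \<and> C_on k N f"
  shows "C_on k S f"
  using assms
proof (induction k arbitrary: f)
  case 0
  then have "\<And>p. p \<in> S \<Longrightarrow> isCont f p"
    by (metis C_on.simps(1) continuous_on_eq_continuous_at)
  then show ?case by (simp add: continuous_at_imp_continuous_on)
next
  case (Suc k)
  have "\<And>p. p \<in> S \<Longrightarrow> isCont f p"
    by (metis Suc.prems C_on_continuous continuous_on_eq_continuous_at)
  then have c: "continuous_on S f" by (simp add: continuous_at_imp_continuous_on)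
  have "C_on k S (\<lambda>p. frechet_derivative f (at p) v)" for v
  proof (rule Suc.IH)
    fix p assume "p \<in> S"
    then obtain N where "open N" "p \<in> N" "C_on (Suc k) N f" using Suc.prems by blast
    then show "\<exists>N. open N \<and> p \<in> N \<and> C_on k N (\<lambda>p. frechet_derivative f (at p) v)"
      by (intro exI[of _ N]) simp
  qed
  moreover have "f differentiable (at p)" if p: "p \<in> S" for p
  proof -
    obtain N where "p \<in> N" "C_on (Suc k) N f" using Suc.prems[OF p] by blast
    then show ?thesis by simp
  qed
  ultimately show ?case using c by simp
qed

text \<open>The way into every induction on the order: any explicit formula for the derivative
  replaces \<open>frechet_derivative\<close>, which is a choice operator and is evaluated only
  through uniqueness of derivatives.\<close>

lemma C_on_SucI:
  assumes "open S" "\<And>p. p \<in> S \<Longrightarrow> (f has_derivative f' p) (at p)"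
    "\<And>v. C_on k S (\<lambda>p. f' p v)"
  shows "C_on (Suc k) S f"
proof -
  have "continuous_on S f"
    using assms(2) by (meson continuous_at_imp_continuous_on has_derivative_continuous)
  moreover have "C_on k S (\<lambda>p. frechet_derivative f (at p) v)" for v
    by (rule C_on_cong[OF assms(1) _ assms(3)[of v]]) (metis frechet_derivative_at assms(2))
  ultimately show ?thesis using assms(2) by (auto simp: differentiable_def)
qed

lemma C_on_SucD:
  "C_on (Suc k) S f \<Longrightarrow> p \<in> S \<Longrightarrow> (f has_derivative frechet_derivative f (at p)) (at p)"
  by (simp add: frechet_derivative_works)

lemma C_on_Suc_derivative:
  "C_on (Suc k) S f \<Longrightarrow> C_on k S (\<lambda>p. frechet_derivative f (at p) v)"
  by simp

lemma C_on_mono_Suc: "C_on (Suc k) S f \<Longrightarrow> C_on k S f"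
  by (induction k arbitrary: f) auto

lemma C_on_const: "C_on k S (\<lambda>_. c)"
proof (induction k arbitrary: c)
  case (Suc k)
  then show ?case by auto
qed auto

lemma C_on_bounded_linear:
  assumes "bounded_linear l" "open S"
  shows "C_on k S l"
proof (cases k)
  case 0
  then show ?thesis by (simp add: assms(1) linear_continuous_on)
next
  case (Suc j)
  show ?thesis unfolding Suc
    by (rule C_on_SucI[OF assms(2), of _ "\<lambda>_. l"])
      (auto intro: bounded_linear_imp_has_derivative assms C_on_const)
qed

lemma C_on_linear_comp:
  assumes "bounded_linear l" "open S" "C_on k S f"
  shows "C_on k S (\<lambda>p. l (f p))"
  using assms(3)
proof (induction k arbitrary: f)
  case 0
  then show ?case
    using assms(1) linear_continuous_on continuous_on_compose2[of UNIV l S f] by auto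
next
  case (Suc k)
  show ?case
    by (rule C_on_SucI[OF assms(2), of _ "\<lambda>p v. l (frechet_derivative f (at p) v)"])
      (use bounded_linear.has_derivative[OF assms(1)] C_on_SucD[OF Suc.prems] Suc.IH
        C_on_Suc_derivative[OF Suc.prems] in \<open>auto\<close>)
qed

lemma C_on_add:
  assumes "open S" "C_on k S f" "C_on k S g"
  shows "C_on k S (\<lambda>p. f p + g p)"
  using assms(2,3)
proof (induction k arbitrary: f g)
  case 0
  then show ?case by (auto intro: continuous_intros)
next
  case (Suc k)
  show ?case
    by (rule C_on_SucI[OF assms(1), of _
          "\<lambda>p v. frechet_derivative f (at p) v + frechet_derivative g (at p) v"])
      (use C_on_SucD[OF Suc.prems(1)] C_on_SucD[OF Suc.prems(2)] Suc.IH
        C_on_Suc_derivative[OF Suc.prems(1)] C_on_Suc_derivative[OF Suc.prems(2)]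
        in \<open>auto intro!: has_derivative_add\<close>)
qed

lemma C_on_mult:
  fixes f g :: "'a::real_normed_vector \<Rightarrow> real"
  assumes "open S" "C_on k S f" "C_on k S g"
  shows "C_on k S (\<lambda>p. f p * g p)"
  using assms(2,3)
proof (induction k arbitrary: f g)
  case 0
  then show ?case by (auto intro: continuous_intros)
next
  case (Suc k)
  show ?case
    by (rule C_on_SucI[OF assms(1), of _
          "\<lambda>p v. f p * frechet_derivative g (at p) v + frechet_derivative f (at p) v * g p"])
      (use C_on_SucD[OF Suc.prems(1)] C_on_SucD[OF Suc.prems(2)] Suc.IH
        C_on_mono_Suc[OF Suc.prems(1)] C_on_mono_Suc[OF Suc.prems(2)]
        C_on_Suc_derivative[OF Suc.prems(1)] C_on_Suc_derivative[OF Suc.prems(2)]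
        in \<open>auto intro!: has_derivative_mult C_on_add[OF assms(1)]\<close>)
qed

lemma C_on_sum:
  assumes "open S" "\<And>i. i \<in> I \<Longrightarrow> C_on k S (f i)"
  shows "C_on k S (\<lambda>p. \<Sum>i\<in>I. f i p)"
proof (cases "finite I")
  case True
  then show ?thesis using assms(2)
  proof (induction I rule: finite_induct)
    case empty
    then show ?case by (simp add: C_on_const)
  next
    case (insert i I)
    then show ?case by (simp add: C_on_add[OF assms(1)])
  qed
qed (simp add: C_on_const)

text \<open>The derivative of \<open>1 / f\<close> is a product of \<open>1 / f\<close> itself with
  the derivative of \<open>f\<close>, so the statement for order \<open>k\<close> feeds the one for
  order \<open>Suc k\<close>.\<close>

lemma C_on_inverse:
  fixes f :: "'a::real_normed_vector \<Rightarrow> real"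
  assumes "open S" "\<And>p. p \<in> S \<Longrightarrow> f p \<noteq> 0" "C_on k S f"
  shows "C_on k S (\<lambda>p. inverse (f p))"
  using assms(3)
proof (induction k)
  case 0
  then show ?case using assms(2) by (auto intro: continuous_intros)
next
  case (Suc k)
  have i: "C_on k S (\<lambda>p. inverse (f p))" by (rule Suc.IH[OF C_on_mono_Suc[OF Suc.prems]])
  have "C_on k S (\<lambda>p. (- 1) * (inverse (f p) * frechet_derivative f (at p) v * inverse (f p)))" for v
    by (intro C_on_mult[OF assms(1)] C_on_const i C_on_Suc_derivative[OF Suc.prems])
  then have "C_on k S (\<lambda>p. - (inverse (f p) * frechet_derivative f (at p) v * inverse (f p)))" for v
    by simp
  then show ?case
    by (intro C_on_SucI[OF assms(1), of _
          "\<lambda>p v. - (inverse (f p) * frechet_derivative f (at p) v * inverse (f p))"])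
      (use C_on_SucD[OF Suc.prems] assms(2) in \<open>auto intro!: has_derivative_inverse\<close>)
qed

lemma smooth_onD: "smooth_on S f \<Longrightarrow> C_on k S f"
  by (simp add: smooth_on_def)

lemma smooth_onI: "(\<And>k. C_on k S f) \<Longrightarrow> smooth_on S f"
  by (simp add: smooth_on_def)

lemma smooth_on_derivative:
  "smooth_on S f \<Longrightarrow> smooth_on S (\<lambda>p. frechet_derivative f (at p) v)"
  unfolding smooth_on_def using C_on_Suc_derivative by blast

lemma smooth_on_has_derivative:
  "smooth_on S f \<Longrightarrow> p \<in> S \<Longrightarrow> (f has_derivative frechet_derivative f (at p)) (at p)"
  by (meson C_on_SucD smooth_on_def)

subsection \<open>Smooth bump functions\<close>

text \<open>One term of the exponential series bounds the whole from below. This is the source of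
  the decay of \<open>exp (- (1 / x))\<close> at 0 faster than every power.\<close>

lemma power_div_fact_le_exp:
  fixes x :: real
  assumes "x \<ge> 0"
  shows "x ^ n / fact n \<le> exp x"
proof -
  have "(\<Sum>i\<in>{n}. x ^ i /\<^sub>R fact i) \<le> (\<Sum>i. x ^ i /\<^sub>R fact i)"
    by (rule sum_le_suminf) (use assms summable_exp_generic[of x] in \<open>auto\<close>)
  then show ?thesis by (simp add: exp_def divide_inverse mult.commute)
qed

text \<open>The powers of \<open>1 / x\<close> are included because the derivatives of \<open>exp (- 1 / x)\<close> are combinations of them.\<close>
definition flat :: "nat \<Rightarrow> real \<Rightarrow> real" where
  "flat k x = (if x > 0 then exp (- (1 / x)) / x ^ k else 0)"

lemma flat_le: "\<bar>flat k x\<bar> \<le> fact (Suc k) * \<bar>x\<bar>"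
proof (cases "x > 0")
  case True
  have "(1 / x) ^ Suc k / fact (Suc k) \<le> exp (1 / x)"
    using power_div_fact_le_exp[of "1 / x" "Suc k"] True by auto
  then have "exp (- (1 / x)) \<le> fact (Suc k) * x ^ Suc k"
    using True by (simp add: exp_minus field_simps del: fact_Suc)
  then have "exp (- (1 / x)) / x ^ k \<le> fact (Suc k) * x"
    using True by (simp add: field_simps del: fact_Suc)
  then show ?thesis using True by (simp add: flat_def del: fact_Suc)
next
  case False
  then have "flat k x = 0" by (simp add: flat_def)
  moreover have "0 \<le> fact (Suc k) * \<bar>x\<bar>" by (intro mult_nonneg_nonneg) (auto simp del: fact_Suc)
  ultimately show ?thesis by linarith
qed

lemma flat_deriv:
  "(flat k has_real_derivative flat (k + 2) x - k * flat (Suc k) x) (at x)"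
proof -
  consider "x > 0" | "x < 0" | "x = 0" by linarith
  then show ?thesis
  proof cases
    case 1
    have p: "k = 0 \<or> x ^ k = x * x ^ (k - Suc 0)" by (cases k) auto
    have "((\<lambda>x. exp (- (1 / x)) / x ^ k) has_real_derivative
        (exp (- (1 / x)) * (1 / x\<^sup>2) * x ^ k - exp (- (1 / x)) * (real k * x ^ (k - 1))) / (x ^ k * x ^ k)) (at x)"
      using 1 by (auto intro!: derivative_eq_intros simp: power2_eq_square)
    also have "(exp (- (1 / x)) * (1 / x\<^sup>2) * x ^ k - exp (- (1 / x)) * (real k * x ^ (k - 1))) / (x ^ k * x ^ k)
        = flat (k + 2) x - k * flat (Suc k) x"
      using 1 p by (simp add: flat_def field_simps power2_eq_square)
    finally have "((\<lambda>x. exp (- (1 / x)) / x ^ k) has_real_derivative flat (k + 2) x - k * flat (Suc k) x) (at x)" .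
    then show ?thesis
      by (rule has_field_derivative_transform_within_open[of _ _ _ "{0<..}"])
        (use 1 in \<open>auto simp: flat_def\<close>)
  next
    case 2
    have "((\<lambda>x. 0) has_real_derivative 0) (at x)" by simp
    then have "(flat k has_real_derivative 0) (at x)"
      by (rule has_field_derivative_transform_within_open[of _ _ _ "{..<0}"])
        (use 2 in \<open>auto simp: flat_def\<close>)
    then show ?thesis using 2 by (simp add: flat_def)
  next
    case 3
    \<comment> \<open>At 0 the difference quotient of \<open>flat k\<close> is
      \<open>flat (Suc k)\<close>, which tends to 0 by \<open>flat_le\<close>; this is where
      including the powers of \<open>1 / x\<close> pays off.\<close>
    have e: "(flat k (0 + h) - flat k 0) / h = flat (Suc k) h" if "h \<noteq> 0" for h
      using that by (auto simp: flat_def field_simps)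
    have "((\<lambda>h. fact (Suc (Suc k)) * \<bar>h\<bar>) \<longlongrightarrow> 0) (at (0::real))"
      by (auto intro!: tendsto_eq_intros simp del: fact_Suc)
    then have "(flat (Suc k) \<longlongrightarrow> 0) (at 0)"
      by (rule Lim_null_comparison[rotated]) (use flat_le[of "Suc k"] in \<open>auto simp del: fact_Suc\<close>)
    then have "((\<lambda>h. (flat k (0 + h) - flat k 0) / h) \<longlongrightarrow> 0) (at 0)"
      by (rule Lim_transform_eventually) (use e in \<open>auto simp: eventually_at_filter\<close>)
    then show ?thesis using 3 by (simp add: DERIV_def flat_def)
  qed
qed

text \<open>The family is closed under differentiation up to linear combinations, hence the
  induction on the order with \<open>k\<close> arbitrary.\<close>

lemma flat_C_on: "C_on m UNIV (flat k)"
proof (induction m arbitrary: k)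
  case 0
  have "isCont (flat k) x" for x using DERIV_isCont[OF flat_deriv] .
  then show ?case by (simp add: continuous_at_imp_continuous_on)
next
  case (Suc m)
  have "C_on m UNIV (\<lambda>p. (flat (k + 2) p + (- real k) * flat (Suc k) p) * v)" for v
    by (intro C_on_mult C_on_add Suc C_on_const) auto
  then show ?case
    by (intro C_on_SucI[of _ _ "\<lambda>p v. (flat (k + 2) p - real k * flat (Suc k) p) * v"])
      (use flat_deriv[unfolded has_field_derivative_def] in \<open>auto\<close>)
qed

text \<open>The usual smooth step from 0 to 1. The denominator is positive because \<open>t\<close>
  and \<open>1 - t\<close> are never both nonpositive.\<close>

definition cutoff :: "real \<Rightarrow> real" where
  "cutoff t = flat 0 t * inverse (flat 0 t + flat 0 (1 - t))"

lemma flat0: "flat 0 x \<ge> 0" "flat 0 x > 0 \<longleftrightarrow> x > 0"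
  by (auto simp: flat_def)

lemma cutoff_denominator: "flat 0 t + flat 0 (1 - t) > 0"
  using flat0[of t] flat0[of "1 - t"] by (smt (verit))

lemma cutoff_props:
  "0 \<le> cutoff t" "cutoff t \<le> 1" "t \<ge> 1 \<Longrightarrow> cutoff t = 1" "t \<le> 0 \<Longrightarrow> cutoff t = 0"
proof -
  have "flat 0 (1 - t) = 0" if "t \<ge> 1" using that by (simp add: flat_def)
  moreover have "flat 0 t = 0" if "t \<le> 0" using that by (simp add: flat_def)
  ultimately show "0 \<le> cutoff t" "cutoff t \<le> 1" "t \<ge> 1 \<Longrightarrow> cutoff t = 1" "t \<le> 0 \<Longrightarrow> cutoff t = 0"
    using cutoff_denominator[of t] flat0[of t] flat0[of "1 - t"]
    by (auto simp: cutoff_def field_simps)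
qed

section \<open>Orthonormal frames of finite-dimensional spaces\<close>

text \<open>An orthonormal basis indexed by numbers, so that coordinates, matrices and frames of
  vector fields all become families over \<open>{..<n}\<close>. The case \<open>n = 0\<close> is
  included, and values from \<open>n\<close> on are irrelevant.\<close>

definition orthoframe :: "nat \<Rightarrow> (nat \<Rightarrow> 'e::real_inner) \<Rightarrow> bool" where
  "orthoframe n e \<longleftrightarrow> (\<forall>i<n. \<forall>j<n. e i \<bullet> e j = (if i = j then 1 else 0)) \<and>
     (\<forall>v. v = (\<Sum>i<n. (e i \<bullet> v) *\<^sub>R e i))"

lemma orthoframe_expand: "orthoframe n e \<Longrightarrow> v = (\<Sum>i<n. (e i \<bullet> v) *\<^sub>R e i)"
  by (simp add: orthoframe_def)

lemma orthoframe_inner: "orthoframe n e \<Longrightarrow> i < n \<Longrightarrow> j < n \<Longrightarrow> e i \<bullet> e j = (if i = j then 1 else 0)"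
  by (simp add: orthoframe_def)

lemma orthoframe_linear:
  fixes l :: "'e::real_inner \<Rightarrow> 'b::real_vector"
  assumes "orthoframe n e" "linear l"
  shows "l v = (\<Sum>i<n. (e i \<bullet> v) *\<^sub>R l (e i))"
proof -
  have "l v = l (\<Sum>i<n. (e i \<bullet> v) *\<^sub>R e i)" using orthoframe_expand[OF assms(1), of v] by simp
  also have "\<dots> = (\<Sum>i<n. (e i \<bullet> v) *\<^sub>R l (e i))"
    using assms(2) by (simp add: linear_sum linear_cmul)
  finally show ?thesis .
qed

definition orthonormal_list :: "'e::real_inner list \<Rightarrow> bool" where
  "orthonormal_list es \<longleftrightarrow>
     (\<forall>i<length es. \<forall>j<length es. es ! i \<bullet> es ! j = (if i = j then 1 else 0))"

lemma orthonormal_list_props: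
  assumes "orthonormal_list es"
  shows "distinct es" "independent (set es)"
proof -
  have inner: "es ! i \<bullet> es ! j = (if i = j then 1 else 0)" if "i < length es" "j < length es" for i j
    using assms that by (simp add: orthonormal_list_def)
  show "distinct es" unfolding distinct_conv_nth using inner by (metis zero_neq_one)
  show "independent (set es)"
  proof (rule pairwise_orthogonal_independent)
    show "pairwise orthogonal (set es)"
      unfolding pairwise_def Linear_Algebra.orthogonal_def using inner by (metis in_set_conv_nth)
    show "0 \<notin> set es" unfolding in_set_conv_nth using inner by (metis inner_zero_left zero_neq_one)
  qed
qed

text \<open>A longest orthonormal list extending \<open>es0\<close> is a basis: otherwise the
  normalised residual of some vector, after subtracting its projection, could be appended. Lengths
  are bounded by \<open>card Bs\<close> since orthonormal vectors are independent. The prescribed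
  start serves to make the normal direction of a hypersurface the first basis vector.\<close>

lemma ex_orthoframe:
  assumes fin: "finite (Bs :: 'e::real_inner set)" "span Bs = UNIV" and e: "e \<noteq> (0::'e) \<or> es0 = []"
    and es0: "es0 = [] \<or> es0 = [e /\<^sub>R norm e]"
  shows "\<exists>es. take (length es0) es = es0 \<and> length es = dim (UNIV :: 'e set) \<and>
    orthoframe (length es) ((!) es)"
proof -
  let ?P = "\<lambda>k. \<exists>es. length es = k \<and> take (length es0) es = es0 \<and> orthonormal_list (es :: 'e list)"
  have bound: "k \<le> card Bs" if "?P k" for k
  proof -
    obtain es where es: "length es = k" "orthonormal_list (es :: 'e list)" using \<open>?P k\<close> by blast
    have "card (set es) \<le> card Bs"
      using orthonormal_list_props(2)[OF es(2)] fin
      by (metis independent_span_bound top_greatest)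
    then show ?thesis using orthonormal_list_props(1)[OF es(2)] es(1) by (simp add: distinct_card)
  qed
  have ex: "?P (length es0)"
  proof -
    have "orthonormal_list es0"
      using es0 e by (auto simp: orthonormal_list_def dot_square_norm power2_eq_square)
    then show ?thesis by fastforce
  qed
  define k where "k = Greatest ?P"
  have k: "?P k" "\<And>k'. ?P k' \<Longrightarrow> k' \<le> k"
    unfolding k_def
    by (rule GreatestI_nat[of ?P, OF ex], erule bound)
      (erule Greatest_le_nat[of ?P], erule bound)
  obtain es where es: "length es = k" "take (length es0) es = es0" "orthonormal_list (es :: 'e list)"
    using k(1) by blast
  have inner: "es ! i \<bullet> es ! j = (if i = j then 1 else 0)" if "i < length es" "j < length es" for i j
    using es(3) that by (simp add: orthonormal_list_def)
  have expand: "v = (\<Sum>i<length es. (es ! i \<bullet> v) *\<^sub>R es ! i)" for v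
  proof (rule ccontr)
    assume ne: "v \<noteq> (\<Sum>i<length es. (es ! i \<bullet> v) *\<^sub>R es ! i)"
    define w where "w = v - (\<Sum>i<length es. (es ! i \<bullet> v) *\<^sub>R es ! i)"
    have w0: "w \<noteq> 0" using ne by (simp add: w_def)
    have wi: "es ! j \<bullet> w = 0" if "j < length es" for j
    proof -
      have "es ! j \<bullet> (\<Sum>i<length es. (es ! i \<bullet> v) *\<^sub>R es ! i)
          = (\<Sum>i<length es. (es ! i \<bullet> v) * (if j = i then 1 else 0))"
        using that by (simp add: inner_sum_right inner)
      also have "\<dots> = (\<Sum>i<length es. if j = i then es ! i \<bullet> v else 0)"
        by (intro sum.cong) auto
      also have "\<dots> = es ! j \<bullet> v" using that by simp
      finally show ?thesis by (simp add: w_def inner_diff_right)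
    qed
    define u where "u = w /\<^sub>R norm w"
    have uu: "u \<bullet> u = 1" using w0 by (simp add: u_def dot_square_norm power2_eq_square)
    have ui: "es ! j \<bullet> u = 0" if "j < length es" for j using wi[OF that] by (simp add: u_def)
    have "orthonormal_list (es @ [u])"
      using inner ui uu es(1)
      by (auto simp: orthonormal_list_def nth_append less_Suc_eq inner_commute)
    moreover have "length es0 \<le> length es" using k(2)[OF ex] es(1) by simp
    ultimately have "?P (Suc k)" using es by (intro exI[of _ "es @ [u]"]) auto
    then show False using k(2) by fastforce
  qed
  have sp: "span (set es) = UNIV"
  proof (rule Set.set_eqI, simp)
    fix v show "v \<in> span (set es)"
      by (subst expand[of v]) (intro span_sum span_scale span_base, auto)
  qed
  have "dim (UNIV :: 'e set) = card (set es)"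
    using orthonormal_list_props(2)[OF es(3)] sp dim_eq_card[of "set es" UNIV]
    by (metis span_UNIV)
  then have "length es = dim (UNIV :: 'e set)"
    using orthonormal_list_props(1)[OF es(3)] by (simp add: distinct_card)
  then show ?thesis using es inner expand unfolding orthoframe_def by blast
qed

text \<open>Coefficient families are functions on all natural numbers. Pinning the values from
  \<open>n\<close> on to 0 makes the cube a product of compact sets, so Tychonoff's theorem
  applies.\<close>

lemma compact_cube: "compact {c :: nat \<Rightarrow> real. \<forall>i. c i \<in> (if i < n then {-R..R} else {0})}"
proof -
  have "compactin (product_topology (\<lambda>_. euclidean) UNIV)
     (PiE UNIV (\<lambda>i. if i < n then {-R..R} else {0::real}))"
    by (subst compactin_PiE) auto
  moreover have "PiE UNIV (\<lambda>i. if i < n then {-R..R} else {0::real}) =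
      {c :: nat \<Rightarrow> real. \<forall>i. c i \<in> (if i < n then {-R..R} else {0})}"
    by (auto simp: PiE_def Pi_def)
  ultimately show ?thesis by (simp add: euclidean_product_topology)
qed

lemma compact_unit_sphere: "compact {c :: nat \<Rightarrow> real. (\<forall>i\<ge>n. c i = 0) \<and> (\<Sum>i<n. (c i)\<^sup>2) = 1}"
proof -
  let ?S = "{c :: nat \<Rightarrow> real. (\<forall>i\<ge>n. c i = 0) \<and> (\<Sum>i<n. (c i)\<^sup>2) = 1}"
  let ?K = "{c :: nat \<Rightarrow> real. \<forall>i. c i \<in> (if i < n then {-1..1} else {0})}"
  have "closed {c :: nat \<Rightarrow> real. (\<Sum>i<n. (c i)\<^sup>2) = 1}"
    by (intro closed_Collect_eq continuous_intros continuous_on_product_coordinates)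
  moreover have "?S = ?K \<inter> {c. (\<Sum>i<n. (c i)\<^sup>2) = 1}"
  proof -
    have "c i \<in> {-1..1}" if "(\<Sum>i<n. (c i)\<^sup>2) = 1" "i < n" for c :: "nat \<Rightarrow> real" and i
    proof -
      have "(c i)\<^sup>2 \<le> (\<Sum>i<n. (c i)\<^sup>2)" by (rule member_le_sum) (use that in \<open>auto\<close>)
      then have "(c i)\<^sup>2 \<le> 1" using that by simp
      then show ?thesis by (simp add: abs_square_le_1 abs_le_iff)
    qed
    then show ?thesis by (force split: if_splits)
  qed
  ultimately show ?thesis using compact_Int_closed[OF compact_cube[of n 1]] by simp
qed

text \<open>A ball lies in the continuous image of a cube of coefficients. Its compactness is what
  makes the preimage of a closed coordinate ball closed in the manifold, as the support of a bump
  function must be.\<close>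

lemma compact_cball_orthoframe:
  assumes "orthoframe n (e :: nat \<Rightarrow> 'e::real_inner)"
  shows "compact (cball (q0::'e) r)"
proof -
  let ?R = "norm q0 + \<bar>r\<bar>"
  let ?K = "{c :: nat \<Rightarrow> real. \<forall>i. c i \<in> (if i < n then {-?R..?R} else {0})}"
  let ?f = "\<lambda>c :: nat \<Rightarrow> real. \<Sum>i<n. c i *\<^sub>R e i"
  have C: "compact (?f ` ?K)"
    by (rule compact_continuous_image[OF _ compact_cube])
      (auto intro!: continuous_intros intro: continuous_on_subset[OF continuous_on_product_coordinates])
  have sub: "cball q0 r \<subseteq> ?f ` ?K"
  proof
    fix q assume q: "q \<in> cball q0 r"
    let ?c = "\<lambda>i. if i < n then e i \<bullet> q else 0"
    have "norm q \<le> ?R" using q norm_triangle_ineq2[of q q0] by (simp add: dist_norm norm_minus_commute)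
    moreover have "\<bar>e i \<bullet> q\<bar> \<le> norm q" if "i < n" for i
    proof -
      have "norm (e i) = 1" using orthoframe_inner[OF assms that that] by (simp add: norm_eq_sqrt_inner)
      then show ?thesis using Cauchy_Schwarz_ineq2[of "e i" q] by simp
    qed
    ultimately have "- ?R \<le> e i \<bullet> q \<and> e i \<bullet> q \<le> ?R" if "i < n" for i
      using that by (smt (verit))
    then have K: "?c \<in> ?K" by auto
    have q: "q = ?f ?c" using orthoframe_expand[OF assms, of q] by simp
    show "q \<in> ?f ` ?K" by (rule image_eqI[of q ?f ?c ?K, OF q K])
  qed
  show ?thesis
    using compact_Int_closed[OF C closed_cball, of q0 r] unfolding Int_absorb1[OF sub] .
qed

text \<open>Expanding the outer derivative along the frame turns the chain rule into a finite sum of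
  products of scalar functions. Each factor has order \<open>k\<close> by the induction hypothesis
  for an arbitrary outer function.\<close>

lemma C_on_compose:
  fixes g :: "'e::real_inner \<Rightarrow> real"
  assumes e: "orthoframe n (e :: nat \<Rightarrow> 'e)" and S: "open S" and T: "open T" "f ` S \<subseteq> T"
    and "C_on k S f" "C_on k T g"
  shows "C_on k S (\<lambda>p. g (f p))"
  using assms(5,6)
proof (induction k arbitrary: g)
  case 0
  then show ?case using T continuous_on_compose2[of T g S f] by auto
next
  case (Suc k)
  have f: "C_on k S f" by (rule C_on_mono_Suc[OF Suc.prems(1)])
  let ?d = "\<lambda>p v. \<Sum>i<n. (e i \<bullet> frechet_derivative f (at p) v) * frechet_derivative g (at (f p)) (e i)"
  have "C_on k S (\<lambda>p. ?d p v)" for v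
    by (intro C_on_sum C_on_mult S C_on_linear_comp[OF bounded_linear_inner_right] Suc.IH[OF f]
        C_on_Suc_derivative[OF Suc.prems(1)] C_on_Suc_derivative[OF Suc.prems(2)])
  moreover have "((\<lambda>p. g (f p)) has_derivative ?d p) (at p)" if p: "p \<in> S" for p
  proof -
    have fp: "f p \<in> T" using p T by auto
    have D: "((\<lambda>p. g (f p)) has_derivative
        (\<lambda>v. frechet_derivative g (at (f p)) (frechet_derivative f (at p) v))) (at p)"
      by (rule has_derivative_compose[OF C_on_SucD[OF Suc.prems(1) p] C_on_SucD[OF Suc.prems(2) fp]])
    have E: "frechet_derivative g (at (f p)) w = (\<Sum>i<n. (e i \<bullet> w) * frechet_derivative g (at (f p)) (e i))" for w
    proof -
      have "linear (frechet_derivative g (at (f p)))"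
        by (rule has_derivative_linear[OF C_on_SucD[OF Suc.prems(2) fp]])
      from orthoframe_linear[OF e this, of w] show ?thesis by simp
    qed
    have "(\<lambda>v. frechet_derivative g (at (f p)) (frechet_derivative f (at p) v)) = ?d p"
      by (rule ext) (rule E)
    with D show ?thesis by (rule subst[rotated])
  qed
  ultimately show ?case by (intro C_on_SucI[OF S])
qed

section \<open>Parametric integrals and Hadamard's lemma\<close>

lemma add_in_ball_iff: "q0 + w \<in> ball q0 r \<longleftrightarrow> norm w < r"
  by (simp add: dist_norm)

text \<open>Differentiation under the integral sign. The inner point moves with velocity
  \<open>A h + t *\<^sub>R B h\<close> when \<open>q\<close> moves in direction \<open>h\<close>, so
  a derivative produces an extra factor \<open>t\<close>; the weight \<open>t ^ k\<close> with
  arbitrary \<open>k\<close> makes the class of integrals closed under differentiation. The bound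
  \<open>AB\<close> keeps all evaluation points inside the ball.\<close>

lemma C_on_parametric_integral:
  fixes K :: "'e::real_inner \<Rightarrow> real"
  assumes e: "orthoframe n (e :: nat \<Rightarrow> 'e)" and A: "bounded_linear A" and B: "bounded_linear B"
    and AB: "\<And>t h. 0 \<le> t \<Longrightarrow> t \<le> 1 \<Longrightarrow> norm (A h + t *\<^sub>R B h) \<le> norm h"
    and K: "C_on m (ball q0 r) K"
  shows "C_on m (ball q0 r)
    (\<lambda>q. integral {0..1} (\<lambda>t. t ^ k * K (q0 + A (q - q0) + t *\<^sub>R B (q - q0))))"
  using K
proof (induction m arbitrary: K k)
  case (0 K k)
  let ?L = "\<lambda>q t. q0 + A (q - q0) + t *\<^sub>R B (q - q0)"
  have lin: "continuous_on S (\<lambda>x. A (fst x - q0))" "continuous_on S (\<lambda>x. B (fst x - q0))"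
    for S :: "('e \<times> real) set"
    by (intro bounded_linear.continuous_on[OF A] bounded_linear.continuous_on[OF B] continuous_intros)+
  have "?L q t \<in> ball q0 r" if "q \<in> ball q0 r" "t \<in> {0..1}" for q t
    using AB[of t "q - q0"] that unfolding add.assoc add_in_ball_iff by (auto simp: dist_norm norm_minus_commute)
  then have Lin: "(\<lambda>x. ?L (fst x) (snd x)) ` (ball q0 r \<times> cbox 0 1) \<subseteq> ball q0 r"
    by (intro image_subsetI) (simp only: mem_Times_iff cbox_interval)
  have "continuous_on (ball q0 r \<times> cbox 0 1) (\<lambda>x. ?L (fst x) (snd x))"
    by (intro continuous_intros lin)
  from continuous_on_compose2[OF _ this Lin, of K]
  have "continuous_on (ball q0 r \<times> cbox 0 1) (\<lambda>x. K (?L (fst x) (snd x)))" using 0 by simp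
  then have "continuous_on (ball q0 r \<times> cbox 0 1) (\<lambda>(q, t). t ^ k * K (?L q t))"
    unfolding case_prod_beta by (intro continuous_intros)
  then have "continuous_on (ball q0 r) (\<lambda>q. integral (cbox 0 1) (\<lambda>t. t ^ k * K (?L q t)))"
    by (rule integral_continuous_on_param)
  then show ?case by simp
next
  case (Suc m K k)
  let ?L = "\<lambda>q t. q0 + A (q - q0) + t *\<^sub>R B (q - q0)"
  define dK where "dK i = (\<lambda>p. frechet_derivative K (at p) (e i))" for i
  define I where "I k K = (\<lambda>q. integral {0..1} (\<lambda>t. t ^ k * K (?L q t)))" for k and K :: "'e \<Rightarrow> real"
  have lin: "continuous_on S (\<lambda>x. A (fst x - q0))" "continuous_on S (\<lambda>x. B (fst x - q0))"
    for S :: "('e \<times> real) set"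
    by (intro bounded_linear.continuous_on[OF A] bounded_linear.continuous_on[OF B] continuous_intros)+
  interpret A: bounded_linear A by (rule A)
  interpret B: bounded_linear B by (rule B)
  have Lin: "?L q t \<in> ball q0 r" if "q \<in> ball q0 r" "0 \<le> t" "t \<le> 1" for q t
    using AB[of t "q - q0"] that unfolding add.assoc add_in_ball_iff by (auto simp: dist_norm norm_minus_commute)
  have contK: "continuous_on (ball q0 r \<times> {0..1}) (\<lambda>x. F (?L (fst x) (snd x)))"
    if "continuous_on (ball q0 r) F" for F :: "'e \<Rightarrow> real"
  proof -
    have "(\<lambda>x. ?L (fst x) (snd x)) ` (ball q0 r \<times> {0..1}) \<subseteq> ball q0 r"
      by (intro image_subsetI Lin) (simp_all only: mem_Times_iff atLeastAtMost_iff)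
    moreover have "continuous_on (ball q0 r \<times> {0..1}) (\<lambda>x. ?L (fst x) (snd x))"
      by (intro continuous_intros lin)
    ultimately show ?thesis by (rule continuous_on_compose2[OF that, rotated])
  qed
  have contt: "continuous_on {0..1} (\<lambda>t. t ^ j * F (?L q t))"
    if "continuous_on (ball q0 r) F" "q \<in> ball q0 r" for F :: "'e \<Rightarrow> real" and q j
  proof -
    have "(\<lambda>t. ?L q t) ` {0..1} \<subseteq> ball q0 r" by (intro image_subsetI Lin that(2)) simp_all
    moreover have "continuous_on {0..1} (\<lambda>t. ?L q t)" by (intro continuous_intros)
    ultimately have "continuous_on {0..1} (\<lambda>t. F (?L q t))"
      by (rule continuous_on_compose2[OF that(1), rotated])
    then show ?thesis by (intro continuous_intros)
  qed
  have dKm: "C_on m (ball q0 r) (dK i)" for i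
    unfolding dK_def by (rule C_on_Suc_derivative[OF Suc.prems])
  have dKc: "continuous_on (ball q0 r) (dK i)" for i by (rule C_on_continuous[OF dKm])
  have Kc: "continuous_on (ball q0 r) K" by (rule C_on_continuous[OF Suc.prems])
  have dKexp: "frechet_derivative K (at p) w = (\<Sum>i<n. (e i \<bullet> w) * dK i p)" if "p \<in> ball q0 r" for p w
    using orthoframe_linear[OF e, of "frechet_derivative K (at p)" w]
      linear_frechet_derivative[of K "at p"] C_on_SucD[OF Suc.prems that]
    unfolding dK_def differentiable_def by auto
  \<comment> \<open>The expected derivative, split along the frame: the \<open>A\<close> part keeps
    the weight \<open>t ^ k\<close>, the \<open>B\<close> part raises it to
    \<open>t ^ Suc k\<close>. So it is again a combination of integrals covered by the induction
    hypothesis.\<close>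
  define D where "D q h = (\<Sum>i<n. (e i \<bullet> A h) * I k (dK i) q + (e i \<bullet> B h) * I (Suc k) (dK i) q)" for q h
  have Dint: "D q h = integral {0..1} (\<lambda>t. t ^ k * frechet_derivative K (at (?L q t)) (A h + t *\<^sub>R B h))"
    and Dint': "(\<lambda>t. t ^ k * frechet_derivative K (at (?L q t)) (A h + t *\<^sub>R B h)) integrable_on {0..1}"
    if q: "q \<in> ball q0 r" for q h
  proof -
    have int: "(\<lambda>t. t ^ j * dK i (?L q t)) integrable_on {0..1}" for i j
      by (rule integrable_continuous_interval[OF contt[OF dKc q]])
    have eq: "t ^ k * frechet_derivative K (at (?L q t)) (A h + t *\<^sub>R B h) =
        (\<Sum>i<n. (e i \<bullet> A h) * (t ^ k * dK i (?L q t)) + (e i \<bullet> B h) * (t ^ Suc k * dK i (?L q t)))"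
      if "t \<in> {0..1}" for t
      using that Lin[OF q, of t] by (simp add: dKexp inner_add_right sum_distrib_left algebra_simps)
    have "((\<lambda>t. \<Sum>i<n. (e i \<bullet> A h) * (t ^ k * dK i (?L q t)) + (e i \<bullet> B h) * (t ^ Suc k * dK i (?L q t)))
        has_integral D q h) {0..1}"
      unfolding D_def I_def
      by (intro has_integral_sum has_integral_add has_integral_mult_right integrable_integral int) auto
    then have "((\<lambda>t. t ^ k * frechet_derivative K (at (?L q t)) (A h + t *\<^sub>R B h)) has_integral D q h) {0..1}"
      by (rule has_integral_eq[rotated]) (use eq in \<open>auto\<close>)
    then show "D q h = integral {0..1} (\<lambda>t. t ^ k * frechet_derivative K (at (?L q t)) (A h + t *\<^sub>R B h))"
      "(\<lambda>t. t ^ k * frechet_derivative K (at (?L q t)) (A h + t *\<^sub>R B h)) integrable_on {0..1}"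
      by (auto simp: integral_unique integrable_on_def)
  qed
  have deriv: "(I k K has_derivative D q) (at q)" if q: "q \<in> ball q0 r" for q
  proof (subst has_derivative_at_alt, intro conjI allI impI)
    show "bounded_linear (D q)"
      unfolding D_def[abs_def]
      by (intro bounded_linear_sum bounded_linear_add bounded_linear_mult_const
          bounded_linear_compose[OF bounded_linear_inner_right] A B)
    fix \<epsilon> :: real assume \<epsilon>: "\<epsilon> > 0"
    \<comment> \<open>There will be \<open>n\<close> error terms, each at most \<open>\<eta>\<close>
      times the distance; adding 1 in the denominator covers \<open>n = 0\<close>.\<close>
    define \<eta> where "\<eta> = \<epsilon> / (1 + real n)"
    have \<eta>: "\<eta> > 0" "real n * \<eta> \<le> \<epsilon>" using \<epsilon> by (auto simp: \<eta>_def field_simps)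
    have "\<exists>N. open N \<and> q \<in> N \<and> (\<forall>y\<in>N \<inter> ball q0 r. \<forall>t\<in>{0..1}. \<bar>dK i (?L y t) - dK i (?L q t)\<bar> \<le> \<eta>)" for i
    proof -
      \<comment> \<open>Compactness of the interval makes the neighbourhood of \<open>q\<close>
        independent of \<open>t\<close>.\<close>
      obtain X0 where "q \<in> X0" "open X0"
        "\<forall>y\<in>X0 \<inter> ball q0 r. \<forall>t\<in>{0..1}. dist (dK i (?L (fst (y, t)) (snd (y, t)))) (dK i (?L (fst (q, t)) (snd (q, t)))) \<le> \<eta>"
        using continuous_on_prod_compactE[OF contK[OF dKc] compact_Icc q \<eta>(1), of i] by blast
      then show ?thesis by (auto simp: dist_real_def)
    qed
    then obtain N where N: "\<And>i. open (N i)" "\<And>i. q \<in> N i"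
      "\<And>i y t. y \<in> N i \<inter> ball q0 r \<Longrightarrow> t \<in> {0..1} \<Longrightarrow> \<bar>dK i (?L y t) - dK i (?L q t)\<bar> \<le> \<eta>"
      by metis
    have "open (ball q0 r \<inter> (\<Inter>i<n. N i))" using N by auto
    moreover have "q \<in> ball q0 r \<inter> (\<Inter>i<n. N i)" using N q by auto
    ultimately obtain d where d: "d > 0" "ball q d \<subseteq> ball q0 r \<inter> (\<Inter>i<n. N i)"
      by (metis open_contains_ball)
    have "norm (I k K y - I k K q - D q (y - q)) \<le> \<epsilon> * norm (y - q)" if y: "norm (y - q) < d" for y
    proof -
      have seg: "q + s *\<^sub>R (y - q) \<in> ball q d" if "0 \<le> s" "s \<le> 1" for s
      proof -
        have "s * norm (y - q) \<le> norm (y - q)" using that mult_left_le_one_le[of "norm (y - q)" s] by simp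
        then show ?thesis using y that by (simp add: dist_norm)
      qed
      have yb: "y \<in> ball q0 r" using seg[of 1] d(2) by auto
      let ?w = "\<lambda>t. A (y - q) + t *\<^sub>R B (y - q)"
      have Lseg: "?L (q + s *\<^sub>R (y - q)) t = ?L q t + s *\<^sub>R ?w t" for s t
        by (simp add: A.diff A.add A.scaleR B.diff B.add B.scaleR algebra_simps)
      have bound: "\<bar>K (?L y t) - K (?L q t) - frechet_derivative K (at (?L q t)) (?w t)\<bar> \<le> \<epsilon> * norm (y - q)"
        if t: "t \<in> {0..1}" for t
      proof -
        let ?g = "\<lambda>s. K (?L q t + s *\<^sub>R ?w t)"
        have inb: "?L q t + s *\<^sub>R ?w t \<in> ball q0 r" if "0 \<le> s" "s \<le> 1" for s
          using Lin[of "q + s *\<^sub>R (y - q)" t] seg[OF that] d(2) t Lseg by auto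
        have g': "(?g has_real_derivative frechet_derivative K (at (?L q t + s *\<^sub>R ?w t)) (?w t)) (at s)"
          if "0 \<le> s" "s \<le> 1" for s
        proof -
          let ?K' = "frechet_derivative K (at (?L q t + s *\<^sub>R ?w t))"
          have "((\<lambda>s. ?L q t + s *\<^sub>R ?w t) has_derivative (\<lambda>h. h *\<^sub>R ?w t)) (at s)"
            by (auto intro!: derivative_eq_intros)
          from has_derivative_compose[OF this C_on_SucD[OF Suc.prems inb[OF that]]]
          have "(?g has_derivative (\<lambda>h. ?K' (h *\<^sub>R ?w t))) (at s)" .
          moreover have "(\<lambda>h. ?K' (h *\<^sub>R ?w t)) = (*) (?K' (?w t))"
            using linear_cmul[OF has_derivative_linear[OF C_on_SucD[OF Suc.prems inb[OF that]]]]
            by (auto simp: mult.commute)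
          ultimately show ?thesis by (simp add: has_field_derivative_def)
        qed
        \<comment> \<open>The mean value theorem is applied along the segment from
          \<open>?L q t\<close> to \<open>?L y t\<close> for each fixed \<open>t\<close>. The
          intermediate parameter depends on \<open>t\<close>, but the resulting bound does
          not.\<close>
        obtain s where s: "0 < s" "s < 1" "?g 1 - ?g 0 = (1 - 0) * frechet_derivative K (at (?L q t + s *\<^sub>R ?w t)) (?w t)"
          using MVT2[of 0 1 ?g "\<lambda>s. frechet_derivative K (at (?L q t + s *\<^sub>R ?w t)) (?w t)"] g' by force
        have "K (?L y t) - K (?L q t) = frechet_derivative K (at (?L q t + s *\<^sub>R ?w t)) (?w t)"
        proof -
          have "q + 1 *\<^sub>R (y - q) = y" by simp
          from Lseg[of 1 t, unfolded this] have Ly: "?L y t = ?L q t + 1 *\<^sub>R ?w t" .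
          show ?thesis
            unfolding Ly using s(3) by (simp only: scaleR_zero_left add_0_right diff_zero mult_1)
        qed
        then have eq: "K (?L y t) - K (?L q t) - frechet_derivative K (at (?L q t)) (?w t) =
            (\<Sum>i<n. (e i \<bullet> ?w t) * (dK i (?L q t + s *\<^sub>R ?w t) - dK i (?L q t)))"
          using inb[of s] Lin[OF q, of t] t s by (simp add: dKexp sum_subtractf algebra_simps)
        have "\<bar>\<Sum>i<n. (e i \<bullet> ?w t) * (dK i (?L q t + s *\<^sub>R ?w t) - dK i (?L q t))\<bar> \<le> (\<Sum>i<n. norm (y - q) * \<eta>)"
        proof (rule order_trans[OF sum_abs sum_mono])
          fix i assume i: "i \<in> {..<n}"
          have "norm (e i) = 1" using orthoframe_inner[OF e, of i i] i by (simp add: norm_eq_sqrt_inner)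
          then have "\<bar>e i \<bullet> ?w t\<bar> \<le> norm (y - q)"
            using Cauchy_Schwarz_ineq2[of "e i" "?w t"] AB[of t "y - q"] t by auto
          moreover have "\<bar>dK i (?L q t + s *\<^sub>R ?w t) - dK i (?L q t)\<bar> \<le> \<eta>"
          proof -
            have "q + s *\<^sub>R (y - q) \<in> ball q d" using seg s by simp
            then have "q + s *\<^sub>R (y - q) \<in> N i \<inter> ball q0 r" using d(2) i by blast
            from N(3)[OF this t] show ?thesis unfolding Lseg .
          qed
          ultimately show "\<bar>(e i \<bullet> ?w t) * (dK i (?L q t + s *\<^sub>R ?w t) - dK i (?L q t))\<bar> \<le> norm (y - q) * \<eta>"
            unfolding abs_mult by (intro mult_mono) auto
        qed
        also have "\<dots> = (real n * \<eta>) * norm (y - q)" by simp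
        also have "\<dots> \<le> \<epsilon> * norm (y - q)" using \<eta>(2) by (rule mult_right_mono) simp
        finally show ?thesis unfolding eq .
      qed
      let ?R = "\<lambda>t. t ^ k * K (?L y t) - t ^ k * K (?L q t) - t ^ k * frechet_derivative K (at (?L q t)) (?w t)"
      have int: "(?R has_integral (I k K y - I k K q - D q (y - q))) {0..1}"
        unfolding I_def Dint[OF q]
        by (intro has_integral_diff integrable_integral Dint'[OF q]
            integrable_continuous_interval[OF contt[OF Kc yb]] integrable_continuous_interval[OF contt[OF Kc q]])
      have "norm (I k K y - I k K q - D q (y - q)) \<le> (\<epsilon> * norm (y - q)) * measure lborel (cbox 0 (1::real))"
      proof (rule has_integral_bound)
        show "(?R has_integral (I k K y - I k K q - D q (y - q))) (cbox 0 1)" using int by simp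
        show "norm (?R t) \<le> \<epsilon> * norm (y - q)" if "t \<in> cbox 0 1" for t
        proof -
          have t: "0 \<le> t" "t \<le> 1" using that by auto
          have "?R t = t ^ k * (K (?L y t) - K (?L q t) - frechet_derivative K (at (?L q t)) (?w t))"
            by (simp add: algebra_simps)
          moreover have "\<bar>t ^ k\<bar> \<le> 1" using t by (simp add: power_le_one)
          ultimately have "norm (?R t) \<le> 1 * \<bar>K (?L y t) - K (?L q t) - frechet_derivative K (at (?L q t)) (?w t)\<bar>"
            by (simp only: real_norm_def abs_mult) (intro mult_right_mono, auto)
          then show ?thesis using bound[of t] t by auto
        qed
      qed (use \<epsilon> in auto)
      then show ?thesis by simp
    qed
    then show "\<exists>d>0. \<forall>y. norm (y - q) < d \<longrightarrow> norm (I k K y - I k K q - D q (y - q)) \<le> \<epsilon> * norm (y - q)"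
      using d(1) by blast
  qed
  have "C_on m (ball q0 r) (I j (dK i))" for i j
    unfolding I_def by (rule Suc.IH[OF dKm])
  then have "C_on m (ball q0 r) (\<lambda>q. D q h)" for h
    unfolding D_def by (intro C_on_sum C_on_add C_on_mult C_on_const) auto
  then have "C_on (Suc m) (ball q0 r) (I k K)"
    using deriv by (intro C_on_SucI[of _ _ D]) auto
  then show ?case by (simp add: I_def)
qed

text \<open>Integrate the derivative of \<open>K\<close> along the segment from
  \<open>q0 + A (q - q0)\<close> to \<open>q\<close>, whose direction is \<open>B (q - q0)\<close>.
  The two complementary maps cover both uses: \<open>A = 0\<close> gives the first-order expansion
  at a point, a projection \<open>A\<close> onto a hyperplane gives division by a linear
  function.\<close>

lemma Hadamard:
  fixes K :: "'e::real_inner \<Rightarrow> real"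
  assumes e: "orthoframe n (e :: nat \<Rightarrow> 'e)" and A: "bounded_linear A" and B: "bounded_linear B"
    and AB: "\<And>t h. 0 \<le> t \<Longrightarrow> t \<le> 1 \<Longrightarrow> norm (A h + t *\<^sub>R B h) \<le> norm h"
    and AB1: "\<And>h. A h + B h = h"
    and K: "smooth_on (ball q0 r) K"
  shows "\<exists>G. (\<forall>i. smooth_on (ball q0 r) (G i)) \<and>
    (\<forall>q\<in>ball q0 r. K q - K (q0 + A (q - q0)) = (\<Sum>i<n. (e i \<bullet> B (q - q0)) * G i q))"
proof -
  let ?L = "\<lambda>q t. q0 + A (q - q0) + t *\<^sub>R B (q - q0)"
  define dK where "dK i = (\<lambda>p. frechet_derivative K (at p) (e i))" for i
  define G where "G i = (\<lambda>q. integral {0..1} (\<lambda>t. t ^ 0 * dK i (?L q t)))" for i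
  interpret B: bounded_linear B by (rule B)
  have dK: "smooth_on (ball q0 r) (dK i)" for i
    unfolding dK_def by (rule smooth_on_derivative[OF K])
  have sm: "smooth_on (ball q0 r) (G i)" for i
    unfolding G_def
    by (intro smooth_onI C_on_parametric_integral[OF e A B AB] smooth_onD[OF dK])
  have Lin: "?L q t \<in> ball q0 r" if "q \<in> ball q0 r" "0 \<le> t" "t \<le> 1" for q t
    using AB[of t "q - q0"] that unfolding add.assoc add_in_ball_iff by (auto simp: dist_norm norm_minus_commute)
  have "K q - K (q0 + A (q - q0)) = (\<Sum>i<n. (e i \<bullet> B (q - q0)) * G i q)" if q: "q \<in> ball q0 r" for q
  proof -
    have dKc: "continuous_on (ball q0 r) (dK i)" for i by (rule C_on_continuous[OF smooth_onD[OF dK]])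
    have int: "(\<lambda>t. t ^ 0 * dK i (?L q t)) integrable_on {0..1}" for i
    proof -
      have "(\<lambda>t. ?L q t) ` {0..1} \<subseteq> ball q0 r" by (intro image_subsetI Lin q) simp_all
      moreover have "continuous_on {0..1} (\<lambda>t. ?L q t)" by (intro continuous_intros)
      ultimately have "continuous_on {0..1} (\<lambda>t. dK i (?L q t))"
        by (rule continuous_on_compose2[OF dKc, rotated])
      then show ?thesis by (intro integrable_continuous_interval) simp
    qed
    let ?w = "B (q - q0)"
    have "((\<lambda>t. K (?L q t)) has_real_derivative (\<Sum>i<n. (e i \<bullet> ?w) * (t ^ 0 * dK i (?L q t)))) (at t within {0..1})"
      if "t \<in> {0..1}" for t
    proof -
      let ?K' = "frechet_derivative K (at (?L q t))"
      have K': "(K has_derivative ?K') (at (?L q t))"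
        using smooth_on_has_derivative[OF K Lin[OF q]] that by auto
      have l: "linear ?K'" using K' linear_frechet_derivative differentiable_def by blast
      have "((\<lambda>t. ?L q t) has_derivative (\<lambda>h. h *\<^sub>R ?w)) (at t within {0..1})"
        by (auto intro!: derivative_eq_intros)
      from has_derivative_compose[OF this K']
      have "((\<lambda>t. K (?L q t)) has_derivative (\<lambda>h. ?K' (h *\<^sub>R ?w))) (at t within {0..1})" .
      moreover have "?K' (h *\<^sub>R ?w) = (\<Sum>i<n. (e i \<bullet> ?w) * (t ^ 0 * dK i (?L q t))) * h" for h
        using linear_cmul[OF l, of h ?w] orthoframe_linear[OF e l, of ?w] by (simp add: dK_def)
      ultimately show ?thesis by (simp add: has_field_derivative_def)
    qed
    then have "((\<lambda>t. \<Sum>i<n. (e i \<bullet> ?w) * (t ^ 0 * dK i (?L q t))) has_integral K (?L q 1) - K (?L q 0)) {0..1}"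
      by (intro fundamental_theorem_of_calculus) (auto simp: has_real_derivative_iff_has_vector_derivative)
    moreover have "((\<lambda>t. \<Sum>i<n. (e i \<bullet> ?w) * (t ^ 0 * dK i (?L q t))) has_integral (\<Sum>i<n. (e i \<bullet> ?w) * G i q)) {0..1}"
      unfolding G_def by (intro has_integral_sum has_integral_mult_right integrable_integral int) auto
    ultimately have "K (?L q 1) - K (?L q 0) = (\<Sum>i<n. (e i \<bullet> ?w) * G i q)"
      by (rule has_integral_unique)
    moreover have "?L q 1 = q" using AB1[of "q - q0"] by (simp add: add.assoc)
    ultimately show ?thesis by simp
  qed
  with sm show ?thesis by blast
qed

lemma Hadamard_point:
  fixes K :: "'e::real_inner \<Rightarrow> real"
  assumes e: "orthoframe n (e :: nat \<Rightarrow> 'e)" and K: "smooth_on (ball q0 r) K"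
  shows "\<exists>G. (\<forall>i. smooth_on (ball q0 r) (G i)) \<and>
    (\<forall>q\<in>ball q0 r. K q = K q0 + (\<Sum>i<n. (e i \<bullet> (q - q0)) * G i q))"
proof -
  have "norm (0 + t *\<^sub>R h) \<le> norm h" if "0 \<le> t" "t \<le> 1" for t and h :: 'e
    using mult_left_le_one_le[of "norm h" t] that by simp
  from Hadamard[OF e bounded_linear_zero bounded_linear_ident this _ K]
  show ?thesis by (simp add: algebra_simps)
qed

text \<open>Here \<open>B\<close> projects to the line of \<open>e 0\<close> and \<open>A\<close> to
  its orthogonal complement. The segment starts in the hyperplane, where \<open>K\<close> vanishes,
  and of the sum only the term with index 0 survives. Pythagoras gives the norm bound.\<close>

lemma Hadamard_hyperplane:
  fixes K :: "'e::real_inner \<Rightarrow> real"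
  assumes e: "orthoframe n (e :: nat \<Rightarrow> 'e)" and n: "0 < n" and K: "smooth_on (ball q0 r) K"
    and q0: "e 0 \<bullet> q0 = 0" and zero: "\<And>q. q \<in> ball q0 r \<Longrightarrow> e 0 \<bullet> q = 0 \<Longrightarrow> K q = 0"
  shows "\<exists>G. smooth_on (ball q0 r) G \<and> (\<forall>q\<in>ball q0 r. K q = (e 0 \<bullet> q) * G q)"
proof -
  let ?B = "\<lambda>h. (e 0 \<bullet> h) *\<^sub>R e 0" and ?A = "\<lambda>h. h - (e 0 \<bullet> h) *\<^sub>R e 0"
  have e00: "e 0 \<bullet> e 0 = 1" using orthoframe_inner[OF e n n] by simp
  have blB: "bounded_linear ?B"
    by (intro bounded_linear_scaleR_const bounded_linear_inner_right)
  have blA: "bounded_linear ?A" by (intro bounded_linear_sub bounded_linear_ident blB)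
  have le: "norm (?A h + t *\<^sub>R ?B h) \<le> norm h" if "0 \<le> t" "t \<le> 1" for t h
  proof -
    have "(?A h + t *\<^sub>R ?B h) \<bullet> (?A h + t *\<^sub>R ?B h) = h \<bullet> h - (1 - t) * (1 + t) * (e 0 \<bullet> h)\<^sup>2"
      using e00 by (simp add: inner_simps inner_commute[of h "e 0"] algebra_simps power2_eq_square)
    also have "\<dots> \<le> h \<bullet> h" using that by simp
    finally show ?thesis by (simp add: norm_le)
  qed
  have AB1: "?A h + ?B h = h" for h by simp
  have "\<exists>G. (\<forall>i. smooth_on (ball q0 r) (G i)) \<and>
      (\<forall>q\<in>ball q0 r. K q - K (q0 + ?A (q - q0)) = (\<Sum>i<n. (e i \<bullet> ?B (q - q0)) * G i q))"
    by (rule Hadamard[OF e blA blB _ AB1 K]) (rule le)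
  then obtain G where G': "\<forall>i. smooth_on (ball q0 r) (G i)"
    "\<forall>q\<in>ball q0 r. K q - K (q0 + ?A (q - q0)) = (\<Sum>i<n. (e i \<bullet> ?B (q - q0)) * G i q)"
    by (elim exE conjE)
  note G = G'(1)[rule_format] G'(2)[rule_format]
  have "K q = (e 0 \<bullet> q) * G 0 q" if q: "q \<in> ball q0 r" for q
  proof -
    have "norm (?A (q - q0)) \<le> norm (q - q0)" using le[of 0 "q - q0"] by simp
    moreover have "norm (q - q0) < r" using q by (simp add: dist_norm norm_minus_commute)
    ultimately have "q0 + ?A (q - q0) \<in> ball q0 r" unfolding add_in_ball_iff by linarith
    moreover have "e 0 \<bullet> (q0 + ?A (q - q0)) = 0"
      using e00 q0 by (simp add: inner_add_right inner_diff_right)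
    ultimately have "K (q0 + ?A (q - q0)) = 0" by (rule zero)
    moreover have "(\<Sum>i<n. (e i \<bullet> ?B (q - q0)) * G i q) = (\<Sum>i<n. if i = 0 then (e 0 \<bullet> q) * G i q else 0)"
      by (intro sum.cong) (use orthoframe_inner[OF e _ n] q0 in \<open>auto simp: inner_diff_right\<close>)
    ultimately show ?thesis using G(2)[OF q] n by simp
  qed
  then show ?thesis using G(1) by blast
qed

section \<open>The sheaf of smooth functions\<close>

lemma is_chartD:
  assumes "is_chart (U, \<phi>)"
  shows "open U" "open (\<phi> ` U)" "continuous_on U \<phi>" "continuous_on (\<phi> ` U) (inv_into U \<phi>)"
    "inj_on \<phi> U"
  using assms unfolding is_chart_def homeomorphism_def inj_on_def by auto metis+

lemma chart_inv: "is_chart (U, \<phi>) \<Longrightarrow> p \<in> U \<Longrightarrow> inv_into U \<phi> (\<phi> p) = p"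
  using is_chartD(5) by (intro inv_into_f_f)

lemma chart_open_image:
  assumes "is_chart (U, \<phi>)" "open W" "W \<subseteq> U"
  shows "open (\<phi> ` W)"
proof -
  have "\<phi> ` W = \<phi> ` U \<inter> inv_into U \<phi> -` W"
    using assms(3) chart_inv[OF assms(1)] by (auto simp: subset_iff image_iff)
  then show ?thesis
    using continuous_open_preimage[OF is_chartD(4)[OF assms(1)] is_chartD(2)[OF assms(1)] assms(2)] by simp
qed

lemma smooth_fun_subset: "smooth_fun A W g \<Longrightarrow> W' \<subseteq> W \<Longrightarrow> smooth_fun A W' g"
  unfolding smooth_fun_def smooth_on_def
  by (fast intro: C_on_subset elim: image_mono)

locale mfd =
  fixes A :: "('x::t2_space, 'e::real_inner) atlas"
  assumes mfd: "manifold A"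
begin

lemma atlas_chart: "(U, \<phi>) \<in> A \<Longrightarrow> is_chart (U, \<phi>)"
  using mfd by (auto simp: manifold_def)

lemma atlas_smooth_chart: "(U, \<phi>) \<in> A \<Longrightarrow> smooth_chart A (U, \<phi>)"
  using mfd unfolding manifold_def smooth_chart_def by blast

lemma atlas_cover: obtains U \<phi> where "(U, \<phi>) \<in> A" "p \<in> U"
proof -
  have "p \<in> (\<Union>C\<in>A. fst C)" using mfd unfolding manifold_def by blast
  then show thesis using that by (auto simp: split_beta)
qed

lemma ex_frame: obtains e :: "nat \<Rightarrow> 'e" where "orthoframe (mdim A) e"
proof -
  obtain Bs :: "'e set" where "finite Bs" "span Bs = UNIV" using mfd unfolding manifold_def by blast
  from ex_orthoframe[OF this, of 0 "[]"] show thesis using that unfolding mdim_def by auto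
qed

lemma ex_frame_at:
  assumes "v \<noteq> (0::'e)"
  obtains e :: "nat \<Rightarrow> 'e" where "orthoframe (mdim A) e" "e 0 = v /\<^sub>R norm v" "0 < mdim A"
proof -
  obtain Bs :: "'e set" where "finite Bs" "span Bs = UNIV" using mfd unfolding manifold_def by blast
  from ex_orthoframe[OF this, of v "[v /\<^sub>R norm v]"] assms obtain es where
    "take 1 es = [v /\<^sub>R norm v]" "length es = mdim A" "orthoframe (length es) ((!) es)"
    unfolding mdim_def by auto
  moreover from this(1) have "es ! 0 = v /\<^sub>R norm v" "0 < length es"
    by (cases es; simp)+
  ultimately show thesis using that by metis
qed

lemma smooth_fun_cong:
  assumes "open W" "\<And>p. p \<in> W \<Longrightarrow> g p = h p" "smooth_fun A W g"
  shows "smooth_fun A W h"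
  unfolding smooth_fun_def
proof (clarify, rule smooth_onI)
  fix U \<phi> k assume C: "(U, \<phi>) \<in> A"
  note ch = atlas_chart[OF C]
  show "C_on k (\<phi> ` (U \<inter> W)) (\<lambda>p. h (inv_into U \<phi> p))"
  proof (rule C_on_cong)
    show "open (\<phi> ` (U \<inter> W))"
      using chart_open_image[OF ch] is_chartD(1)[OF ch] assms(1) by auto
    show "C_on k (\<phi> ` (U \<inter> W)) (\<lambda>p. g (inv_into U \<phi> p))"
      using assms(3) C unfolding smooth_fun_def smooth_on_def by blast
  qed (use assms(2) chart_inv[OF ch] in auto)
qed

lemma smooth_fun_local:
  assumes "\<And>p. p \<in> W \<Longrightarrow> \<exists>N. open N \<and> p \<in> N \<and> smooth_fun A N g"
  shows "smooth_fun A W g"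
  unfolding smooth_fun_def
proof (clarify, rule smooth_onI, rule C_on_local)
  fix U \<phi> k q assume C: "(U, \<phi>) \<in> A" and q: "q \<in> \<phi> ` (U \<inter> W)"
  note ch = atlas_chart[OF C]
  obtain p where p: "p \<in> U" "p \<in> W" "q = \<phi> p" using q by auto
  obtain N where N: "open N" "p \<in> N" "smooth_fun A N g" using assms[OF p(2)] by blast
  have "open (\<phi> ` (U \<inter> N))"
    using chart_open_image[OF ch, of "U \<inter> N"] is_chartD(1)[OF ch] N(1) by auto
  moreover have "C_on k (\<phi> ` (U \<inter> N)) (\<lambda>p. g (inv_into U \<phi> p))"
    using N(3) C unfolding smooth_fun_def smooth_on_def by blast
  ultimately show "\<exists>N. open N \<and> q \<in> N \<and> C_on k N (\<lambda>p. g (inv_into U \<phi> p))"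
    using p N(2) by (intro exI[of _ "\<phi> ` (U \<inter> N)"]) auto
qed

lemma smooth_fun_opI:
  assumes "open W"
    "\<And>U \<phi> k. (U, \<phi>) \<in> A \<Longrightarrow> open (\<phi> ` (U \<inter> W)) \<Longrightarrow> C_on k (\<phi> ` (U \<inter> W)) (\<lambda>p. g (inv_into U \<phi> p))"
  shows "smooth_fun A W g"
  unfolding smooth_fun_def
proof (clarify, rule smooth_onI)
  fix U \<phi> k assume C: "(U, \<phi>) \<in> A"
  show "C_on k (\<phi> ` (U \<inter> W)) (\<lambda>p. g (inv_into U \<phi> p))"
    using assms(2)[OF C] chart_open_image[OF atlas_chart[OF C], of "U \<inter> W"]
      is_chartD(1)[OF atlas_chart[OF C]] assms(1) by auto
qed

lemma smooth_fun_C_on: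
  "smooth_fun A W g \<Longrightarrow> (U, \<phi>) \<in> A \<Longrightarrow> C_on k (\<phi> ` (U \<inter> W)) (\<lambda>p. g (inv_into U \<phi> p))"
  unfolding smooth_fun_def smooth_on_def by blast

lemma smooth_fun_const: "open W \<Longrightarrow> smooth_fun A W (\<lambda>_. c)"
  by (rule smooth_fun_opI) (auto intro: C_on_const)

lemma smooth_fun_add:
  "open W \<Longrightarrow> smooth_fun A W g \<Longrightarrow> smooth_fun A W h \<Longrightarrow> smooth_fun A W (\<lambda>p. g p + h p)"
  by (rule smooth_fun_opI) (auto intro: C_on_add smooth_fun_C_on)

lemma smooth_fun_mult:
  "open W \<Longrightarrow> smooth_fun A W g \<Longrightarrow> smooth_fun A W h \<Longrightarrow> smooth_fun A W (\<lambda>p. g p * h p)"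
  by (rule smooth_fun_opI) (auto intro: C_on_mult smooth_fun_C_on)

lemma smooth_fun_cmult:
  "open W \<Longrightarrow> smooth_fun A W g \<Longrightarrow> smooth_fun A W (\<lambda>p. c * g p)"
  by (intro smooth_fun_mult smooth_fun_const)

lemma smooth_fun_uminus: "open W \<Longrightarrow> smooth_fun A W g \<Longrightarrow> smooth_fun A W (\<lambda>p. - g p)"
  using smooth_fun_cmult[of W g "- 1"] by simp

lemma smooth_fun_diff:
  "open W \<Longrightarrow> smooth_fun A W g \<Longrightarrow> smooth_fun A W h \<Longrightarrow> smooth_fun A W (\<lambda>p. g p - h p)"
  using smooth_fun_add[of W g "\<lambda>p. - h p"] smooth_fun_uminus[of W h] by simp

lemma smooth_fun_sum:
  assumes "open W" "\<And>i. i \<in> I \<Longrightarrow> smooth_fun A W (g i)"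
  shows "smooth_fun A W (\<lambda>p. \<Sum>i\<in>I. g i p)"
proof (cases "finite I")
  case True
  then show ?thesis using assms(2)
    by (induction I rule: finite_induct) (auto intro: smooth_fun_add smooth_fun_const assms(1))
qed (simp add: smooth_fun_const assms(1))

lemma smooth_fun_prod:
  assumes "open W" "\<And>i. i \<in> I \<Longrightarrow> smooth_fun A W (g i)"
  shows "smooth_fun A W (\<lambda>p. \<Prod>i\<in>I. g i p)"
proof (cases "finite I")
  case True
  then show ?thesis using assms(2)
    by (induction I rule: finite_induct) (auto intro: smooth_fun_mult smooth_fun_const assms(1))
qed (simp add: smooth_fun_const assms(1))

lemma smooth_fun_inverse:
  assumes "open W" "\<And>p. p \<in> W \<Longrightarrow> g p \<noteq> 0" "smooth_fun A W g"
  shows "smooth_fun A W (\<lambda>p. inverse (g p))"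
proof (rule smooth_fun_opI[OF assms(1)])
  fix U \<phi> k assume C: "(U, \<phi>) \<in> A" and o: "open (\<phi> ` (U \<inter> W))"
  show "C_on k (\<phi> ` (U \<inter> W)) (\<lambda>p. inverse (g (inv_into U \<phi> p)))"
    by (rule C_on_inverse[OF o _ smooth_fun_C_on[OF assms(3) C]])
      (use assms(2) chart_inv[OF atlas_chart[OF C]] in auto)
qed

lemma smooth_fun_divide:
  assumes "open W" "\<And>p. p \<in> W \<Longrightarrow> h p \<noteq> 0" "smooth_fun A W g" "smooth_fun A W h"
  shows "smooth_fun A W (\<lambda>p. g p / h p)"
  unfolding divide_inverse by (intro smooth_fun_mult smooth_fun_inverse assms)

lemma smooth_fun_continuous:
  assumes "open W" "smooth_fun A W g"
  shows "continuous_on W g"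
proof (rule continuous_at_imp_continuous_on, rule ballI)
  fix p assume p: "p \<in> W"
  obtain U \<phi> where C: "(U, \<phi>) \<in> A" "p \<in> U" by (rule atlas_cover)
  note ch = atlas_chart[OF C(1)]
  have "continuous_on (\<phi> ` (U \<inter> W)) (\<lambda>p. g (inv_into U \<phi> p))"
    using C_on_continuous[OF smooth_fun_C_on[OF assms(2) C(1), of 0]] .
  moreover have "continuous_on (U \<inter> W) \<phi>" using is_chartD(3)[OF ch] continuous_on_subset by blast
  ultimately have "continuous_on (U \<inter> W) (\<lambda>p. g (inv_into U \<phi> (\<phi> p)))"
    by (rule continuous_on_compose2) simp
  then have "continuous_on (U \<inter> W) g"
    by (rule continuous_on_eq) (use chart_inv[OF ch] in auto)
  moreover have "open (U \<inter> W)" using is_chartD(1)[OF ch] assms(1) by auto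
  ultimately show "isCont g p" using p C(2) by (simp add: continuous_on_eq_continuous_at)
qed

text \<open>Transition maps are smooth both ways, so one chart decides smoothness on its domain. The
  chart may lie outside the given atlas: straightening charts of a hypersurface come from the
  maximal one.\<close>

lemma smooth_fun_chart_iff:
  assumes C: "smooth_chart A (U, \<phi>)" and W: "open W" "W \<subseteq> U"
  shows "smooth_fun A W g \<longleftrightarrow> smooth_on (\<phi> ` W) (\<lambda>q. g (inv_into U \<phi> q))"
proof -
  obtain e :: "nat \<Rightarrow> 'e" where e: "orthoframe (mdim A) e" by (rule ex_frame)
  have ch: "is_chart (U, \<phi>)" using C by (simp add: smooth_chart_def)
  have trans: "C_on k (\<psi> ` (V \<inter> W)) (\<lambda>q. \<phi> (inv_into V \<psi> q))"
    "C_on k (\<phi> ` (V \<inter> W)) (\<lambda>q. \<psi> (inv_into U \<phi> q))" if "(V, \<psi>) \<in> A" for V \<psi> k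
  proof -
    have "compatible (U, \<phi>) (V, \<psi>)" using C that by (auto simp: smooth_chart_def)
    then show "C_on k (\<psi> ` (V \<inter> W)) (\<lambda>q. \<phi> (inv_into V \<psi> q))"
      "C_on k (\<phi> ` (V \<inter> W)) (\<lambda>q. \<psi> (inv_into U \<phi> q))"
      using W(2) unfolding compatible_def smooth_on_def by (auto intro: C_on_subset)
  qed
  have open_im: "open (\<psi> ` (V \<inter> W))" if "is_chart (V, \<psi>)" for V and \<psi> :: "'x \<Rightarrow> 'e"
    using chart_open_image[OF that, of "V \<inter> W"] is_chartD(1)[OF that] W(1) by auto
  have open_im2: "open (\<phi> ` (V \<inter> W))" if "open V" for V
    using chart_open_image[OF ch, of "V \<inter> W"] that W by auto
  show ?thesis
  proof
    assume g: "smooth_fun A W g"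
    show "smooth_on (\<phi> ` W) (\<lambda>q. g (inv_into U \<phi> q))"
    proof (rule smooth_onI, rule C_on_local)
      fix k q assume "q \<in> \<phi> ` W"
      then obtain p where p: "p \<in> W" "q = \<phi> p" by auto
      obtain V \<psi> where V: "(V, \<psi>) \<in> A" "p \<in> V" by (rule atlas_cover)
      note chV = atlas_chart[OF V(1)]
      have inv: "inv_into U \<phi> (\<phi> z) = z" "inv_into V \<psi> (\<psi> z) = z" if "z \<in> V \<inter> W" for z
        using chart_inv[OF ch] chart_inv[OF chV] that W(2) by auto
      have "C_on k (\<phi> ` (V \<inter> W)) (\<lambda>q. g (inv_into V \<psi> (\<psi> (inv_into U \<phi> q))))"
        by (rule C_on_compose[OF e open_im2 open_im[OF chV] _ trans(2)[OF V(1)] smooth_fun_C_on[OF g V(1)]])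
          (use is_chartD(1)[OF chV] inv in auto)
      then have "C_on k (\<phi> ` (V \<inter> W)) (\<lambda>q. g (inv_into U \<phi> q))"
        by (rule C_on_cong[rotated 2]) (use open_im2 is_chartD(1)[OF chV] inv in auto)
      then show "\<exists>N. open N \<and> q \<in> N \<and> C_on k N (\<lambda>q. g (inv_into U \<phi> q))"
        using p V(2) open_im2[OF is_chartD(1)[OF chV]] by blast
    qed
  next
    assume g: "smooth_on (\<phi> ` W) (\<lambda>q. g (inv_into U \<phi> q))"
    show "smooth_fun A W g"
    proof (rule smooth_fun_opI[OF W(1)])
      fix V \<psi> k assume V: "(V, \<psi>) \<in> A" and o: "open (\<psi> ` (V \<inter> W))"
      note chV = atlas_chart[OF V]
      have inv: "inv_into U \<phi> (\<phi> z) = z" "inv_into V \<psi> (\<psi> z) = z" if "z \<in> V \<inter> W" for z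
        using chart_inv[OF ch] chart_inv[OF chV] that W(2) by auto
      have "C_on k (\<psi> ` (V \<inter> W)) (\<lambda>q. g (inv_into U \<phi> (\<phi> (inv_into V \<psi> q))))"
        by (rule C_on_compose[OF e o chart_open_image[OF ch W] _ trans(1)[OF V] smooth_onD[OF g]])
          (use inv in auto)
      then show "C_on k (\<psi> ` (V \<inter> W)) (\<lambda>q. g (inv_into V \<psi> q))"
        by (rule C_on_cong[rotated 2]) (use o inv in auto)
    qed
  qed
qed

lemma smooth_fun_compose_chart:
  assumes C: "smooth_chart A (U, \<phi>)" and W: "open W" "W \<subseteq> U"
    and T: "open T" "\<phi> ` W \<subseteq> T" and G: "smooth_on T G"
  shows "smooth_fun A W (\<lambda>p. G (\<phi> p))"
  unfolding smooth_fun_chart_iff[OF C W]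
proof (rule smooth_onI)
  fix k
  have ch: "is_chart (U, \<phi>)" using C by (simp add: smooth_chart_def)
  show "C_on k (\<phi> ` W) (\<lambda>q. G (\<phi> (inv_into U \<phi> q)))"
    by (rule C_on_cong[OF chart_open_image[OF ch W] _ C_on_subset[OF smooth_onD[OF G] T(2)]])
      (use chart_inv[OF ch] W(2) in auto)
qed

lemma smooth_fun_coordinate:
  assumes "smooth_chart A (U, \<phi>)"
  shows "smooth_fun A U (\<lambda>p. v \<bullet> \<phi> p)"
  using assms by (intro smooth_fun_compose_chart[OF assms _ _ open_UNIV])
    (auto intro: smooth_onI C_on_bounded_linear bounded_linear_inner_right simp: smooth_chart_def is_chartD(1))

lemma smooth_fun_real_compose:
  assumes "open W" "smooth_fun A W g" "\<And>k. C_on k UNIV (h :: real \<Rightarrow> real)"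
  shows "smooth_fun A W (\<lambda>p. h (g p))"
proof (rule smooth_fun_opI[OF assms(1)])
  fix U \<phi> k assume C: "(U, \<phi>) \<in> A" and o: "open (\<phi> ` (U \<inter> W))"
  have e: "orthoframe 1 (\<lambda>_. 1 :: real)" by (simp add: orthoframe_def)
  show "C_on k (\<phi> ` (U \<inter> W)) (\<lambda>p. h (g (inv_into U \<phi> p)))"
    by (rule C_on_compose[OF e o open_UNIV _ smooth_fun_C_on[OF assms(2) C] assms(3)]) simp
qed

lemma smooth_fun_cutoff:
  assumes "open W" "smooth_fun A W g"
  shows "smooth_fun A W (\<lambda>p. cutoff (g p))"
  unfolding cutoff_def
  by (intro smooth_fun_mult smooth_fun_inverse smooth_fun_add smooth_fun_real_compose[of _ _ "flat 0"]
      smooth_fun_diff smooth_fun_const assms flat_C_on)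
    (use cutoff_denominator in \<open>metis less_irrefl\<close>)

text \<open>A cutoff of a quadratic polynomial in one chart, extended by 0. The set \<open>K\<close>
  is compact, hence closed in a Hausdorff space, so that smoothness outside the chart can be checked
  on its complement. It is part of the conclusion because later products with functions known only
  on \<open>W\<close> are extended by 0 across it.\<close>

lemma ex_bump:
  assumes "open W" "x \<in> W"
  obtains \<rho> N K where "smooth_fun A UNIV \<rho>" "\<And>p. 0 \<le> \<rho> p" "\<And>p. \<rho> p \<le> 1"
    "open N" "x \<in> N" "N \<subseteq> W" "\<And>p. p \<in> N \<Longrightarrow> \<rho> p = 1"
    "closed K" "K \<subseteq> W" "\<And>p. p \<notin> K \<Longrightarrow> \<rho> p = 0"
proof -
  obtain e :: "nat \<Rightarrow> 'e" where e: "orthoframe (mdim A) e" by (rule ex_frame)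
  obtain U \<phi> where C: "(U, \<phi>) \<in> A" "x \<in> U" by (rule atlas_cover)
  note ch = atlas_chart[OF C(1)]
  have oW: "open (U \<inter> W)" using is_chartD(1)[OF ch] assms(1) by auto
  have "open (\<phi> ` (U \<inter> W))" by (rule chart_open_image[OF ch oW]) auto
  moreover have "\<phi> x \<in> \<phi> ` (U \<inter> W)" using C(2) assms(2) by auto
  ultimately obtain \<epsilon> where \<epsilon>: "\<epsilon> > 0" "cball (\<phi> x) \<epsilon> \<subseteq> \<phi> ` (U \<inter> W)"
    using open_contains_cball by blast
  define K where "K = inv_into U \<phi> ` cball (\<phi> x) \<epsilon>"
  have "continuous_on (cball (\<phi> x) \<epsilon>) (inv_into U \<phi>)"
    by (rule continuous_on_subset[OF is_chartD(4)[OF ch]]) (use \<epsilon>(2) in auto)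
  then have "compact K" unfolding K_def
    by (rule compact_continuous_image[OF _ compact_cball_orthoframe[OF e]])
  then have K: "closed K" by (rule compact_imp_closed)
  have KW: "K \<subseteq> U \<inter> W" unfolding K_def using \<epsilon>(2) chart_inv[OF ch] by fastforce
  have K_iff: "p \<in> K \<longleftrightarrow> norm (\<phi> p - \<phi> x) \<le> \<epsilon>" if "p \<in> U" for p
  proof -
    have "p \<in> K \<longleftrightarrow> \<phi> p \<in> cball (\<phi> x) \<epsilon>"
    proof
      assume "p \<in> K"
      then obtain q where q: "q \<in> cball (\<phi> x) \<epsilon>" "p = inv_into U \<phi> q" unfolding K_def by blast
      then obtain z where "z \<in> U" "q = \<phi> z" using \<epsilon>(2) by blast
      then show "\<phi> p \<in> cball (\<phi> x) \<epsilon>" using q chart_inv[OF ch] by simp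
    next
      assume "\<phi> p \<in> cball (\<phi> x) \<epsilon>"
      then have "inv_into U \<phi> (\<phi> p) \<in> K" unfolding K_def by (rule imageI)
      then show "p \<in> K" using chart_inv[OF ch that] by simp
    qed
    then show ?thesis by (simp add: dist_norm norm_minus_commute)
  qed
  \<comment> \<open>The squared coordinate distance to \<open>x\<close>, written through coordinate
    functions because these are known to be smooth.\<close>
  define s where "s p = (\<Sum>i<mdim A. (e i \<bullet> \<phi> p - e i \<bullet> \<phi> x) * (e i \<bullet> \<phi> p - e i \<bullet> \<phi> x))" for p
  have s: "s p = (norm (\<phi> p - \<phi> x))\<^sup>2" for p
  proof -
    let ?v = "\<phi> p - \<phi> x"
    have "?v \<bullet> ?v = (\<Sum>i<mdim A. (e i \<bullet> ?v) *\<^sub>R e i) \<bullet> ?v"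
      using orthoframe_expand[OF e, of ?v] by simp
    also have "\<dots> = s p" by (simp add: s_def inner_sum_left inner_diff_right right_diff_distrib sum_subtractf)
    finally show ?thesis by (simp add: power2_norm_eq_inner)
  qed
  \<comment> \<open>The value is 2 at \<open>x\<close> and falls to 0 at distance
    \<open>\<epsilon>\<close>: above 1 near \<open>x\<close>, where the cutoff is 1, and at most 0
    outside \<open>K\<close>, where it vanishes.\<close>
  define t where "t p = 2 - (2 / \<epsilon>\<^sup>2) * s p" for p
  define \<rho> where "\<rho> p = (if p \<in> K then cutoff (t p) else 0)" for p
  have smt: "smooth_fun A (U \<inter> W) t"
    unfolding t_def[abs_def] s_def[abs_def]
    by (intro smooth_fun_diff smooth_fun_cmult smooth_fun_sum smooth_fun_mult smooth_fun_const oW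
        smooth_fun_subset[OF smooth_fun_coordinate[OF atlas_smooth_chart[OF C(1)]]]) auto
  have eq: "\<rho> p = cutoff (t p)" if "p \<in> U \<inter> W" for p
  proof (cases "p \<in> K")
    case False
    then have "\<epsilon> < norm (\<phi> p - \<phi> x)" using K_iff that by auto
    then have "\<epsilon>\<^sup>2 < s p" unfolding s using \<epsilon>(1) by (intro power_strict_mono) auto
    then have "t p \<le> 0" using \<epsilon>(1) by (simp add: t_def field_simps)
    then show ?thesis using False cutoff_props(4) by (simp add: \<rho>_def)
  qed (simp add: \<rho>_def)
  have "smooth_fun A UNIV \<rho>"
  proof (rule smooth_fun_local)
    fix p :: 'x
    show "\<exists>N. open N \<and> p \<in> N \<and> smooth_fun A N \<rho>"
    proof (cases "p \<in> U \<inter> W")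
      case True
      have "smooth_fun A (U \<inter> W) \<rho>"
        by (rule smooth_fun_cong[OF oW _ smooth_fun_cutoff[OF oW smt]]) (use eq in auto)
      then show ?thesis using True oW by blast
    next
      case False
      have "smooth_fun A (- K) \<rho>"
        by (rule smooth_fun_cong[OF _ _ smooth_fun_const[of _ 0]]) (use K in \<open>auto simp: \<rho>_def\<close>)
      moreover have "open (- K)" using K by auto
      ultimately show ?thesis using False KW by blast
    qed
  qed
  moreover have "\<exists>N. open N \<and> x \<in> N \<and> N \<subseteq> U \<inter> W \<and> (\<forall>p\<in>N. \<rho> p = 1)"
  proof (intro exI conjI)
    let ?N = "(U \<inter> W) \<inter> t -` {1<..}"
    show "open ?N"
      by (rule continuous_open_preimage[OF smooth_fun_continuous[OF oW smt] oW]) auto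
    show "x \<in> ?N" using C(2) assms(2) by (simp add: t_def s)
    show "\<forall>p\<in>?N. \<rho> p = 1" using eq cutoff_props(3) by auto
  qed auto
  ultimately show thesis
    using that[of \<rho> _ K] K KW cutoff_props(1,2) by (auto simp: \<rho>_def)
qed

lemma smooth_fun_extend:
  assumes "smooth_fun A UNIV \<rho>" "closed K" "K \<subseteq> W" "open W" "\<And>p. p \<notin> K \<Longrightarrow> \<rho> p = 0" "smooth_fun A W g"
  shows "smooth_fun A UNIV (\<lambda>p. \<rho> p * g p)"
proof (rule smooth_fun_local)
  fix p :: 'x
  show "\<exists>N. open N \<and> p \<in> N \<and> smooth_fun A N (\<lambda>p. \<rho> p * g p)"
  proof (cases "p \<in> W")
    case True
    then show ?thesis
      using assms by (intro exI[of _ W]) (auto intro: smooth_fun_mult smooth_fun_subset)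
  next
    case False
    have "open (- K)" using assms(2) by auto
    moreover have "smooth_fun A (- K) (\<lambda>p. \<rho> p * g p)"
      by (rule smooth_fun_cong[OF _ _ smooth_fun_const[of _ 0]]) (use assms in auto)
    ultimately show ?thesis using False assms(3) by blast
  qed
qed

text \<open>Two local quotients by \<open>s\<close> agree where \<open>s\<close> is nonzero. This
  set is dense, so they agree on the whole overlap by continuity and glue to a smooth
  function.\<close>

lemma smooth_quotient_glue:
  assumes W: "open W" and s: "smooth_fun A W s"
    and dense: "\<And>N. open N \<Longrightarrow> N \<subseteq> W \<Longrightarrow> N \<noteq> {} \<Longrightarrow> \<exists>q\<in>N. s q \<noteq> 0"
    and loc: "\<And>p. p \<in> W \<Longrightarrow> \<exists>N h. open N \<and> p \<in> N \<and> N \<subseteq> W \<and> smooth_fun A N h \<and> (\<forall>q\<in>N. g q = s q * h q)"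
  shows "\<exists>h. smooth_fun A W h \<and> (\<forall>q\<in>W. g q = s q * h q)"
proof -
  obtain N h where N: "\<And>p. p \<in> W \<Longrightarrow> open (N p) \<and> p \<in> N p \<and> N p \<subseteq> W \<and> smooth_fun A (N p) (h p)
      \<and> (\<forall>q\<in>N p. g q = s q * h p q)"
    using loc by metis
  \<comment> \<open>At every point the quotient chosen for that point is used; independence of the
    choice is the next claim.\<close>
  define H where "H p = h p p" for p
  have eq: "H q = h p q" if p: "p \<in> W" and q: "q \<in> N p" for p q
  proof (rule ccontr)
    assume ne: "H q \<noteq> h p q"
    have qW: "q \<in> W" using N[OF p] q by blast
    let ?M = "N p \<inter> N q"
    have o: "open ?M" using N[OF p] N[OF qW] by blast
    have c: "continuous_on ?M (h p)" "continuous_on ?M (h q)"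
      using N[OF p] N[OF qW] smooth_fun_continuous continuous_on_subset by (metis inf_le1, metis inf_le2)
    then have "continuous_on ?M (\<lambda>z. h q z - h p z)" by (intro continuous_intros)
    from continuous_open_preimage[OF this o, of "- {0}"]
    have "open (?M \<inter> (\<lambda>z. h q z - h p z) -` (- {0}))" by auto
    moreover have "q \<in> ?M \<inter> (\<lambda>z. h q z - h p z) -` (- {0})"
      using ne q N[OF qW] by (simp add: H_def)
    moreover have "?M \<inter> (\<lambda>z. h q z - h p z) -` (- {0}) \<subseteq> W" using N[OF p] by blast
    ultimately have "\<exists>z\<in>?M \<inter> (\<lambda>z. h q z - h p z) -` (- {0}). s z \<noteq> 0"
      by (intro dense) (assumption, assumption, rule notI, simp)
    then obtain z where "z \<in> ?M \<inter> (\<lambda>z. h q z - h p z) -` (- {0})" and sz: "s z \<noteq> 0" by (rule bexE)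
    then have z: "z \<in> ?M" "h q z \<noteq> h p z" by auto
    have "s z * h q z = s z * h p z" using N[OF p] N[OF qW] z(1) by (metis IntD1 IntD2)
    then show False using z sz by simp
  qed
  have "smooth_fun A W H"
  proof (rule smooth_fun_local)
    fix p assume p: "p \<in> W"
    have "smooth_fun A (N p) H"
      by (rule smooth_fun_cong[of _ "h p"]) (use N[OF p] eq[OF p] in auto)
    then show "\<exists>N. open N \<and> p \<in> N \<and> smooth_fun A N H" using N[OF p] by blast
  qed
  moreover have "\<forall>q\<in>W. g q = s q * H q" using N by (auto simp: H_def)
  ultimately show ?thesis by blast
qed

end

section \<open>Tangent vectors and local coordinates\<close>

context mfd
begin

lemma smooth_nearI: "open W \<Longrightarrow> x \<in> W \<Longrightarrow> smooth_fun A W g \<Longrightarrow> smooth_near A x g"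
  unfolding smooth_near_def by blast

lemma smooth_near2E:
  assumes "smooth_near A x g" "smooth_near A x h"
  obtains W where "open W" "x \<in> W" "smooth_fun A W g" "smooth_fun A W h"
proof -
  obtain V W where "open V" "x \<in> V" "smooth_fun A V g" "open W" "x \<in> W" "smooth_fun A W h"
    using assms unfolding smooth_near_def by blast
  then show thesis using that[of "V \<inter> W"] smooth_fun_subset by (metis IntI inf_le1 inf_le2 open_Int)
qed

lemma smooth_near_const: "smooth_near A x (\<lambda>_. c)"
  by (rule smooth_nearI[OF open_UNIV _ smooth_fun_const]) auto

lemma smooth_near_mult:
  "smooth_near A x g \<Longrightarrow> smooth_near A x h \<Longrightarrow> smooth_near A x (\<lambda>p. g p * h p)"
  by (erule (1) smooth_near2E) (auto intro: smooth_nearI smooth_fun_mult)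

lemma smooth_near_add:
  "smooth_near A x g \<Longrightarrow> smooth_near A x h \<Longrightarrow> smooth_near A x (\<lambda>p. g p + h p)"
  by (erule (1) smooth_near2E) (auto intro: smooth_nearI smooth_fun_add)

lemma smooth_near_diff:
  "smooth_near A x g \<Longrightarrow> smooth_near A x h \<Longrightarrow> smooth_near A x (\<lambda>p. g p - h p)"
  by (erule (1) smooth_near2E) (auto intro: smooth_nearI smooth_fun_diff)

lemma smooth_near_cmult: "smooth_near A x g \<Longrightarrow> smooth_near A x (\<lambda>p. c * g p)"
  by (intro smooth_near_mult smooth_near_const)

lemma smooth_near_sum:
  assumes "finite I" "\<And>i. i \<in> I \<Longrightarrow> smooth_near A x (g i)"
  shows "smooth_near A x (\<lambda>p. \<Sum>i\<in>I. g i p)"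
  using assms
  by (induction I rule: finite_induct) (auto intro: smooth_near_add smooth_near_const)

lemma smooth_near_cong:
  assumes "open W" "x \<in> W" "\<And>p. p \<in> W \<Longrightarrow> g p = h p" "smooth_near A x g"
  shows "smooth_near A x h"
proof -
  obtain V where V: "open V" "x \<in> V" "smooth_fun A V g" using assms(4) unfolding smooth_near_def by blast
  have "smooth_fun A (V \<inter> W) h"
    by (rule smooth_fun_cong[of _ g]) (use V assms smooth_fun_subset[OF V(3)] in auto)
  then show ?thesis using V assms by (intro smooth_nearI[of "V \<inter> W"]) auto
qed

section \<open>Calculus with derivations at a point\<close>

context
  fixes x v
  assumes v: "v \<in> tangent_space A x"
begin

lemma tangent_linear:
  "smooth_near A x g \<Longrightarrow> smooth_near A x h \<Longrightarrow> v (\<lambda>p. a * g p + b * h p) = a * v g + b * v h"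
  using v unfolding tangent_space_def by blast

lemma tangent_mult:
  "smooth_near A x g \<Longrightarrow> smooth_near A x h \<Longrightarrow> v (\<lambda>p. g p * h p) = v g * h x + g x * v h"
  using v unfolding tangent_space_def by blast

lemma tangent_germ:
  assumes "smooth_near A x g" "open W" "x \<in> W" "\<And>p. p \<in> W \<Longrightarrow> g p = h p"
  shows "v g = v h"
proof -
  have "smooth_near A x h" by (rule smooth_near_cong[OF assms(2,3,4,1)])
  moreover have "\<forall>\<^sub>F p in nhds x. g p = h p" using assms(2-4) by (auto simp: eventually_nhds)
  ultimately show ?thesis using v assms(1) unfolding tangent_space_def by blast
qed

lemma tangent_not_smooth: "\<not> smooth_near A x g \<Longrightarrow> v g = 0"
  using v unfolding tangent_space_def by blast

lemma tangent_add: "smooth_near A x g \<Longrightarrow> smooth_near A x h \<Longrightarrow> v (\<lambda>p. g p + h p) = v g + v h"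
  using tangent_linear[of g h 1 1] by simp

lemma tangent_diff: "smooth_near A x g \<Longrightarrow> smooth_near A x h \<Longrightarrow> v (\<lambda>p. g p - h p) = v g - v h"
  using tangent_linear[of g h 1 "- 1"] by simp

lemma tangent_const: "v (\<lambda>_. c) = 0"
proof -
  have "v (\<lambda>_. 1) = 0" using tangent_mult[of "\<lambda>_. 1" "\<lambda>_. 1"] smooth_near_const by simp
  then show ?thesis using tangent_linear[of "\<lambda>_. 1" "\<lambda>_. 1" c 0] smooth_near_const by simp
qed

lemma tangent_sum:
  assumes "finite I" "\<And>i. i \<in> I \<Longrightarrow> smooth_near A x (g i)"
  shows "v (\<lambda>p. \<Sum>i\<in>I. g i p) = (\<Sum>i\<in>I. v (g i))"
  using assms
  by (induction I rule: finite_induct) (auto simp: tangent_const tangent_add smooth_near_sum)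

end

lemma tangent_lincomb:
  assumes "\<And>i. i \<in> I \<Longrightarrow> v i \<in> tangent_space A x"
  shows "(\<lambda>g. \<Sum>i\<in>I. c i * v i g) \<in> tangent_space A x"
proof -
  have "(\<Sum>i\<in>I. c i * v i (\<lambda>p. a * g p + b * h p)) = a * (\<Sum>i\<in>I. c i * v i g) + b * (\<Sum>i\<in>I. c i * v i h)"
    if "smooth_near A x g" "smooth_near A x h" for g h a b
  proof -
    have "(\<Sum>i\<in>I. c i * v i (\<lambda>p. a * g p + b * h p)) = (\<Sum>i\<in>I. a * (c i * v i g) + b * (c i * v i h))"
      by (rule sum.cong) (use tangent_linear[OF assms that] in \<open>auto simp: algebra_simps\<close>)
    then show ?thesis by (simp add: sum.distrib sum_distrib_left)
  qed
  moreover have "(\<Sum>i\<in>I. c i * v i (\<lambda>p. g p * h p)) = (\<Sum>i\<in>I. c i * v i g) * h x + g x * (\<Sum>i\<in>I. c i * v i h)"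
    if "smooth_near A x g" "smooth_near A x h" for g h
  proof -
    have "(\<Sum>i\<in>I. c i * v i (\<lambda>p. g p * h p)) = (\<Sum>i\<in>I. (c i * v i g) * h x + g x * (c i * v i h))"
      by (rule sum.cong) (use tangent_mult[OF assms that] in \<open>auto simp: algebra_simps\<close>)
    then show ?thesis by (simp add: sum.distrib sum_distrib_left sum_distrib_right)
  qed
  moreover have "(\<Sum>i\<in>I. c i * v i g) = (\<Sum>i\<in>I. c i * v i h)"
    if gh: "smooth_near A x g" "smooth_near A x h" "\<forall>\<^sub>F p in nhds x. g p = h p" for g h
  proof (rule sum.cong)
    fix i assume i: "i \<in> I"
    obtain W where "open W" "x \<in> W" "\<forall>p\<in>W. g p = h p" using gh(3) unfolding eventually_nhds by blast
    then have "v i g = v i h" by (intro tangent_germ[OF assms[OF i] gh(1), of W]) auto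
    then show "c i * v i g = c i * v i h" by simp
  qed simp
  moreover have "(\<Sum>i\<in>I. c i * v i g) = 0" if "\<not> smooth_near A x g" for g
    using tangent_not_smooth[OF assms that] by simp
  ultimately show ?thesis unfolding tangent_space_def mem_Collect_eq by blast
qed

text \<open>The directional derivative in a chart. The value 0 on functions not smooth near the
  point is the normalisation that tangent vectors carry as functionals on all functions.\<close>

definition chart_partial :: "'x set \<Rightarrow> ('x \<Rightarrow> 'e) \<Rightarrow> 'e \<Rightarrow> 'x vfield" where
  "chart_partial U \<phi> w p g = (if smooth_near A p g
     then frechet_derivative (\<lambda>q. g (inv_into U \<phi> q)) (at (\<phi> p)) w else 0)"

lemma smooth_near_chart:
  assumes C: "smooth_chart A (U, \<phi>)" and p: "p \<in> U" and g: "smooth_near A p g"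
  obtains W where "open W" "p \<in> W" "W \<subseteq> U" "smooth_fun A W g" "open (\<phi> ` W)"
    "smooth_on (\<phi> ` W) (\<lambda>q. g (inv_into U \<phi> q))"
proof -
  have ch: "is_chart (U, \<phi>)" using C by (simp add: smooth_chart_def)
  obtain V where V: "open V" "p \<in> V" "smooth_fun A V g" using g unfolding smooth_near_def by blast
  have W: "open (U \<inter> V)" "U \<inter> V \<subseteq> U" "smooth_fun A (U \<inter> V) g"
    using V is_chartD(1)[OF ch] smooth_fun_subset[OF V(3)] by auto
  then show thesis
    using that[of "U \<inter> V"] p V(2) smooth_fun_chart_iff[OF C W(1,2)] chart_open_image[OF ch W(1,2)]
    by auto
qed

lemma chart_partial_derivative:
  assumes C: "smooth_chart A (U, \<phi>)" and p: "p \<in> U" and g: "smooth_near A p g"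
  shows "((\<lambda>q. g (inv_into U \<phi> q)) has_derivative (\<lambda>w. chart_partial U \<phi> w p g)) (at (\<phi> p))"
proof -
  obtain W where "p \<in> W" "smooth_on (\<phi> ` W) (\<lambda>q. g (inv_into U \<phi> q))"
    by (rule smooth_near_chart[OF C p g])
  from smooth_on_has_derivative[OF this(2), of "\<phi> p"] this(1) show ?thesis
    unfolding chart_partial_def using g by simp
qed

lemma chart_partial_tangent:
  assumes C: "smooth_chart A (U, \<phi>)" and p: "p \<in> U"
  shows "chart_partial U \<phi> w p \<in> tangent_space A p"
proof -
  have ch: "is_chart (U, \<phi>)" using C by (simp add: smooth_chart_def)
  note inv = chart_inv[OF ch p]
  have 1: "chart_partial U \<phi> w p (\<lambda>p. a * g p + b * h p) = a * chart_partial U \<phi> w p g + b * chart_partial U \<phi> w p h"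
    if g: "smooth_near A p g" and h: "smooth_near A p h" for g h a b
  proof -
    have s: "smooth_near A p (\<lambda>p. a * g p + b * h p)"
      using g h by (intro smooth_near_add smooth_near_cmult)
    have "((\<lambda>q. a * g (inv_into U \<phi> q) + b * h (inv_into U \<phi> q)) has_derivative
        (\<lambda>w. a * chart_partial U \<phi> w p g + b * chart_partial U \<phi> w p h)) (at (\<phi> p))"
      by (intro has_derivative_add has_derivative_mult_right chart_partial_derivative[OF C p] g h)
    from has_derivative_unique[OF chart_partial_derivative[OF C p s] this] show ?thesis by metis
  qed
  have 2: "chart_partial U \<phi> w p (\<lambda>p. g p * h p) = chart_partial U \<phi> w p g * h p + g p * chart_partial U \<phi> w p h"
    if g: "smooth_near A p g" and h: "smooth_near A p h" for g h
  proof -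
    note s = smooth_near_mult[OF g h]
    have "((\<lambda>q. g (inv_into U \<phi> q) * h (inv_into U \<phi> q)) has_derivative
        (\<lambda>w. g (inv_into U \<phi> (\<phi> p)) * chart_partial U \<phi> w p h + chart_partial U \<phi> w p g * h (inv_into U \<phi> (\<phi> p)))) (at (\<phi> p))"
      by (intro has_derivative_mult chart_partial_derivative[OF C p] g h)
    from has_derivative_unique[OF chart_partial_derivative[OF C p s] this]
    have "chart_partial U \<phi> w p (\<lambda>p. g p * h p) =
        g (inv_into U \<phi> (\<phi> p)) * chart_partial U \<phi> w p h + chart_partial U \<phi> w p g * h (inv_into U \<phi> (\<phi> p))"
      by metis
    then show ?thesis unfolding inv by simp
  qed
  have 3: "chart_partial U \<phi> w p g = chart_partial U \<phi> w p h"
    if g: "smooth_near A p g" and h: "smooth_near A p h" and ev: "\<forall>\<^sub>F p in nhds p. g p = h p" for g h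
  proof -
    obtain V where V: "open V" "p \<in> V" "\<forall>z\<in>V. g z = h z" using ev unfolding eventually_nhds by blast
    have o: "open (\<phi> ` (U \<inter> V))"
      using chart_open_image[OF ch, of "U \<inter> V"] is_chartD(1)[OF ch] V(1) by auto
    have "frechet_derivative (\<lambda>q. g (inv_into U \<phi> q)) (at (\<phi> p)) = frechet_derivative (\<lambda>q. h (inv_into U \<phi> q)) (at (\<phi> p))"
      by (rule frechet_derivative_cong_open[OF o]) (use p V chart_inv[OF ch] in auto)
    then show ?thesis using g h by (simp add: chart_partial_def)
  qed
  have 4: "chart_partial U \<phi> w p g = 0" if "\<not> smooth_near A p g" for g
    using that by (simp add: chart_partial_def)
  show ?thesis unfolding tangent_space_def mem_Collect_eq using 1 2 3 4 by blast
qed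

lemma chart_partial_smooth:
  assumes C: "smooth_chart A (U, \<phi>)" and W: "open W" "W \<subseteq> U" and g: "smooth_fun A W g"
  shows "smooth_fun A W (\<lambda>p. chart_partial U \<phi> w p g)"
proof -
  have ch: "is_chart (U, \<phi>)" using C by (simp add: smooth_chart_def)
  have "smooth_on (\<phi> ` W) (\<lambda>q. frechet_derivative (\<lambda>q. g (inv_into U \<phi> q)) (at q) w)"
    by (rule smooth_on_derivative) (use smooth_fun_chart_iff[OF C W] g in blast)
  from smooth_fun_compose_chart[OF C W chart_open_image[OF ch W] order_refl this]
  show ?thesis
    by (rule smooth_fun_cong[OF W(1), rotated])
      (use smooth_nearI[OF W(1) _ g] in \<open>auto simp: chart_partial_def\<close>)
qed

lemma chart_partial_coordinate:
  assumes C: "smooth_chart A (U, \<phi>)" and p: "p \<in> U"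
  shows "chart_partial U \<phi> w p (\<lambda>p. v \<bullet> \<phi> p) = v \<bullet> w"
proof -
  have ch: "is_chart (U, \<phi>)" using C by (simp add: smooth_chart_def)
  have s: "smooth_near A p (\<lambda>p. v \<bullet> \<phi> p)"
    by (rule smooth_nearI[OF is_chartD(1)[OF ch] p smooth_fun_coordinate[OF C]])
  have "((\<lambda>q. v \<bullet> q) has_derivative (\<lambda>w. v \<bullet> w)) (at (\<phi> p))"
    by (intro bounded_linear_imp_has_derivative bounded_linear_inner_right)
  then have "((\<lambda>q. v \<bullet> \<phi> (inv_into U \<phi> q)) has_derivative (\<lambda>w. v \<bullet> w)) (at (\<phi> p))"
    by (rule has_derivative_transform_within_open[OF _ is_chartD(2)[OF ch]])
      (use p chart_inv[OF ch] in auto)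
  from has_derivative_unique[OF chart_partial_derivative[OF C p s] this] show ?thesis by metis
qed

text \<open>By Hadamard's lemma \<open>g\<close> is a constant plus a sum of
  \<open>(X i - X i p) * H i\<close> with smooth \<open>H i\<close>. A derivation kills the constant
  and sees only the numbers \<open>H i p\<close>. Applying the same formula to the coordinate
  derivations identifies these numbers as the partial derivatives of \<open>g\<close>.\<close>

lemma tangent_expand:
  assumes C: "smooth_chart A (U, \<phi>)" and e: "orthoframe (mdim A) e" and p: "p \<in> U"
    and v: "v \<in> tangent_space A p"
  shows "v g = (\<Sum>i<mdim A. v (\<lambda>p. e i \<bullet> \<phi> p) * chart_partial U \<phi> (e i) p g)"
proof (cases "smooth_near A p g")
  case False
  then show ?thesis using tangent_not_smooth[OF v] by (simp add: chart_partial_def)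
next
  case True
  let ?n = "mdim A"
  have ch: "is_chart (U, \<phi>)" using C by (simp add: smooth_chart_def)
  obtain W where W: "open W" "p \<in> W" "W \<subseteq> U" "smooth_fun A W g" "open (\<phi> ` W)"
    "smooth_on (\<phi> ` W) (\<lambda>q. g (inv_into U \<phi> q))"
    by (rule smooth_near_chart[OF C p True])
  obtain r where r: "r > 0" "ball (\<phi> p) r \<subseteq> \<phi> ` W"
    using W(2,5) open_contains_ball by (metis imageI)
  have "smooth_on (ball (\<phi> p) r) (\<lambda>q. g (inv_into U \<phi> q))"
    using W(6) r(2) unfolding smooth_on_def by (blast intro: C_on_subset)
  from Hadamard_point[OF e this] obtain G where G: "\<forall>i. smooth_on (ball (\<phi> p) r) (G i)"
    "\<forall>q\<in>ball (\<phi> p) r. g (inv_into U \<phi> q) = g (inv_into U \<phi> (\<phi> p)) + (\<Sum>i<?n. (e i \<bullet> (q - \<phi> p)) * G i q)"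
    by (elim exE conjE)
  define X where "X i = (\<lambda>p. e i \<bullet> \<phi> p)" for i
  define H where "H i = (\<lambda>p. G i (\<phi> p))" for i
  define N where "N = U \<inter> \<phi> -` ball (\<phi> p) r"
  have N: "open N" "p \<in> N" "N \<subseteq> U"
    unfolding N_def using continuous_open_preimage[OF is_chartD(3)[OF ch] is_chartD(1)[OF ch] open_ball] p r(1)
    by auto
  have sH: "smooth_near A p (H i)" for i
    unfolding H_def
    by (rule smooth_nearI[OF N(1,2) smooth_fun_compose_chart[OF C N(1,3) open_ball _ G(1)[rule_format]]])
      (auto simp: N_def)
  have sX: "smooth_near A p (X i)" for i
    unfolding X_def by (rule smooth_nearI[OF is_chartD(1)[OF ch] p smooth_fun_coordinate[OF C]])
  have eq: "g q = g p + (\<Sum>i<?n. (X i q - X i p) * H i q)" if "q \<in> N" for q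
    using G(2)[rule_format, of "\<phi> q"] that chart_inv[OF ch, of q] chart_inv[OF ch, of p] p
    by (simp add: N_def X_def H_def inner_diff_right)
  have key: "u g = (\<Sum>i<?n. u (X i) * H i p)" if u: "u \<in> tangent_space A p" for u
  proof -
    have s: "smooth_near A p (\<lambda>q. (X i q - X i p) * H i q)" for i
      by (intro smooth_near_mult smooth_near_diff smooth_near_const sX sH)
    have "u g = u (\<lambda>q. g p + (\<Sum>i<?n. (X i q - X i p) * H i q))"
      by (rule tangent_germ[OF u True N(1,2) eq])
    also have "\<dots> = (\<Sum>i<?n. u (\<lambda>q. (X i q - X i p) * H i q))"
      using s by (simp add: tangent_add[OF u] tangent_const[OF u] tangent_sum[OF u] smooth_near_const smooth_near_sum)
    also have "\<dots> = (\<Sum>i<?n. u (X i) * H i p)"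
      by (intro sum.cong refl)
        (simp add: tangent_mult[OF u] smooth_near_diff smooth_near_const sX sH tangent_diff[OF u] tangent_const[OF u])
    finally show ?thesis .
  qed
  have "chart_partial U \<phi> (e j) p g = H j p" if j: "j < ?n" for j
  proof -
    have "chart_partial U \<phi> (e j) p g = (\<Sum>i<?n. (e i \<bullet> e j) * H i p)"
      unfolding key[OF chart_partial_tangent[OF C p]] X_def chart_partial_coordinate[OF C p] ..
    also have "\<dots> = (\<Sum>i<?n. if i = j then H i p else 0)"
      by (intro sum.cong) (use orthoframe_inner[OF e _ j] in auto)
    finally show ?thesis using j by simp
  qed
  then show ?thesis using key[OF v] by (simp add: X_def)
qed

end

lemma smooth_map_pullback:
  assumes "manifold A" "manifold B" "smooth_map A B f" "open W" "smooth_fun B W g"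
  shows "smooth_fun A (f -` W) (\<lambda>p. g (f p))"
proof -
  interpret A: mfd A by unfold_locales fact
  interpret B: mfd B by unfold_locales fact
  obtain e :: "nat \<Rightarrow> 'd" where e: "orthoframe (mdim B) e" by (rule B.ex_frame)
  have cont: "continuous_on UNIV f" using assms(3) by (simp add: smooth_map_def)
  have of: "open (f -` S)" if "open S" for S using open_vimage[OF that cont] .
  show ?thesis
  proof (rule A.smooth_fun_local)
    fix p assume "p \<in> f -` W"
    then have p: "f p \<in> W" by simp
    obtain U \<phi> where U: "(U, \<phi>) \<in> A" "p \<in> U" by (rule A.atlas_cover)
    obtain V \<psi> where V: "(V, \<psi>) \<in> B" "f p \<in> V" by (rule B.atlas_cover)
    note chU = A.atlas_chart[OF U(1)] and chV = B.atlas_chart[OF V(1)]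
    define N where "N = U \<inter> f -` (V \<inter> W)"
    have N: "open N" "N \<subseteq> U" "p \<in> N"
      using of[of "V \<inter> W"] is_chartD(1)[OF chU] is_chartD(1)[OF chV] assms(4) U V p
      by (auto simp: N_def)
    have "smooth_on (\<phi> ` N) (\<lambda>q. g (f (inv_into U \<phi> q)))"
    proof (rule smooth_onI)
      fix k
      have "C_on k (\<phi> ` (U \<inter> f -` V)) (\<lambda>p. \<psi> (f (inv_into U \<phi> p)))"
        using assms(3) U(1) V(1) unfolding smooth_map_def smooth_on_def by blast
      then have t: "C_on k (\<phi> ` N) (\<lambda>p. \<psi> (f (inv_into U \<phi> p)))"
        by (rule C_on_subset) (auto simp: N_def)
      have inv: "inv_into U \<phi> (\<phi> z) = z" "inv_into V \<psi> (\<psi> (f z)) = f z" if "z \<in> N" for z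
        using chart_inv[OF chU] chart_inv[OF chV] that by (auto simp: N_def)
      have "C_on k (\<phi> ` N) (\<lambda>q. g (inv_into V \<psi> (\<psi> (f (inv_into U \<phi> q)))))"
      proof (rule C_on_compose[OF e chart_open_image[OF chU N(1,2)] _ _ t B.smooth_fun_C_on[OF assms(5) V(1)]])
        show "open (\<psi> ` (V \<inter> W))"
          using chart_open_image[OF chV, of "V \<inter> W"] is_chartD(1)[OF chV] assms(4) by auto
        show "(\<lambda>p. \<psi> (f (inv_into U \<phi> p))) ` \<phi> ` N \<subseteq> \<psi> ` (V \<inter> W)"
          using inv by (auto simp: N_def)
      qed
      then show "C_on k (\<phi> ` N) (\<lambda>q. g (f (inv_into U \<phi> q)))"
        by (rule C_on_cong[OF chart_open_image[OF chU N(1,2)], rotated]) (use inv in auto)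
    qed
    then have "smooth_fun A N (\<lambda>p. g (f p))"
      using A.smooth_fun_chart_iff[OF A.atlas_smooth_chart[OF U(1)] N(1,2)] by simp
    then show "\<exists>N. open N \<and> p \<in> N \<and> smooth_fun A N (\<lambda>p. g (f p))" using N by blast
  qed
qed

section \<open>Coordinates adapted to a hypersurface\<close>

text \<open>\<open>X\<close> are coordinates on \<open>U\<close>, \<open>D\<close> their coordinate vector fields, and \<open>r\<close> is a defining function of
  \<open>Z \<inter> U\<close>: the first coordinate, or 1 if \<open>Z\<close> does not meet \<open>U\<close>.\<close>
definition b_chart :: "('x::t2_space, 'e::real_inner) atlas \<Rightarrow> 'x set \<Rightarrow> 'x set \<Rightarrow>
    (nat \<Rightarrow> 'x \<Rightarrow> real) \<Rightarrow> (nat \<Rightarrow> 'x vfield) \<Rightarrow> ('x \<Rightarrow> real) \<Rightarrow> bool" where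
  "b_chart A Z U X D r \<longleftrightarrow> open U \<and>
     (\<forall>i<mdim A. smooth_fun A U (X i)) \<and>
     (\<forall>i<mdim A. \<forall>p\<in>U. D i p \<in> tangent_space A p) \<and>
     (\<forall>i<mdim A. \<forall>W g. open W \<longrightarrow> W \<subseteq> U \<longrightarrow> smooth_fun A W g \<longrightarrow> smooth_fun A W (\<lambda>p. D i p g)) \<and>
     (\<forall>i<mdim A. \<forall>j<mdim A. \<forall>p\<in>U. D i p (X j) = (if i = j then 1 else 0)) \<and>
     (\<forall>p\<in>U. \<forall>v\<in>tangent_space A p. \<forall>g. v g = (\<Sum>i<mdim A. v (X i) * D i p g)) \<and>
     (\<forall>p\<in>U. p \<in> Z \<longleftrightarrow> r p = 0) \<and>
     (U \<inter> Z = {} \<and> r = (\<lambda>_. 1) \<or> 0 < mdim A \<and> r = X 0) \<and>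
     (\<forall>W g. open W \<longrightarrow> W \<subseteq> U \<longrightarrow> smooth_fun A W g \<longrightarrow> (\<forall>p\<in>W \<inter> Z. g p = 0) \<longrightarrow>
        (\<exists>h. smooth_fun A W h \<and> (\<forall>p\<in>W. g p = r p * h p)))"

locale bmfd =
  fixes A :: "('x::t2_space, 'e::real_inner) atlas" and Z :: "'x set"
  assumes bmfd: "b_manifold A Z"
begin

sublocale mfd A
  using bmfd by unfold_locales (simp add: b_manifold_def)

lemma Z_closed: "closed Z"
  using bmfd by (simp add: b_manifold_def hypersurface_def)

text \<open>In a straightening chart \<open>Z\<close> is a piece of a hyperplane, and an arbitrarily
  small step along its normal leaves it.\<close>

lemma Z_dense:
  assumes "open N" "N \<noteq> {}"
  shows "\<exists>q\<in>N. q \<notin> Z"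
proof (rule ccontr)
  assume "\<not> ?thesis"
  then obtain p where p: "p \<in> N" "N \<subseteq> Z" using assms by blast
  then obtain U \<phi> e where U: "smooth_chart A (U, \<phi>)" "p \<in> U" "e \<noteq> 0"
    "\<phi> ` (U \<inter> Z) = {q \<in> \<phi> ` U. e \<bullet> q = 0}"
    using bmfd unfolding b_manifold_def hypersurface_def by blast
  have ch: "is_chart (U, \<phi>)" using U(1) by (simp add: smooth_chart_def)
  have "open (\<phi> ` (U \<inter> N))"
    using chart_open_image[OF ch, of "U \<inter> N"] is_chartD(1)[OF ch] assms(1) by auto
  then obtain r where r: "r > 0" "ball (\<phi> p) r \<subseteq> \<phi> ` (U \<inter> N)"
    using p(1) U(2) open_contains_ball by (metis IntI imageI)
  let ?w = "(r / (2 * norm e)) *\<^sub>R e"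
  have "norm ?w < r" using r(1) U(3) by simp
  then have "\<phi> p + ?w \<in> ball (\<phi> p) r" unfolding add_in_ball_iff .
  then have "\<phi> p + ?w \<in> \<phi> ` (U \<inter> Z)" using r(2) p(2) by blast
  then have "e \<bullet> (\<phi> p + ?w) = 0" unfolding U(4) by simp
  moreover have "\<phi> p \<in> \<phi> ` (U \<inter> Z)" using p U(2) by blast
  then have "e \<bullet> \<phi> p = 0" unfolding U(4) by simp
  ultimately have "r / (2 * norm e) * (e \<bullet> e) = 0" by (simp add: inner_add_right)
  then show False using U(3) r(1) by simp
qed

lemma ex_b_chart_off:
  assumes "x \<notin> Z"
  shows "\<exists>U X D r. x \<in> U \<and> b_chart A Z U X D r"
proof -
  obtain e :: "nat \<Rightarrow> 'e" where e: "orthoframe (mdim A) e" by (rule ex_frame)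
  obtain U \<phi> where C: "(U, \<phi>) \<in> A" "x \<in> U" by (rule atlas_cover)
  note ch = atlas_chart[OF C(1)] and sc = atlas_smooth_chart[OF C(1)]
  have "b_chart A Z (U - Z) (\<lambda>i p. e i \<bullet> \<phi> p) (\<lambda>i. chart_partial U \<phi> (e i)) (\<lambda>_. 1)"
    unfolding b_chart_def
  proof (intro conjI)
    show "open (U - Z)" using is_chartD(1)[OF ch] Z_closed by auto
    show "\<forall>i<mdim A. smooth_fun A (U - Z) (\<lambda>p. e i \<bullet> \<phi> p)"
      using smooth_fun_subset[OF smooth_fun_coordinate[OF sc]] by blast
    show "\<forall>i<mdim A. \<forall>p\<in>U - Z. chart_partial U \<phi> (e i) p \<in> tangent_space A p"
      using chart_partial_tangent[OF sc] by blast
    show "\<forall>i<mdim A. \<forall>W g. open W \<longrightarrow> W \<subseteq> U - Z \<longrightarrow> smooth_fun A W g \<longrightarrow>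
        smooth_fun A W (\<lambda>p. chart_partial U \<phi> (e i) p g)"
      using chart_partial_smooth[OF sc] by blast
    show "\<forall>i<mdim A. \<forall>j<mdim A. \<forall>p\<in>U - Z. chart_partial U \<phi> (e i) p (\<lambda>p. e j \<bullet> \<phi> p) = (if i = j then 1 else 0)"
      using chart_partial_coordinate[OF sc] orthoframe_inner[OF e] by auto
    show "\<forall>p\<in>U - Z. \<forall>v\<in>tangent_space A p. \<forall>g. v g =
        (\<Sum>i<mdim A. v (\<lambda>p. e i \<bullet> \<phi> p) * chart_partial U \<phi> (e i) p g)"
      using tangent_expand[OF sc e] by blast
  qed auto
  then show ?thesis using C(2) assms by blast
qed

text \<open>The orthonormal frame starts with the normal of the hyperplane, so the first coordinate
  defines \<open>Z\<close>. Division by it is local: Hadamard's lemma at points of \<open>Z\<close>,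
  an ordinary quotient elsewhere. The local quotients glue because \<open>Z\<close> has no
  interior.\<close>

lemma ex_b_chart_on:
  assumes "x \<in> Z"
  shows "\<exists>U X D r. x \<in> U \<and> b_chart A Z U X D r"
proof -
  obtain U \<phi> v where sc: "smooth_chart A (U, \<phi>)" and x: "x \<in> U" and v: "v \<noteq> 0"
    "\<phi> ` (U \<inter> Z) = {q \<in> \<phi> ` U. v \<bullet> q = 0}"
    using assms bmfd unfolding b_manifold_def hypersurface_def by blast
  have ch: "is_chart (U, \<phi>)" using sc by (simp add: smooth_chart_def)
  obtain e where e: "orthoframe (mdim A) e" "e 0 = v /\<^sub>R norm v" "0 < mdim A" by (rule ex_frame_at[OF v(1)])
  have Z: "p \<in> Z \<longleftrightarrow> e 0 \<bullet> \<phi> p = 0" if "p \<in> U" for p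
  proof -
    have "p \<in> Z \<longleftrightarrow> \<phi> p \<in> \<phi> ` (U \<inter> Z)"
      using that is_chartD(5)[OF ch] by (auto simp: inj_on_def)
    also have "\<dots> \<longleftrightarrow> v \<bullet> \<phi> p = 0" unfolding v(2) using that by auto
    finally show ?thesis using v(1) e(2) by simp
  qed
  have "b_chart A Z U (\<lambda>i p. e i \<bullet> \<phi> p) (\<lambda>i. chart_partial U \<phi> (e i)) (\<lambda>p. e 0 \<bullet> \<phi> p)"
    unfolding b_chart_def
  proof (intro conjI)
    show "open U" by (rule is_chartD(1)[OF ch])
    show "\<forall>i<mdim A. smooth_fun A U (\<lambda>p. e i \<bullet> \<phi> p)"
      using smooth_fun_coordinate[OF sc] by blast
    show "\<forall>i<mdim A. \<forall>p\<in>U. chart_partial U \<phi> (e i) p \<in> tangent_space A p"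
      using chart_partial_tangent[OF sc] by blast
    show "\<forall>i<mdim A. \<forall>W g. open W \<longrightarrow> W \<subseteq> U \<longrightarrow> smooth_fun A W g \<longrightarrow>
        smooth_fun A W (\<lambda>p. chart_partial U \<phi> (e i) p g)"
      using chart_partial_smooth[OF sc] by blast
    show "\<forall>i<mdim A. \<forall>j<mdim A. \<forall>p\<in>U. chart_partial U \<phi> (e i) p (\<lambda>p. e j \<bullet> \<phi> p) = (if i = j then 1 else 0)"
      using chart_partial_coordinate[OF sc] orthoframe_inner[OF e(1)] by auto
    show "\<forall>p\<in>U. \<forall>v\<in>tangent_space A p. \<forall>g. v g =
        (\<Sum>i<mdim A. v (\<lambda>p. e i \<bullet> \<phi> p) * chart_partial U \<phi> (e i) p g)"
      using tangent_expand[OF sc e(1)] by blast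
    show "\<forall>p\<in>U. (p \<in> Z) = (e 0 \<bullet> \<phi> p = 0)" using Z by blast
    show "U \<inter> Z = {} \<and> (\<lambda>p. e 0 \<bullet> \<phi> p) = (\<lambda>_. 1) \<or> 0 < mdim A \<and> (\<lambda>p. e 0 \<bullet> \<phi> p) = (\<lambda>p. e 0 \<bullet> \<phi> p)"
      using e(3) by blast
    show "\<forall>W g. open W \<longrightarrow> W \<subseteq> U \<longrightarrow> smooth_fun A W g \<longrightarrow> (\<forall>p\<in>W \<inter> Z. g p = 0) \<longrightarrow>
        (\<exists>h. smooth_fun A W h \<and> (\<forall>p\<in>W. g p = e 0 \<bullet> \<phi> p * h p))"
    proof (intro allI impI)
      fix W g assume W: "open W" "W \<subseteq> U" and g: "smooth_fun A W g" and g0: "\<forall>p\<in>W \<inter> Z. g p = 0"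
      have r: "smooth_fun A W (\<lambda>p. e 0 \<bullet> \<phi> p)"
        by (rule smooth_fun_subset[OF smooth_fun_coordinate[OF sc] W(2)])
      show "\<exists>h. smooth_fun A W h \<and> (\<forall>p\<in>W. g p = e 0 \<bullet> \<phi> p * h p)"
      proof (rule smooth_quotient_glue[OF W(1) r])
        show "\<exists>q\<in>N. e 0 \<bullet> \<phi> q \<noteq> 0" if N: "open N" "N \<subseteq> W" "N \<noteq> {}" for N
        proof -
          obtain q where "q \<in> N" "q \<notin> Z" using Z_dense[OF N(1,3)] by blast
          then show ?thesis using Z[of q] N(2) W(2) by (intro bexI[of _ q]) auto
        qed
        fix p assume p: "p \<in> W"
        show "\<exists>N h. open N \<and> p \<in> N \<and> N \<subseteq> W \<and> smooth_fun A N h \<and> (\<forall>q\<in>N. g q = e 0 \<bullet> \<phi> q * h q)"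
        proof (cases "p \<in> Z")
          case False
          have N: "open (W - Z)" using W(1) Z_closed by auto
          have nz: "e 0 \<bullet> \<phi> q \<noteq> 0" if "q \<in> W - Z" for q using Z[of q] that W(2) by auto
          have "smooth_fun A (W - Z) (\<lambda>q. g q / (e 0 \<bullet> \<phi> q))"
            by (rule smooth_fun_divide[OF N nz smooth_fun_subset[OF g] smooth_fun_subset[OF r]]) auto
          then show ?thesis using N nz p False
            by (intro exI[of _ "W - Z"] exI[of _ "\<lambda>q. g q / (e 0 \<bullet> \<phi> q)"]) auto
        next
          case True
          have sg: "smooth_on (\<phi> ` W) (\<lambda>q. g (inv_into U \<phi> q))"
            using g smooth_fun_chart_iff[OF sc W] by blast
          have "open (\<phi> ` W)" by (rule chart_open_image[OF ch W])
          then obtain \<rho> where \<rho>: "\<rho> > 0" "ball (\<phi> p) \<rho> \<subseteq> \<phi> ` W"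
            using p open_contains_ball by (metis imageI)
          have "smooth_on (ball (\<phi> p) \<rho>) (\<lambda>q. g (inv_into U \<phi> q))"
            using sg \<rho>(2) unfolding smooth_on_def by (blast intro: C_on_subset)
          moreover have "e 0 \<bullet> \<phi> p = 0" using Z[of p] True p W(2) by auto
          moreover have "g (inv_into U \<phi> q) = 0" if q: "q \<in> ball (\<phi> p) \<rho>" "e 0 \<bullet> q = 0" for q
          proof -
            obtain z where z: "z \<in> W" "q = \<phi> z" using q(1) \<rho>(2) by blast
            then have "z \<in> Z" using Z[of z] q(2) W(2) by auto
            then show ?thesis using z g0 chart_inv[OF ch, of z] W(2) by auto
          qed
          ultimately have "\<exists>G. smooth_on (ball (\<phi> p) \<rho>) G \<and>
              (\<forall>q\<in>ball (\<phi> p) \<rho>. g (inv_into U \<phi> q) = (e 0 \<bullet> q) * G q)"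
            by (rule Hadamard_hyperplane[OF e(1,3)])
          then obtain G where G: "smooth_on (ball (\<phi> p) \<rho>) G"
            "\<forall>q\<in>ball (\<phi> p) \<rho>. g (inv_into U \<phi> q) = (e 0 \<bullet> q) * G q" by blast
          define N where "N = U \<inter> \<phi> -` ball (\<phi> p) \<rho>"
          have N: "open N" "p \<in> N" "N \<subseteq> U"
            unfolding N_def
            using continuous_open_preimage[OF is_chartD(3)[OF ch] is_chartD(1)[OF ch] open_ball] p W(2) \<rho>(1)
            by auto
          have "N \<subseteq> W" using \<rho>(2) is_chartD(5)[OF ch] W(2) unfolding N_def inj_on_def by blast
          moreover have "smooth_fun A N (\<lambda>q. G (\<phi> q))"
            by (rule smooth_fun_compose_chart[OF sc N(1,3) open_ball _ G(1)]) (auto simp: N_def)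
          moreover have "\<forall>q\<in>N. g q = e 0 \<bullet> \<phi> q * G (\<phi> q)"
            using G(2) chart_inv[OF ch] by (auto simp: N_def)
          ultimately show ?thesis using N by blast
        qed
      qed
    qed
  qed
  then show ?thesis using x by blast
qed

lemma ex_b_chart: "\<exists>U X D r. x \<in> U \<and> b_chart A Z U X D r"
  using ex_b_chart_off ex_b_chart_on by (cases "x \<in> Z")

end

section \<open>Vector fields\<close>

context mfd
begin

lemma vector_fieldD: "V \<in> vector_fields A W \<Longrightarrow> x \<in> W \<Longrightarrow> V x \<in> tangent_space A x"
  by (simp add: vector_fields_def)

lemma vector_field_smooth:
  "V \<in> vector_fields A W \<Longrightarrow> open W' \<Longrightarrow> W' \<subseteq> W \<Longrightarrow> smooth_fun A W' g \<Longrightarrow> smooth_fun A W' (\<lambda>p. V p g)"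
  unfolding vector_fields_def by blast

lemma vector_fields_subset: "V \<in> vector_fields A W \<Longrightarrow> W' \<subseteq> W \<Longrightarrow> V \<in> vector_fields A W'"
  unfolding vector_fields_def mem_Collect_eq by (meson subset_iff)

lemma vector_field_near:
  assumes "V \<in> vector_fields A W" "open W" "x \<in> W" "smooth_near A x g"
  shows "smooth_near A x (\<lambda>p. V p g)"
proof -
  obtain N where N: "open N" "x \<in> N" "smooth_fun A N g" using assms(4) unfolding smooth_near_def by blast
  have "smooth_fun A (N \<inter> W) (\<lambda>p. V p g)"
    by (rule vector_field_smooth[OF assms(1)]) (use N assms(2) smooth_fun_subset[OF N(3)] in auto)
  then show ?thesis using N assms by (intro smooth_nearI[of "N \<inter> W"]) auto
qed

lemma vector_field_lincomb:
  assumes "open W" "finite I" "\<And>i. i \<in> I \<Longrightarrow> smooth_fun A W (h i)" "\<And>i. i \<in> I \<Longrightarrow> B i \<in> vector_fields A W"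
  shows "(\<lambda>p g. \<Sum>i\<in>I. h i p * B i p g) \<in> vector_fields A W"
proof -
  have "smooth_fun A W' (\<lambda>p. \<Sum>i\<in>I. h i p * B i p g)"
    if "open W'" "W' \<subseteq> W" "smooth_fun A W' g" for W' g
  proof (rule smooth_fun_sum[OF that(1)])
    fix i assume i: "i \<in> I"
    show "smooth_fun A W' (\<lambda>p. h i p * B i p g)"
      by (rule smooth_fun_mult[OF that(1) smooth_fun_subset[OF assms(3)[OF i] that(2)]
            vector_field_smooth[OF assms(4)[OF i] that]])
  qed
  moreover have "(\<lambda>g. \<Sum>i\<in>I. h i x * B i x g) \<in> tangent_space A x" if "x \<in> W" for x
    by (rule tangent_lincomb) (rule vector_fieldD[OF assms(4) that])
  ultimately show ?thesis
    unfolding vector_fields_def mem_Collect_eq by (intro conjI ballI allI impI)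
qed

lemma vector_field_local:
  assumes "\<And>p. \<exists>N V'. open N \<and> p \<in> N \<and> V' \<in> vector_fields A N \<and> (\<forall>q\<in>N. V q = V' q)"
  shows "V \<in> vector_fields A UNIV"
  unfolding vector_fields_def
proof (intro CollectI conjI ballI allI impI)
  fix x :: 'x
  show "V x \<in> tangent_space A x" using assms[of x] vector_fieldD by metis
next
  fix W' g assume W': "open W'" and g: "smooth_fun A W' g"
  show "smooth_fun A W' (\<lambda>p. V p g)"
  proof (rule smooth_fun_local)
    fix p assume p: "p \<in> W'"
    obtain N V' where N: "open N" "p \<in> N" "V' \<in> vector_fields A N" "\<forall>q\<in>N. V q = V' q" using assms by blast
    have "smooth_fun A (N \<inter> W') (\<lambda>q. V' q g)"
      by (rule vector_field_smooth[OF N(3)]) (use N W' smooth_fun_subset[OF g] in auto)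
    then have "smooth_fun A (N \<inter> W') (\<lambda>q. V q g)"
      by (rule smooth_fun_cong[rotated 2]) (use N W' in auto)
    then show "\<exists>N. open N \<and> p \<in> N \<and> smooth_fun A N (\<lambda>p. V p g)"
      using N W' p by (intro exI[of _ "N \<inter> W'"]) auto
  qed
qed

lemma lie_bracket_apply:
  "smooth_near A x g \<Longrightarrow> lie_bracket A V W x g = V x (\<lambda>p. W p g) - W x (\<lambda>p. V p g)"
  by (simp add: lie_bracket_def)

text \<open>In the Leibniz rule for a second derivative the mixed products of first derivatives are
  symmetric in \<open>V\<close> and \<open>W\<close>, so they cancel in the commutator. The inner
  rule is needed at all points near \<open>x\<close>, hence the neighbourhoods on which both
  functions are smooth.\<close>

lemma lie_bracket_vector_field:
  assumes S: "open S" and V: "V \<in> vector_fields A S" and W: "W \<in> vector_fields A S"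
  shows "lie_bracket A V W \<in> vector_fields A S"
  unfolding vector_fields_def
proof (intro CollectI conjI ballI allI impI)
  fix x assume x: "x \<in> S"
  note Vx = vector_fieldD[OF V x] and Wx = vector_fieldD[OF W x]
  note nV = vector_field_near[OF V S x] and nW = vector_field_near[OF W S x]
  have ex: "\<exists>M. open M \<and> x \<in> M \<and> M \<subseteq> S \<and> (\<forall>q\<in>M. smooth_near A q g) \<and> (\<forall>q\<in>M. smooth_near A q h)"
    if gh: "smooth_near A x g" "smooth_near A x h" for g h
  proof -
    obtain M where "open M" "x \<in> M" "smooth_fun A M g" "smooth_fun A M h" by (rule smooth_near2E[OF gh])
    then show ?thesis using smooth_nearI S x smooth_fun_subset
      by (intro exI[of _ "M \<inter> S"]) auto
  qed
  have 1: "lie_bracket A V W x (\<lambda>p. a * g p + b * h p) = a * lie_bracket A V W x g + b * lie_bracket A V W x h"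
    if gh: "smooth_near A x g" "smooth_near A x h" for g h a b
  proof -
    have s: "smooth_near A x (\<lambda>p. a * g p + b * h p)" using gh by (intro smooth_near_add smooth_near_cmult)
    obtain M where M: "open M" "x \<in> M" "M \<subseteq> S" "\<forall>q\<in>M. smooth_near A q g" "\<forall>q\<in>M. smooth_near A q h"
      using ex[OF gh] by blast
    have c: "u x (\<lambda>p. w p (\<lambda>p. a * g p + b * h p)) = a * u x (\<lambda>p. w p g) + b * u x (\<lambda>p. w p h)"
      if u: "u \<in> vector_fields A S" and w: "w \<in> vector_fields A S" for u w
    proof -
      have "u x (\<lambda>p. w p (\<lambda>p. a * g p + b * h p)) = u x (\<lambda>p. a * w p g + b * w p h)"
        by (rule tangent_germ[OF vector_fieldD[OF u x] vector_field_near[OF w S x s] M(1,2)])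
          (rule tangent_linear[OF vector_fieldD[OF w]], use M in auto)
      also have "\<dots> = a * u x (\<lambda>p. w p g) + b * u x (\<lambda>p. w p h)"
        by (rule tangent_linear[OF vector_fieldD[OF u x]]; rule vector_field_near[OF w S x]; rule gh)
      finally show ?thesis .
    qed
    show ?thesis unfolding lie_bracket_apply[OF s] lie_bracket_apply[OF gh(1)] lie_bracket_apply[OF gh(2)]
        c[OF V W] c[OF W V] by (simp add: algebra_simps)
  qed
  have 2: "lie_bracket A V W x (\<lambda>p. g p * h p) = lie_bracket A V W x g * h x + g x * lie_bracket A V W x h"
    if gh: "smooth_near A x g" "smooth_near A x h" for g h
  proof -
    note s = smooth_near_mult[OF gh]
    obtain M where M: "open M" "x \<in> M" "M \<subseteq> S" "\<forall>q\<in>M. smooth_near A q g" "\<forall>q\<in>M. smooth_near A q h"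
      using ex[OF gh] by blast
    have c: "u x (\<lambda>p. w p (\<lambda>p. g p * h p)) =
        u x (\<lambda>p. w p g) * h x + w x g * u x h + (u x g * w x h + g x * u x (\<lambda>p. w p h))"
      if u: "u \<in> vector_fields A S" and w: "w \<in> vector_fields A S" for u w
    proof -
      note ux = vector_fieldD[OF u x] and nw = vector_field_near[OF w S x]
      have "u x (\<lambda>p. w p (\<lambda>p. g p * h p)) = u x (\<lambda>p. w p g * h p + g p * w p h)"
        by (rule tangent_germ[OF ux nw[OF s] M(1,2)])
          (rule tangent_mult[OF vector_fieldD[OF w]], use M in auto)
      also have "\<dots> = u x (\<lambda>p. w p g * h p) + u x (\<lambda>p. g p * w p h)"
        by (intro tangent_add[OF ux] smooth_near_mult nw gh)
      finally show ?thesis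
        by (simp add: tangent_mult[OF ux nw[OF gh(1)] gh(2)] tangent_mult[OF ux gh(1) nw[OF gh(2)]])
    qed
    show ?thesis unfolding lie_bracket_apply[OF s] lie_bracket_apply[OF gh(1)] lie_bracket_apply[OF gh(2)]
        c[OF V W] c[OF W V] by (simp add: algebra_simps)
  qed
  have 3: "lie_bracket A V W x g = lie_bracket A V W x h"
    if gh: "smooth_near A x g" "smooth_near A x h" "\<forall>\<^sub>F p in nhds x. g p = h p" for g h
  proof -
    obtain M where M: "open M" "x \<in> M" "\<forall>q\<in>M. g q = h q" using gh(3) unfolding eventually_nhds by blast
    obtain M' where M': "open M'" "x \<in> M'" "M' \<subseteq> S" "\<forall>q\<in>M'. smooth_near A q g"
      using ex[OF gh(1,2)] by blast
    have c: "u x (\<lambda>p. w p g) = u x (\<lambda>p. w p h)"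
      if u: "u \<in> vector_fields A S" and w: "w \<in> vector_fields A S" for u w
    proof (rule tangent_germ[OF vector_fieldD[OF u x] vector_field_near[OF w S x gh(1)], of "M \<inter> M'"])
      fix q assume q: "q \<in> M \<inter> M'"
      show "w q g = w q h"
        by (rule tangent_germ[OF vector_fieldD[OF w] _ M(1)]) (use q M M' in auto)
    qed (use M M' in auto)
    show ?thesis unfolding lie_bracket_apply[OF gh(1)] lie_bracket_apply[OF gh(2)] c[OF V W] c[OF W V] ..
  qed
  have 4: "lie_bracket A V W x g = 0" if "\<not> smooth_near A x g" for g
    using that by (simp add: lie_bracket_def)
  show "lie_bracket A V W x \<in> tangent_space A x"
    unfolding tangent_space_def mem_Collect_eq using 1 2 3 4 by blast
next
  fix W' g assume W': "open W'" "W' \<subseteq> S" and g: "smooth_fun A W' g"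
  have "smooth_fun A W' (\<lambda>p. V p (\<lambda>q. W q g) - W p (\<lambda>q. V q g))"
    by (intro smooth_fun_diff W' vector_field_smooth[OF V] vector_field_smooth[OF W] g)
  then show "smooth_fun A W' (\<lambda>p. lie_bracket A V W p g)"
    by (rule smooth_fun_cong[OF W'(1), rotated])
      (use smooth_nearI[OF W'(1) _ g] in \<open>auto simp: lie_bracket_apply\<close>)
qed

end

section \<open>The module of b-fields and its local frames\<close>

context bmfd
begin

abbreviation "bf \<equiv> b_fields A Z"

lemma bf_vector_field: "V \<in> bf \<Longrightarrow> V \<in> vector_fields A UNIV"
  by (simp add: b_fields_def)

lemma bf_tangent: "V \<in> bf \<Longrightarrow> V x \<in> tangent_space A x"
  using vector_fieldD bf_vector_field by blast

lemma bf_smooth: "V \<in> bf \<Longrightarrow> open W \<Longrightarrow> smooth_fun A W g \<Longrightarrow> smooth_fun A W (\<lambda>p. V p g)"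
  using vector_field_smooth[OF bf_vector_field] by blast

lemma bf_near: "V \<in> bf \<Longrightarrow> smooth_near A x g \<Longrightarrow> smooth_near A x (\<lambda>p. V p g)"
  using vector_field_near[OF bf_vector_field] by blast

lemma bf_vanish:
  assumes "V \<in> bf" "x \<in> Z" "smooth_near A x g" "open W" "x \<in> W" "\<And>p. p \<in> W \<Longrightarrow> p \<in> Z \<Longrightarrow> g p = 0"
  shows "V x g = 0"
proof -
  have "\<forall>\<^sub>F p in nhds x. p \<in> Z \<longrightarrow> g p = 0" using assms(4-6) by (auto simp: eventually_nhds)
  then show ?thesis using assms(1-3) by (auto simp: b_fields_def tangent_space_sub_def)
qed

lemma bfI:
  assumes "V \<in> vector_fields A UNIV"
    "\<And>x g W. x \<in> Z \<Longrightarrow> smooth_near A x g \<Longrightarrow> open W \<Longrightarrow> x \<in> W \<Longrightarrow> (\<And>p. p \<in> W \<Longrightarrow> p \<in> Z \<Longrightarrow> g p = 0) \<Longrightarrow> V x g = 0"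
  shows "V \<in> bf"
  unfolding b_fields_def tangent_space_sub_def
proof (intro CollectI conjI ballI allI impI)
  fix x g assume x: "x \<in> Z" "smooth_near A x g" and ev: "\<forall>\<^sub>F p in nhds x. p \<in> Z \<longrightarrow> g p = 0"
  obtain W where "open W" "x \<in> W" "\<forall>p\<in>W. p \<in> Z \<longrightarrow> g p = 0" using ev unfolding eventually_nhds by blast
  then show "V x g = 0" using assms(2)[OF x] by blast
qed (use assms(1) vector_fieldD in auto)

lemma bf_lincomb:
  assumes "finite I" "\<And>i. i \<in> I \<Longrightarrow> smooth_fun A UNIV (h i)" "\<And>i. i \<in> I \<Longrightarrow> B i \<in> bf"
  shows "(\<lambda>p g. \<Sum>i\<in>I. h i p * B i p g) \<in> bf"
proof (rule bfI)
  show "(\<lambda>p g. \<Sum>i\<in>I. h i p * B i p g) \<in> vector_fields A UNIV"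
    using assms bf_vector_field by (intro vector_field_lincomb) auto
  show "(\<Sum>i\<in>I. h i x * B i x g) = 0"
    if "x \<in> Z" "smooth_near A x g" "open W" "x \<in> W" "\<And>p. p \<in> W \<Longrightarrow> p \<in> Z \<Longrightarrow> g p = 0" for x g W
    using bf_vanish[OF assms(3) that] by simp
qed

lemma bf_lincomb2:
  assumes "smooth_fun A UNIV h" "smooth_fun A UNIV k" "V \<in> bf" "W \<in> bf"
  shows "(\<lambda>p g. h p * V p g + k p * W p g) \<in> bf"
  using bf_lincomb[of "{0, 1 :: nat}" "\<lambda>i. if i = 0 then h else k" "\<lambda>i. if i = 0 then V else W"] assms
  by auto

lemma bf_diff:
  assumes "V \<in> bf" "W \<in> bf"
  shows "(\<lambda>p g. V p g - W p g) \<in> bf"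
  using bf_lincomb2[OF smooth_fun_const smooth_fun_const assms, of 1 "- 1"] by simp

text \<open>A b-field maps functions vanishing on \<open>Z\<close> near a point to functions that
  vanish there too, and so does a composition of two.\<close>

lemma bf_lie_bracket:
  assumes V: "V \<in> bf" and W: "W \<in> bf"
  shows "lie_bracket A V W \<in> bf"
proof (rule bfI)
  show "lie_bracket A V W \<in> vector_fields A UNIV"
    using V W bf_vector_field by (intro lie_bracket_vector_field) auto
  fix x g M assume x: "x \<in> Z" and g: "smooth_near A x g" and M: "open M" "x \<in> M"
    and zero: "\<And>p. p \<in> M \<Longrightarrow> p \<in> Z \<Longrightarrow> g p = 0"
  obtain S where S: "open S" "x \<in> S" "smooth_fun A S g" using g unfolding smooth_near_def by blast
  have "u x (\<lambda>p. w p g) = 0" if "u \<in> bf" "w \<in> bf" for u w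
  proof (rule bf_vanish[OF that(1) x bf_near[OF that(2) g], of "M \<inter> S"])
    fix p assume p: "p \<in> M \<inter> S" "p \<in> Z"
    show "w p g = 0"
      by (rule bf_vanish[OF that(2) p(2), of _ M]) (use p S M zero smooth_nearI in auto)
  qed (use M S in auto)
  from this[OF V W] this[OF W V] show "lie_bracket A V W x g = 0" unfolding lie_bracket_apply[OF g] by simp
qed

text \<open>Coefficients can be compared by dividing by \<open>r\<close> only off \<open>Z\<close>;
  this carries the result to \<open>Z\<close>.\<close>

lemma continuous_zero_off_Z:
  fixes c :: "'x \<Rightarrow> real"
  assumes "open N" "continuous_on N c" "\<And>p. p \<in> N \<Longrightarrow> p \<notin> Z \<Longrightarrow> c p = 0" "p \<in> N"
  shows "c p = 0"
proof (rule ccontr)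
  assume "c p \<noteq> 0"
  moreover have "open (N \<inter> c -` (- {0}))"
    by (rule continuous_open_preimage[OF assms(2,1)]) auto
  ultimately obtain q where "q \<in> N \<inter> c -` (- {0})" "q \<notin> Z" using Z_dense assms(4) by blast
  then show False using assms(3) by auto
qed

text \<open>On \<open>Z\<close> the values of a frame of the b-tangent bundle are linearly dependent as tangent vectors,
  so independence is expressed by continuous coefficients on open sets.\<close>
definition local_frame :: "'x set \<Rightarrow> (nat \<Rightarrow> 'x vfield) \<Rightarrow> bool" where
  "local_frame N Es \<longleftrightarrow> open N \<and> (\<forall>i<mdim A. Es i \<in> bf) \<and>
     (\<forall>V\<in>bf. \<exists>a. (\<forall>i<mdim A. smooth_fun A N (a i)) \<and> (\<forall>p\<in>N. \<forall>g. V p g = (\<Sum>i<mdim A. a i p * Es i p g))) \<and>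
     (\<forall>M a. open M \<longrightarrow> M \<subseteq> N \<longrightarrow> (\<forall>i<mdim A. continuous_on M (a i)) \<longrightarrow>
        (\<forall>p\<in>M. \<forall>g. (\<Sum>i<mdim A. a i p * Es i p g) = 0) \<longrightarrow> (\<forall>p\<in>M. \<forall>i<mdim A. a i p = 0))"

text \<open>The frame \<open>r \<partial>\<^sub>0, \<partial>\<^sub>1, \<dots>\<close> of the
  b-tangent bundle. Fibres are made of global sections, so the frame consists of global b-fields
  that have this form only on the smaller set \<open>N\<close>. Where \<open>Z\<close> is absent,
  \<open>r\<close> is 1 and the frame is the coordinate frame.\<close>

definition adapted_frame :: "'x set \<Rightarrow> (nat \<Rightarrow> 'x \<Rightarrow> real) \<Rightarrow> (nat \<Rightarrow> 'x vfield) \<Rightarrow> ('x \<Rightarrow> real) \<Rightarrow>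
    'x set \<Rightarrow> (nat \<Rightarrow> 'x vfield) \<Rightarrow> bool" where
  "adapted_frame U X D r N Es \<longleftrightarrow> b_chart A Z U X D r \<and> open N \<and> N \<subseteq> U \<and> (\<forall>i<mdim A. Es i \<in> bf) \<and>
     (\<forall>i<mdim A. \<forall>p\<in>N. \<forall>g. Es i p g = (if i = 0 then r p else 1) * D i p g)"

context
  fixes U X D r
  assumes bc: "b_chart A Z U X D r"
begin

lemmas b_chart_conj = bc[unfolded b_chart_def]
lemmas b_chart_conj3 = b_chart_conj[THEN conjunct2, THEN conjunct2, THEN conjunct2]
lemmas b_chart_conj6 = b_chart_conj3[THEN conjunct2, THEN conjunct2, THEN conjunct2]

lemma b_chart_open: "open U" by (rule b_chart_conj[THEN conjunct1])

lemma b_chart_X: "i < mdim A \<Longrightarrow> smooth_fun A U (X i)"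
  by (rule b_chart_conj[THEN conjunct2, THEN conjunct1, rule_format])

lemma b_chart_X_near: "i < mdim A \<Longrightarrow> p \<in> U \<Longrightarrow> smooth_near A p (X i)"
  using smooth_nearI[OF b_chart_open] b_chart_X by blast

lemma b_chart_D: "i < mdim A \<Longrightarrow> p \<in> U \<Longrightarrow> D i p \<in> tangent_space A p"
  by (rule b_chart_conj[THEN conjunct2, THEN conjunct2, THEN conjunct1, rule_format])

lemma b_chart_D_smooth:
  "i < mdim A \<Longrightarrow> open W \<Longrightarrow> W \<subseteq> U \<Longrightarrow> smooth_fun A W g \<Longrightarrow> smooth_fun A W (\<lambda>p. D i p g)"
  by (rule b_chart_conj3[THEN conjunct1, rule_format])

lemma b_chart_DX: "i < mdim A \<Longrightarrow> j < mdim A \<Longrightarrow> p \<in> U \<Longrightarrow> D i p (X j) = (if i = j then 1 else 0)"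
  by (rule b_chart_conj3[THEN conjunct2, THEN conjunct1, rule_format])

lemma b_chart_expand: "p \<in> U \<Longrightarrow> v \<in> tangent_space A p \<Longrightarrow> v g = (\<Sum>i<mdim A. v (X i) * D i p g)"
  by (rule b_chart_conj3[THEN conjunct2, THEN conjunct2, THEN conjunct1, rule_format])

lemma b_chart_Z: "p \<in> U \<Longrightarrow> p \<in> Z \<longleftrightarrow> r p = 0"
  by (rule b_chart_conj6[THEN conjunct1, rule_format])

lemma b_chart_cases: "U \<inter> Z = {} \<and> r = (\<lambda>_. 1) \<or> 0 < mdim A \<and> r = X 0"
  by (rule b_chart_conj6[THEN conjunct2, THEN conjunct1])

lemma b_chart_divide:
  "open W \<Longrightarrow> W \<subseteq> U \<Longrightarrow> smooth_fun A W g \<Longrightarrow> (\<And>p. p \<in> W \<Longrightarrow> p \<in> Z \<Longrightarrow> g p = 0) \<Longrightarrow>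
    \<exists>h. smooth_fun A W h \<and> (\<forall>p\<in>W. g p = r p * h p)"
  by (rule b_chart_conj6[THEN conjunct2, THEN conjunct2, rule_format]) auto

lemma b_chart_r: "smooth_fun A U r"
  using b_chart_cases smooth_fun_const[OF b_chart_open] b_chart_X by blast

lemma b_chart_Dr:
  assumes "i < mdim A" "i \<noteq> 0" "p \<in> U"
  shows "D i p r = 0"
  using b_chart_cases
proof (elim disjE conjE)
  assume "r = (\<lambda>_. 1)"
  then show ?thesis using tangent_const[OF b_chart_D[OF assms(1,3)]] by simp
next
  assume "0 < mdim A" "r = X 0"
  then show ?thesis using b_chart_DX[OF assms(1) _ assms(3), of 0] assms(2) by simp
qed

text \<open>The coordinate fields are cut off by a bump function. Tangency to \<open>Z\<close> is
  clear for index 0, where the factor \<open>r\<close> vanishes. For the other indices a function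
  vanishing on \<open>Z\<close> is locally \<open>r * h\<close>, and its derivative at
  \<open>Z\<close> is 0 because \<open>D i\<close> kills \<open>r\<close> and \<open>r\<close> is 0
  there.\<close>

lemma ex_adapted_frame:
  assumes x: "x \<in> U"
  shows "\<exists>N Es. x \<in> N \<and> adapted_frame U X D r N Es"
proof -
  obtain \<rho> N K where b: "smooth_fun A UNIV \<rho>" "\<And>p. 0 \<le> \<rho> p" "\<And>p. \<rho> p \<le> 1"
    "open N" "x \<in> N" "N \<subseteq> U" "\<And>p. p \<in> N \<Longrightarrow> \<rho> p = 1"
    "closed K" "K \<subseteq> U" "\<And>p. p \<notin> K \<Longrightarrow> \<rho> p = 0"
    using ex_bump[OF b_chart_open x] by metis
  define s where "s i p = (if i = 0 then r p else 1)" for i :: nat and p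
  define Es where "Es i p g = \<rho> p * (s i p * D i p g)" for i p g
  have s: "smooth_fun A U (s i)" for i
    unfolding s_def using b_chart_r smooth_fun_const[OF b_chart_open] by (cases "i = 0") auto
  have "Es i \<in> bf" if i: "i < mdim A" for i
  proof (rule bfI)
    show "Es i \<in> vector_fields A UNIV"
    proof (rule vector_field_local)
      fix p
      show "\<exists>N V'. open N \<and> p \<in> N \<and> V' \<in> vector_fields A N \<and> (\<forall>q\<in>N. Es i q = V' q)"
      proof (cases "p \<in> U")
        case True
        have "D i \<in> vector_fields A U"
          unfolding vector_fields_def using b_chart_D[OF i] b_chart_D_smooth[OF i] by blast
        then have "(\<lambda>p g. \<Sum>j\<in>{i}. (\<rho> p * s j p) * D j p g) \<in> vector_fields A U"
          using smooth_fun_subset[OF b(1)] s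
          by (intro vector_field_lincomb b_chart_open smooth_fun_mult) auto
        then have "Es i \<in> vector_fields A U" by (simp add: Es_def[abs_def] mult.assoc)
        then show ?thesis using True b_chart_open by blast
      next
        case False
        have "(\<lambda>p g. \<Sum>j\<in>{}. 0 * D j p g) \<in> vector_fields A (- K)"
          using b(8) by (intro vector_field_lincomb) auto
        moreover have "\<forall>q\<in>- K. Es i q = (\<lambda>g. \<Sum>j\<in>{}. 0 * D j q g)"
          using b(10) by (auto simp: Es_def)
        moreover have "open (- K)" using b(8) by auto
        ultimately show ?thesis using False b(9) by blast
      qed
    qed
    fix p g W assume p: "p \<in> Z" and g: "smooth_near A p g" and W: "open W" "p \<in> W"
      and zero: "\<And>q. q \<in> W \<Longrightarrow> q \<in> Z \<Longrightarrow> g q = 0"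
    show "Es i p g = 0"
    proof (cases "p \<in> U \<and> i \<noteq> 0")
      case True
      then have pU: "p \<in> U" and i0: "i \<noteq> 0" by auto
      obtain S where S: "open S" "p \<in> S" "smooth_fun A S g" using g unfolding smooth_near_def by blast
      let ?M = "U \<inter> W \<inter> S"
      have M: "open ?M" "?M \<subseteq> U" "p \<in> ?M" using b_chart_open W S pU by auto
      obtain h where h: "smooth_fun A ?M h" "\<forall>q\<in>?M. g q = r q * h q"
        using b_chart_divide[OF M(1,2) smooth_fun_subset[OF S(3)]] zero by blast
      note n = smooth_nearI[OF M(1,3)]
      note Dp = b_chart_D[OF i pU]
      have nr: "smooth_near A p r" and nh: "smooth_near A p h"
        using n smooth_fun_subset[OF b_chart_r M(2)] h(1) by auto
      have "D i p g = D i p (\<lambda>q. r q * h q)"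
        by (rule tangent_germ[OF Dp g M(1,3)]) (use h(2) in blast)
      also have "\<dots> = 0"
        using tangent_mult[OF Dp nr nh] b_chart_Dr[OF i i0 pU] b_chart_Z[OF pU] p by simp
      finally show ?thesis by (simp add: Es_def)
    next
      case False
      then show ?thesis using b(9,10) b_chart_Z[of p] p by (auto simp: Es_def s_def)
    qed
  qed
  then have "adapted_frame U X D r N Es"
    unfolding adapted_frame_def using bc b(4,6,7) by (simp add: Es_def s_def)
  then show ?thesis using b(5) by blast
qed

end

text \<open>Coordinates read off the coefficients of a combination, the first one only up to the
  factor \<open>r\<close>. This ambiguity on \<open>Z\<close> is the reason for the continuity
  arguments below.\<close>

lemma adapted_frame_X:
  assumes "adapted_frame U X D r N Es" "p \<in> N" "j < mdim A"
  shows "(\<Sum>i<mdim A. a i * Es i p (X j)) = a j * (if j = 0 then r p else 1)"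
proof -
  have bc: "b_chart A Z U X D r" and p: "p \<in> U" using assms(1,2) by (auto simp: adapted_frame_def)
  have "(\<Sum>i<mdim A. a i * Es i p (X j)) = (\<Sum>i<mdim A. if i = j then a j * (if j = 0 then r p else 1) else 0)"
    by (intro sum.cong) (use assms b_chart_DX[OF bc _ assms(3) p] in \<open>auto simp: adapted_frame_def\<close>)
  then show ?thesis using assms(3) by simp
qed

text \<open>A b-field maps the first coordinate to a function that vanishes on \<open>Z\<close>,
  hence to \<open>r\<close> times a smooth function, which is the coefficient of the first frame
  field. Uniqueness follows by evaluating on coordinates, dividing by \<open>r\<close> off
  \<open>Z\<close> and using continuity.\<close>

lemma adapted_frame_local_frame:
  assumes af: "adapted_frame U X D r N Es"
  shows "local_frame N Es"
proof -
  note c = af[unfolded adapted_frame_def]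
  have bc: "b_chart A Z U X D r" and N: "open N" "N \<subseteq> U" using c by blast+
  note Es = c[THEN conjunct2, THEN conjunct2, THEN conjunct2, THEN conjunct1, rule_format]
    c[THEN conjunct2, THEN conjunct2, THEN conjunct2, THEN conjunct2, rule_format]
  have ex: "\<exists>a. (\<forall>i<mdim A. smooth_fun A N (a i)) \<and> (\<forall>p\<in>N. \<forall>g. V p g = (\<Sum>i<mdim A. a i p * Es i p g))"
    if V: "V \<in> bf" for V
  proof -
    have sV: "smooth_fun A N (\<lambda>p. V p (X i))" if "i < mdim A" for i
      by (rule bf_smooth[OF V N(1) smooth_fun_subset[OF b_chart_X[OF bc that] N(2)]])
    have "\<exists>h. 0 < mdim A \<longrightarrow> smooth_fun A N h \<and> (\<forall>p\<in>N. V p (X 0) = r p * h p)"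
    proof (cases "0 < mdim A")
      case True
      have "V p (X 0) = 0" if p: "p \<in> N" "p \<in> Z" for p
      proof -
        have r: "r = X 0" using b_chart_cases[OF bc] p N(2) by auto
        show ?thesis
          by (rule bf_vanish[OF V p(2) b_chart_X_near[OF bc True] N(1) p(1)])
            (use p N(2) b_chart_Z[OF bc] r in auto)
      qed
      then show ?thesis using b_chart_divide[OF bc N sV[OF True]] by blast
    qed auto
    then obtain h where h': "0 < mdim A \<longrightarrow> smooth_fun A N h \<and> (\<forall>p\<in>N. V p (X 0) = r p * h p)" ..
    then have h: "0 < mdim A \<Longrightarrow> smooth_fun A N h" "\<And>p. 0 < mdim A \<Longrightarrow> p \<in> N \<Longrightarrow> V p (X 0) = r p * h p"
      by blast+
    define a where "a i p = (if i = 0 then h p else V p (X i))" for i p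
    have "smooth_fun A N (a i)" if "i < mdim A" for i
      using h(1) sV[OF that] that unfolding a_def by (cases "i = 0") auto
    moreover have "V p g = (\<Sum>i<mdim A. a i p * Es i p g)" if p: "p \<in> N" for p g
    proof -
      have "V p g = (\<Sum>i<mdim A. V p (X i) * D i p g)"
        using b_chart_expand[OF bc _ bf_tangent[OF V]] p N(2) by blast
      also have "\<dots> = (\<Sum>i<mdim A. a i p * Es i p g)"
        by (intro sum.cong) (use h(2) p Es(2) in \<open>auto simp: a_def\<close>)
      finally show ?thesis .
    qed
    ultimately show ?thesis by blast
  qed
  have un: "a i p = 0" if M: "open M" "M \<subseteq> N" and a: "\<forall>i<mdim A. continuous_on M (a i)"
    and zero: "\<forall>p\<in>M. \<forall>g. (\<Sum>i<mdim A. a i p * Es i p g) = 0" and p: "p \<in> M" and i: "i < mdim A" for M a p i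
  proof -
    have z: "a i q * (if i = 0 then r q else 1) = 0" if "q \<in> M" for q
      using adapted_frame_X[OF af _ i, of q "\<lambda>i. a i q"] zero that M(2) by auto
    show ?thesis
    proof (cases "i = 0")
      case True
      show ?thesis
      proof (rule continuous_zero_off_Z[OF M(1) _ _ p, of "a i"])
        show "continuous_on M (a i)" using a i by blast
        show "a i q = 0" if "q \<in> M" "q \<notin> Z" for q
          using z[OF that(1)] True b_chart_Z[OF bc, of q] that M(2) N(2) by auto
      qed
    next
      case False
      then show ?thesis using z[OF p] by simp
    qed
  qed
  show ?thesis unfolding local_frame_def
  proof (intro conjI allI impI ballI)
    show "a i p = 0" if "open M" "M \<subseteq> N" "\<forall>i<mdim A. continuous_on M (a i)"
      "\<forall>p\<in>M. \<forall>g. (\<Sum>i<mdim A. a i p * Es i p g) = 0" "p \<in> M" "i < mdim A" for M a p i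
      by (rule un[OF that])
  qed (use N(1) Es(1) ex in blast)+
qed

lemma ex_adapted_frame_at: "\<exists>U X D r N Es. x \<in> N \<and> adapted_frame U X D r N Es"
  using ex_b_chart[of x] ex_adapted_frame by metis

lemma ex_local_frame: "\<exists>N Es. x \<in> N \<and> local_frame N Es"
  using ex_adapted_frame_at[of x] adapted_frame_local_frame by metis

section \<open>Coefficients in a local frame and equality of fibre classes\<close>

definition coef :: "'x set \<Rightarrow> (nat \<Rightarrow> 'x vfield) \<Rightarrow> 'x vfield \<Rightarrow> nat \<Rightarrow> 'x \<Rightarrow> real" where
  "coef N Es V = (SOME a. (\<forall>i<mdim A. smooth_fun A N (a i)) \<and>
     (\<forall>p\<in>N. \<forall>g. V p g = (\<Sum>i<mdim A. a i p * Es i p g)))"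

context
  fixes N Es
  assumes lf: "local_frame N Es"
begin

lemma local_frame_open: "open N"
  by (rule lf[unfolded local_frame_def, THEN conjunct1])

lemma local_frame_bf: "i < mdim A \<Longrightarrow> Es i \<in> bf"
  by (rule lf[unfolded local_frame_def, THEN conjunct2, THEN conjunct1, rule_format])

lemma local_frame_unique:
  assumes "open M" "M \<subseteq> N" "\<And>i. i < mdim A \<Longrightarrow> continuous_on M (a i)" "\<And>i. i < mdim A \<Longrightarrow> continuous_on M (b i)"
    "\<And>p g. p \<in> M \<Longrightarrow> (\<Sum>i<mdim A. a i p * Es i p g) = (\<Sum>i<mdim A. b i p * Es i p g)" "p \<in> M" "i < mdim A"
  shows "a i p = b i p"
proof -
  have "a i p - b i p = 0"
  proof (rule lf[unfolded local_frame_def, THEN conjunct2, THEN conjunct2, THEN conjunct2, rule_format,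
        of M "\<lambda>i p. a i p - b i p" p i])
    show "continuous_on M (\<lambda>p. a i p - b i p)" if "i < mdim A" for i
      by (intro continuous_intros assms(3,4) that)
    show "(\<Sum>i<mdim A. (a i p - b i p) * Es i p g) = 0" if "p \<in> M" for p g
      using assms(5)[OF that] by (simp add: left_diff_distrib sum_subtractf)
  qed (use assms in auto)
  then show ?thesis by simp
qed

lemma coef_props:
  assumes "V \<in> bf"
  shows "i < mdim A \<Longrightarrow> smooth_fun A N (coef N Es V i)"
    and "p \<in> N \<Longrightarrow> V p g = (\<Sum>i<mdim A. coef N Es V i p * Es i p g)"
proof -
  note c = someI_ex[OF bspec[OF lf[unfolded local_frame_def, THEN conjunct2, THEN conjunct2, THEN conjunct1] assms],
      folded coef_def]
  show "i < mdim A \<Longrightarrow> smooth_fun A N (coef N Es V i)"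
    by (rule c[THEN conjunct1, rule_format])
  show "p \<in> N \<Longrightarrow> V p g = (\<Sum>i<mdim A. coef N Es V i p * Es i p g)"
    by (rule c[THEN conjunct2, rule_format])
qed

lemma coef_continuous: "V \<in> bf \<Longrightarrow> i < mdim A \<Longrightarrow> M \<subseteq> N \<Longrightarrow> continuous_on M (coef N Es V i)"
  using smooth_fun_continuous[OF local_frame_open coef_props(1)] continuous_on_subset by blast

lemma coef_unique:
  assumes "V \<in> bf" "open M" "M \<subseteq> N" "\<And>i. i < mdim A \<Longrightarrow> continuous_on M (a i)"
    "\<And>p g. p \<in> M \<Longrightarrow> V p g = (\<Sum>i<mdim A. a i p * Es i p g)" "p \<in> M" "i < mdim A"
  shows "coef N Es V i p = a i p"
  by (rule local_frame_unique[OF assms(2,3) _ assms(4) _ assms(6,7)])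
    (use coef_continuous[OF assms(1)] coef_props(2)[OF assms(1)] assms(3,5) in \<open>auto simp: subset_iff\<close>)

lemma coef_lincomb:
  assumes "finite I" "\<And>k. k \<in> I \<Longrightarrow> smooth_fun A UNIV (h k)" "\<And>k. k \<in> I \<Longrightarrow> B k \<in> bf" "p \<in> N" "i < mdim A"
  shows "coef N Es (\<lambda>p g. \<Sum>k\<in>I. h k p * B k p g) i p = (\<Sum>k\<in>I. h k p * coef N Es (B k) i p)"
proof (rule coef_unique[where a = "\<lambda>i p. \<Sum>k\<in>I. h k p * coef N Es (B k) i p", OF _ local_frame_open order_refl _ _ assms(4,5)])
  show "(\<lambda>p g. \<Sum>k\<in>I. h k p * B k p g) \<in> bf" by (rule bf_lincomb) (use assms in auto)
  show "continuous_on N (\<lambda>p. \<Sum>k\<in>I. h k p * coef N Es (B k) i p)" if "i < mdim A" for i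
    using assms that
    by (intro continuous_intros coef_continuous)
      (auto intro: continuous_on_subset[OF smooth_fun_continuous[OF open_UNIV assms(2)]])
  show "(\<Sum>k\<in>I. h k p * B k p g) = (\<Sum>i<mdim A. (\<Sum>k\<in>I. h k p * coef N Es (B k) i p) * Es i p g)" if "p \<in> N" for p g
  proof -
    have "(\<Sum>k\<in>I. h k p * B k p g) = (\<Sum>k\<in>I. \<Sum>i<mdim A. h k p * coef N Es (B k) i p * Es i p g)"
      by (intro sum.cong refl) (simp add: coef_props(2)[OF assms(3) that] sum_distrib_left mult.assoc)
    also have "\<dots> = (\<Sum>i<mdim A. \<Sum>k\<in>I. h k p * coef N Es (B k) i p * Es i p g)" by (rule sum.swap)
    finally show ?thesis by (simp add: sum_distrib_right)
  qed
qed

lemma coef_frame: "p \<in> N \<Longrightarrow> i < mdim A \<Longrightarrow> j < mdim A \<Longrightarrow> coef N Es (Es j) i p = (if i = j then 1 else 0)"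
proof (rule coef_unique[where a = "\<lambda>i p. if i = j then 1 else 0", OF local_frame_bf local_frame_open order_refl])
  assume j: "j < mdim A"
  show "Es j p g = (\<Sum>i<mdim A. (if i = j then 1 else 0) * Es i p g)" for p g
  proof -
    have "(\<Sum>i<mdim A. (if i = j then 1 else 0) * Es i p g) = (\<Sum>i<mdim A. if i = j then Es i p g else 0)"
      by (intro sum.cong) auto
    then show ?thesis using j by simp
  qed
qed auto

text \<open>Stands in for the frame expansion, whose coefficients are only locally defined, where linearity
  over global functions is all that is known.\<close>
lemma frame_decomposition:
  assumes "p \<in> N"
  obtains \<rho> where "smooth_fun A UNIV \<rho>" "\<rho> p = 1"
    "\<And>V i. V \<in> bf \<Longrightarrow> i < mdim A \<Longrightarrow> smooth_fun A UNIV (\<lambda>q. \<rho> q * coef N Es V i q)"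
    "\<And>V q g. V \<in> bf \<Longrightarrow> V q g = (1 - \<rho> q) * V q g + (\<Sum>i<mdim A. (\<rho> q * coef N Es V i q) * Es i q g)"
proof -
  obtain \<rho> M K where b: "smooth_fun A UNIV \<rho>" "p \<in> M" "\<And>q. q \<in> M \<Longrightarrow> \<rho> q = 1"
    "closed K" "K \<subseteq> N" "\<And>q. q \<notin> K \<Longrightarrow> \<rho> q = 0"
    using ex_bump[OF local_frame_open assms] by metis
  show thesis
  proof (rule that[OF b(1)])
    show "\<rho> p = 1" using b by blast
    show "smooth_fun A UNIV (\<lambda>q. \<rho> q * coef N Es V i q)" if "V \<in> bf" "i < mdim A" for V i
      by (rule smooth_fun_extend[OF b(1,4,5) local_frame_open b(6) coef_props(1)[OF that]])
    show "V q g = (1 - \<rho> q) * V q g + (\<Sum>i<mdim A. (\<rho> q * coef N Es V i q) * Es i q g)" if V: "V \<in> bf" for V q g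
    proof (cases "q \<in> N")
      case True
      have "(\<Sum>i<mdim A. (\<rho> q * coef N Es V i q) * Es i q g) = \<rho> q * V q g"
        by (simp add: coef_props(2)[OF V True] sum_distrib_left mult.assoc)
      then show ?thesis by (simp add: algebra_simps)
    next
      case False
      then have "\<rho> q = 0" using b by blast
      then show ?thesis by simp
    qed
  qed
qed

text \<open>The bridge from the algebraic fibre, a quotient of the module of b-fields, to
  coordinates. In one direction the coefficients of a product vanish where its scalar factor does.
  In the other, \<open>V - W\<close> is the sum of the frame fields weighted by
  \<open>\<rho>\<close> times the coefficient differences, plus \<open>1 - \<rho>\<close> times
  \<open>V - W\<close>; all these weights vanish at \<open>p\<close>. The last summand accounts for
  \<open>Suc ?n\<close>.\<close>

lemma b_class_mem_iff:
  assumes V: "V \<in> bf" and W: "W \<in> bf" and p: "p \<in> N"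
  shows "W \<in> b_class A Z p V \<longleftrightarrow> (\<forall>i<mdim A. coef N Es V i p = coef N Es W i p)"
proof
  assume "W \<in> b_class A Z p V"
  then obtain k :: nat and h B where h: "\<And>i. i < k \<Longrightarrow> smooth_fun A UNIV (h i) \<and> h i p = 0 \<and> B i \<in> bf"
    "\<And>p g. V p g - W p g = (\<Sum>i<k. h i p * B i p g)"
    unfolding b_class_def by blast
  have "V = (\<lambda>p g. \<Sum>i<Suc k. (if i < k then h i else (\<lambda>_. 1)) p * (if i < k then B i else W) p g)"
  proof (intro ext)
    fix q g
    have "V q g = (\<Sum>i<k. h i q * B i q g) + W q g" using h(2)[of q g] by simp
    then show "V q g = (\<Sum>i<Suc k. (if i < k then h i else (\<lambda>_. 1)) q * (if i < k then B i else W) q g)"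
      by simp
  qed
  moreover have "coef N Es (\<lambda>p g. \<Sum>i<Suc k. (if i < k then h i else (\<lambda>_. 1)) p * (if i < k then B i else W) p g) j p
      = (\<Sum>i<Suc k. (if i < k then h i else (\<lambda>_. 1)) p * coef N Es (if i < k then B i else W) j p)" if "j < mdim A" for j
    by (rule coef_lincomb) (use h W p that smooth_fun_const in \<open>auto simp: less_Suc_eq\<close>)
  moreover have "(\<Sum>i<Suc k. (if i < k then h i else (\<lambda>_. 1)) p * coef N Es (if i < k then B i else W) j p) = coef N Es W j p" for j
    using h by simp
  ultimately show "\<forall>i<mdim A. coef N Es V i p = coef N Es W i p" by metis
next
  assume eq: "\<forall>i<mdim A. coef N Es V i p = coef N Es W i p"
  obtain \<rho> where \<rho>: "smooth_fun A UNIV \<rho>" "\<rho> p = 1"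
    "\<And>V i. V \<in> bf \<Longrightarrow> i < mdim A \<Longrightarrow> smooth_fun A UNIV (\<lambda>q. \<rho> q * coef N Es V i q)"
    "\<And>V q g. V \<in> bf \<Longrightarrow> V q g = (1 - \<rho> q) * V q g + (\<Sum>i<mdim A. (\<rho> q * coef N Es V i q) * Es i q g)"
    by (rule frame_decomposition[OF p]) blast
  let ?n = "mdim A"
  define h where "h i q = (if i < ?n then \<rho> q * coef N Es V i q - \<rho> q * coef N Es W i q else 1 - \<rho> q)" for i q
  define B where "B i = (if i < ?n then Es i else (\<lambda>p g. V p g - W p g))" for i
  have "smooth_fun A UNIV (h i) \<and> h i p = 0 \<and> B i \<in> bf" for i
    using \<rho>(1-3) eq V W local_frame_bf bf_diff[OF V W]
    by (cases "i < ?n") (auto simp: h_def[abs_def] B_def intro!: smooth_fun_diff smooth_fun_const)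
  moreover have "V q g - W q g = (\<Sum>i<Suc ?n. h i q * B i q g)" for q g
  proof -
    have "(\<Sum>i<Suc ?n. h i q * B i q g) = (\<Sum>i<?n. (\<rho> q * coef N Es V i q) * Es i q g) -
        (\<Sum>i<?n. (\<rho> q * coef N Es W i q) * Es i q g) + (1 - \<rho> q) * (V q g - W q g)"
      by (simp add: h_def B_def left_diff_distrib sum_subtractf)
    then show ?thesis using \<rho>(4)[OF V, of q g] \<rho>(4)[OF W, of q g] by (simp add: algebra_simps)
  qed
  ultimately show "W \<in> b_class A Z p V"
    unfolding b_class_def using W by (intro CollectI conjI exI[of _ "Suc ?n"] exI[of _ h] exI[of _ B]) auto
qed

lemma b_class_eq_iff:
  assumes "V \<in> bf" "W \<in> bf" "p \<in> N"
  shows "b_class A Z p V = b_class A Z p W \<longleftrightarrow> (\<forall>i<mdim A. coef N Es V i p = coef N Es W i p)"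
proof
  assume "b_class A Z p V = b_class A Z p W"
  then show "\<forall>i<mdim A. coef N Es V i p = coef N Es W i p"
    using b_class_mem_iff[OF assms] b_class_mem_iff[OF assms(2,2,3)] by simp
next
  assume eq: "\<forall>i<mdim A. coef N Es V i p = coef N Es W i p"
  show "b_class A Z p V = b_class A Z p W"
  proof (rule Set.set_eqI)
    fix B
    show "B \<in> b_class A Z p V \<longleftrightarrow> B \<in> b_class A Z p W"
    proof (cases "B \<in> bf")
      case True
      then show ?thesis using b_class_mem_iff[OF assms(1) True assms(3)] b_class_mem_iff[OF assms(2) True assms(3)] eq by auto
    qed (simp add: b_class_def)
  qed
qed

end

end

section \<open>Determinants and Pfaffians of families of reals\<close>

lemma det_nat_mat: "Determinant.det (Matrix.mat n n (\<lambda>(i, j). M i j)) = det_nat n M"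
  unfolding det_def'[OF mat_carrier] det_nat_def atLeast0LessThan
proof (intro sum.cong refl arg_cong2[of _ _ _ _ "(*)"] prod.cong)
  fix s i assume "s \<in> {s. s permutes {..<n}}" and i: "i \<in> {..<n}"
  then have s: "s permutes {..<n}" by simp
  show "Matrix.mat n n (\<lambda>(i, j). M i j) $$ (i, s i) = M i (s i)"
    using permutes_in_image[OF s, of i] i by simp
qed

lemma mat_mult_vec_index:
  assumes "i < n"
  shows "vec_index (Matrix.mat n n (\<lambda>(i, j). M i j) *\<^sub>v Matrix.vec n a) i = (\<Sum>j<n. M i j * a j :: real)"
  using assms by (simp add: scalar_prod_def atLeast0LessThan)

lemma det_nat_Cramer:
  assumes eq: "\<And>i. i < n \<Longrightarrow> (\<Sum>j<n. M i j * a j) = b i" and k: "k < n"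
  shows "det_nat n (\<lambda>i j. if j = k then b i else M i j) = a k * det_nat n M"
proof -
  let ?M = "Matrix.mat n n (\<lambda>(i, j). M i j)" and ?a = "Matrix.vec n a"
  have "replace_col ?M (?M *\<^sub>v ?a) k = Matrix.mat n n (\<lambda>(i, j). if j = k then b i else M i j)"
    unfolding replace_col_def
    by (rule eq_matI) (use mat_mult_vec_index[of _ n M a] eq in auto)
  then show ?thesis
    using cramer_lemma_mat[of ?M n ?a k] k by (simp add: det_nat_mat[symmetric])
qed

lemma det_nat_nonzero:
  assumes "\<And>c. (\<And>i. i < n \<Longrightarrow> (\<Sum>j<n. M i j * c j) = 0) \<Longrightarrow> \<forall>j<n. c j = 0"
  shows "det_nat n M \<noteq> 0"
proof
  let ?M = "Matrix.mat n n (\<lambda>(i, j). M i j)"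
  assume "det_nat n M = 0"
  then obtain v where v: "v \<in> carrier_vec n" "v \<noteq> 0\<^sub>v n" "?M *\<^sub>v v = 0\<^sub>v n"
    using det_0_iff_vec_prod_zero_field[of ?M n] by (auto simp: det_nat_mat)
  define c where "c j = vec_index v j" for j
  have vc: "v = Matrix.vec n c" using v(1) by (auto simp: c_def)
  have "(\<Sum>j<n. M i j * c j) = 0" if "i < n" for i
    using mat_mult_vec_index[OF that, of M c] v(3) that unfolding vc by simp
  then have "\<forall>j<n. c j = 0" by (rule assms)
  then show False using v(1,2) unfolding vc by (auto intro!: eq_vecI)
qed

lemma ex_matrix_inverse:
  fixes M :: "nat \<Rightarrow> nat \<Rightarrow> real"
  assumes "\<And>c. (\<And>i. i < n \<Longrightarrow> (\<Sum>j<n. M i j * c j) = 0) \<Longrightarrow> \<forall>j<n. c j = 0"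
  shows "\<exists>N. (\<forall>i<n. \<forall>k<n. (\<Sum>j<n. M i j * N j k) = (if i = k then 1 else 0)) \<and>
    (\<forall>i<n. \<forall>k<n. (\<Sum>j<n. N i j * M j k) = (if i = k then 1 else 0))"
proof -
  let ?A = "Matrix.mat n n (\<lambda>(i, j). M i j)"
  define d where "d = det_nat n M"
  have d: "d \<noteq> 0" unfolding d_def by (rule det_nat_nonzero) (rule assms)
  note adj = adj_mat[of ?A n, OF mat_carrier, unfolded det_nat_mat, folded d_def]
  define N where "N i j = adj_mat ?A $$ (i, j) / d" for i j
  have dims: "dim_row (adj_mat ?A) = n" "dim_col (adj_mat ?A) = n" using adj(1) by auto
  have 1: "(\<Sum>j<n. M i j * N j k) = (if i = k then 1 else 0)" if "i < n" "k < n" for i k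
  proof -
    have "(?A * adj_mat ?A) $$ (i, k) = (\<Sum>j<n. M i j * adj_mat ?A $$ (j, k))"
      using that dims by (simp add: scalar_prod_def atLeast0LessThan)
    then have "(\<Sum>j<n. M i j * adj_mat ?A $$ (j, k)) = (if i = k then d else 0)"
      unfolding adj(2) using that by (auto split: if_splits)
    then show ?thesis using d by (simp add: N_def sum_divide_distrib[symmetric])
  qed
  have 2: "(\<Sum>j<n. N i j * M j k) = (if i = k then 1 else 0)" if "i < n" "k < n" for i k
  proof -
    have "(adj_mat ?A * ?A) $$ (i, k) = (\<Sum>j<n. adj_mat ?A $$ (i, j) * M j k)"
      using that dims by (simp add: scalar_prod_def atLeast0LessThan)
    then have "(\<Sum>j<n. adj_mat ?A $$ (i, j) * M j k) = (if i = k then d else 0)"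
      unfolding adj(3) using that by (auto split: if_splits)
    then show ?thesis using d by (simp add: N_def sum_divide_distrib[symmetric])
  qed
  show ?thesis using 1 2 by blast
qed

lemma det_nat_transpose: "det_nat n (\<lambda>i j. M j i) = det_nat n M"
proof -
  have "Matrix.mat n n (\<lambda>(i, j). M j i) = transpose_mat (Matrix.mat n n (\<lambda>(i, j). M i j))"
    by (rule eq_matI) auto
  then show ?thesis
    using det_transpose[of "Matrix.mat n n (\<lambda>(i, j). M i j)" n] by (simp add: det_nat_mat[symmetric])
qed

text \<open>Padding the system with zero rows gives a square matrix. Each product in its Leibniz
  formula contains an entry of a zero row, so the determinant is 0 and the kernel is not
  trivial.\<close>

lemma ex_underdetermined_solution:
  assumes "q < n"
  obtains w :: "nat \<Rightarrow> real" and j where "j < n" "w j \<noteq> 0" "\<And>a. a < q \<Longrightarrow> (\<Sum>j<n. c a j * w j) = 0"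
proof -
  let ?M = "\<lambda>a j. if a < q then c a j else 0"
  have "det_nat n ?M = 0"
    unfolding det_nat_def
  proof (rule sum.neutral, rule ballI)
    fix s
    have "(\<Prod>i<n. ?M i (s i)) = 0" using assms by (intro prod_zero) auto
    then show "of_int (sign s) * (\<Prod>i<n. ?M i (s i)) = 0" by simp
  qed
  then obtain w where w: "\<And>i. i < n \<Longrightarrow> (\<Sum>j<n. ?M i j * w j) = 0" "\<not> (\<forall>j<n. w j = 0)"
    using det_nat_nonzero[of n ?M] by blast
  then obtain j where "j < n" "w j \<noteq> 0" by blast
  moreover have "(\<Sum>j<n. c a j * w j) = 0" if "a < q" for a
    using w(1)[of a] that assms by simp
  ultimately show thesis using that by blast
qed

lemma det_nat_scale_column:
  assumes "0 < n"
  shows "det_nat n (\<lambda>i j. (if j = 0 then r else 1) * M i j) = r * det_nat n M"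
proof -
  have "(\<Prod>i<n. (if s i = 0 then r else 1) * M i (s i)) = r * (\<Prod>i<n. M i (s i))" if s: "s permutes {..<n}" for s
  proof -
    have "(\<Prod>i<n. if s i = 0 then r else 1) = (\<Prod>i<n. if i = 0 then r else 1)"
      using prod.permute[OF s, of "\<lambda>i. if i = 0 then r else 1"] by (simp add: o_def)
    then show ?thesis using assms by (simp add: prod.distrib)
  qed
  then show ?thesis
    unfolding det_nat_def sum_distrib_left by (intro sum.cong refl) simp
qed

lemma det_nat_id: "det_nat n (\<lambda>i j. if i = j then 1 else 0) = 1"
proof -
  have "Matrix.mat n n (\<lambda>(i, j). if i = j then 1 else 0 :: real) = 1\<^sub>m n" by (rule eq_matI) auto
  then show ?thesis using det_nat_mat[of n "\<lambda>i j. if i = j then 1 else 0"] by simp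
qed

text \<open>The left side is a determinant with columns chosen by \<open>\<phi>\<close>, which
  vanishes for a repeated column. The middle branch is there because \<open>permutes\<close> also
  demands the identity outside \<open>{..<n}\<close>, which injectivity on that set does not
  give.\<close>

lemma det_nat_columns:
  assumes \<phi>: "\<phi> ` {..<n} \<subseteq> {..<n}"
  shows "(\<Sum>s | s permutes {..<n}. of_int (sign s) * (\<Prod>a<n. M (s a) (\<phi> a))) =
    (if \<phi> permutes {..<n} then of_int (sign \<phi>) * det_nat n M else
     if inj_on \<phi> {..<n} then det_nat n (\<lambda>a b. M b (\<phi> a)) else 0)"
proof -
  have eq: "(\<Sum>s | s permutes {..<n}. of_int (sign s) * (\<Prod>a<n. M (s a) (\<phi> a))) = det_nat n (\<lambda>a b. M b (\<phi> a))"
    by (simp add: det_nat_def)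
  show ?thesis
  proof (cases "\<phi> permutes {..<n}")
    case True
    let ?A = "Matrix.mat n n (\<lambda>(i, j). M j i)"
    have "Matrix.mat n n (\<lambda>(i, j). ?A $$ (\<phi> i, j)) = Matrix.mat n n (\<lambda>(a, b). M b (\<phi> a))"
      by (rule eq_matI) (use \<phi> in auto)
    moreover have "\<phi> permutes {0..<n}" using True by (simp add: atLeast0LessThan)
    ultimately have "det_nat n (\<lambda>a b. M b (\<phi> a)) = of_int (sign \<phi>) * det_nat n (\<lambda>i j. M j i)"
      using det_permute_rows[of ?A n \<phi>] by (simp add: det_nat_mat[symmetric])
    then show ?thesis using True eq det_nat_transpose by simp
  next
    case False
    show ?thesis
    proof (cases "inj_on \<phi> {..<n}")
      case ni: False
      then obtain i j where ij: "i < n" "j < n" "i \<noteq> j" "\<phi> i = \<phi> j" by (auto simp: inj_on_def)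
      let ?A = "Matrix.mat n n (\<lambda>(a, b). M b (\<phi> a))"
      have "Matrix.row ?A i = Matrix.row ?A j" using ij by (intro eq_vecI) auto
      then have "Determinant.det ?A = 0" using det_identical_rows[of ?A n i j] ij by simp
      then show ?thesis using False ni eq by (simp add: det_nat_mat)
    qed (simp add: eq False)
  qed
qed

text \<open>\<open>m!\<close> times the Pfaffian of \<open>N\<close>.\<close>
definition pf :: "nat \<Rightarrow> (nat \<Rightarrow> nat \<Rightarrow> real) \<Rightarrow> real" where
  "pf m N = (\<Sum>s | s permutes {..<2 * m}. of_int (sign s) * (\<Prod>i<m. N (s (2 * i)) (s (2 * i + 1)))) / 2 ^ m"

section \<open>The Pfaffian under a change of basis\<close>

lemma prod_pairs:
  fixes f :: "nat \<Rightarrow> real"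
  shows "(\<Prod>i<m. f (2 * i) * f (2 * i + 1)) = (\<Prod>a<2 * m. f a)"
  by (induction m) (simp_all add: mult.assoc)

text \<open>The rule that the Pfaffian of a congruent matrix is multiplied by the determinant.
  Expanding the product of double sums means choosing a pair of columns for each factor. The sum
  over \<open>s\<close> is then a determinant with the chosen columns; it vanishes unless the choice
  is a permutation, and otherwise equals its sign times \<open>det_nat (2 * m) M\<close>.\<close>

lemma pf_transform:
  "pf m (\<lambda>a b. \<Sum>j<2 * m. \<Sum>k<2 * m. N j k * M a j * M b k) = det_nat (2 * m) M * pf m N"
proof -
  let ?n = "2 * m"
  let ?P = "{s. s permutes {..<?n}}"
  let ?Q = "PiE {..<m} (\<lambda>_. {..<?n} \<times> {..<?n})"
  let ?L = "\<Sum>s\<in>?P. of_int (sign s) * (\<Prod>i<m. \<Sum>j<?n. \<Sum>k<?n. N j k * M (s (2 * i)) j * M (s (2 * i + 1)) k)"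
  \<comment> \<open>The chosen pairs written one after another as a function on
    \<open>{..<?n}\<close>. The identity outside this range lets an injective choice count as a
    permutation.\<close>
  define \<phi> where "\<phi> g a = (if a < ?n then if even a then fst (g (a div 2)) else snd (g (a div 2)) else a)"
    for g :: "nat \<Rightarrow> nat \<times> nat" and a
  have \<phi>2: "\<phi> g (2 * i) = fst (g i)" "\<phi> g (2 * i + 1) = snd (g i)" if "i < m" for g i
    using that by (auto simp: \<phi>_def)
  have \<phi>im: "\<phi> g ` {..<?n} \<subseteq> {..<?n}" if g: "g \<in> ?Q" for g
  proof (rule image_subsetI)
    fix a assume a: "a \<in> {..<?n}"
    then have "a div 2 \<in> {..<m}" by auto
    with g have "g (a div 2) \<in> {..<?n} \<times> {..<?n}" by (rule PiE_mem)
    then show "\<phi> g a \<in> {..<?n}" using a by (auto simp: \<phi>_def)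
  qed
  have step: "(\<Prod>i<m. \<Sum>j<?n. \<Sum>k<?n. N j k * M (s (2 * i)) j * M (s (2 * i + 1)) k) =
      (\<Sum>g\<in>?Q. (\<Prod>i<m. N (\<phi> g (2 * i)) (\<phi> g (2 * i + 1))) * (\<Prod>a<?n. M (s a) (\<phi> g a)))" for s
  proof -
    have "(\<Prod>i<m. \<Sum>j<?n. \<Sum>k<?n. N j k * M (s (2 * i)) j * M (s (2 * i + 1)) k) =
        (\<Prod>i<m. \<Sum>x\<in>{..<?n} \<times> {..<?n}. N (fst x) (snd x) * M (s (2 * i)) (fst x) * M (s (2 * i + 1)) (snd x))"
      by (simp add: sum.cartesian_product case_prod_beta)
    also have "\<dots> = (\<Sum>g\<in>?Q. \<Prod>i<m. N (fst (g i)) (snd (g i)) * M (s (2 * i)) (fst (g i)) * M (s (2 * i + 1)) (snd (g i)))"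
      by (rule prod_sum_PiE) auto
    also have "\<dots> = (\<Sum>g\<in>?Q. (\<Prod>i<m. N (\<phi> g (2 * i)) (\<phi> g (2 * i + 1))) * (\<Prod>a<?n. M (s a) (\<phi> g a)))"
    proof (rule sum.cong[OF refl])
      fix g
      have "(\<Prod>a<?n. M (s a) (\<phi> g a)) = (\<Prod>i<m. M (s (2 * i)) (\<phi> g (2 * i)) * M (s (2 * i + 1)) (\<phi> g (2 * i + 1)))"
        by (rule prod_pairs[symmetric])
      then show "(\<Prod>i<m. N (fst (g i)) (snd (g i)) * M (s (2 * i)) (fst (g i)) * M (s (2 * i + 1)) (snd (g i))) =
          (\<Prod>i<m. N (\<phi> g (2 * i)) (\<phi> g (2 * i + 1))) * (\<Prod>a<?n. M (s a) (\<phi> g a))"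
        using \<phi>2[of _ g] by (simp add: prod.distrib[symmetric] mult.assoc)
    qed
    finally show ?thesis .
  qed
  have "?L = (\<Sum>s\<in>?P. \<Sum>g\<in>?Q. (\<Prod>i<m. N (\<phi> g (2 * i)) (\<phi> g (2 * i + 1))) *
      (of_int (sign s) * (\<Prod>a<?n. M (s a) (\<phi> g a))))"
    unfolding step by (simp add: sum_distrib_left mult.left_commute)
  also have "\<dots> = (\<Sum>g\<in>?Q. (\<Prod>i<m. N (\<phi> g (2 * i)) (\<phi> g (2 * i + 1))) *
      (\<Sum>s\<in>?P. of_int (sign s) * (\<Prod>a<?n. M (s a) (\<phi> g a))))"
    by (subst sum.swap) (simp add: sum_distrib_left)
  also have "\<dots> = (\<Sum>g\<in>?Q. (\<Prod>i<m. N (\<phi> g (2 * i)) (\<phi> g (2 * i + 1))) *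
      (if \<phi> g permutes {..<?n} then of_int (sign (\<phi> g)) * det_nat ?n M else 0))"
  proof (intro sum.cong refl arg_cong2[of _ _ _ _ "(*)"])
    fix g assume g: "g \<in> ?Q"
    have "\<phi> g permutes {..<?n}" if "inj_on (\<phi> g) {..<?n}"
    proof (rule bij_imp_permutes)
      show "bij_betw (\<phi> g) {..<?n} {..<?n}"
        using that \<phi>im[OF g] by (simp add: bij_betw_def endo_inj_surj)
    qed (simp add: \<phi>_def)
    then show "(\<Sum>s\<in>?P. of_int (sign s) * (\<Prod>a<?n. M (s a) (\<phi> g a))) =
        (if \<phi> g permutes {..<?n} then of_int (sign (\<phi> g)) * det_nat ?n M else 0)"
      using det_nat_columns[OF \<phi>im[OF g], of M] by auto
  qed
  also have "\<dots> = (\<Sum>g\<in>{g\<in>?Q. \<phi> g permutes {..<?n}}. (\<Prod>i<m. N (\<phi> g (2 * i)) (\<phi> g (2 * i + 1))) *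
      (of_int (sign (\<phi> g)) * det_nat ?n M))"
    by (rule sum.mono_neutral_cong_right) (auto intro!: finite_PiE)
  also have "\<dots> = (\<Sum>s\<in>?P. (\<Prod>i<m. N (s (2 * i)) (s (2 * i + 1))) * (of_int (sign s) * det_nat ?n M))"
  proof (rule sum.reindex_bij_witness[of _ "\<lambda>s. \<lambda>i\<in>{..<m}. (s (2 * i), s (2 * i + 1))" \<phi>])
    fix g assume g: "g \<in> {g \<in> ?Q. \<phi> g permutes {..<?n}}"
    show "(\<lambda>i\<in>{..<m}. (\<phi> g (2 * i), \<phi> g (2 * i + 1))) = g"
    proof
      fix i show "(\<lambda>i\<in>{..<m}. (\<phi> g (2 * i), \<phi> g (2 * i + 1))) i = g i"
        using g \<phi>2[of i g] by (cases "i < m") (auto simp: PiE_def extensional_def)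
    qed
    show "\<phi> g \<in> ?P" using g by simp
  next
    fix s assume "s \<in> ?P"
    then have s: "s permutes {..<?n}" by simp
    have e: "\<phi> (\<lambda>i\<in>{..<m}. (s (2 * i), s (2 * i + 1))) = s"
    proof
      fix a
      show "\<phi> (\<lambda>i\<in>{..<m}. (s (2 * i), s (2 * i + 1))) a = s a"
      proof (cases "a < ?n")
        case True
        then have "a div 2 < m" by auto
        moreover have "even a \<Longrightarrow> 2 * (a div 2) = a" "odd a \<Longrightarrow> 2 * (a div 2) + 1 = a" by auto
        ultimately show ?thesis using True by (auto simp: \<phi>_def)
      next
        case False
        then show ?thesis using permutes_not_in[OF s, of a] by (simp add: \<phi>_def)
      qed
    qed
    then show "\<phi> (\<lambda>i\<in>{..<m}. (s (2 * i), s (2 * i + 1))) = s" .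
    have "s a < ?n" if "a < ?n" for a using permutes_in_image[OF s, of a] that by simp
    then have "(\<lambda>i\<in>{..<m}. (s (2 * i), s (2 * i + 1))) \<in> ?Q" by (auto intro!: PiE_I)
    then show "(\<lambda>i\<in>{..<m}. (s (2 * i), s (2 * i + 1))) \<in> {g \<in> ?Q. \<phi> g permutes {..<?n}}"
      using e s by simp
  qed simp
  finally have "?L = det_nat ?n M * (\<Sum>s\<in>?P. of_int (sign s) * (\<Prod>i<m. N (s (2 * i)) (s (2 * i + 1))))"
    by (simp add: sum_distrib_left mult_ac)
  then show ?thesis unfolding pf_def by simp
qed

text \<open>The standard symplectic matrix. A nondegenerate alternating \<open>N\<close> is congruent to it, and the Pfaffian
  changes by the determinant of the congruence.\<close>
definition J0 :: "nat \<Rightarrow> nat \<Rightarrow> real" where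
  "J0 a b = (if even a \<and> b = Suc a then 1 else if odd a \<and> a = Suc b then - 1 else 0)"

lemma J0_skew: "J0 a b = - J0 b a"
  by (auto simp: J0_def)

section \<open>Positivity of the Pfaffian of the standard matrix\<close>

definition pf_term :: "nat \<Rightarrow> (nat \<Rightarrow> nat) \<Rightarrow> real" where
  "pf_term m s = of_int (sign s) * (\<Prod>i<m. J0 (s (2 * i)) (s (2 * i + 1)))"

text \<open>Exchanging the two members of a pair reverses the sign of the permutation and of exactly
  one factor.\<close>

lemma pf_term_flip:
  assumes s: "s permutes {..<2 * m}" and i: "i < m"
  shows "pf_term m (s \<circ> Transposition.transpose (2 * i) (2 * i + 1)) = pf_term m s"
proof -
  let ?t = "Transposition.transpose (2 * i) (2 * i + 1)"
  have "sign (s \<circ> ?t) = - sign s"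
    using permutes_imp_permutation[OF _ s] by (simp add: sign_compose permutation_swap_id sign_swap_id)
  moreover have "(\<Prod>j<m. J0 ((s \<circ> ?t) (2 * j)) ((s \<circ> ?t) (2 * j + 1))) = - (\<Prod>j<m. J0 (s (2 * j)) (s (2 * j + 1)))"
  proof -
    have "(\<Prod>j<m. J0 ((s \<circ> ?t) (2 * j)) ((s \<circ> ?t) (2 * j + 1))) =
        (\<Prod>j<m. (if j = i then - 1 else 1) * J0 (s (2 * j)) (s (2 * j + 1)))"
    proof (intro prod.cong refl)
      fix j
      show "J0 ((s \<circ> ?t) (2 * j)) ((s \<circ> ?t) (2 * j + 1)) = (if j = i then - 1 else 1) * J0 (s (2 * j)) (s (2 * j + 1))"
      proof (cases "j = i")
        case True
        then show ?thesis using J0_skew[of "s (2 * i + 1)" "s (2 * i)"] by simp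
      next
        case False
        then have "2 * j \<noteq> 2 * i" "2 * j \<noteq> 2 * i + 1" "2 * j + 1 \<noteq> 2 * i" "2 * j + 1 \<noteq> 2 * i + 1" by presburger+
        then show ?thesis using False by (simp add: transpose_apply_other del: Suc_eq_plus1 Suc_eq_plus1_left)
      qed
    qed
    then show ?thesis using i by (simp add: prod.distrib)
  qed
  ultimately show ?thesis by (simp add: pf_term_def)
qed

text \<open>Exchanging two whole pairs is a product of two transpositions, hence even, and only
  reorders the factors.\<close>

lemma pf_term_swap:
  assumes s: "s permutes {..<2 * m}" and i: "i < m" "k < m"
  shows "pf_term m (s \<circ> (Transposition.transpose (2 * i) (2 * k) \<circ> Transposition.transpose (2 * i + 1) (2 * k + 1))) = pf_term m s"
proof -
  let ?t = "Transposition.transpose (2 * i) (2 * k) \<circ> Transposition.transpose (2 * i + 1) (2 * k + 1)"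
  have "sign ?t = 1" by (simp add: sign_compose permutation_swap_id sign_swap_id)
  then have "sign (s \<circ> ?t) = sign s"
    using permutes_imp_permutation[OF _ s] by (simp add: sign_compose permutation_swap_id permutation_compose)
  moreover have t: "?t (2 * j) = 2 * Transposition.transpose i k j" "?t (2 * j + 1) = 2 * Transposition.transpose i k j + 1" for j
  proof -
    have "2 * a \<noteq> 2 * b + 1" for a b :: nat by presburger
    then show "?t (2 * j) = 2 * Transposition.transpose i k j" "?t (2 * j + 1) = 2 * Transposition.transpose i k j + 1"
      by (auto simp: Transposition.transpose_def)
  qed
  moreover have "(\<Prod>j<m. J0 (s (2 * Transposition.transpose i k j)) (s (2 * Transposition.transpose i k j + 1))) = (\<Prod>j<m. J0 (s (2 * j)) (s (2 * j + 1)))"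
    using prod.permute[OF permutes_swap_id[of i "{..<m}" k], of "\<lambda>j. J0 (s (2 * j)) (s (2 * j + 1))"] i
    by (simp add: o_def)
  ultimately show ?thesis unfolding pf_term_def o_apply[of s] by simp
qed

text \<open>In a nonzero term the two largest indices form one of the pairs. A flip and a swap put
  this pair, in order, into the last place without changing the term. There it contributes the
  factor 1 and can be removed.\<close>

lemma pf_term_nonneg: "s permutes {..<2 * m} \<Longrightarrow> 0 \<le> pf_term m s"
proof (induction m arbitrary: s)
  case 0
  then show ?case by (simp add: pf_term_def)
next
  case (Suc m)
  note s = Suc.prems
  show ?case
  proof (cases "pf_term (Suc m) s = 0")
    case False
    have nz: "J0 (s (2 * i)) (s (2 * i + 1)) \<noteq> 0" if "i < Suc m" for i
    proof
      assume z: "J0 (s (2 * i)) (s (2 * i + 1)) = 0"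
      have "(\<Prod>i<Suc m. J0 (s (2 * i)) (s (2 * i + 1))) = 0"
        by (rule prod_zero) (use that z in \<open>auto intro!: bexI[of _ i]\<close>)
      then show False using False by (simp only: pf_term_def mult_zero_right)
    qed
    obtain c where "2 * m = s c" by (rule surjE[OF permutes_surj[OF s]])
    then have c: "s c = 2 * m" by simp
    have cl: "c < 2 * Suc m" using permutes_in_image[OF s, of c] c by simp
    define i where "i = c div 2"
    have i: "i < Suc m" "c = 2 * i \<or> c = 2 * i + 1" using cl by (auto simp: i_def)
    have "\<exists>s1. s1 permutes {..<2 * Suc m} \<and> pf_term (Suc m) s1 = pf_term (Suc m) s \<and>
        s1 (2 * i) = 2 * m \<and> s1 (2 * i + 1) = 2 * m + 1"
    proof (cases "c = 2 * i")
      case True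
      then have "s (2 * i + 1) = 2 * m + 1" using nz[OF i(1)] c by (auto simp: J0_def split: if_splits)
      then show ?thesis using s c True by blast
    next
      case False
      then have c2: "c = 2 * i + 1" using i by simp
      then have "s (2 * i) = 2 * m + 1"
      proof -
        have "\<not> (even (s (2 * i)) \<and> 2 * m = Suc (s (2 * i)))" by presburger
        moreover have "J0 (s (2 * i)) (2 * m) \<noteq> 0" using nz[OF i(1)] c c2 by simp
        ultimately show ?thesis by (auto simp: J0_def split: if_splits)
      qed
      moreover have "s \<circ> Transposition.transpose (2 * i) (2 * i + 1) permutes {..<2 * Suc m}"
        by (rule permutes_compose[OF permutes_swap_id s]) (use i in auto)
      ultimately show ?thesis
        using pf_term_flip[OF s i(1)] c c2 by (intro exI[of _ "s \<circ> Transposition.transpose (2 * i) (2 * i + 1)"]) simp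
    qed
    then obtain s1 where s1: "s1 permutes {..<2 * Suc m}" "pf_term (Suc m) s1 = pf_term (Suc m) s"
      "s1 (2 * i) = 2 * m" "s1 (2 * i + 1) = 2 * m + 1" by blast
    let ?t = "Transposition.transpose (2 * i) (2 * m) \<circ> Transposition.transpose (2 * i + 1) (2 * m + 1)"
    define s2 where "s2 = s1 \<circ> ?t"
    have "?t permutes {..<2 * Suc m}"
      by (intro permutes_compose permutes_swap_id) (use i in auto)
    then have s2: "s2 permutes {..<2 * Suc m}" unfolding s2_def by (rule permutes_compose[OF _ s1(1)])
    have t2: "pf_term (Suc m) s2 = pf_term (Suc m) s"
      unfolding s2_def using pf_term_swap[OF s1(1) i(1), of m] s1(2) by simp
    have "2 * m \<noteq> 2 * i + 1" "2 * m + 1 \<noteq> 2 * i" by presburger+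
    then have v: "s2 (2 * m) = 2 * m" "s2 (2 * m + 1) = 2 * m + 1"
      using s1(3,4) by (auto simp: s2_def Transposition.transpose_def)
    have "s2 permutes {..<2 * m}"
    proof (rule permutes_superset[OF s2])
      fix x assume "x \<in> {..<2 * Suc m} - {..<2 * m}"
      then have "x = 2 * m \<or> x = 2 * m + 1" by auto
      then show "s2 x = x" using v by auto
    qed
    from Suc.IH[OF this] have "0 \<le> pf_term m s2" .
    moreover have "pf_term (Suc m) s2 = pf_term m s2"
      using v by (simp add: pf_term_def J0_def)
    ultimately show ?thesis using t2 by simp
  qed simp
qed

lemma pf_J0: "pf m J0 > 0"
proof -
  have "(\<Sum>s | s permutes {..<2 * m}. pf_term m s) > 0"
  proof (rule sum_pos2[of _ id])
    show "0 < pf_term m id" by (simp add: pf_term_def J0_def)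
  qed (auto simp: finite_permutations permutes_id pf_term_nonneg)
  then show ?thesis by (simp add: pf_def pf_term_def)
qed

lemma sum_J0:
  assumes "b < 2 * k"
  shows "(\<Sum>a<2 * k. \<gamma> a * J0 a b) = (if even b then - \<gamma> (Suc b) else \<gamma> (b - 1))"
proof -
  define c where "c = (if even b then Suc b else b - 1)"
  have c: "c < 2 * k" using assms unfolding c_def by presburger
  have "(\<Sum>a<2 * k. \<gamma> a * J0 a b) = (\<Sum>a<2 * k. if a = c then \<gamma> c * J0 c b else 0)"
  proof (intro sum.cong refl)
    fix a
    have "J0 a b = 0" if "a \<noteq> c"
      using that unfolding J0_def c_def by (auto split: if_splits)
    then show "\<gamma> a * J0 a b = (if a = c then \<gamma> c * J0 c b else 0)" by simp
  qed
  also have "\<dots> = \<gamma> c * J0 c b" using c by simp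
  also have "\<dots> = (if even b then - \<gamma> (Suc b) else \<gamma> (b - 1))"
    unfolding c_def J0_def by (cases b) auto
  finally show ?thesis .
qed

text \<open>Symplectic Gram-Schmidt. Given \<open>2 * l\<close> vectors of a symplectic family, a
  count of equations gives a nonzero \<open>w\<close> orthogonal to all of them, nondegeneracy gives
  a vector dual to \<open>w\<close>, and subtracting a combination of the earlier vectors makes this
  partner orthogonal to them as well.\<close>

lemma ex_symplectic_family:
  assumes skew: "\<And>j k. j < 2 * m \<Longrightarrow> k < 2 * m \<Longrightarrow> N j k = - N k j"
    and nondeg: "\<And>c. (\<And>k. k < 2 * m \<Longrightarrow> (\<Sum>j<2 * m. c j * N j k) = 0) \<Longrightarrow> \<forall>j<2 * m. c j = 0"
    and "l \<le> m"
  shows "\<exists>M. \<forall>a<2 * l. \<forall>b<2 * l. (\<Sum>j<2 * m. \<Sum>k<2 * m. N j k * M a j * M b k) = J0 a b"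
  using \<open>l \<le> m\<close>
proof (induction l)
  case (Suc l)
  let ?n = "2 * m"
  define B where "B v w = (\<Sum>j<?n. \<Sum>k<?n. N j k * v j * w k)" for v w :: "nat \<Rightarrow> real"
  have Bskew: "B v w = - B w v" for v w
  proof -
    have "B v w = (\<Sum>k<?n. \<Sum>j<?n. N j k * v j * w k)" unfolding B_def by (rule sum.swap)
    also have "\<dots> = (\<Sum>k<?n. \<Sum>j<?n. - (N k j * w k * v j))"
    proof (intro sum.cong refl)
      fix k j assume "k \<in> {..<?n}" "j \<in> {..<?n}"
      then have "N j k = - N k j" by (intro skew) auto
      then show "N j k * v j * w k = - (N k j * w k * v j)" by simp
    qed
    finally show ?thesis by (simp add: B_def sum_negf)
  qed
  have Bdiff: "B (\<lambda>j. v j - w j) u = B v u - B w u" for v w u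
    by (simp add: B_def sum_subtractf left_diff_distrib right_diff_distrib)
  have Bsum: "B (\<lambda>j. \<Sum>a\<in>I. \<gamma> a * v a j) u = (\<Sum>a\<in>I. \<gamma> a * B (v a) u)" for I \<gamma> v u
  proof -
    have "B (\<lambda>j. \<Sum>a\<in>I. \<gamma> a * v a j) u = (\<Sum>j<?n. \<Sum>k<?n. \<Sum>a\<in>I. \<gamma> a * (N j k * v a j * u k))"
      by (simp add: B_def sum_distrib_left sum_distrib_right mult_ac)
    also have "\<dots> = (\<Sum>j<?n. \<Sum>a\<in>I. \<Sum>k<?n. \<gamma> a * (N j k * v a j * u k))"
      by (intro sum.cong refl sum.swap)
    also have "\<dots> = (\<Sum>a\<in>I. \<Sum>j<?n. \<Sum>k<?n. \<gamma> a * (N j k * v a j * u k))" by (rule sum.swap)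
    finally show ?thesis by (simp add: B_def sum_distrib_left)
  qed
  obtain M where "\<forall>a<2 * l. \<forall>b<2 * l. (\<Sum>j<?n. \<Sum>k<?n. N j k * M a j * M b k) = J0 a b"
    using Suc by auto
  then have M: "B (M a) (M b) = J0 a b" if "a < 2 * l" "b < 2 * l" for a b using that by (simp add: B_def)
  obtain w j0 where w: "j0 < ?n" "w j0 \<noteq> 0" "\<And>a. a < 2 * l \<Longrightarrow> (\<Sum>j<?n. (\<Sum>k<?n. N j k * M a k) * w j) = 0"
  proof -
    have "2 * l < ?n" using Suc.prems by simp
    from ex_underdetermined_solution[OF this, of "\<lambda>a j. \<Sum>k<?n. N j k * M a k"] that show thesis by blast
  qed
  have wM: "B w (M a) = 0" if "a < 2 * l" for a
    using w(3)[OF that] by (simp add: B_def sum_distrib_left sum_distrib_right mult_ac)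
  obtain k0 where k0: "k0 < ?n" "(\<Sum>j<?n. w j * N j k0) \<noteq> 0" using nondeg[of w] w(1,2) by blast
  \<comment> \<open>A multiple of one standard basis vector that does not pair to 0 with
    \<open>w\<close>, scaled so that the pairing becomes 1.\<close>
  define w' where "w' k = (if k = k0 then 1 / (\<Sum>j<?n. w j * N j k0) else 0)" for k
  have "B w w' = (\<Sum>j<?n. w j * N j k0 * (1 / (\<Sum>j<?n. w j * N j k0)))"
    unfolding B_def
  proof (intro sum.cong refl)
    fix j
    have "(\<Sum>k<?n. N j k * w j * w' k) = (\<Sum>k<?n. if k = k0 then N j k0 * w j * w' k0 else 0)"
      by (intro sum.cong) (auto simp: w'_def)
    then show "(\<Sum>k<?n. N j k * w j * w' k) = w j * N j k0 * (1 / (\<Sum>j<?n. w j * N j k0))"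
      using k0(1) by (simp add: w'_def)
  qed
  also have "\<dots> = 1" using k0(2) by (simp add: sum_distrib_right[symmetric] sum_divide_distrib[symmetric])
  finally have ww': "B w w' = 1" .
  \<comment> \<open>By \<open>sum_J0\<close> these coefficients reproduce the pairings of
    \<open>w'\<close> with the earlier vectors. The correction does not affect the pairing with
    \<open>w\<close>, which is orthogonal to them.\<close>
  define \<gamma> where "\<gamma> b = (if even b then B w' (M (Suc b)) else - B w' (M (b - 1)))" for b
  define u where "u j = w' j - (\<Sum>b<2 * l. \<gamma> b * M b j)" for j
  have uM: "B u (M a) = 0" if a: "a < 2 * l" for a
  proof -
    have "B u (M a) = B w' (M a) - (\<Sum>b<2 * l. \<gamma> b * B (M b) (M a))"
      unfolding u_def[abs_def] by (simp add: Bdiff Bsum)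
    also have "(\<Sum>b<2 * l. \<gamma> b * B (M b) (M a)) = (\<Sum>b<2 * l. \<gamma> b * J0 b a)"
      using M a by simp
    also have "\<dots> = B w' (M a)" unfolding sum_J0[OF a] by (cases a) (auto simp: \<gamma>_def)
    finally show ?thesis by simp
  qed
  have wu: "B w u = 1"
  proof -
    have "B u w = B w' w - (\<Sum>b<2 * l. \<gamma> b * B (M b) w)"
      unfolding u_def[abs_def] by (simp add: Bdiff Bsum)
    moreover have "B (M b) w = 0" if "b < 2 * l" for b using wM[OF that] Bskew[of "M b" w] by simp
    ultimately have "B u w = B w' w" by simp
    then show ?thesis using ww' Bskew[of w u] Bskew[of w w'] by simp
  qed
  have self: "B v v = 0" for v using Bskew[of v v] by simp
  define M' where "M' a = (if a < 2 * l then M a else if a = 2 * l then w else u)" for a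
  have "B (M' a) (M' b) = J0 a b" if "a < 2 * Suc l" "b < 2 * Suc l" for a b
  proof -
    have "a < 2 * l \<or> a = 2 * l \<or> a = 2 * l + 1" "b < 2 * l \<or> b = 2 * l \<or> b = 2 * l + 1" using that by auto
    moreover have "J0 a b = 0" if "a < 2 * l" "b = 2 * l \<or> b = 2 * l + 1" for a b
    proof -
      have "\<not> (even a \<and> b = Suc a)" using that by presburger
      then show ?thesis using that by (auto simp: J0_def)
    qed
    moreover from this have "J0 b a = 0" if "a < 2 * l" "b = 2 * l \<or> b = 2 * l + 1" for a b
      using that J0_skew[of b a] by simp
    moreover have "J0 (2 * l) (2 * l) = 0" "J0 (2 * l) (2 * l + 1) = 1" "J0 (2 * l + 1) (2 * l) = - 1"
      "J0 (2 * l + 1) (2 * l + 1) = 0" by (auto simp: J0_def)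
    moreover have "B (M a) w = 0" "B (M a) u = 0" if "a < 2 * l" for a
      using wM[OF that] uM[OF that] Bskew[of "M a" w] Bskew[of "M a" u] by auto
    moreover have "B u w = - 1" using wu Bskew[of u w] by simp
    ultimately show ?thesis using M wM uM wu self unfolding M'_def by (elim disjE) simp_all
  qed
  then show ?case unfolding B_def by blast
qed simp

lemma pf_nonzero:
  assumes skew: "\<And>j k. j < 2 * m \<Longrightarrow> k < 2 * m \<Longrightarrow> N j k = - N k j"
    and nondeg: "\<And>c. (\<And>k. k < 2 * m \<Longrightarrow> (\<Sum>j<2 * m. c j * N j k) = 0) \<Longrightarrow> \<forall>j<2 * m. c j = 0"
  shows "pf m N \<noteq> 0"
proof -
  have "\<exists>M. \<forall>a<2 * m. \<forall>b<2 * m. (\<Sum>j<2 * m. \<Sum>k<2 * m. N j k * M a j * M b k) = J0 a b"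
    by (rule ex_symplectic_family[of m N m]) (rule skew, assumption+, rule nondeg, assumption+, simp)
  then obtain M where "\<forall>a<2 * m. \<forall>b<2 * m. (\<Sum>j<2 * m. \<Sum>k<2 * m. N j k * M a j * M b k) = J0 a b" ..
  then have M: "(\<Sum>j<2 * m. \<Sum>k<2 * m. N j k * M a j * M b k) = J0 a b" if "a < 2 * m" "b < 2 * m" for a b
    using that by blast
  have "pf m (\<lambda>a b. \<Sum>j<2 * m. \<Sum>k<2 * m. N j k * M a j * M b k) = pf m J0"
    unfolding pf_def
  proof (intro arg_cong2[of _ _ _ _ "(/)"] sum.cong refl arg_cong2[of _ _ _ _ "(*)"] prod.cong)
    fix s i assume "s \<in> {s. s permutes {..<2 * m}}" and i: "i \<in> {..<m}"
    then have s: "s permutes {..<2 * m}" by simp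
    have "s (2 * i) < 2 * m" "s (2 * i + 1) < 2 * m"
      using permutes_in_image[OF s, of "2 * i"] permutes_in_image[OF s, of "2 * i + 1"] i by auto
    then show "(\<Sum>j<2 * m. \<Sum>k<2 * m. N j k * M (s (2 * i)) j * M (s (2 * i + 1)) k) = J0 (s (2 * i)) (s (2 * i + 1))"
      by (rule M)
  qed
  then show ?thesis using pf_transform[of m N M] pf_J0[of m] by auto
qed

lemma wedge_power_eq_pf:
  assumes "length vs = 2 * m"
    "\<And>a b. a < 2 * m \<Longrightarrow> b < 2 * m \<Longrightarrow> \<beta> (vs ! a) (vs ! b) = (\<Sum>j<2 * m. \<Sum>k<2 * m. N j k * M a j * M b k)"
  shows "wedge_power m \<beta> vs = det_nat (2 * m) M * pf m N"
proof -
  have "wedge_power m \<beta> vs = pf m (\<lambda>a b. \<Sum>j<2 * m. \<Sum>k<2 * m. N j k * M a j * M b k)"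
    unfolding pf_def wedge_power_def
  proof (intro arg_cong2[of _ _ _ _ "(/)"] sum.cong refl arg_cong2[of _ _ _ _ "(*)"] prod.cong)
    fix s i assume "s \<in> {s. s permutes {..<2 * m}}" and i: "i \<in> {..<m}"
    then have s: "s permutes {..<2 * m}" by simp
    have "s (2 * i) < 2 * m" "s (2 * i + 1) < 2 * m"
      using permutes_in_image[OF s, of "2 * i"] permutes_in_image[OF s, of "2 * i + 1"] i by auto
    then show "\<beta> (vs ! s (2 * i)) (vs ! s (2 * i + 1)) = (\<Sum>j<2 * m. \<Sum>k<2 * m. N j k * M (s (2 * i)) j * M (s (2 * i + 1)) k)"
      by (rule assms(2))
  qed
  then show ?thesis using pf_transform by simp
qed

section \<open>Fibres of the b-tangent bundle and tensorial forms\<close>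

context mfd
begin

lemma smooth_fun_det_nat:
  assumes "open W" "\<And>i j. i < n \<Longrightarrow> j < n \<Longrightarrow> smooth_fun A W (M i j)"
  shows "smooth_fun A W (\<lambda>p. det_nat n (\<lambda>i j. M i j p))"
  unfolding det_nat_def
proof (intro smooth_fun_sum smooth_fun_cmult smooth_fun_prod assms(1))
  fix s i assume "s \<in> {s. s permutes {..<n}}" and i: "i \<in> {..<n}"
  then have s: "s permutes {..<n}" by simp
  show "smooth_fun A W (M i (s i))"
    using assms(2)[of i "s i"] permutes_in_image[OF s, of i] i by simp
qed

text \<open>Cramer's rule presents the solution as a quotient of determinants in the smooth data, so
  a solution given merely pointwise is smooth.\<close>

lemma smooth_solve:
  fixes n :: nat
  assumes W: "open W" and M: "\<And>i j. i < n \<Longrightarrow> j < n \<Longrightarrow> smooth_fun A W (M i j)"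
    and b: "\<And>i. i < n \<Longrightarrow> smooth_fun A W (b i)"
    and eq: "\<And>p i. p \<in> W \<Longrightarrow> i < n \<Longrightarrow> (\<Sum>j<n. M i j p * a j p) = b i p"
    and inj: "\<And>p c. p \<in> W \<Longrightarrow> (\<And>i. i < n \<Longrightarrow> (\<Sum>j<n. M i j p * c j) = 0) \<Longrightarrow> \<forall>j<n. c j = 0"
    and k: "k < n"
  shows "smooth_fun A W (a k)"
proof -
  define d where "d p = det_nat n (\<lambda>i j. M i j p)" for p
  define d' where "d' p = det_nat n (\<lambda>i j. if j = k then b i p else M i j p)" for p
  have nz: "d p \<noteq> 0" if "p \<in> W" for p
    unfolding d_def by (rule det_nat_nonzero) (rule inj[OF that])
  have eq': "d' p / d p = a k p" if "p \<in> W" for p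
  proof -
    have "d' p = a k p * d p"
      unfolding d_def d'_def by (rule det_nat_Cramer[OF eq[OF that] k])
    then show ?thesis using nz[OF that] by simp
  qed
  have "smooth_fun A W (\<lambda>p. d' p / d p)"
  proof (rule smooth_fun_divide[OF W nz])
    show "smooth_fun A W d'" unfolding d'_def[abs_def]
    proof (rule smooth_fun_det_nat[OF W])
      fix i j assume "i < n" "j < n"
      then show "smooth_fun A W (\<lambda>p. if j = k then b i p else M i j p)"
        using M[of i j] b[of i] by (cases "j = k") auto
    qed
    show "smooth_fun A W d" unfolding d_def[abs_def] by (rule smooth_fun_det_nat[OF W M])
  qed
  then show ?thesis by (rule smooth_fun_cong[OF W, rotated]) (rule eq')
qed

end

context bmfd
begin

abbreviation "bcl \<equiv> b_class A Z"

section \<open>Linear algebra in the fibres\<close>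

lemma ex_coordinates:
  obtains N Es where "p \<in> N" "local_frame N Es"
  using ex_local_frame by blast

lemma bf_zero: "(\<lambda>q g. 0) \<in> bf"
  using bf_lincomb[of "{}"] by simp

lemma bf_const_lincomb:
  "(\<And>i. i \<in> I \<Longrightarrow> V i \<in> bf) \<Longrightarrow> finite I \<Longrightarrow> (\<lambda>q g. \<Sum>i\<in>I. c i * V i q g) \<in> bf"
  using bf_lincomb[of I "\<lambda>i _. c i" V] smooth_fun_const by simp

lemma coef_const_lincomb:
  assumes "local_frame N Es" "finite I" "\<And>k. k \<in> I \<Longrightarrow> B k \<in> bf" "p \<in> N" "i < mdim A"
  shows "coef N Es (\<lambda>q g. \<Sum>k\<in>I. c k * B k q g) i p = (\<Sum>k\<in>I. c k * coef N Es (B k) i p)"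
  by (rule coef_lincomb[OF assms(1,2) _ assms(3-5), of "\<lambda>k _. c k"]) (auto intro: smooth_fun_const)

lemma b_class_self: "V \<in> bf \<Longrightarrow> V \<in> bcl p V"
  using ex_local_frame[of p] b_class_mem_iff by metis

lemma b_rep_class:
  assumes "V \<in> bf"
  shows "b_rep (bcl p V) \<in> bcl p V" "b_rep (bcl p V) \<in> bf" "bcl p (b_rep (bcl p V)) = bcl p V"
proof -
  show 1: "b_rep (bcl p V) \<in> bcl p V"
    unfolding b_rep_def by (rule someI[of _ V]) (rule b_class_self[OF assms])
  then show 2: "b_rep (bcl p V) \<in> bf" by (simp add: b_class_def)
  obtain N Es where N: "p \<in> N" "local_frame N Es" by (rule ex_coordinates)
  show "bcl p (b_rep (bcl p V)) = bcl p V"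
    using 1 b_class_mem_iff[OF N(2) assms 2 N(1)] b_class_eq_iff[OF N(2) 2 assms N(1)] by simp
qed

lemma b_class_value:
  assumes "W \<in> bcl p V"
  shows "W p = V p"
proof
  fix g
  obtain k :: nat and h B where "\<And>i. i < k \<Longrightarrow> h i p = 0" "V p g - W p g = (\<Sum>i<k. h i p * B i p g)"
    using assms unfolding b_class_def by blast
  then have "V p g - W p g = 0" by simp
  then show "W p g = V p g" by simp
qed

lemma anchor_class: "V \<in> bf \<Longrightarrow> anchor p (bcl p V) = V p"
  unfolding anchor_def using b_class_value b_rep_class(1) by blast

lemma b_fibreE:
  assumes "u \<in> b_fibre A Z p"
  obtains V where "V \<in> bf" "u = bcl p V"
  using assms unfolding b_fibre_def by blast

lemma b_fibreI: "V \<in> bf \<Longrightarrow> bcl p V \<in> b_fibre A Z p"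
  unfolding b_fibre_def by blast

text \<open>\<open>b_lincomb\<close> passes through chosen representatives; coefficients in a frame
  show that every other choice gives the same class.\<close>

lemma b_lincomb_class:
  assumes "\<And>i. i < length us \<Longrightarrow> Vs i \<in> bf" "\<And>i. i < length us \<Longrightarrow> us ! i = bcl p (Vs i)"
  shows "b_lincomb A Z p cs us = bcl p (\<lambda>q g. \<Sum>i<length us. cs ! i * Vs i q g)"
proof -
  obtain N Es where N: "p \<in> N" "local_frame N Es" by (rule ex_coordinates)
  have R: "b_rep (us ! i) \<in> bf" if "i < length us" for i
    using b_rep_class(2)[OF assms(1)[OF that]] assms(2)[OF that] by simp
  have "coef N Es (b_rep (us ! i)) j p = coef N Es (Vs i) j p" if "i < length us" "j < mdim A" for i j
  proof -
    have "bcl p (b_rep (us ! i)) = bcl p (Vs i)"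
      using b_rep_class(3)[OF assms(1)[OF that(1)]] assms(2)[OF that(1)] by simp
    then show ?thesis
      using b_class_eq_iff[OF N(2) R[OF that(1)] assms(1)[OF that(1)] N(1)] that(2) by simp
  qed
  then have "coef N Es (\<lambda>q g. \<Sum>i<length us. cs ! i * b_rep (us ! i) q g) j p =
      coef N Es (\<lambda>q g. \<Sum>i<length us. cs ! i * Vs i q g) j p" if "j < mdim A" for j
    using that coef_const_lincomb[OF N(2) _ _ N(1) that, of "{..<length us}" "\<lambda>i. b_rep (us ! i)"] R
      coef_const_lincomb[OF N(2) _ _ N(1) that, of "{..<length us}" Vs] assms(1) by simp
  then show ?thesis
    unfolding b_lincomb_def
    by (subst b_class_eq_iff[OF N(2) bf_const_lincomb bf_const_lincomb N(1)]) (use R assms(1) in auto)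
qed

lemma b_lincomb_class2:
  assumes "V \<in> bf" "W \<in> bf"
  shows "b_lincomb A Z p [a, b] [bcl p V, bcl p W] = bcl p (\<lambda>q g. a * V q g + b * W q g)"
proof -
  have "b_lincomb A Z p [a, b] [bcl p V, bcl p W] =
      bcl p (\<lambda>q g. \<Sum>i<length [bcl p V, bcl p W]. [a, b] ! i * ([V, W] ! i) q g)"
    by (rule b_lincomb_class) (use assms in \<open>auto simp: less_Suc_eq\<close>)
  then show ?thesis by simp
qed

lemma b_lincomb_class1:
  assumes "V \<in> bf"
  shows "b_lincomb A Z p [a] [bcl p V] = bcl p (\<lambda>q g. a * V q g)"
proof -
  have "b_lincomb A Z p [a] [bcl p V] = bcl p (\<lambda>q g. \<Sum>i<length [bcl p V]. [a] ! i * ([V] ! i) q g)"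
    by (rule b_lincomb_class) (use assms in auto)
  then show ?thesis by simp
qed

lemma b_zero_class: "b_zero A Z p = bcl p (\<lambda>q g. 0)"
  by (simp add: b_lincomb_def)

lemma b_class_zero_iff:
  assumes "local_frame N Es" "p \<in> N" "V \<in> bf"
  shows "bcl p V = b_zero A Z p \<longleftrightarrow> (\<forall>i<mdim A. coef N Es V i p = 0)"
proof -
  have "coef N Es (\<lambda>q g. 0) i p = 0" if "i < mdim A" for i
    using coef_const_lincomb[OF assms(1) _ _ assms(2) that, of "{}"] by simp
  then show ?thesis unfolding b_zero_class using b_class_eq_iff[OF assms(1,3) bf_zero assms(2)] by simp
qed

text \<open>In the fibre over \<open>p\<close> only the values at \<open>p\<close> of the
  coefficient functions matter. This turns fibrewise linearity into linearity over
  functions.\<close>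

lemma b_class_smooth_lincomb2:
  assumes "smooth_fun A UNIV h" "smooth_fun A UNIV k" "V \<in> bf" "W \<in> bf"
  shows "bcl p (\<lambda>q g. h q * V q g + k q * W q g) = b_lincomb A Z p [h p, k p] [bcl p V, bcl p W]"
proof -
  obtain N Es where N: "p \<in> N" "local_frame N Es" by (rule ex_coordinates)
  have c: "coef N Es (\<lambda>q g. h q * V q g + k q * W q g) i p = h p * coef N Es V i p + k p * coef N Es W i p"
    if "i < mdim A" "smooth_fun A UNIV h" "smooth_fun A UNIV k" for i h k
    using coef_lincomb[OF N(2), of "{0, 1 :: nat}" "\<lambda>i. if i = 0 then h else k" "\<lambda>i. if i = 0 then V else W" p i]
      that assms(3,4) N(1) by simp
  show ?thesis
    unfolding b_lincomb_class2[OF assms(3,4)]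
    by (subst b_class_eq_iff[OF N(2) bf_lincomb2[OF assms] bf_lincomb2[OF smooth_fun_const smooth_fun_const assms(3,4)] N(1)])
      (use c assms(1,2) c[OF _ smooth_fun_const smooth_fun_const] in auto)
qed

lemma frame_lincomb:
  assumes "local_frame N Es"
  shows "b_lincomb A Z p (map c [0..<mdim A]) (map (bcl p) (map Es [0..<mdim A])) =
    bcl p (\<lambda>q g. \<Sum>i<mdim A. c i * Es i q g)"
proof -
  have "b_lincomb A Z p (map c [0..<mdim A]) (map (bcl p) (map Es [0..<mdim A])) =
      bcl p (\<lambda>q g. \<Sum>i<length (map (bcl p) (map Es [0..<mdim A])). map c [0..<mdim A] ! i * Es i q g)"
    by (rule b_lincomb_class) (use local_frame_bf[OF assms] in auto)
  also have "\<dots> = bcl p (\<lambda>q g. \<Sum>i<mdim A. c i * Es i q g)"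
    by (intro arg_cong[of _ _ "bcl p"] ext sum.cong) auto
  finally show ?thesis .
qed

lemma coef_frame_lincomb:
  assumes "local_frame N Es" "p \<in> N" "i < mdim A"
  shows "coef N Es (\<lambda>q g. \<Sum>j<mdim A. c j * Es j q g) i p = c i"
proof -
  have "coef N Es (\<lambda>q g. \<Sum>j<mdim A. c j * Es j q g) i p = (\<Sum>j<mdim A. c j * coef N Es (Es j) i p)"
    using coef_const_lincomb[OF assms(1) _ _ assms(2,3), of "{..<mdim A}" Es] local_frame_bf[OF assms(1)] by simp
  also have "\<dots> = (\<Sum>j<mdim A. if j = i then c j else 0)"
    by (intro sum.cong) (use coef_frame[OF assms] in auto)
  finally show ?thesis using assms(3) by simp
qed

lemma class_frame_lincomb:
  assumes "local_frame N Es" "p \<in> N" "V \<in> bf" "\<And>i. i < mdim A \<Longrightarrow> c i = coef N Es V i p"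
  shows "bcl p (\<lambda>q g. \<Sum>i<mdim A. c i * Es i q g) = bcl p V"
  by (subst b_class_eq_iff[OF assms(1) bf_const_lincomb assms(3,2)])
    (use local_frame_bf[OF assms(1)] coef_frame_lincomb[OF assms(1,2)] assms(4) in auto)

lemma local_frame_b_frame:
  assumes lf: "local_frame N Es"
  shows "b_frame A Z N (map Es [0..<mdim A])"
  unfolding b_frame_def b_basis_def
proof (intro conjI ballI)
  show "open N" by (rule local_frame_open[OF lf])
  show "set (map Es [0..<mdim A]) \<subseteq> bf" using local_frame_bf[OF lf] by auto
  fix x assume x: "x \<in> N"
  show "set (map (bcl x) (map Es [0..<mdim A])) \<subseteq> b_fibre A Z x"
    using local_frame_bf[OF lf] b_fibreI by auto
  fix u assume "u \<in> b_fibre A Z x"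
  then obtain V where V: "V \<in> bf" "u = bcl x V" by (rule b_fibreE)
  show "\<exists>!cs. length cs = length (map (bcl x) (map Es [0..<mdim A])) \<and>
      u = b_lincomb A Z x cs (map (bcl x) (map Es [0..<mdim A]))"
  proof (rule ex1I)
    show "length (map (\<lambda>i. coef N Es V i x) [0..<mdim A]) = length (map (bcl x) (map Es [0..<mdim A])) \<and>
        u = b_lincomb A Z x (map (\<lambda>i. coef N Es V i x) [0..<mdim A]) (map (bcl x) (map Es [0..<mdim A]))"
      unfolding frame_lincomb[OF lf] using class_frame_lincomb[OF lf x V(1)] V(2) by simp
    fix cs assume cs: "length cs = length (map (bcl x) (map Es [0..<mdim A])) \<and>
        u = b_lincomb A Z x cs (map (bcl x) (map Es [0..<mdim A]))"
    then have l: "length cs = mdim A" by simp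
    then have m: "cs = map ((!) cs) [0..<mdim A]" by (metis map_nth)
    have e: "bcl x (\<lambda>q g. \<Sum>i<mdim A. cs ! i * Es i q g) = bcl x V"
      using cs m V(2) frame_lincomb[OF lf, of x "(!) cs"] by simp
    have "(\<lambda>q g. \<Sum>i<mdim A. cs ! i * Es i q g) \<in> bf"
      by (rule bf_const_lincomb) (use local_frame_bf[OF lf] in auto)
    from b_class_eq_iff[OF lf this V(1) x] e have "\<forall>i<mdim A. cs ! i = coef N Es V i x"
      using coef_frame_lincomb[OF lf x] by simp
    then show "cs = map (\<lambda>i. coef N Es V i x) [0..<mdim A]" using l by (intro nth_equalityI) auto
  qed
qed simp

text \<open>A b-two-form through its action on global sections. Linearity over functions is what
  makes its value at a point depend only on the classes there. In this shape forms can be built from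
  differentials of one-forms, and the Koszul formula applies directly.\<close>

definition b_form :: "('x vfield \<Rightarrow> 'x vfield \<Rightarrow> 'x \<Rightarrow> real) \<Rightarrow> bool" where
  "b_form G \<longleftrightarrow> (\<forall>V\<in>bf. \<forall>W\<in>bf. \<forall>p. G V W p = - G W V p) \<and>
     (\<forall>U\<in>bf. \<forall>V\<in>bf. \<forall>W\<in>bf. \<forall>h k. smooth_fun A UNIV h \<longrightarrow> smooth_fun A UNIV k \<longrightarrow>
        (\<forall>p. G U (\<lambda>q g. h q * V q g + k q * W q g) p = h p * G U V p + k p * G U W p)) \<and>
     (\<forall>V\<in>bf. \<forall>W\<in>bf. smooth_fun A UNIV (G V W))"

context
  fixes G
  assumes G: "b_form G"
begin

lemma b_form_skew: "V \<in> bf \<Longrightarrow> W \<in> bf \<Longrightarrow> G V W p = - G W V p"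
  by (rule G[unfolded b_form_def, THEN conjunct1, rule_format])

lemma b_form_linear:
  "U \<in> bf \<Longrightarrow> V \<in> bf \<Longrightarrow> W \<in> bf \<Longrightarrow> smooth_fun A UNIV h \<Longrightarrow> smooth_fun A UNIV k \<Longrightarrow>
    G U (\<lambda>q g. h q * V q g + k q * W q g) p = h p * G U V p + k p * G U W p"
  by (rule G[unfolded b_form_def, THEN conjunct2, THEN conjunct1, rule_format])

lemma b_form_smooth: "V \<in> bf \<Longrightarrow> W \<in> bf \<Longrightarrow> smooth_fun A UNIV (G V W)"
  by (rule G[unfolded b_form_def, THEN conjunct2, THEN conjunct2, rule_format])

lemma b_form_sum:
  assumes U: "U \<in> bf" and "finite I" "\<And>i. i \<in> I \<Longrightarrow> smooth_fun A UNIV (h i)" "\<And>i. i \<in> I \<Longrightarrow> B i \<in> bf"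
  shows "G U (\<lambda>q g. \<Sum>i\<in>I. h i q * B i q g) p = (\<Sum>i\<in>I. h i p * G U (B i) p)"
  using assms(2-4)
proof (induction I rule: finite_induct)
  case empty
  have "G U (\<lambda>q g. (\<lambda>_. 0) q * U q g + (\<lambda>_. 0) q * U q g) p = 0 * G U U p + 0 * G U U p"
    by (rule b_form_linear[OF U U U]) (auto intro: smooth_fun_const)
  then show ?case by simp
next
  case (insert i I)
  have "G U (\<lambda>q g. h i q * B i q g + (\<lambda>_. 1) q * (\<lambda>q g. \<Sum>i\<in>I. h i q * B i q g) q g) p =
      h i p * G U (B i) p + 1 * G U (\<lambda>q g. \<Sum>i\<in>I. h i q * B i q g) p"
    by (rule b_form_linear[OF U _ bf_lincomb]) (use insert smooth_fun_const in auto)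
  then show ?case using insert by simp
qed

text \<open>Frame coefficients are local, while linearity is available for global functions only. In
  \<open>frame_decomposition\<close> the coefficients are cut off by \<open>\<rho>\<close>, and the
  remainder carries the factor \<open>1 - \<rho>\<close>, which is 0 at \<open>p\<close>.\<close>

lemma b_form_frame:
  assumes lf: "local_frame N Es" and p: "p \<in> N" and U: "U \<in> bf" and V: "V \<in> bf"
  shows "G U V p = (\<Sum>i<mdim A. coef N Es V i p * G U (Es i) p)"
proof -
  obtain \<rho> where \<rho>: "smooth_fun A UNIV \<rho>" "\<rho> p = 1"
    "\<And>V i. V \<in> bf \<Longrightarrow> i < mdim A \<Longrightarrow> smooth_fun A UNIV (\<lambda>q. \<rho> q * coef N Es V i q)"
    "\<And>V q g. V \<in> bf \<Longrightarrow> V q g = (1 - \<rho> q) * V q g + (\<Sum>i<mdim A. (\<rho> q * coef N Es V i q) * Es i q g)"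
    by (rule frame_decomposition[OF lf p]) blast
  let ?S = "\<lambda>q g. \<Sum>i<mdim A. (\<rho> q * coef N Es V i q) * Es i q g"
  have S: "?S \<in> bf" by (rule bf_lincomb) (use \<rho>(3)[OF V] local_frame_bf[OF lf] in auto)
  have "V = (\<lambda>q g. (\<lambda>q. 1 - \<rho> q) q * V q g + (\<lambda>_. 1) q * ?S q g)"
    using \<rho>(4)[OF V] by (intro ext) simp
  then have "G U V p = G U (\<lambda>q g. (\<lambda>q. 1 - \<rho> q) q * V q g + (\<lambda>_. 1) q * ?S q g) p" by (rule arg_cong)
  also have "\<dots> = (1 - \<rho> p) * G U V p + 1 * G U ?S p"
    by (rule b_form_linear[OF U V S smooth_fun_diff[OF open_UNIV smooth_fun_const[OF open_UNIV] \<rho>(1)]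
          smooth_fun_const[OF open_UNIV]])
  also have "G U ?S p = (\<Sum>i<mdim A. (\<rho> p * coef N Es V i p) * G U (Es i) p)"
    by (rule b_form_sum[OF U]) (use \<rho>(3)[OF V] local_frame_bf[OF lf] in auto)
  finally show ?thesis by (simp add: \<rho>(2))
qed

lemma b_form_frame_left:
  assumes "local_frame N Es" "p \<in> N" "U \<in> bf" "V \<in> bf"
  shows "G V U p = (\<Sum>i<mdim A. coef N Es V i p * G (Es i) U p)"
  using b_form_frame[OF assms] b_form_skew[OF assms(4,3), of p] b_form_skew[OF local_frame_bf[OF assms(1)] assms(3)]
  by (simp add: sum_negf)

lemma b_form_class_cong:
  assumes "U \<in> bf" "V \<in> bf" "V' \<in> bf" "bcl p V = bcl p V'"
  shows "G U V p = G U V' p"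
proof -
  obtain N Es where N: "p \<in> N" "local_frame N Es" by (rule ex_coordinates)
  show ?thesis
    using b_form_frame[OF N(2,1) assms(1,2)] b_form_frame[OF N(2,1) assms(1,3)]
      b_class_eq_iff[OF N(2) assms(2,3) N(1)] assms(4) by simp
qed

end

lemma b_two_form_b_form:
  assumes "b_two_form A Z \<omega>"
  shows "b_form (\<lambda>V W p. \<omega> p (bcl p V) (bcl p W))"
  unfolding b_form_def
proof (intro conjI ballI allI impI)
  note c = assms[unfolded b_two_form_def]
  note c1 = c[THEN conjunct1, rule_format]
  show "\<omega> p (bcl p V) (bcl p W) = - \<omega> p (bcl p W) (bcl p V)" if "V \<in> bf" "W \<in> bf" for V W p
    by (rule c1[OF b_fibreI b_fibreI, THEN conjunct1]) (use that in auto)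
  show "smooth_fun A UNIV (\<lambda>p. \<omega> p (bcl p V) (bcl p W))" if "V \<in> bf" "W \<in> bf" for V W
    by (rule c[THEN conjunct2, rule_format]) (use that in auto)
  show "\<omega> p (bcl p U) (bcl p (\<lambda>q g. h q * V q g + k q * W q g)) =
      h p * \<omega> p (bcl p U) (bcl p V) + k p * \<omega> p (bcl p U) (bcl p W)"
    if "U \<in> bf" "V \<in> bf" "W \<in> bf" "smooth_fun A UNIV h" "smooth_fun A UNIV k" for U V W h k p
    unfolding b_class_smooth_lincomb2[OF that(4,5,2,3)]
    by (rule c1[OF b_fibreI b_fibreI, THEN conjunct2, rule_format, OF _ _ b_fibreI]) (use that in auto)
qed

end

section \<open>The b-differential\<close>

lemma ex1_unique: "\<exists>!x. P x \<Longrightarrow> P a \<Longrightarrow> P b \<Longrightarrow> a = b"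
  by blast

locale bmap = X: bmfd A ZX + Y: bmfd B ZY
  for A :: "('x::t2_space, 'e::real_inner) atlas" and ZX
    and B :: "('y::t2_space, 'h::real_inner) atlas" and ZY +
  fixes f :: "'x \<Rightarrow> 'y"
  assumes bmap: "b_map A ZX B ZY f"
begin

lemma f_smooth: "smooth_map A B f"
  using bmap by (simp add: b_map_def)

lemma f_Z: "f p \<in> ZY \<longleftrightarrow> p \<in> ZX"
  using bmap by (auto simp: b_map_def)

lemma f_open: "open W \<Longrightarrow> open (f -` W)"
  using f_smooth open_vimage unfolding smooth_map_def by blast

lemma pullback: "open W \<Longrightarrow> smooth_fun B W g \<Longrightarrow> smooth_fun A (f -` W) (\<lambda>p. g (f p))"
  by (rule smooth_map_pullback[OF X.mfd Y.mfd f_smooth])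

lemma pullback_near:
  assumes "smooth_near B (f p) g"
  shows "smooth_near A p (\<lambda>q. g (f q))"
proof -
  obtain W where "open W" "f p \<in> W" "smooth_fun B W g" using assms unfolding smooth_near_def by blast
  then show ?thesis using X.smooth_nearI[OF f_open _ pullback] by simp
qed

lemma differential_tangent:
  assumes v: "v \<in> tangent_space A p"
  shows "differential B f p v \<in> tangent_space B (f p)"
proof -
  have 1: "differential B f p v (\<lambda>q. a * g q + b * h q) = a * differential B f p v g + b * differential B f p v h"
    if gh: "smooth_near B (f p) g" "smooth_near B (f p) h" for g h a b
    using X.tangent_linear[OF v pullback_near[OF gh(1)] pullback_near[OF gh(2)], of a b]
      gh Y.smooth_near_add[OF Y.smooth_near_cmult[OF gh(1), of a] Y.smooth_near_cmult[OF gh(2), of b]]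
    by (simp add: differential_def)
  have 2: "differential B f p v (\<lambda>q. g q * h q) = differential B f p v g * h (f p) + g (f p) * differential B f p v h"
    if gh: "smooth_near B (f p) g" "smooth_near B (f p) h" for g h
    using X.tangent_mult[OF v pullback_near[OF gh(1)] pullback_near[OF gh(2)]] gh Y.smooth_near_mult[OF gh]
    by (simp add: differential_def)
  have 3: "differential B f p v g = differential B f p v h"
    if gh: "smooth_near B (f p) g" "smooth_near B (f p) h" "\<forall>\<^sub>F q in nhds (f p). g q = h q" for g h
  proof -
    obtain M where M: "open M" "f p \<in> M" "\<forall>q\<in>M. g q = h q" using gh(3) unfolding eventually_nhds by blast
    have "v (\<lambda>q. g (f q)) = v (\<lambda>q. h (f q))"
      by (rule X.tangent_germ[OF v pullback_near[OF gh(1)] f_open[OF M(1)]]) (use M in auto)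
    then show ?thesis using gh by (simp add: differential_def)
  qed
  have 4: "differential B f p v g = 0" if "\<not> smooth_near B (f p) g" for g
    using that by (simp add: differential_def)
  show ?thesis unfolding tangent_space_def mem_Collect_eq using 1 2 3 4 by blast
qed

text \<open>By transversality, the pullback of a defining function for \<open>ZY\<close> is a defining function for \<open>ZX\<close>.\<close>
lemma pullback_divide:
  assumes bc: "b_chart B ZY U C D r" and W: "open W" "W \<subseteq> f -` U" and g: "smooth_fun A W g"
    and zero: "\<And>p. p \<in> W \<Longrightarrow> p \<in> ZX \<Longrightarrow> g p = 0"
  shows "\<exists>h. smooth_fun A W h \<and> (\<forall>p\<in>W. g p = r (f p) * h p)"
proof (rule X.smooth_quotient_glue[OF W(1)])
  have rf: "smooth_fun A (f -` U) (\<lambda>p. r (f p))"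
    by (rule pullback[OF Y.b_chart_open[OF bc] Y.b_chart_r[OF bc]])
  show rW: "smooth_fun A W (\<lambda>p. r (f p))" by (rule smooth_fun_subset[OF rf W(2)])
  have r0: "r (f p) = 0 \<longleftrightarrow> p \<in> ZX" if "p \<in> W" for p
    using Y.b_chart_Z[OF bc, of "f p"] f_Z that W(2) by auto
  show "\<exists>q\<in>N. r (f q) \<noteq> 0" if N: "open N" "N \<subseteq> W" "N \<noteq> {}" for N
  proof -
    obtain q where "q \<in> N" "q \<notin> ZX" using X.Z_dense[OF N(1,3)] by blast
    then show ?thesis using r0[of q] N(2) by (intro bexI[of _ q]) auto
  qed
  fix p assume p: "p \<in> W"
  show "\<exists>N h. open N \<and> p \<in> N \<and> N \<subseteq> W \<and> smooth_fun A N h \<and> (\<forall>q\<in>N. g q = r (f q) * h q)"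
  proof (cases "p \<in> ZX")
    case False
    have N: "open (W - ZX)" using W(1) X.Z_closed by auto
    have "smooth_fun A (W - ZX) (\<lambda>q. g q / r (f q))"
      by (rule X.smooth_fun_divide[OF N _ smooth_fun_subset[OF g] smooth_fun_subset[OF rW]]) (use r0 in auto)
    then show ?thesis using N p False r0
      by (intro exI[of _ "W - ZX"] exI[of _ "\<lambda>q. g q / r (f q)"]) auto
  next
    case True
    obtain U' C' D' r' where U': "p \<in> U'" "b_chart A ZX U' C' D' r'" using X.ex_b_chart[of p] by blast
    note bc' = U'(2)
    let ?M = "W \<inter> U'"
    have M: "open ?M" "?M \<subseteq> U'" "p \<in> ?M" using W(1) X.b_chart_open[OF bc'] p U'(1) by auto
    obtain m where m: "smooth_fun A ?M m" "\<forall>q\<in>?M. r (f q) = r' q * m q"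
      using X.b_chart_divide[OF bc' M(1,2) smooth_fun_subset[OF rW]] r0 by blast
    obtain h0 where h0: "smooth_fun A ?M h0" "\<forall>q\<in>?M. g q = r' q * h0 q"
      using X.b_chart_divide[OF bc' M(1,2) smooth_fun_subset[OF g]] zero by blast
    have fp: "f p \<in> U" "f p \<in> ZY" using p W(2) True f_Z by auto
    have r: "0 < mdim B" "r = C 0" using Y.b_chart_cases[OF bc] fp by auto
    \<comment> \<open>Transversality splits the normal coordinate field at \<open>f p\<close> into
      the image of some \<open>v\<close> and a part tangent to \<open>ZY\<close>, which kills
      \<open>r\<close>. So \<open>v\<close> has derivative 1 on the pullback of \<open>r\<close>.
      This pullback is \<open>r' * m\<close> with \<open>r' p = 0\<close>, which forces
      \<open>m p\<close> to be nonzero, and the factor \<open>m\<close> can be divided away near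
      \<open>p\<close>.\<close>
    have "D 0 (f p) \<in> tangent_space B (f p)" by (rule Y.b_chart_D[OF bc r(1) fp(1)])
    then obtain v w where vw: "D 0 (f p) = (\<lambda>g. differential B f p v g + w g)"
      "v \<in> tangent_space A p" "w \<in> tangent_space_sub B ZY (f p)"
      using bmap fp(2) unfolding b_map_def transverse_to_def by blast
    have nr: "smooth_near B (f p) r"
      by (rule Y.smooth_nearI[OF Y.b_chart_open[OF bc] fp(1) Y.b_chart_r[OF bc]])
    have "\<forall>\<^sub>F q in nhds (f p). q \<in> ZY \<longrightarrow> r q = 0"
      unfolding eventually_nhds using Y.b_chart_open[OF bc] fp(1) Y.b_chart_Z[OF bc] by blast
    then have "w r = 0" using vw(3) nr unfolding tangent_space_sub_def by blast
    moreover have "D 0 (f p) r = 1" using Y.b_chart_DX[OF bc r(1) r(1) fp(1)] r(2) by simp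
    ultimately have "v (\<lambda>q. r (f q)) = 1" using vw(1) nr by (simp add: differential_def)
    moreover have "v (\<lambda>q. r (f q)) = v r' * m p"
    proof -
      have nr': "smooth_near A p r'" by (rule X.smooth_nearI[OF X.b_chart_open[OF bc'] U'(1) X.b_chart_r[OF bc']])
      have nm: "smooth_near A p m" by (rule X.smooth_nearI[OF M(1,3) m(1)])
      have "v (\<lambda>q. r (f q)) = v (\<lambda>q. r' q * m q)"
        by (rule X.tangent_germ[OF vw(2) pullback_near[OF nr] M(1,3)]) (use m(2) in blast)
      also have "\<dots> = v r' * m p + r' p * v m" by (rule X.tangent_mult[OF vw(2) nr' nm])
      finally show ?thesis using X.b_chart_Z[OF bc' U'(1)] True by simp
    qed
    ultimately have mp: "m p \<noteq> 0" by auto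
    let ?N = "?M \<inter> m -` (- {0})"
    have N: "open ?N" by (rule continuous_open_preimage[OF X.smooth_fun_continuous[OF M(1) m(1)] M(1)]) auto
    have "smooth_fun A ?N (\<lambda>q. h0 q / m q)"
      by (rule X.smooth_fun_divide[OF N _ smooth_fun_subset[OF h0(1)] smooth_fun_subset[OF m(1)]]) auto
    moreover have "\<forall>q\<in>?N. g q = r (f q) * (h0 q / m q)" using h0(2) m(2) by simp
    moreover have "p \<in> ?N" using M(3) mp by simp
    ultimately show ?thesis using N by (intro exI[of _ ?N] exI[of _ "\<lambda>q. h0 q / m q"]) auto
  qed
qed

text \<open>The components of the b-differential of \<open>V\<close> in a frame along
  \<open>f\<close>. The test functions must be smooth near the image point: a composition
  \<open>g \<circ> f\<close> can be smooth, and seen by \<open>V\<close>, although the frame fields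
  send \<open>g\<close> to 0.\<close>

definition pcoef :: "'y set \<Rightarrow> (nat \<Rightarrow> 'y vfield) \<Rightarrow> 'x vfield \<Rightarrow> nat \<Rightarrow> 'x \<Rightarrow> real" where
  "pcoef N Es V = (SOME b. (\<forall>j<mdim B. smooth_fun A (f -` N) (b j)) \<and>
     (\<forall>p\<in>f -` N. \<forall>g. smooth_near B (f p) g \<longrightarrow> V p (\<lambda>q. g (f q)) = (\<Sum>j<mdim B. b j p * Es j (f p) g)))"

context
  fixes U C D r N Es
  assumes af: "Y.adapted_frame U C D r N Es"
begin

lemma af_chart: "b_chart B ZY U C D r" and af_open: "open N" and af_subset: "N \<subseteq> U"
  using af[unfolded Y.adapted_frame_def] by blast+

lemma af_frame: "Y.local_frame N Es"
  by (rule Y.adapted_frame_local_frame[OF af])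

lemma af_apply: "i < mdim B \<Longrightarrow> p \<in> N \<Longrightarrow> Es i p g = (if i = 0 then r p else 1) * D i p g"
  by (rule af[unfolded Y.adapted_frame_def, THEN conjunct2, THEN conjunct2, THEN conjunct2, THEN conjunct2, rule_format])

text \<open>The first coordinate composed with \<open>f\<close> vanishes on \<open>ZX\<close>, hence
  so does its derivative by a b-field. By \<open>pullback_divide\<close> this derivative is
  \<open>r (f p)\<close> times a smooth function, which is the component along the first frame
  field; the other components are plain derivatives.\<close>

lemma pcoef_ex:
  assumes V: "V \<in> X.bf"
  shows "\<exists>b. (\<forall>j<mdim B. smooth_fun A (f -` N) (b j)) \<and>
     (\<forall>p\<in>f -` N. \<forall>g. smooth_near B (f p) g \<longrightarrow> V p (\<lambda>q. g (f q)) = (\<Sum>j<mdim B. b j p * Es j (f p) g))"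
proof -
  note oW = f_open[OF af_open]
  have sV: "smooth_fun A (f -` N) (\<lambda>p. V p (\<lambda>q. C j (f q)))" if "j < mdim B" for j
    by (rule X.bf_smooth[OF V oW pullback[OF af_open smooth_fun_subset[OF Y.b_chart_X[OF af_chart that] af_subset]]])
  have "\<exists>h. 0 < mdim B \<longrightarrow> smooth_fun A (f -` N) h \<and> (\<forall>p\<in>f -` N. V p (\<lambda>q. C 0 (f q)) = r (f p) * h p)"
  proof (cases "0 < mdim B")
    case True
    have "\<exists>h. smooth_fun A (f -` N) h \<and> (\<forall>p\<in>f -` N. V p (\<lambda>q. C 0 (f q)) = r (f p) * h p)"
    proof (rule pullback_divide[OF af_chart oW _ sV[OF True]])
      show "f -` N \<subseteq> f -` U" using af_subset by auto
      show "V p (\<lambda>q. C 0 (f q)) = 0" if p: "p \<in> f -` N" "p \<in> ZX" for p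
      proof -
        have fp: "f p \<in> U" "f p \<in> ZY" using p af_subset f_Z by auto
        have r: "r = C 0" using Y.b_chart_cases[OF af_chart] fp by auto
        show ?thesis
        proof (rule X.bf_vanish[OF V p(2) pullback_near[OF Y.b_chart_X_near[OF af_chart True fp(1)]] oW p(1)])
          show "C 0 (f q) = 0" if "q \<in> f -` N" "q \<in> ZX" for q
            using that Y.b_chart_Z[OF af_chart, of "f q"] af_subset f_Z r by auto
        qed
      qed
    qed
    then show ?thesis by blast
  qed auto
  then obtain h where h': "0 < mdim B \<longrightarrow> smooth_fun A (f -` N) h \<and> (\<forall>p\<in>f -` N. V p (\<lambda>q. C 0 (f q)) = r (f p) * h p)" ..
  then have h: "0 < mdim B \<Longrightarrow> smooth_fun A (f -` N) h"
    "\<And>p. 0 < mdim B \<Longrightarrow> p \<in> f -` N \<Longrightarrow> V p (\<lambda>q. C 0 (f q)) = r (f p) * h p" by blast+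
  define b where "b j p = (if j = 0 then h p else V p (\<lambda>q. C j (f q)))" for j p
  have "smooth_fun A (f -` N) (b j)" if "j < mdim B" for j
    using h(1) sV[OF that] that unfolding b_def by (cases "j = 0") auto
  moreover have "V p (\<lambda>q. g (f q)) = (\<Sum>j<mdim B. b j p * Es j (f p) g)"
    if p: "p \<in> f -` N" and g: "smooth_near B (f p) g" for p g
  proof -
    have fp: "f p \<in> U" "f p \<in> N" using p af_subset by auto
    have "V p (\<lambda>q. g (f q)) = differential B f p (V p) g" using g by (simp add: differential_def)
    also have "\<dots> = (\<Sum>j<mdim B. differential B f p (V p) (C j) * D j (f p) g)"
      by (rule Y.b_chart_expand[OF af_chart fp(1) differential_tangent[OF X.bf_tangent[OF V]]])
    also have "\<dots> = (\<Sum>j<mdim B. b j p * Es j (f p) g)"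
    proof (rule sum.cong[OF refl])
      fix j assume j: "j \<in> {..<mdim B}"
      have "differential B f p (V p) (C j) = V p (\<lambda>q. C j (f q))"
        using Y.b_chart_X_near[OF af_chart _ fp(1)] j by (simp add: differential_def)
      then show "differential B f p (V p) (C j) * D j (f p) g = b j p * Es j (f p) g"
        using af_apply[OF _ fp(2), of j g] j h(2)[OF _ p] by (auto simp: b_def)
    qed
    finally show ?thesis .
  qed
  ultimately show ?thesis by blast
qed

lemma pcoef_smooth: "V \<in> X.bf \<Longrightarrow> j < mdim B \<Longrightarrow> smooth_fun A (f -` N) (pcoef N Es V j)"
  by (rule someI_ex[OF pcoef_ex, folded pcoef_def, THEN conjunct1, rule_format])

lemma pcoef_expand: "V \<in> X.bf \<Longrightarrow> f p \<in> N \<Longrightarrow> smooth_near B (f p) g \<Longrightarrow>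
    V p (\<lambda>q. g (f q)) = (\<Sum>j<mdim B. pcoef N Es V j p * Es j (f p) g)"
  by (rule someI_ex[OF pcoef_ex, folded pcoef_def, THEN conjunct2, rule_format]) auto

lemma pcoef_unique:
  assumes M: "open M" "M \<subseteq> f -` N" and a: "\<And>j. j < mdim B \<Longrightarrow> continuous_on M (a j)"
    and b: "\<And>j. j < mdim B \<Longrightarrow> continuous_on M (b j)"
    and eq: "\<And>p g. p \<in> M \<Longrightarrow> smooth_near B (f p) g \<Longrightarrow>
      (\<Sum>j<mdim B. a j p * Es j (f p) g) = (\<Sum>j<mdim B. b j p * Es j (f p) g)"
    and p: "p \<in> M" and j: "j < mdim B"
  shows "a j p = b j p"
proof -
  have z: "a j q * (if j = 0 then r (f q) else 1) = b j q * (if j = 0 then r (f q) else 1)" if "q \<in> M" for q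
  proof -
    have fq: "f q \<in> N" "f q \<in> U" using that M(2) af_subset by auto
    show ?thesis
      using eq[OF that Y.b_chart_X_near[OF af_chart j fq(2)]]
        Y.adapted_frame_X[OF af fq(1) j, of "\<lambda>i. a i q"] Y.adapted_frame_X[OF af fq(1) j, of "\<lambda>i. b i q"] by simp
  qed
  show ?thesis
  proof (cases "j = 0")
    case True
    have "a j p - b j p = 0"
    proof (rule X.continuous_zero_off_Z[OF M(1) _ _ p, of "\<lambda>p. a j p - b j p"])
      show "continuous_on M (\<lambda>p. a j p - b j p)" using a b j by (intro continuous_intros)
      show "a j q - b j q = 0" if "q \<in> M" "q \<notin> ZX" for q
        using z[OF that(1)] True Y.b_chart_Z[OF af_chart, of "f q"] that M(2) af_subset f_Z by auto
    qed
    then show ?thesis by simp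
  next
    case False
    then show ?thesis using z[OF p] by simp
  qed
qed

lemma pcoef_continuous: "V \<in> X.bf \<Longrightarrow> j < mdim B \<Longrightarrow> M \<subseteq> f -` N \<Longrightarrow> continuous_on M (pcoef N Es V j)"
  using X.smooth_fun_continuous[OF f_open[OF af_open] pcoef_smooth] continuous_on_subset by blast

lemma pcoef_eqI:
  assumes V: "V \<in> X.bf" and M: "open M" "M \<subseteq> f -` N" and a: "\<And>j. j < mdim B \<Longrightarrow> continuous_on M (a j)"
    and eq: "\<And>p g. p \<in> M \<Longrightarrow> smooth_near B (f p) g \<Longrightarrow> V p (\<lambda>q. g (f q)) = (\<Sum>j<mdim B. a j p * Es j (f p) g)"
    and p: "p \<in> M" and j: "j < mdim B"
  shows "pcoef N Es V j p = a j p"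
proof (rule pcoef_unique[OF M pcoef_continuous[OF V _ M(2)] a _ p j])
  fix q g assume q: "q \<in> M" and g: "smooth_near B (f q) g"
  have "f q \<in> N" using q M(2) by auto
  from pcoef_expand[OF V this g] eq[OF q g]
  show "(\<Sum>j<mdim B. pcoef N Es V j q * Es j (f q) g) = (\<Sum>j<mdim B. a j q * Es j (f q) g)" by simp
qed

lemma pcoef_lincomb:
  assumes fin: "finite I" and h: "\<And>k. k \<in> I \<Longrightarrow> smooth_fun A UNIV (h k)" and F: "\<And>k. k \<in> I \<Longrightarrow> F k \<in> X.bf"
    and p: "f p \<in> N" and j: "j < mdim B"
  shows "pcoef N Es (\<lambda>p g. \<Sum>k\<in>I. h k p * F k p g) j p = (\<Sum>k\<in>I. h k p * pcoef N Es (F k) j p)"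
proof (rule pcoef_eqI[where a = "\<lambda>j p. \<Sum>k\<in>I. h k p * pcoef N Es (F k) j p", OF X.bf_lincomb f_open[OF af_open] order_refl])
  show "continuous_on (f -` N) (\<lambda>p. \<Sum>k\<in>I. h k p * pcoef N Es (F k) j p)" if "j < mdim B" for j
    by (intro continuous_on_sum continuous_on_mult pcoef_continuous F order_refl that
        continuous_on_subset[OF X.smooth_fun_continuous[OF open_UNIV h]] subset_UNIV)
  fix q g assume q: "q \<in> f -` N" and g: "smooth_near B (f q) g"
  have "(\<Sum>k\<in>I. h k q * F k q (\<lambda>z. g (f z))) = (\<Sum>k\<in>I. \<Sum>j<mdim B. h k q * pcoef N Es (F k) j q * Es j (f q) g)"
  proof (rule sum.cong[OF refl])
    fix k assume "k \<in> I"
    then show "h k q * F k q (\<lambda>z. g (f z)) = (\<Sum>j<mdim B. h k q * pcoef N Es (F k) j q * Es j (f q) g)"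
      using pcoef_expand[OF F _ g, of k] q by (simp add: sum_distrib_left mult.assoc)
  qed
  also have "\<dots> = (\<Sum>j<mdim B. \<Sum>k\<in>I. h k q * pcoef N Es (F k) j q * Es j (f q) g)" by (rule sum.swap)
  finally show "(\<Sum>k\<in>I. h k q * F k q (\<lambda>z. g (f z))) = (\<Sum>j<mdim B. (\<Sum>k\<in>I. h k q * pcoef N Es (F k) j q) * Es j (f q) g)"
    by (simp add: sum_distrib_right)
qed (use assms in auto)

lemma pcoef_const_lincomb2:
  assumes "V \<in> X.bf" "W \<in> X.bf" "f p \<in> N" "j < mdim B"
  shows "pcoef N Es (\<lambda>q g. a * V q g + b * W q g) j p = a * pcoef N Es V j p + b * pcoef N Es W j p"
  using pcoef_lincomb[of "{0, 1 :: nat}" "\<lambda>i _. if i = 0 then a else b" "\<lambda>i. if i = 0 then V else W" p j]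
    assms X.smooth_fun_const by simp

lemma pcoef_class:
  assumes V: "V \<in> X.bf" and V': "V' \<in> b_class A ZX p V" and p: "f p \<in> N" and j: "j < mdim B"
  shows "pcoef N Es V' j p = pcoef N Es V j p"
proof -
  obtain k :: nat and h F where h: "\<And>i. i < k \<Longrightarrow> smooth_fun A UNIV (h i) \<and> h i p = 0 \<and> F i \<in> X.bf"
    "\<And>q g. V q g - V' q g = (\<Sum>i<k. h i q * F i q g)" and V'b: "V' \<in> X.bf"
    using V' unfolding b_class_def by blast
  have "(\<lambda>q g. 1 * V q g + (- 1) * V' q g) = (\<lambda>q g. \<Sum>i<k. h i q * F i q g)"
    using h(2) by (intro ext) simp
  then have "1 * pcoef N Es V j p + (- 1) * pcoef N Es V' j p = pcoef N Es (\<lambda>q g. \<Sum>i<k. h i q * F i q g) j p"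
    using pcoef_const_lincomb2[OF V V'b p j, of 1 "- 1"] by simp
  also have "\<dots> = (\<Sum>i<k. h i p * pcoef N Es (F i) j p)"
    by (rule pcoef_lincomb) (use h p j in auto)
  also have "\<dots> = 0" using h(1) by simp
  finally show ?thesis by simp
qed

end

lemma pcoef_change:
  assumes af: "Y.adapted_frame U C D r N Es" and af': "Y.adapted_frame U' C' D' r' N' Es'"
    and V: "V \<in> X.bf" and p: "f p \<in> N" "f p \<in> N'" and i: "i < mdim B"
  shows "pcoef N' Es' V i p = (\<Sum>j<mdim B. pcoef N Es V j p * Y.coef N' Es' (Es j) i (f p))"
proof -
  let ?M = "f -` (N \<inter> N')"
  note lf = af_frame[OF af] and lf' = af_frame[OF af']
  have M: "open ?M" using f_open[of "N \<inter> N'"] af_open[OF af] af_open[OF af'] by auto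
  show ?thesis
  proof (rule pcoef_eqI[OF af' V M, where a = "\<lambda>i p. \<Sum>j<mdim B. pcoef N Es V j p * Y.coef N' Es' (Es j) i (f p)"])
    show "continuous_on ?M (\<lambda>p. \<Sum>j<mdim B. pcoef N Es V j p * Y.coef N' Es' (Es j) i (f p))" if "i < mdim B" for i
    proof (intro continuous_on_sum continuous_on_mult)
      fix j assume j: "j \<in> {..<mdim B}"
      show "continuous_on ?M (pcoef N Es V j)" by (rule pcoef_continuous[OF af V]) (use j in auto)
      have "smooth_fun A (f -` N') (\<lambda>p. Y.coef N' Es' (Es j) i (f p))"
        by (rule pullback[OF af_open[OF af'] Y.coef_props(1)[OF lf' Y.local_frame_bf[OF lf] that]]) (use j in auto)
      from X.smooth_fun_continuous[OF f_open[OF af_open[OF af']] this]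
      show "continuous_on ?M (\<lambda>p. Y.coef N' Es' (Es j) i (f p))"
        by (rule continuous_on_subset) auto
    qed
    fix q g assume q: "q \<in> ?M" and g: "smooth_near B (f q) g"
    have "V q (\<lambda>z. g (f z)) = (\<Sum>j<mdim B. pcoef N Es V j q * Es j (f q) g)"
      by (rule pcoef_expand[OF af V _ g]) (use q in auto)
    also have "\<dots> = (\<Sum>j<mdim B. \<Sum>i<mdim B. pcoef N Es V j q * Y.coef N' Es' (Es j) i (f q) * Es' i (f q) g)"
    proof (rule sum.cong[OF refl])
      fix j assume "j \<in> {..<mdim B}"
      then have "Es j (f q) g = (\<Sum>i<mdim B. Y.coef N' Es' (Es j) i (f q) * Es' i (f q) g)"
        using Y.coef_props(2)[OF lf' Y.local_frame_bf[OF lf]] q by auto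
      then show "pcoef N Es V j q * Es j (f q) g =
          (\<Sum>i<mdim B. pcoef N Es V j q * Y.coef N' Es' (Es j) i (f q) * Es' i (f q) g)"
        by (simp only: sum_distrib_left mult.assoc)
    qed
    also have "\<dots> = (\<Sum>i<mdim B. \<Sum>j<mdim B. pcoef N Es V j q * Y.coef N' Es' (Es j) i (f q) * Es' i (f q) g)"
      by (rule sum.swap)
    finally show "V q (\<lambda>z. g (f z)) =
        (\<Sum>i<mdim B. (\<Sum>j<mdim B. pcoef N Es V j q * Y.coef N' Es' (Es j) i (f q)) * Es' i (f q) g)"
      by (simp add: sum_distrib_right)
  qed (use p i in auto)
qed

section \<open>The b-differential as a bundle map\<close>

definition frame_at :: "'y \<Rightarrow> 'y set \<times> (nat \<Rightarrow> 'y vfield)" where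
  "frame_at y = (SOME P. y \<in> fst P \<and> (\<exists>U C D r. Y.adapted_frame U C D r (fst P) (snd P)))"

lemma frame_at:
  "y \<in> fst (frame_at y) \<and> (\<exists>U C D r. Y.adapted_frame U C D r (fst (frame_at y)) (snd (frame_at y)))"
proof -
  obtain U C D r N Es where "y \<in> N" "Y.adapted_frame U C D r N Es" using Y.ex_adapted_frame_at[of y] by blast
  then have "y \<in> fst (N, Es) \<and> (\<exists>U C D r. Y.adapted_frame U C D r (fst (N, Es)) (snd (N, Es)))"
    unfolding fst_conv snd_conv by blast
  then show ?thesis unfolding frame_at_def by (rule someI)
qed

text \<open>A frame is chosen at every point of the target. \<open>bd_class\<close> shows that
  neither this choice nor the representative \<open>b_rep u\<close> matters. The value
  \<open>{}\<close> off the fibres is the convention of \<open>b_bundle_map\<close>, without which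
  the lift would not be unique.\<close>

definition bd :: "'x \<Rightarrow> 'x bvec \<Rightarrow> 'y bvec" where
  "bd x u = (if u \<in> b_fibre A ZX x then b_class B ZY (f x)
     (\<lambda>q g. \<Sum>j<mdim B. pcoef (fst (frame_at (f x))) (snd (frame_at (f x))) (b_rep u) j x * snd (frame_at (f x)) j q g)
   else {})"

lemma bd_class:
  assumes af: "Y.adapted_frame U C D r N Es" and x: "f x \<in> N" and V: "V \<in> X.bf"
  shows "bd x (b_class A ZX x V) = b_class B ZY (f x) (\<lambda>q g. \<Sum>j<mdim B. pcoef N Es V j x * Es j q g)"
proof -
  obtain U0 C0 D0 r0 where x0: "f x \<in> fst (frame_at (f x))"
    and af0: "Y.adapted_frame U0 C0 D0 r0 (fst (frame_at (f x))) (snd (frame_at (f x)))"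
    using frame_at[of "f x"] by blast
  define N0 Es0 where "N0 = fst (frame_at (f x))" and "Es0 = snd (frame_at (f x))"
  note af0 = af0[folded N0_def Es0_def] and x0 = x0[folded N0_def]
  note lf = af_frame[OF af] and lf0 = af_frame[OF af0]
  let ?V = "b_rep (b_class A ZX x V)"
  have V': "?V \<in> b_class A ZX x V" by (rule X.b_rep_class(1)[OF V])
  have "bd x (b_class A ZX x V) = b_class B ZY (f x) (\<lambda>q g. \<Sum>j<mdim B. pcoef N0 Es0 ?V j x * Es0 j q g)"
    unfolding bd_def N0_def Es0_def using X.b_fibreI[OF V] by simp
  also have "\<dots> = b_class B ZY (f x) (\<lambda>q g. \<Sum>j<mdim B. pcoef N Es V j x * Es j q g)"
  proof (subst Y.b_class_eq_iff[OF lf Y.bf_const_lincomb Y.bf_const_lincomb x])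
    show "\<forall>i<mdim B. Y.coef N Es (\<lambda>q g. \<Sum>j<mdim B. pcoef N0 Es0 ?V j x * Es0 j q g) i (f x) =
        Y.coef N Es (\<lambda>q g. \<Sum>j<mdim B. pcoef N Es V j x * Es j q g) i (f x)"
    proof (intro allI impI)
      fix i assume i: "i < mdim B"
      have "Y.coef N Es (\<lambda>q g. \<Sum>j<mdim B. pcoef N0 Es0 ?V j x * Es0 j q g) i (f x) =
          (\<Sum>j<mdim B. pcoef N0 Es0 ?V j x * Y.coef N Es (Es0 j) i (f x))"
        by (rule Y.coef_const_lincomb[OF lf _ _ x i]) (use Y.local_frame_bf[OF lf0] in auto)
      also have "\<dots> = pcoef N Es ?V i x"
        by (rule pcoef_change[OF af0 af X.b_rep_class(2)[OF V] x0 x i, symmetric])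
      also have "\<dots> = pcoef N Es V i x" by (rule pcoef_class[OF af V V' x i])
      also have "\<dots> = Y.coef N Es (\<lambda>q g. \<Sum>j<mdim B. pcoef N Es V j x * Es j q g) i (f x)"
        by (rule Y.coef_frame_lincomb[OF lf x i, symmetric])
      finally show "Y.coef N Es (\<lambda>q g. \<Sum>j<mdim B. pcoef N0 Es0 ?V j x * Es0 j q g) i (f x) =
          Y.coef N Es (\<lambda>q g. \<Sum>j<mdim B. pcoef N Es V j x * Es j q g) i (f x)" .
    qed
  qed (use Y.local_frame_bf[OF lf] Y.local_frame_bf[OF lf0] in auto)
  finally show ?thesis .
qed

lemma bd_anchor:
  assumes "u \<in> b_fibre A ZX x"
  shows "anchor (f x) (bd x u) = differential B f x (anchor x u)"
proof -
  obtain V where V: "V \<in> X.bf" "u = b_class A ZX x V" using assms by (rule X.b_fibreE)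
  obtain U C D r N Es where N: "f x \<in> N" "Y.adapted_frame U C D r N Es" using Y.ex_adapted_frame_at[of "f x"] by blast
  note lf = af_frame[OF N(2)]
  have bf: "(\<lambda>q g. \<Sum>j<mdim B. pcoef N Es V j x * Es j q g) \<in> Y.bf"
    by (rule Y.bf_const_lincomb) (use Y.local_frame_bf[OF lf] in auto)
  show ?thesis
    unfolding V(2) bd_class[OF N(2,1) V(1)] Y.anchor_class[OF bf] X.anchor_class[OF V(1)]
  proof
    fix g
    show "(\<Sum>j<mdim B. pcoef N Es V j x * Es j (f x) g) = differential B f x (V x) g"
    proof (cases "smooth_near B (f x) g")
      case True
      then show ?thesis using pcoef_expand[OF N(2) V(1) N(1) True] by (simp add: differential_def)
    next
      case False
      then show ?thesis
        using Y.tangent_not_smooth[OF Y.bf_tangent[OF bf] False] by (simp add: differential_def)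
    qed
  qed
qed

text \<open>In an arbitrary b-frame the components solve a linear system whose matrix expresses that
  frame in an adapted one and whose right side consists of the smooth \<open>pcoef\<close>. The
  matrix is injective because the zero vector has only one expansion in a basis.\<close>

lemma bd_smooth:
  assumes bfr: "b_frame B ZY S Fs" and V: "V \<in> X.bf"
  shows "\<exists>a. (\<forall>i<mdim B. smooth_fun A (f -` S) (a i)) \<and> (\<forall>x\<in>f -` S. bd x (b_class A ZX x V) =
    b_lincomb B ZY (f x) (map (\<lambda>i. a i x) [0..<mdim B]) (map (b_class B ZY (f x)) Fs))"
proof -
  note c = bfr[unfolded b_frame_def]
  have oS: "open S" and len: "length Fs = mdim B" and F: "set Fs \<subseteq> Y.bf"
    and basis: "\<And>y. y \<in> S \<Longrightarrow> b_basis B ZY y (map (b_class B ZY y) Fs)" using c by blast+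
  have Fi: "Fs ! i \<in> Y.bf" if "i < mdim B" for i using F len that by auto
  have fib: "bd x (b_class A ZX x V) \<in> b_fibre B ZY (f x)" for x
  proof -
    obtain U C D r N Es where N: "f x \<in> N" "Y.adapted_frame U C D r N Es" using Y.ex_adapted_frame_at[of "f x"] by blast
    have "(\<lambda>q g. \<Sum>j<mdim B. pcoef N Es V j x * Es j q g) \<in> Y.bf"
      by (rule Y.bf_const_lincomb) (use Y.local_frame_bf[OF af_frame[OF N(2)]] in auto)
    then show ?thesis unfolding bd_class[OF N(2,1) V] by (rule Y.b_fibreI)
  qed
  have ex: "\<exists>cs. length cs = mdim B \<and> bd x (b_class A ZX x V) = b_lincomb B ZY (f x) cs (map (b_class B ZY (f x)) Fs)"
    if "x \<in> f -` S" for x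
  proof -
    have "\<exists>!cs. length cs = length (map (b_class B ZY (f x)) Fs) \<and>
        bd x (b_class A ZX x V) = b_lincomb B ZY (f x) cs (map (b_class B ZY (f x)) Fs)"
      using basis[of "f x"] that fib unfolding b_basis_def by blast
    then show ?thesis using len by auto
  qed
  define cs where "cs x = (SOME cs. length cs = mdim B \<and>
      bd x (b_class A ZX x V) = b_lincomb B ZY (f x) cs (map (b_class B ZY (f x)) Fs))" for x
  have cs: "length (cs x) = mdim B" "bd x (b_class A ZX x V) = b_lincomb B ZY (f x) (cs x) (map (b_class B ZY (f x)) Fs)"
    if "x \<in> f -` S" for x
    using someI_ex[OF ex[OF that]] unfolding cs_def by blast+
  define a where "a i x = cs x ! i" for i x
  have lin: "b_lincomb B ZY y c (map (b_class B ZY y) Fs) = b_class B ZY y (\<lambda>q g. \<Sum>i<mdim B. c ! i * (Fs ! i) q g)" for y c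
  proof -
    have "b_lincomb B ZY y c (map (b_class B ZY y) Fs) =
        b_class B ZY y (\<lambda>q g. \<Sum>i<length (map (b_class B ZY y) Fs). c ! i * (Fs ! i) q g)"
      by (rule Y.b_lincomb_class) (use Fi len in auto)
    then show ?thesis using len by simp
  qed
  have sm: "smooth_fun A (f -` S) (a i)" if i: "i < mdim B" for i
  proof (rule X.smooth_fun_local)
    fix x assume x: "x \<in> f -` S"
    obtain U C D r N Es where N: "f x \<in> N" "Y.adapted_frame U C D r N Es" using Y.ex_adapted_frame_at[of "f x"] by blast
    note lf = af_frame[OF N(2)]
    let ?M = "f -` (N \<inter> S)"
    have M: "open ?M" using f_open[of "N \<inter> S"] af_open[OF N(2)] oS by auto
    have "smooth_fun A ?M (a i)"
    proof (rule X.smooth_solve[OF M, of "mdim B" "\<lambda>j i p. Y.coef N Es (Fs ! i) j (f p)" "pcoef N Es V" a])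
      show "smooth_fun A ?M (\<lambda>p. Y.coef N Es (Fs ! j) i (f p))" if "i < mdim B" "j < mdim B" for i j
        by (rule smooth_fun_subset[OF pullback[OF af_open[OF N(2)] Y.coef_props(1)[OF lf Fi[OF that(2)] that(1)]]]) auto
      show "smooth_fun A ?M (pcoef N Es V j)" if "j < mdim B" for j
        by (rule smooth_fun_subset[OF pcoef_smooth[OF N(2) V that]]) auto
      show "(\<Sum>j<mdim B. Y.coef N Es (Fs ! j) i (f p) * a j p) = pcoef N Es V i p" if p: "p \<in> ?M" and i: "i < mdim B" for p i
      proof -
        have pN: "f p \<in> N" "p \<in> f -` S" using p by auto
        have bf1: "(\<lambda>q g. \<Sum>j<mdim B. cs p ! j * (Fs ! j) q g) \<in> Y.bf" by (rule Y.bf_const_lincomb) (use Fi in auto)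
        have bf2: "(\<lambda>q g. \<Sum>j<mdim B. pcoef N Es V j p * Es j q g) \<in> Y.bf"
          by (rule Y.bf_const_lincomb) (use Y.local_frame_bf[OF lf] in auto)
        have "b_class B ZY (f p) (\<lambda>q g. \<Sum>j<mdim B. pcoef N Es V j p * Es j q g) =
            b_class B ZY (f p) (\<lambda>q g. \<Sum>j<mdim B. cs p ! j * (Fs ! j) q g)"
          using cs(2)[OF pN(2)] unfolding bd_class[OF N(2) pN(1) V] lin .
        then have "Y.coef N Es (\<lambda>q g. \<Sum>j<mdim B. pcoef N Es V j p * Es j q g) i (f p) =
            Y.coef N Es (\<lambda>q g. \<Sum>j<mdim B. cs p ! j * (Fs ! j) q g) i (f p)"
          using Y.b_class_eq_iff[OF lf bf2 bf1 pN(1)] i by blast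
        also have "\<dots> = (\<Sum>j<mdim B. cs p ! j * Y.coef N Es (Fs ! j) i (f p))"
          by (rule Y.coef_const_lincomb[OF lf _ _ pN(1) i]) (use Fi in auto)
        finally show ?thesis
          using Y.coef_frame_lincomb[OF lf pN(1) i, of "\<lambda>j. pcoef N Es V j p"] by (simp add: a_def mult.commute)
      qed
      show "\<forall>j<mdim B. c j = 0" if p: "p \<in> ?M"
        and z: "\<And>i. i < mdim B \<Longrightarrow> (\<Sum>j<mdim B. Y.coef N Es (Fs ! j) i (f p) * c j) = 0" for p c
      proof -
        have pN: "f p \<in> N" "f p \<in> S" using p by auto
        let ?cl = "map (b_class B ZY (f p)) Fs"
        have e: "b_lincomb B ZY (f p) (map c [0..<mdim B]) ?cl = b_zero B ZY (f p)"
        proof -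
          have bf: "(\<lambda>q g. \<Sum>i<mdim B. map c [0..<mdim B] ! i * (Fs ! i) q g) \<in> Y.bf"
            by (rule Y.bf_const_lincomb) (use Fi in auto)
          have "Y.coef N Es (\<lambda>q g. \<Sum>i<mdim B. map c [0..<mdim B] ! i * (Fs ! i) q g) i (f p) = 0" if "i < mdim B" for i
          proof -
            have "Y.coef N Es (\<lambda>q g. \<Sum>i<mdim B. map c [0..<mdim B] ! i * (Fs ! i) q g) i (f p) =
                (\<Sum>j<mdim B. map c [0..<mdim B] ! j * Y.coef N Es (Fs ! j) i (f p))"
              by (rule Y.coef_const_lincomb[OF lf _ _ pN(1) that]) (use Fi in auto)
            then show ?thesis using z[OF that] by (simp add: mult.commute)
          qed
          then show ?thesis unfolding lin using Y.b_class_zero_iff[OF lf pN(1) bf] by blast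
        qed
        have e0: "b_lincomb B ZY (f p) (map (\<lambda>_. 0) [0..<mdim B]) ?cl = b_zero B ZY (f p)"
        proof -
          have "(\<lambda>q g. \<Sum>i<mdim B. map (\<lambda>_. 0) [0..<mdim B] ! i * (Fs ! i) q g) = (\<lambda>q g. 0)"
            by (intro ext sum.neutral) auto
          then show ?thesis unfolding lin Y.b_zero_class by (rule arg_cong)
        qed
        have zf: "b_zero B ZY (f p) \<in> b_fibre B ZY (f p)" unfolding Y.b_zero_class by (rule Y.b_fibreI[OF Y.bf_zero])
        then have "\<exists>!cs. length cs = length ?cl \<and> b_zero B ZY (f p) = b_lincomb B ZY (f p) cs ?cl"
          using basis[OF pN(2)] unfolding b_basis_def by blast
        moreover have "length (map c [0..<mdim B]) = length ?cl \<and>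
            b_zero B ZY (f p) = b_lincomb B ZY (f p) (map c [0..<mdim B]) ?cl"
          unfolding e using len by simp
        moreover have "length (map (\<lambda>_. 0 :: real) [0..<mdim B]) = length ?cl \<and>
            b_zero B ZY (f p) = b_lincomb B ZY (f p) (map (\<lambda>_. 0) [0..<mdim B]) ?cl"
          unfolding e0 using len by simp
        ultimately have "map c [0..<mdim B] = map (\<lambda>_. 0) [0..<mdim B]" by (rule ex1_unique)
        then show ?thesis by simp
      qed
    qed (rule i)
    then show "\<exists>M. open M \<and> x \<in> M \<and> smooth_fun A M (a i)" using M x N(1) by (intro exI[of _ ?M]) auto
  qed
  have "bd x (b_class A ZX x V) =
      b_lincomb B ZY (f x) (map (\<lambda>i. a i x) [0..<mdim B]) (map (b_class B ZY (f x)) Fs)" if "x \<in> f -` S" for x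
  proof -
    have "map (\<lambda>i. a i x) [0..<mdim B] = cs x"
      using cs(1)[OF that] unfolding a_def by (metis map_nth)
    then show ?thesis using cs(2)[OF that] by simp
  qed
  with sm show ?thesis by blast
qed

lemma bd_linear:
  assumes V: "V \<in> X.bf" and W: "W \<in> X.bf"
  shows "bd x (b_lincomb A ZX x [a, b] [b_class A ZX x V, b_class A ZX x W]) =
    b_lincomb B ZY (f x) [a, b] [bd x (b_class A ZX x V), bd x (b_class A ZX x W)]"
proof -
  obtain U C D r N Es where N: "f x \<in> N" "Y.adapted_frame U C D r N Es" using Y.ex_adapted_frame_at[of "f x"] by blast
  note lf = af_frame[OF N(2)]
  have VW: "(\<lambda>q g. a * V q g + b * W q g) \<in> X.bf"
    using X.bf_lincomb2[OF X.smooth_fun_const X.smooth_fun_const V W] by auto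
  have bf: "(\<lambda>q g. \<Sum>j<mdim B. c j * Es j q g) \<in> Y.bf" for c
    by (rule Y.bf_const_lincomb) (use Y.local_frame_bf[OF lf] in auto)
  have eq: "(\<lambda>q g. \<Sum>j<mdim B. pcoef N Es (\<lambda>q g. a * V q g + b * W q g) j x * Es j q g) =
      (\<lambda>q g. a * (\<Sum>j<mdim B. pcoef N Es V j x * Es j q g) + b * (\<Sum>j<mdim B. pcoef N Es W j x * Es j q g))"
  proof (intro ext)
    fix q g
    have "(\<Sum>j<mdim B. pcoef N Es (\<lambda>q g. a * V q g + b * W q g) j x * Es j q g) =
        (\<Sum>j<mdim B. a * (pcoef N Es V j x * Es j q g) + b * (pcoef N Es W j x * Es j q g))"
      by (intro sum.cong refl) (use pcoef_const_lincomb2[OF N(2) V W N(1), of _ a b] in \<open>auto simp: algebra_simps\<close>)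
    then show "(\<Sum>j<mdim B. pcoef N Es (\<lambda>q g. a * V q g + b * W q g) j x * Es j q g) =
        a * (\<Sum>j<mdim B. pcoef N Es V j x * Es j q g) + b * (\<Sum>j<mdim B. pcoef N Es W j x * Es j q g)"
      by (simp add: sum.distrib sum_distrib_left)
  qed
  show ?thesis
    unfolding X.b_lincomb_class2[OF V W] bd_class[OF N(2,1) VW] bd_class[OF N(2,1) V] bd_class[OF N(2,1) W]
      Y.b_lincomb_class2[OF bf bf] eq ..
qed

lemma bd_bundle_map: "b_bundle_map A ZX B ZY f bd"
  unfolding b_bundle_map_def
proof (intro conjI allI impI ballI)
  show "bd x u = {}" if "u \<notin> b_fibre A ZX x" for x u using that by (simp add: bd_def)
  fix x u assume u: "u \<in> b_fibre A ZX x"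
  then obtain V where V: "V \<in> X.bf" "u = b_class A ZX x V" by (rule X.b_fibreE)
  obtain U C D r N Es where N: "f x \<in> N" "Y.adapted_frame U C D r N Es" using Y.ex_adapted_frame_at[of "f x"] by blast
  have "(\<lambda>q g. \<Sum>j<mdim B. pcoef N Es V j x * Es j q g) \<in> Y.bf"
    by (rule Y.bf_const_lincomb) (use Y.local_frame_bf[OF af_frame[OF N(2)]] in auto)
  then show "bd x u \<in> b_fibre B ZY (f x)" unfolding V(2) bd_class[OF N(2,1) V(1)] by (rule Y.b_fibreI)
  fix v a b assume "v \<in> b_fibre A ZX x"
  then obtain W where W: "W \<in> X.bf" "v = b_class A ZX x W" by (rule X.b_fibreE)
  show "bd x (b_lincomb A ZX x [a, b] [u, v]) = b_lincomb B ZY (f x) [a, b] [bd x u, bd x v]"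
    unfolding V(2) W(2) by (rule bd_linear[OF V(1) W(1)])
qed (rule bd_smooth)

text \<open>On \<open>ZX\<close> the anchor condition alone does not determine a lift. Smoothness of
  the components in a local frame does: they satisfy the equation that characterises
  \<open>pcoef\<close>, where uniqueness extends from the dense complement of
  \<open>ZX\<close>.\<close>

lemma bd_unique:
  assumes D': "b_bundle_map A ZX B ZY f D'"
    and anc: "\<And>x u. u \<in> b_fibre A ZX x \<Longrightarrow> anchor (f x) (D' x u) = differential B f x (anchor x u)"
  shows "D' = bd"
proof (intro ext)
  fix x u
  note c = D'[unfolded b_bundle_map_def]
  show "D' x u = bd x u"
  proof (cases "u \<in> b_fibre A ZX x")
    case False
    then show ?thesis using c[THEN conjunct1, rule_format, OF False] by (simp add: bd_def)
  next
    case True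
    then obtain V where V: "V \<in> X.bf" "u = b_class A ZX x V" by (rule X.b_fibreE)
    obtain U C D r N Es where N: "f x \<in> N" "Y.adapted_frame U C D r N Es" using Y.ex_adapted_frame_at[of "f x"] by blast
    note lf = af_frame[OF N(2)]
    have bf: "(\<lambda>q g. \<Sum>j<mdim B. c j * Es j q g) \<in> Y.bf" for c
      by (rule Y.bf_const_lincomb) (use Y.local_frame_bf[OF lf] in auto)
    obtain a where a: "\<forall>i<mdim B. smooth_fun A (f -` N) (a i)"
      "\<forall>x\<in>f -` N. D' x (b_class A ZX x V) =
        b_lincomb B ZY (f x) (map (\<lambda>i. a i x) [0..<mdim B]) (map (b_class B ZY (f x)) (map Es [0..<mdim B]))"
      using c[THEN conjunct2, THEN conjunct2, rule_format, OF Y.local_frame_b_frame[OF lf] V(1)] by blast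
    have D'c: "D' z (b_class A ZX z V) = b_class B ZY (f z) (\<lambda>q g. \<Sum>j<mdim B. a j z * Es j q g)" if "z \<in> f -` N" for z
      using a(2)[rule_format, OF that] unfolding Y.frame_lincomb[OF lf] .
    have "pcoef N Es V j x = a j x" if "j < mdim B" for j
    proof (rule pcoef_eqI[OF N(2) V(1) f_open[OF af_open[OF N(2)]] order_refl _ _ _ that])
      show "continuous_on (f -` N) (a i)" if "i < mdim B" for i
        by (rule X.smooth_fun_continuous[OF f_open[OF af_open[OF N(2)]]]) (use a(1) that in blast)
      fix z g assume z: "z \<in> f -` N" and g: "smooth_near B (f z) g"
      have "differential B f z (V z) g = (\<Sum>j<mdim B. a j z * Es j (f z) g)"
        using anc[OF X.b_fibreI[OF V(1)], of z] unfolding D'c[OF z] Y.anchor_class[OF bf] X.anchor_class[OF V(1)] by metis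
      then show "V z (\<lambda>q. g (f q)) = (\<Sum>j<mdim B. a j z * Es j (f z) g)" using g by (simp add: differential_def)
    qed (use N(1) in simp)
    then have "(\<lambda>q g. \<Sum>j<mdim B. a j x * Es j q g) = (\<lambda>q g. \<Sum>j<mdim B. pcoef N Es V j x * Es j q g)" by simp
    then show ?thesis unfolding V(2) bd_class[OF N(2,1) V(1)] using D'c[of x] N(1) by simp
  qed
qed

lemma b_differential_eq: "b_differential A ZX B ZY f = bd"
  unfolding b_differential_def
  by (rule the_equality) (use bd_bundle_map bd_anchor bd_unique in blast)+

end

section \<open>Differentials of one-forms\<close>

context mfd
begin

abbreviation "vf \<equiv> vector_fields A UNIV"

lemma vf_tangent: "V \<in> vf \<Longrightarrow> V x \<in> tangent_space A x"
  using vector_fieldD by blast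

lemma vf_near: "V \<in> vf \<Longrightarrow> smooth_near A x g \<Longrightarrow> smooth_near A x (\<lambda>p. V p g)"
  by (rule vector_field_near[OF _ open_UNIV UNIV_I])

lemma vf_smooth: "V \<in> vf \<Longrightarrow> open W \<Longrightarrow> smooth_fun A W g \<Longrightarrow> smooth_fun A W (\<lambda>p. V p g)"
  by (rule vector_field_smooth) auto

lemma vf_bracket: "V \<in> vf \<Longrightarrow> W \<in> vf \<Longrightarrow> lie_bracket A V W \<in> vf"
  by (rule lie_bracket_vector_field[OF open_UNIV])

lemma smooth_near_UNIV: "smooth_fun A UNIV g \<Longrightarrow> smooth_near A x g"
  by (rule smooth_nearI[OF open_UNIV]) auto

lemma bracket_bracket:
  assumes "U \<in> vf" "V \<in> vf" "W \<in> vf" "smooth_near A x g"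
  shows "lie_bracket A (lie_bracket A U V) W x g =
    U x (\<lambda>p. V p (\<lambda>q. W q g)) - V x (\<lambda>p. U p (\<lambda>q. W q g)) -
    (W x (\<lambda>p. U p (\<lambda>q. V q g)) - W x (\<lambda>p. V p (\<lambda>q. U q g)))"
proof -
  note UV = vf_bracket[OF assms(1,2)]
  obtain S where S: "open S" "x \<in> S" "smooth_fun A S g" using assms(4) unfolding smooth_near_def by blast
  have "W x (\<lambda>p. lie_bracket A U V p g) = W x (\<lambda>p. U p (\<lambda>q. V q g) - V p (\<lambda>q. U q g))"
    by (rule tangent_germ[OF vf_tangent[OF assms(3)] vf_near[OF UV assms(4)] S(1,2)])
      (rule lie_bracket_apply, rule smooth_nearI[OF S(1) _ S(3)])
  also have "\<dots> = W x (\<lambda>p. U p (\<lambda>q. V q g)) - W x (\<lambda>p. V p (\<lambda>q. U q g))"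
    by (rule tangent_diff[OF vf_tangent[OF assms(3)] vf_near[OF assms(1) vf_near[OF assms(2,4)]]
          vf_near[OF assms(2) vf_near[OF assms(1,4)]]])
  finally show ?thesis
    unfolding lie_bracket_apply[OF assms(4)] lie_bracket_apply[OF vf_near[OF assms(3,4)]] by simp
qed

lemma one_form_linear:
  "one_form A S \<beta> \<Longrightarrow> x \<in> S \<Longrightarrow> v \<in> tangent_space A x \<Longrightarrow> w \<in> tangent_space A x \<Longrightarrow>
    \<beta> x (\<lambda>g. a * v g + b * w g) = a * \<beta> x v + b * \<beta> x w"
  unfolding one_form_def linear_on_tangent_def by blast

lemma tangent_lincomb2:
  assumes "v \<in> tangent_space A x" "w \<in> tangent_space A x"
  shows "(\<lambda>g. a * v g + b * w g) \<in> tangent_space A x"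
  using tangent_lincomb[of "{0, 1 :: nat}" "\<lambda>i. if i = 0 then v else w" x "\<lambda>i. if i = 0 then a else b"] assms
  by simp

text \<open>The Jacobi identity for vector fields, transported by a one-form. Linearity of
  \<open>\<beta>\<close> is stated for two-term combinations of tangent vectors, hence the nested
  form of the sum and of zero.\<close>

lemma one_form_Jacobi:
  assumes \<beta>: "one_form A UNIV \<beta>" and "U \<in> vf" "V \<in> vf" "W \<in> vf"
  shows "\<beta> x (lie_bracket A (lie_bracket A U V) W x) - \<beta> x (lie_bracket A (lie_bracket A U W) V x) +
    \<beta> x (lie_bracket A (lie_bracket A V W) U x) = 0"
proof -
  let ?a = "lie_bracket A (lie_bracket A U V) W x"
    and ?b = "lie_bracket A (lie_bracket A U W) V x"
    and ?c = "lie_bracket A (lie_bracket A V W) U x"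
  have t: "?a \<in> tangent_space A x" "?b \<in> tangent_space A x" "?c \<in> tangent_space A x"
    by (rule vf_tangent[OF vf_bracket[OF vf_bracket]]; fact)+
  have z: "(\<lambda>g. 1 * (\<lambda>g. 1 * ?a g + (- 1) * ?b g) g + 1 * ?c g) = (\<lambda>g. 0 * ?a g + 0 * ?a g)"
  proof
    fix g
    show "1 * (\<lambda>g. 1 * ?a g + (- 1) * ?b g) g + 1 * ?c g = 0 * ?a g + 0 * ?a g"
    proof (cases "smooth_near A x g")
      case True
      then show ?thesis using assms by (simp add: bracket_bracket)
    next
      case False
      then show ?thesis by (simp add: lie_bracket_def)
    qed
  qed
  have "\<beta> x (\<lambda>g. 1 * (\<lambda>g. 1 * ?a g + (- 1) * ?b g) g + 1 * ?c g) = 1 * (1 * \<beta> x ?a + (- 1) * \<beta> x ?b) + 1 * \<beta> x ?c"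
    unfolding one_form_linear[OF \<beta> UNIV_I tangent_lincomb2[OF t(1,2)] t(3)]
      one_form_linear[OF \<beta> UNIV_I t(1,2)] ..
  moreover have "\<beta> x (\<lambda>g. 0 * ?a g + 0 * ?a g) = 0"
    unfolding one_form_linear[OF \<beta> UNIV_I t(1) t(1)] by simp
  ultimately show ?thesis unfolding z by simp
qed

lemma one_form_smooth: "one_form A S \<beta> \<Longrightarrow> V \<in> vector_fields A S \<Longrightarrow> smooth_fun A S (\<lambda>p. \<beta> p (V p))"
  unfolding one_form_def by blast

lemma koszul1_smooth:
  assumes \<beta>: "one_form A UNIV \<beta>" and "V \<in> vf" "W \<in> vf"
  shows "smooth_fun A UNIV (koszul1 A (\<lambda>V p. \<beta> p (V p)) V W)"
  unfolding koszul1_def[abs_def]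
  by (rule smooth_fun_diff[OF open_UNIV smooth_fun_diff[OF open_UNIV
        vf_smooth[OF assms(2) open_UNIV one_form_smooth[OF \<beta> assms(3)]]
        vf_smooth[OF assms(3) open_UNIV one_form_smooth[OF \<beta> assms(2)]]]
        one_form_smooth[OF \<beta> vf_bracket[OF assms(2,3)]]])

text \<open>The square of the differential is 0: second derivatives cancel against the derivatives
  along brackets, the mixed bracket terms cancel in pairs, and the iterated brackets vanish by the
  Jacobi identity.\<close>

lemma koszul2_koszul1:
  assumes \<beta>: "one_form A UNIV \<beta>" and U: "U \<in> vf" and V: "V \<in> vf" and W: "W \<in> vf"
  shows "koszul2 A (koszul1 A (\<lambda>V p. \<beta> p (V p))) U V W x = 0"
proof -
  let ?F = "\<lambda>V p. \<beta> p (V p)"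
  have n: "smooth_near A x (?F V)" if "V \<in> vf" for V
    by (rule smooth_near_UNIV[OF one_form_smooth[OF \<beta> that]])
  have d: "T x (koszul1 A ?F P Q) = T x (\<lambda>p. P p (?F Q)) - T x (\<lambda>p. Q p (?F P)) - T x (?F (lie_bracket A P Q))"
    if "T \<in> vf" "P \<in> vf" "Q \<in> vf" for T P Q
  proof -
    note t = vf_tangent[OF that(1)]
    note nn = vf_near[OF that(2) n[OF that(3)]] vf_near[OF that(3) n[OF that(2)]] n[OF vf_bracket[OF that(2,3)]]
    show ?thesis unfolding koszul1_def[abs_def]
      by (simp only: tangent_diff[OF t smooth_near_diff[OF nn(1,2)] nn(3)] tangent_diff[OF t nn(1,2)])
  qed
  have k: "koszul1 A ?F (lie_bracket A P Q) T x = P x (\<lambda>p. Q p (?F T)) - Q x (\<lambda>p. P p (?F T)) -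
      T x (?F (lie_bracket A P Q)) - \<beta> x (lie_bracket A (lie_bracket A P Q) T x)"
    if "T \<in> vf" "P \<in> vf" "Q \<in> vf" for T P Q
    unfolding koszul1_def lie_bracket_apply[OF n[OF that(1)]] ..
  show ?thesis
    unfolding koszul2_def d[OF U V W] d[OF V U W] d[OF W U V] k[OF W U V] k[OF V U W] k[OF U V W]
    using one_form_Jacobi[OF \<beta> U V W, of x] by simp
qed

end

section \<open>Gluing closed forms with a partition of unity\<close>

context bmfd
begin

lemma bf_vf: "V \<in> bf \<Longrightarrow> V \<in> vf" by (rule bf_vector_field)

text \<open>The form \<open>\<gamma> + \<Sum>\<^sub>i d (r\<^sub>i (\<alpha>\<^sub>i + \<alpha>'\<^sub>i))\<close> is closed, and equals \<open>\<Sum>\<^sub>i r\<^sub>i \<eta>\<^sub>i\<close> up to terms containing \<open>d r\<^sub>i\<close>.\<close>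
lemma ex_glued_form:
  assumes fin: "finite I" and r: "\<And>i. i \<in> I \<Longrightarrow> smooth_fun A UNIV (r i)" and sum1: "\<And>x. (\<Sum>i\<in>I. r i x) = 1"
    and W: "\<And>i. i \<in> I \<Longrightarrow> open (W i)" and K: "\<And>i. i \<in> I \<Longrightarrow> closed (K i)" "\<And>i. i \<in> I \<Longrightarrow> K i \<subseteq> W i"
    and rK: "\<And>i x. i \<in> I \<Longrightarrow> x \<notin> K i \<Longrightarrow> r i x = 0"
    and \<gamma>: "closed_two_form A UNIV \<gamma>" and \<eta>: "\<And>i. i \<in> I \<Longrightarrow> two_form A (W i) (\<eta> i)"
    and \<alpha>: "\<And>i. i \<in> I \<Longrightarrow> one_form A (W i) (\<alpha> i)" and \<alpha>': "\<And>i. i \<in> I \<Longrightarrow> one_form A UNIV (\<alpha>' i)"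
    and coh: "\<And>i U V x. i \<in> I \<Longrightarrow> U \<in> vf \<Longrightarrow> V \<in> vf \<Longrightarrow> x \<in> W i \<Longrightarrow> \<eta> i x (U x) (V x) - \<gamma> x (U x) (V x) =
      koszul1 A (\<lambda>V p. \<alpha> i p (V p)) U V x + koszul1 A (\<lambda>V p. \<alpha>' i p (V p)) U V x"
  obtains H where "b_form H" "\<And>U V W x. U \<in> bf \<Longrightarrow> V \<in> bf \<Longrightarrow> W \<in> bf \<Longrightarrow> koszul2 A H U V W x = 0"
    "\<And>U V x. U \<in> bf \<Longrightarrow> V \<in> bf \<Longrightarrow> (\<And>i. i \<in> I \<Longrightarrow> U x (r i) = 0) \<Longrightarrow> (\<And>i. i \<in> I \<Longrightarrow> V x (r i) = 0) \<Longrightarrow>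
      H U V x = (\<Sum>i\<in>I. if x \<in> W i then r i x * \<eta> i x (U x) (V x) else 0)"
proof -
  \<comment> \<open>Two primitives occur because the local form is compared with some representative
    of the class on \<open>W i\<close>, and this representative with \<open>\<gamma>\<close>
    globally. The value 0 outside \<open>W i\<close> is harmless after multiplication by
    \<open>r i\<close>, which is supported in \<open>K i\<close>.\<close>
  define a where "a i x v = (if x \<in> W i then \<alpha> i x v + \<alpha>' i x v else 0)" for i x v
  define \<beta>i where "\<beta>i i x v = r i x * a i x v" for i x v
  define \<beta> where "\<beta> x v = (\<Sum>i\<in>I. \<beta>i i x v)" for x v
  \<comment> \<open>The form \<open>r i * \<eta> i\<close> plus the wedge product of the
    differential of \<open>r i\<close> with the primitive.\<close>
  define t where "t i x u v = (if x \<in> W i then r i x * \<eta> i x u v + u (r i) * a i x v - v (r i) * a i x u else 0)"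
    for i x u v
  have a_lin: "a i x (\<lambda>g. c * v g + d * w g) = c * a i x v + d * a i x w"
    if i: "i \<in> I" and vw: "v \<in> tangent_space A x" "w \<in> tangent_space A x" for i x v w c d
  proof (cases "x \<in> W i")
    case True
    then show ?thesis
      using one_form_linear[OF \<alpha>[OF i] True vw, of c d] one_form_linear[OF \<alpha>'[OF i] UNIV_I vw, of c d]
      by (simp add: a_def algebra_simps)
  qed (simp add: a_def)
  have a_smooth: "smooth_fun A (W i) (\<lambda>p. a i p (V p))" if i: "i \<in> I" and V: "V \<in> vf" for i V
  proof -
    have "smooth_fun A (W i) (\<lambda>p. \<alpha> i p (V p) + \<alpha>' i p (V p))"
      by (rule smooth_fun_add[OF W[OF i] one_form_smooth[OF \<alpha>[OF i] vector_fields_subset[OF V subset_UNIV]]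
          smooth_fun_subset[OF one_form_smooth[OF \<alpha>'[OF i] V] subset_UNIV]])
    then show ?thesis by (rule smooth_fun_cong[OF W[OF i], rotated]) (simp add: a_def)
  qed
  have \<beta>i_one: "one_form A UNIV (\<beta>i i)" if i: "i \<in> I" for i
    unfolding one_form_def linear_on_tangent_def
  proof (intro conjI ballI allI)
    show "\<beta>i i x (\<lambda>g. c * v g + d * w g) = c * \<beta>i i x v + d * \<beta>i i x w"
      if "v \<in> tangent_space A x" "w \<in> tangent_space A x" for x v w c d
      unfolding \<beta>i_def a_lin[OF i that] by (simp add: algebra_simps)
    show "smooth_fun A UNIV (\<lambda>p. \<beta>i i p (V p))" if "V \<in> vf" for V
      unfolding \<beta>i_def by (rule smooth_fun_extend[OF r[OF i] K(1)[OF i] K(2)[OF i] W[OF i] rK[OF i] a_smooth[OF i that]])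
  qed
  have \<beta>_one: "one_form A UNIV \<beta>"
    unfolding one_form_def linear_on_tangent_def
  proof (intro conjI ballI allI)
    show "\<beta> x (\<lambda>g. c * v g + d * w g) = c * \<beta> x v + d * \<beta> x w"
      if "v \<in> tangent_space A x" "w \<in> tangent_space A x" for x v w c d
    proof -
      have "\<beta> x (\<lambda>g. c * v g + d * w g) = (\<Sum>i\<in>I. c * \<beta>i i x v + d * \<beta>i i x w)"
        unfolding \<beta>_def by (rule sum.cong[OF refl]) (rule one_form_linear[OF \<beta>i_one UNIV_I that])
      then show ?thesis by (simp add: \<beta>_def sum.distrib sum_distrib_left)
    qed
    show "smooth_fun A UNIV (\<lambda>p. \<beta> p (V p))" if "V \<in> vf" for V
      unfolding \<beta>_def by (rule smooth_fun_sum[OF open_UNIV one_form_smooth[OF \<beta>i_one that]])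
  qed
  have k1: "koszul1 A (\<lambda>V p. \<beta>i i p (V p)) U V x = t i x (U x) (V x) - r i x * \<gamma> x (U x) (V x)"
    if i: "i \<in> I" and U: "U \<in> vf" and V: "V \<in> vf" for i U V x
  proof (cases "x \<in> W i")
    case True
    note UV = vf_bracket[OF U V]
    have nr: "smooth_near A x (r i)" by (rule smooth_near_UNIV[OF r[OF i]])
    have nal: "smooth_near A x (\<lambda>p. \<alpha> i p (P p))" if "P \<in> vf" for P
      by (rule smooth_nearI[OF W[OF i] True one_form_smooth[OF \<alpha>[OF i] vector_fields_subset[OF that]]]) auto
    have nal': "smooth_near A x (\<lambda>p. \<alpha>' i p (P p))" if "P \<in> vf" for P
      by (rule smooth_near_UNIV[OF one_form_smooth[OF \<alpha>'[OF i] that]])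
    have d: "P x (\<lambda>p. \<beta>i i p (Q p)) = P x (r i) * a i x (Q x) +
        r i x * (P x (\<lambda>p. \<alpha> i p (Q p)) + P x (\<lambda>p. \<alpha>' i p (Q p)))" if P: "P \<in> vf" and Q: "Q \<in> vf" for P Q
    proof -
      note Px = vf_tangent[OF P]
      have "P x (\<lambda>p. \<beta>i i p (Q p)) = P x (\<lambda>p. r i p * (\<alpha> i p (Q p) + \<alpha>' i p (Q p)))"
        by (rule tangent_germ[OF Px smooth_near_UNIV[OF one_form_smooth[OF \<beta>i_one[OF i] Q]] W[OF i] True])
          (simp add: \<beta>i_def a_def)
      also have "\<dots> = P x (r i) * (\<alpha> i x (Q x) + \<alpha>' i x (Q x)) + r i x * P x (\<lambda>p. \<alpha> i p (Q p) + \<alpha>' i p (Q p))"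
        by (rule tangent_mult[OF Px nr smooth_near_add[OF nal[OF Q] nal'[OF Q]]])
      also have "P x (\<lambda>p. \<alpha> i p (Q p) + \<alpha>' i p (Q p)) = P x (\<lambda>p. \<alpha> i p (Q p)) + P x (\<lambda>p. \<alpha>' i p (Q p))"
        by (rule tangent_add[OF Px nal[OF Q] nal'[OF Q]])
      finally show ?thesis using True by (simp add: a_def)
    qed
    have c: "\<eta> i x (U x) (V x) = \<gamma> x (U x) (V x) +
        (U x (\<lambda>p. \<alpha> i p (V p)) - V x (\<lambda>p. \<alpha> i p (U p)) - \<alpha> i x (lie_bracket A U V x)) +
        (U x (\<lambda>p. \<alpha>' i p (V p)) - V x (\<lambda>p. \<alpha>' i p (U p)) - \<alpha>' i x (lie_bracket A U V x))"
      using coh[OF i U V True] by (simp add: koszul1_def)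
    have b: "\<beta>i i x (lie_bracket A U V x) = r i x * (\<alpha> i x (lie_bracket A U V x) + \<alpha>' i x (lie_bracket A U V x))"
      using True by (simp add: \<beta>i_def a_def)
    show ?thesis
      unfolding koszul1_def d[OF U V] d[OF V U] b t_def c using True by (simp add: algebra_simps)
  next
    case False
    have o: "open (- K i)" and x: "x \<in> - K i" using K[OF i] False by auto
    have z: "P x (\<lambda>p. \<beta>i i p (Q p)) = 0" if P: "P \<in> vf" and Q: "Q \<in> vf" for P Q
    proof -
      have "P x (\<lambda>p. \<beta>i i p (Q p)) = P x (\<lambda>p. 0)"
        by (rule tangent_germ[OF vf_tangent[OF P] smooth_near_UNIV[OF one_form_smooth[OF \<beta>i_one[OF i] Q]] o x])
          (use rK[OF i] in \<open>simp add: \<beta>i_def\<close>)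
      then show ?thesis using tangent_const[OF vf_tangent[OF P]] by simp
    qed
    have r0: "r i x = 0" using rK[OF i] x by simp
    show ?thesis unfolding koszul1_def z[OF U V] z[OF V U] t_def using False r0 by (simp add: \<beta>i_def)
  qed
  define H where "H U V x = \<gamma> x (U x) (V x) + koszul1 A (\<lambda>V p. \<beta> p (V p)) U V x" for U V x
  \<comment> \<open>The \<open>\<gamma>\<close> parts cancel since the weights sum to 1. This
    pointwise formula gives skewness and linearity over functions, while closedness is read off from
    the definition of \<open>H\<close>.\<close>
  have Ht: "H U V x = (\<Sum>i\<in>I. t i x (U x) (V x))" if U: "U \<in> vf" and V: "V \<in> vf" for U V x
  proof -
    have s: "P x (\<lambda>p. \<beta> p (Q p)) = (\<Sum>i\<in>I. P x (\<lambda>p. \<beta>i i p (Q p)))" if "P \<in> vf" "Q \<in> vf" for P Q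
      unfolding \<beta>_def
      by (rule tangent_sum[OF vf_tangent[OF that(1)] fin]) (rule smooth_near_UNIV[OF one_form_smooth[OF \<beta>i_one that(2)]])
    have "koszul1 A (\<lambda>V p. \<beta> p (V p)) U V x = (\<Sum>i\<in>I. koszul1 A (\<lambda>V p. \<beta>i i p (V p)) U V x)"
      unfolding koszul1_def s[OF U V] s[OF V U] by (simp add: \<beta>_def sum_subtractf)
    also have "\<dots> = (\<Sum>i\<in>I. t i x (U x) (V x)) - (\<Sum>i\<in>I. r i x) * \<gamma> x (U x) (V x)"
      by (simp add: k1[OF _ U V] sum_subtractf sum_distrib_right)
    finally show ?thesis by (simp add: H_def sum1)
  qed
  have \<gamma>2: "two_form A UNIV \<gamma>" and \<gamma>c: "\<And>U V W x. U \<in> vf \<Longrightarrow> V \<in> vf \<Longrightarrow> W \<in> vf \<Longrightarrow>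
      koszul2 A (\<lambda>V V' p. \<gamma> p (V p) (V' p)) U V W x = 0"
    using \<gamma> unfolding closed_two_form_def by blast+
  have \<gamma>s: "smooth_fun A UNIV (\<lambda>p. \<gamma> p (U p) (V p))" if "U \<in> vf" "V \<in> vf" for U V
    using \<gamma>2 that unfolding two_form_def by blast
  have Hs: "smooth_fun A UNIV (H U V)" if "U \<in> vf" "V \<in> vf" for U V
    unfolding H_def[abs_def] by (rule smooth_fun_add[OF open_UNIV \<gamma>s[OF that] koszul1_smooth[OF \<beta>_one that]])
  have t_skew: "t i x u v = - t i x v u" if "i \<in> I" "u \<in> tangent_space A x" "v \<in> tangent_space A x" for i x u v
  proof (cases "x \<in> W i")
    case True
    then have "\<eta> i x u v = - \<eta> i x v u" using \<eta>[OF that(1)] that(2,3) unfolding two_form_def by blast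
    then show ?thesis by (simp add: t_def algebra_simps)
  qed (simp add: t_def)
  have t_lin: "t i x u (\<lambda>g. c * v g + d * w g) = c * t i x u v + d * t i x u w"
    if i: "i \<in> I" and uvw: "u \<in> tangent_space A x" "v \<in> tangent_space A x" "w \<in> tangent_space A x" for i x u v w c d
  proof (cases "x \<in> W i")
    case True
    then have "linear_on_tangent A x (\<eta> i x u)" using \<eta>[OF i] uvw(1) unfolding two_form_def by blast
    then have e: "\<eta> i x u (\<lambda>g. c * v g + d * w g) = c * \<eta> i x u v + d * \<eta> i x u w"
      using uvw(2,3) unfolding linear_on_tangent_def by blast
    show ?thesis unfolding t_def e a_lin[OF i uvw(2,3)] using True by (simp add: algebra_simps)
  qed (simp add: t_def)
  show thesis
  proof (rule that[of H])
    show "b_form H"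
      unfolding b_form_def
    proof (intro conjI ballI allI impI)
      fix U V x assume "U \<in> bf" "V \<in> bf"
      then have UV: "U \<in> vf" "V \<in> vf" using bf_vf by blast+
      have "(\<Sum>i\<in>I. t i x (U x) (V x)) = (\<Sum>i\<in>I. - t i x (V x) (U x))"
        by (rule sum.cong[OF refl]) (rule t_skew[OF _ vf_tangent[OF UV(1)] vf_tangent[OF UV(2)]])
      then show "H U V x = - H V U x" unfolding Ht[OF UV] Ht[OF UV(2,1)] by (simp add: sum_negf)
    next
      fix U V W h k x assume b: "U \<in> bf" "V \<in> bf" "W \<in> bf" and hk: "smooth_fun A UNIV h" "smooth_fun A UNIV k"
      have v: "U \<in> vf" "V \<in> vf" "W \<in> vf" using b bf_vf by blast+
      have L: "(\<lambda>q g. h q * V q g + k q * W q g) \<in> vf" by (rule bf_vf[OF bf_lincomb2[OF hk b(2,3)]])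
      have "(\<Sum>i\<in>I. t i x (U x) (\<lambda>g. h x * V x g + k x * W x g)) =
          (\<Sum>i\<in>I. h x * t i x (U x) (V x) + k x * t i x (U x) (W x))"
        by (rule sum.cong[OF refl]) (rule t_lin[OF _ vf_tangent[OF v(1)] vf_tangent[OF v(2)] vf_tangent[OF v(3)]])
      then show "H U (\<lambda>q g. h q * V q g + k q * W q g) x = h x * H U V x + k x * H U W x"
        unfolding Ht[OF v(1) L] Ht[OF v(1,2)] Ht[OF v(1,3)] by (simp add: sum.distrib sum_distrib_left)
    next
      fix U V assume "U \<in> bf" "V \<in> bf"
      then show "smooth_fun A UNIV (H U V)" by (intro Hs bf_vf)
    qed
    show "koszul2 A H U V W x = 0" if b: "U \<in> bf" "V \<in> bf" "W \<in> bf" for U V W x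
    proof -
      have v: "U \<in> vf" "V \<in> vf" "W \<in> vf" using b bf_vf by blast+
      have d: "T x (H P Q) = T x (\<lambda>p. \<gamma> p (P p) (Q p)) + T x (koszul1 A (\<lambda>V p. \<beta> p (V p)) P Q)"
        if "T \<in> vf" "P \<in> vf" "Q \<in> vf" for T P Q
        unfolding H_def[abs_def]
        by (rule tangent_add[OF vf_tangent[OF that(1)] smooth_near_UNIV[OF \<gamma>s[OF that(2,3)]]
              smooth_near_UNIV[OF koszul1_smooth[OF \<beta>_one that(2,3)]]])
      have "koszul2 A H U V W x = koszul2 A (\<lambda>V V' p. \<gamma> p (V p) (V' p)) U V W x +
          koszul2 A (koszul1 A (\<lambda>V p. \<beta> p (V p))) U V W x"
        unfolding koszul2_def d[OF v] d[OF v(2,1,3)] d[OF v(3,1,2)] by (simp add: H_def)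
      then show ?thesis unfolding \<gamma>c[OF v] koszul2_koszul1[OF \<beta>_one v] by simp
    qed
    show "H U V x = (\<Sum>i\<in>I. if x \<in> W i then r i x * \<eta> i x (U x) (V x) else 0)"
      if b: "U \<in> bf" "V \<in> bf" and z: "\<And>i. i \<in> I \<Longrightarrow> U x (r i) = 0" "\<And>i. i \<in> I \<Longrightarrow> V x (r i) = 0" for U V x
      unfolding Ht[OF bf_vf[OF b(1)] bf_vf[OF b(2)]] by (rule sum.cong[OF refl]) (simp add: t_def z)
  qed
qed

end

section \<open>Pullbacks of closed b-forms\<close>

lemma skew_sum_swap:
  fixes om :: "nat \<Rightarrow> nat \<Rightarrow> real"
  assumes "\<And>j k. j < n \<Longrightarrow> k < n \<Longrightarrow> om j k = - om k j"
  shows "(\<Sum>j<n. \<Sum>k<n. om j k * x j * y k) = - (\<Sum>j<n. \<Sum>k<n. om j k * y j * x k)"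
proof -
  have "(\<Sum>j<n. \<Sum>k<n. om j k * x j * y k) = (\<Sum>k<n. \<Sum>j<n. om j k * x j * y k)" by (rule sum.swap)
  also have "\<dots> = (\<Sum>k<n. \<Sum>j<n. - (om k j * y k * x j))"
  proof (intro sum.cong refl)
    fix k j assume "k \<in> {..<n}" "j \<in> {..<n}"
    then have "om j k = - om k j" by (intro assms) auto
    then show "om j k * x j * y k = - (om k j * y k * x j)" by simp
  qed
  finally show ?thesis by (simp add: sum_negf)
qed

text \<open>The bookkeeping behind the closedness of a pullback. Here \<open>om\<close> is the
  matrix of the form in a commuting frame, \<open>E l\<close> its derivative along the frame field
  \<open>l\<close>, and \<open>u\<close>, \<open>v\<close>, \<open>w\<close> are the components of
  three fields; \<open>uv\<close> stands for the derivative along \<open>u\<close> of the components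
  of \<open>v\<close>, and similarly for the other pairs. Derivatives of components cancel against
  the bracket terms by skewness, and the rest is a combination of the closedness relations for the
  frame.\<close>

lemma pullback_closed_algebra:
  fixes om :: "nat \<Rightarrow> nat \<Rightarrow> real" and E :: "nat \<Rightarrow> nat \<Rightarrow> nat \<Rightarrow> real"
  assumes skew: "\<And>j k. j < n \<Longrightarrow> k < n \<Longrightarrow> om j k = - om k j"
    and closed: "\<And>l j k. l < n \<Longrightarrow> j < n \<Longrightarrow> k < n \<Longrightarrow> E l j k - E j l k + E k l j = 0"
    and S: "\<And>x y z xy xz. S x y z xy xz = (\<Sum>j<n. \<Sum>k<n. (\<Sum>l<n. x l * E l j k) * y j * z k +
      om j k * xy j * z k + om j k * y j * xz k)"
    and T: "\<And>x y. T x y = (\<Sum>j<n. \<Sum>k<n. om j k * x j * y k)"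
  shows "S u v w uv uw - S v u w vu vw + S w u v wu wv
     - T (\<lambda>j. uv j - vu j) w + T (\<lambda>j. uw j - wu j) v - T (\<lambda>j. vw j - wv j) u = 0"
proof -
  define R where "R x y z = (\<Sum>j<n. \<Sum>k<n. \<Sum>l<n. x l * y j * z k * E l j k)" for x y z :: "nat \<Rightarrow> real"
  have S': "S x y z xy xz = R x y z + T xy z + T y xz" for x y z xy xz
    unfolding S T R_def by (simp add: sum.distrib sum_distrib_right sum_distrib_left mult_ac)
  have T': "T (\<lambda>j. x j - y j) z = T x z - T y z" for x y z
    unfolding T by (simp add: algebra_simps sum_subtractf)
  have Ts: "T x y = - T y x" for x y
    unfolding T by (rule skew_sum_swap[OF skew])
  have "R u v w - R v u w + R w u v = 0"
  proof -
    have r1: "R v u w = (\<Sum>j<n. \<Sum>k<n. \<Sum>l<n. u l * v j * w k * E j l k)"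
    proof -
      have "R v u w = (\<Sum>k<n. \<Sum>j<n. \<Sum>l<n. v l * u j * w k * E l j k)" unfolding R_def by (rule sum.swap)
      also have "\<dots> = (\<Sum>k<n. \<Sum>l<n. \<Sum>j<n. v l * u j * w k * E l j k)" by (intro sum.cong refl sum.swap)
      also have "\<dots> = (\<Sum>l<n. \<Sum>k<n. \<Sum>j<n. v l * u j * w k * E l j k)" by (rule sum.swap)
      finally show ?thesis by (simp add: mult_ac)
    qed
    have r2: "R w u v = (\<Sum>j<n. \<Sum>k<n. \<Sum>l<n. u l * v j * w k * E k l j)"
    proof -
      have "R w u v = (\<Sum>k<n. \<Sum>j<n. \<Sum>l<n. w l * u j * v k * E l j k)" unfolding R_def by (rule sum.swap)
      also have "\<dots> = (\<Sum>k<n. \<Sum>l<n. \<Sum>j<n. w l * u j * v k * E l j k)" by (intro sum.cong refl sum.swap)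
      finally show ?thesis by (simp add: mult_ac)
    qed
    have "R u v w - R v u w + R w u v = (\<Sum>j<n. \<Sum>k<n. \<Sum>l<n. u l * v j * w k * (E l j k - E j l k + E k l j))"
      unfolding r1 r2 unfolding R_def by (simp add: sum.distrib sum_subtractf algebra_simps)
    also have "\<dots> = 0" using closed by (intro sum.neutral ballI) simp
    finally show ?thesis .
  qed
  then show ?thesis
    unfolding S' T' using Ts[of v uw] Ts[of u vw] Ts[of u wv] by simp
qed


section \<open>Brackets in adapted frames\<close>

context bmap
begin

lemma pcoef_coordinate:
  assumes af: "Y.adapted_frame U C D r N Es" and V: "V \<in> X.bf" and p: "f p \<in> N" and j: "j < mdim B"
  shows "V p (\<lambda>q. C j (f q)) = pcoef N Es V j p * (if j = 0 then r (f p) else 1)"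
proof -
  have "f p \<in> U" using p af_subset[OF af] by blast
  from pcoef_expand[OF af V p Y.b_chart_X_near[OF af_chart[OF af] j this]]
  show ?thesis unfolding Y.adapted_frame_X[OF af p j] .
qed

text \<open>The adapted frame commutes, so components of a bracket are obtained by differentiating
  components as if they were those of a coordinate frame. The identity is first found multiplied by
  \<open>s\<close>, by evaluating the bracket on a coordinate composed with \<open>f\<close>, and is
  divided by \<open>s\<close> off \<open>ZX\<close>.\<close>

lemma pcoef_bracket:
  assumes af: "Y.adapted_frame U C D r N Es" and V: "V \<in> X.bf" and W: "W \<in> X.bf" and p: "f p \<in> N" and j: "j < mdim B"
  shows "pcoef N Es (lie_bracket A V W) j p = V p (pcoef N Es W j) - W p (pcoef N Es V j)"
proof -
  let ?S = "f -` N"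
  note VW = X.bf_lie_bracket[OF V W] and oS = f_open[OF af_open[OF af]]
  define s where "s q = (if j = 0 then r (f q) else 1)" for q
  have rs: "smooth_fun A ?S (\<lambda>q. r (f q))"
    by (rule pullback[OF af_open[OF af] smooth_fun_subset[OF Y.b_chart_r[OF af_chart[OF af]] af_subset[OF af]]])
  have ss: "smooth_fun A ?S s"
    using rs X.smooth_fun_const[OF oS, of 1] unfolding s_def by (cases "j = 0") auto
  \<comment> \<open>If \<open>s\<close> is not constant it is the first coordinate composed with
    \<open>f\<close>, so its derivative along \<open>P\<close> is \<open>s\<close> times the
    component of \<open>P\<close>, and both sides are the same product. These are the terms that
    would otherwise spoil the commutator.\<close>
  have sym: "P q s * pcoef N Es Q j q = Q q s * pcoef N Es P j q" if P: "P \<in> X.bf" and Q: "Q \<in> X.bf" and q: "q \<in> ?S" for P Q q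
  proof (cases "s = (\<lambda>_. 1)")
    case True
    then show ?thesis using X.tangent_const[OF X.bf_tangent[OF P]] X.tangent_const[OF X.bf_tangent[OF Q]] by simp
  next
    case False
    have j0: "j = 0" using False by (auto simp: s_def)
    have "r = C 0" using Y.b_chart_cases[OF af_chart[OF af]] False j0 by (auto simp: s_def)
    then have s: "s = (\<lambda>q. C j (f q))" unfolding s_def j0 by simp
    have "f q \<in> N" using q by simp
    from pcoef_coordinate[OF af P this j] pcoef_coordinate[OF af Q this j]
    show ?thesis unfolding s by simp
  qed
  have key: "s q * pcoef N Es (lie_bracket A V W) j q = s q * (V q (pcoef N Es W j) - W q (pcoef N Es V j))" if q: "q \<in> ?S" for q
  proof -
    have fq: "f q \<in> N" using q by simp
    have nC: "smooth_near A q (\<lambda>q. C j (f q))"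
      by (rule pullback_near[OF Y.b_chart_X_near[OF af_chart[OF af] j]]) (use fq af_subset[OF af] in blast)
    have ns: "smooth_near A q s" by (rule X.smooth_nearI[OF oS q ss])
    have np: "smooth_near A q (pcoef N Es P j)" if "P \<in> X.bf" for P
      by (rule X.smooth_nearI[OF oS q pcoef_smooth[OF af that j]])
    have d: "P q (\<lambda>z. Q z (\<lambda>q. C j (f q))) = P q s * pcoef N Es Q j q + s q * P q (pcoef N Es Q j)"
      if P: "P \<in> X.bf" and Q: "Q \<in> X.bf" for P Q
    proof -
      note t = X.bf_tangent[OF P]
      have "P q (\<lambda>z. Q z (\<lambda>q. C j (f q))) = P q (\<lambda>z. s z * pcoef N Es Q j z)"
        by (rule X.tangent_germ[OF t X.bf_near[OF Q nC] oS q])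
          (use pcoef_coordinate[OF af Q _ j] in \<open>simp add: s_def\<close>)
      also have "\<dots> = P q s * pcoef N Es Q j q + s q * P q (pcoef N Es Q j)"
        by (rule X.tangent_mult[OF t ns np[OF Q]])
      finally show ?thesis .
    qed
    have "pcoef N Es (lie_bracket A V W) j q * s q = lie_bracket A V W q (\<lambda>q. C j (f q))"
      using pcoef_coordinate[OF af VW fq j] by (simp add: s_def)
    also have "\<dots> = s q * (V q (pcoef N Es W j) - W q (pcoef N Es V j))"
      unfolding X.lie_bracket_apply[OF nC] d[OF V W] d[OF W V] using sym[OF V W q] by (simp add: algebra_simps)
    finally show ?thesis by (simp add: mult.commute)
  qed
  let ?c = "\<lambda>q. pcoef N Es (lie_bracket A V W) j q - (V q (pcoef N Es W j) - W q (pcoef N Es V j))"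
  have "?c p = 0"
  proof (rule X.continuous_zero_off_Z[OF oS])
    have "smooth_fun A ?S ?c"
      by (rule X.smooth_fun_diff[OF oS pcoef_smooth[OF af VW j] X.smooth_fun_diff[OF oS
            X.bf_smooth[OF V oS pcoef_smooth[OF af W j]] X.bf_smooth[OF W oS pcoef_smooth[OF af V j]]]])
    then show "continuous_on ?S ?c" by (rule X.smooth_fun_continuous[OF oS])
    show "?c q = 0" if "q \<in> ?S" "q \<notin> ZX" for q
    proof -
      have "s q \<noteq> 0"
        using that f_Z[of q] Y.b_chart_Z[OF af_chart[OF af], of "f q"] af_subset[OF af] by (auto simp: s_def)
      then show ?thesis using key[OF that(1)] by simp
    qed
    show "p \<in> ?S" using p by simp
  qed
  then show ?thesis by simp
qed

end

context bmfd
begin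

text \<open>The second derivative of a coordinate along two frame fields is nonzero at most if all
  three indices are 0, so it is symmetric and the bracket kills every coordinate. As the first
  coefficient appears with the factor \<open>r\<close>, it is 0 off \<open>Z\<close> and then
  everywhere.\<close>

lemma adapted_frame_commute:
  assumes af: "adapted_frame U X D r N Es" and y: "y \<in> N" and l: "l < mdim A" and j: "j < mdim A" and i: "i < mdim A"
  shows "coef N Es (lie_bracket A (Es l) (Es j)) i y = 0"
proof -
  note lf = adapted_frame_local_frame[OF af]
  note c = af[unfolded adapted_frame_def]
  have bc: "b_chart A Z U X D r" and N: "open N" "N \<subseteq> U" using c by blast+
  have bfE: "Es k \<in> bf" if "k < mdim A" for k by (rule local_frame_bf[OF lf that])
  have Eapp: "Es k p g = (if k = 0 then r p else 1) * D k p g" if "k < mdim A" "p \<in> N" for k p g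
    by (rule c[THEN conjunct2, THEN conjunct2, THEN conjunct2, THEN conjunct2, rule_format, OF that])
  note br = bf_lie_bracket[OF bfE[OF l] bfE[OF j]]
  have ex: "Es k p (X i) = (if k = i then (if i = 0 then r p else 1) else 0)" if "k < mdim A" "p \<in> N" for k p
    using Eapp[OF that, of "X i"] b_chart_DX[OF bc that(1) i, of p] that(2) N(2) by auto
  have val: "Es a q (\<lambda>p. Es b p (X i)) = (if a = 0 \<and> b = 0 \<and> i = 0 then r q * D 0 q r else 0)"
    if a: "a < mdim A" and b: "b < mdim A" and q: "q \<in> N" for a b q
  proof -
    have qU: "q \<in> U" using q N by blast
    note t = bf_tangent[OF bfE[OF a], of q]
    have "Es a q (\<lambda>p. Es b p (X i)) = Es a q (\<lambda>p. if b = i then (if i = 0 then r p else 1) else 0)"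
      by (rule tangent_germ[OF t bf_near[OF bfE[OF b] b_chart_X_near[OF bc i qU]] N(1) q]) (rule ex[OF b])
    also have "\<dots> = (if a = 0 \<and> b = 0 \<and> i = 0 then r q * D 0 q r else 0)"
    proof (cases "b = i \<and> i = 0")
      case True
      then have "Es a q (\<lambda>p. if b = i then (if i = 0 then r p else 1) else 0) = Es a q r" by simp
      also have "\<dots> = (if a = 0 then r q * D 0 q r else 0)"
        using Eapp[OF a q, of r] b_chart_Dr[OF bc a _ qU] by simp
      finally show ?thesis using True by simp
    next
      case False
      then have "Es a q (\<lambda>p. if b = i then (if i = 0 then r p else 1) else 0) = 0"
        using tangent_const[OF t, of 1] tangent_const[OF t, of 0] by (cases "b = i") auto
      then show ?thesis using False by auto
    qed
    finally show ?thesis .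
  qed
  have z: "coef N Es (lie_bracket A (Es l) (Es j)) i q * (if i = 0 then r q else 1) = 0" if q: "q \<in> N" for q
  proof -
    have qU: "q \<in> U" using q N by blast
    have "coef N Es (lie_bracket A (Es l) (Es j)) i q * (if i = 0 then r q else 1) = lie_bracket A (Es l) (Es j) q (X i)"
      using coef_props(2)[OF lf br q, of "X i"]
        adapted_frame_X[OF af q i, of "\<lambda>i. coef N Es (lie_bracket A (Es l) (Es j)) i q"] by simp
    also have "\<dots> = 0"
      unfolding lie_bracket_apply[OF b_chart_X_near[OF bc i qU]] val[OF l j q] val[OF j l q] by auto
    finally show ?thesis .
  qed
  show ?thesis
  proof (cases "i = 0")
    case True
    show ?thesis
    proof (rule continuous_zero_off_Z[OF N(1) coef_continuous[OF lf br i order_refl] _ y])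
      show "coef N Es (lie_bracket A (Es l) (Es j)) i q = 0" if "q \<in> N" "q \<notin> Z" for q
        using z[OF that(1)] True b_chart_Z[OF bc, of q] that N(2) by auto
    qed
  next
    case False
    then show ?thesis using z[OF y] by simp
  qed
qed

lemma b_form_bracket_frame:
  assumes G: "b_form G" and af: "adapted_frame U X D r N Es" and y: "y \<in> N"
    and ljk: "l < mdim A" "j < mdim A" "k < mdim A"
  shows "G (lie_bracket A (Es l) (Es j)) (Es k) y = 0"
proof -
  note lf = adapted_frame_local_frame[OF af]
  show ?thesis
    using b_form_frame_left[OF G lf y local_frame_bf[OF lf ljk(3)] bf_lie_bracket[OF local_frame_bf[OF lf ljk(1)] local_frame_bf[OF lf ljk(2)]]]
      adapted_frame_commute[OF af y ljk(1,2)] by simp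
qed

end

section \<open>The pulled-back b-form\<close>

context bmap
begin

context
  fixes \<omega>
  assumes \<omega>: "b_two_form B ZY \<omega>" and closed: "b_closed B ZY \<omega>"
begin

definition pull :: "'x vfield \<Rightarrow> 'x vfield \<Rightarrow> 'x \<Rightarrow> real" where
  "pull V W p = \<omega> (f p) (bd p (b_class A ZX p V)) (bd p (b_class A ZX p W))"

lemmas base_form = Y.b_two_form_b_form[OF \<omega>]

lemma pull_expand:
  assumes af: "Y.adapted_frame U C D r N Es" and p: "f p \<in> N" and V: "V \<in> X.bf" and W: "W \<in> X.bf"
  shows "pull V W p = (\<Sum>j<mdim B. \<Sum>k<mdim B.
    \<omega> (f p) (b_class B ZY (f p) (Es j)) (b_class B ZY (f p) (Es k)) * pcoef N Es V j p * pcoef N Es W k p)"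
proof -
  note lf = af_frame[OF af]
  define G where "G V W y = \<omega> y (b_class B ZY y V) (b_class B ZY y W)" for V W y
  have G: "Y.b_form G" unfolding G_def[abs_def] by (rule base_form)
  have bf: "(\<lambda>q g. \<Sum>j<mdim B. c j * Es j q g) \<in> Y.bf" for c
    by (rule Y.bf_const_lincomb) (use Y.local_frame_bf[OF lf] in auto)
  have "pull V W p = G (\<lambda>q g. \<Sum>j<mdim B. pcoef N Es V j p * Es j q g) (\<lambda>q g. \<Sum>j<mdim B. pcoef N Es W j p * Es j q g) (f p)"
    unfolding pull_def bd_class[OF af p V] bd_class[OF af p W] G_def ..
  also have "\<dots> = (\<Sum>j<mdim B. pcoef N Es V j p * G (Es j) (\<lambda>q g. \<Sum>j<mdim B. pcoef N Es W j p * Es j q g) (f p))"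
    unfolding Y.b_form_frame_left[OF G lf p bf bf]
    by (intro sum.cong refl) (simp add: Y.coef_frame_lincomb[OF lf p])
  also have "\<dots> = (\<Sum>j<mdim B. pcoef N Es V j p * (\<Sum>k<mdim B. pcoef N Es W k p * G (Es j) (Es k) (f p)))"
  proof (intro sum.cong refl arg_cong2[of _ _ _ _ "(*)"])
    fix j assume j: "j \<in> {..<mdim B}"
    then have "Es j \<in> Y.bf" using Y.local_frame_bf[OF lf] by simp
    from Y.b_form_frame[OF G lf p this bf]
    show "G (Es j) (\<lambda>q g. \<Sum>j<mdim B. pcoef N Es W j p * Es j q g) (f p) = (\<Sum>k<mdim B. pcoef N Es W k p * G (Es j) (Es k) (f p))"
      by (simp add: Y.coef_frame_lincomb[OF lf p])
  qed
  finally show ?thesis by (simp add: G_def sum_distrib_left mult_ac)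
qed

lemma pull_b_form: "X.b_form pull"
  unfolding X.b_form_def
proof (intro conjI ballI allI impI)
  fix V W p assume VW: "V \<in> X.bf" "W \<in> X.bf"
  have "bd p (b_class A ZX p V) \<in> b_fibre B ZY (f p)" if "V \<in> X.bf" for V
    using bd_bundle_map X.b_fibreI[OF that] unfolding b_bundle_map_def by blast
  then show "pull V W p = - pull W V p"
    using \<omega> VW unfolding pull_def b_two_form_def by blast
next
  fix U V W h k p assume b: "U \<in> X.bf" "V \<in> X.bf" "W \<in> X.bf" and hk: "smooth_fun A UNIV h" "smooth_fun A UNIV k"
  obtain U' C D r N Es where N: "f p \<in> N" "Y.adapted_frame U' C D r N Es" using Y.ex_adapted_frame_at[of "f p"] by blast
  note L = X.bf_lincomb2[OF hk b(2,3)]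
  have c: "pcoef N Es (\<lambda>q g. h q * V q g + k q * W q g) j p = h p * pcoef N Es V j p + k p * pcoef N Es W j p"
    if "j < mdim B" for j
    using pcoef_lincomb[OF N(2), of "{0, 1 :: nat}" "\<lambda>i. if i = 0 then h else k" "\<lambda>i. if i = 0 then V else W" p j]
      that b hk N(1) by simp
  show "pull U (\<lambda>q g. h q * V q g + k q * W q g) p = h p * pull U V p + k p * pull U W p"
    unfolding pull_expand[OF N(2,1) b(1) L] pull_expand[OF N(2,1) b(1,2)] pull_expand[OF N(2,1) b(1,3)]
    by (simp add: c sum_distrib_left sum.distrib algebra_simps)
next
  fix V W assume VW: "V \<in> X.bf" "W \<in> X.bf"
  show "smooth_fun A UNIV (pull V W)"
  proof (rule X.smooth_fun_local)
    fix p
    obtain U' C D r N Es where N: "f p \<in> N" "Y.adapted_frame U' C D r N Es" using Y.ex_adapted_frame_at[of "f p"] by blast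
    note lf = af_frame[OF N(2)] and oN = af_open[OF N(2)]
    note oS = f_open[OF oN]
    have "smooth_fun A (f -` N) (\<lambda>p. \<Sum>j<mdim B. \<Sum>k<mdim B.
        \<omega> (f p) (b_class B ZY (f p) (Es j)) (b_class B ZY (f p) (Es k)) * pcoef N Es V j p * pcoef N Es W k p)"
    proof (intro X.smooth_fun_sum X.smooth_fun_mult oS)
      fix j k assume "j \<in> {..<mdim B}" "k \<in> {..<mdim B}"
      then have jk: "j < mdim B" "k < mdim B" by auto
      have "smooth_fun B UNIV (\<lambda>y. \<omega> y (b_class B ZY y (Es j)) (b_class B ZY y (Es k)))"
        by (rule Y.b_form_smooth[OF base_form Y.local_frame_bf[OF lf jk(1)] Y.local_frame_bf[OF lf jk(2)]])
      from smooth_fun_subset[OF pullback[OF open_UNIV this]]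
      show "smooth_fun A (f -` N) (\<lambda>p. \<omega> (f p) (b_class B ZY (f p) (Es j)) (b_class B ZY (f p) (Es k)))" by auto
      show "smooth_fun A (f -` N) (pcoef N Es V j)" "smooth_fun A (f -` N) (pcoef N Es W k)"
        by (rule pcoef_smooth[OF N(2)]; fact)+
    qed
    then have "smooth_fun A (f -` N) (pull V W)"
      by (rule X.smooth_fun_cong[OF oS, rotated]) (use pull_expand[OF N(2) _ VW] in simp)
    then show "\<exists>M. open M \<and> p \<in> M \<and> smooth_fun A M (pull V W)" using oS N(1) by blast
  qed
qed

lemma pull_closed:
  assumes U: "U \<in> X.bf" and V: "V \<in> X.bf" and W: "W \<in> X.bf"
  shows "koszul2 A pull U V W p = 0"
proof -
  obtain S C D r N Es where N: "f p \<in> N" "Y.adapted_frame S C D r N Es" using Y.ex_adapted_frame_at[of "f p"] by blast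
  note af = N(2)
  note lf = af_frame[OF af] and oS = f_open[OF af_open[OF af]]
  have p: "p \<in> f -` N" using N(1) by simp
  let ?n = "mdim B"
  have bfE: "Es k \<in> Y.bf" if "k < ?n" for k by (rule Y.local_frame_bf[OF lf that])
  define G where "G V W y = \<omega> y (b_class B ZY y V) (b_class B ZY y W)" for V W y
  have G: "Y.b_form G" unfolding G_def[abs_def] by (rule base_form)
  define Om where "Om j k = G (Es j) (Es k)" for j k
  have Om_smooth: "smooth_fun B UNIV (Om j k)" if "j < ?n" "k < ?n" for j k
    unfolding Om_def by (rule Y.b_form_smooth[OF G bfE[OF that(1)] bfE[OF that(2)]])
  define om where "om j k = Om j k (f p)" for j k
  define E where "E l j k = Es l (f p) (Om j k)" for l j k
  define c where "c P j = pcoef N Es P j" for P j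
  have cs: "smooth_near A p (c P j)" if "P \<in> X.bf" "j < ?n" for P j
    unfolding c_def by (rule X.smooth_nearI[OF oS p pcoef_smooth[OF af that]])
  have Oms: "smooth_near A p (\<lambda>q. Om j k (f q))" if "j < ?n" "k < ?n" for j k
    by (rule pullback_near[OF Y.smooth_nearI[OF open_UNIV UNIV_I Om_smooth[OF that]]])
  have pe: "pull P Q q = (\<Sum>j<?n. \<Sum>k<?n. Om j k (f q) * c P j q * c Q k q)" if "P \<in> X.bf" "Q \<in> X.bf" "q \<in> f -` N" for P Q q
    using pull_expand[OF af _ that(1,2), of q] that(3) by (simp add: Om_def G_def c_def)
  define Sd where "Sd x y z xy xz = (\<Sum>j<?n. \<Sum>k<?n. (\<Sum>l<?n. x l * E l j k) * y j * z k +
      om j k * xy j * z k + om j k * y j * xz k)" for x y z xy xz :: "nat \<Rightarrow> real"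
  define T where "T x y = (\<Sum>j<?n. \<Sum>k<?n. om j k * x j * y k)" for x y :: "nat \<Rightarrow> real"
  have d: "P p (pull Q R) = Sd (\<lambda>j. c P j p) (\<lambda>j. c Q j p) (\<lambda>j. c R j p) (\<lambda>j. P p (c Q j)) (\<lambda>j. P p (c R j))"
    if P: "P \<in> X.bf" and Q: "Q \<in> X.bf" and R: "R \<in> X.bf" for P Q R
  proof -
    note t = X.bf_tangent[OF P, of p]
    have nm: "smooth_near A p (\<lambda>q. Om j k (f q) * c Q j q * c R k q)" if "j < ?n" "k < ?n" for j k
      by (intro X.smooth_near_mult Oms cs that Q R)
    have ns: "smooth_near A p (\<lambda>q. \<Sum>k<?n. Om j k (f q) * c Q j q * c R k q)" if "j < ?n" for j
      by (rule X.smooth_near_sum) (use nm[OF that] in auto)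
    have "P p (pull Q R) = P p (\<lambda>q. \<Sum>j<?n. \<Sum>k<?n. Om j k (f q) * c Q j q * c R k q)"
      by (rule X.tangent_germ[OF t X.smooth_near_UNIV[OF X.b_form_smooth[OF pull_b_form Q R]] oS p pe[OF Q R]])
    also have "\<dots> = (\<Sum>j<?n. P p (\<lambda>q. \<Sum>k<?n. Om j k (f q) * c Q j q * c R k q))"
      by (rule X.tangent_sum[OF t]) (use ns in auto)
    also have "\<dots> = (\<Sum>j<?n. \<Sum>k<?n. P p (\<lambda>q. Om j k (f q) * c Q j q * c R k q))"
      by (intro sum.cong refl X.tangent_sum[OF t]) (use nm in auto)
    also have "\<dots> = (\<Sum>j<?n. \<Sum>k<?n. (\<Sum>l<?n. c P l p * E l j k) * c Q j p * c R k p +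
      om j k * P p (c Q j) * c R k p + om j k * c Q j p * P p (c R k))"
    proof (intro sum.cong refl)
      fix j k assume "j \<in> {..<?n}" "k \<in> {..<?n}"
      then have jk: "j < ?n" "k < ?n" by auto
      note n1 = Oms[OF jk] and n2 = cs[OF Q jk(1)] and n3 = cs[OF R jk(2)]
      have e: "P p (\<lambda>q. Om j k (f q)) = (\<Sum>l<?n. c P l p * E l j k)"
        unfolding c_def E_def
        by (rule pcoef_expand[OF af P N(1) Y.smooth_nearI[OF open_UNIV UNIV_I Om_smooth[OF jk]]])
      show "P p (\<lambda>q. Om j k (f q) * c Q j q * c R k q) = (\<Sum>l<?n. c P l p * E l j k) * c Q j p * c R k p +
          om j k * P p (c Q j) * c R k p + om j k * c Q j p * P p (c R k)"
        unfolding X.tangent_mult[OF t X.smooth_near_mult[OF n1 n2] n3] X.tangent_mult[OF t n1 n2] e om_def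
        by (simp add: algebra_simps)
    qed
    finally show ?thesis unfolding Sd_def .
  qed
  have b: "pull (lie_bracket A P Q) R p = T (\<lambda>j. P p (c Q j) - Q p (c P j)) (\<lambda>j. c R j p)"
    if P: "P \<in> X.bf" and Q: "Q \<in> X.bf" and R: "R \<in> X.bf" for P Q R
  proof -
    have "c (lie_bracket A P Q) j p = P p (c Q j) - Q p (c P j)" if "j < ?n" for j
      unfolding c_def by (rule pcoef_bracket[OF af P Q N(1) that])
    then show ?thesis unfolding pe[OF X.bf_lie_bracket[OF P Q] R p] T_def om_def by simp
  qed
  have skew: "om j k = - om k j" if "j < ?n" "k < ?n" for j k
    unfolding om_def Om_def by (rule Y.b_form_skew[OF G bfE[OF that(1)] bfE[OF that(2)]])
  \<comment> \<open>Closedness of the form on three frame fields; the bracket terms of the Koszul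
    formula drop out because the frame commutes.\<close>
  have cl: "E l j k - E j l k + E k l j = 0" if ljk: "l < ?n" "j < ?n" "k < ?n" for l j k
  proof -
    have "koszul2 B G (Es l) (Es j) (Es k) (f p) = 0"
      using closed bfE ljk unfolding b_closed_def G_def[abs_def] by blast
    then show ?thesis
      unfolding koszul2_def Y.b_form_bracket_frame[OF G af N(1) ljk(1,2,3)]
        Y.b_form_bracket_frame[OF G af N(1) ljk(1,3,2)] Y.b_form_bracket_frame[OF G af N(1) ljk(2,3,1)]
      by (simp add: E_def Om_def)
  qed
  show ?thesis
    unfolding koszul2_def d[OF U V W] d[OF V U W] d[OF W U V] b[OF U V W] b[OF U W V] b[OF V W U]
    by (rule pullback_closed_algebra[OF skew cl Sd_def T_def])
qed

end

end

section \<open>Taming forms on compact b-manifolds\<close>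

text \<open>With \<open>m i j\<close> the value of a form on the \<open>i\<close>-th frame vector
  and \<open>J\<close> of the \<open>j\<close>-th, this is the value of the form on \<open>V\<close>
  and its image under \<open>J\<close>, as a function of the coefficients of \<open>V\<close>. The
  matrix need not be symmetric.\<close>

definition qform :: "nat \<Rightarrow> (nat \<Rightarrow> nat \<Rightarrow> real) \<Rightarrow> (nat \<Rightarrow> real) \<Rightarrow> real" where
  "qform n m c = (\<Sum>i<n. \<Sum>j<n. c i * c j * m i j)"

lemma qform_cong: "(\<And>i. i < n \<Longrightarrow> c i = d i) \<Longrightarrow> qform n m c = qform n m d"
  unfolding qform_def by (intro sum.cong refl) auto

lemma qform_scale: "qform n m (\<lambda>i. s * c i) = s\<^sup>2 * qform n m c"
  unfolding qform_def by (simp add: sum_distrib_left power2_eq_square mult_ac)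

text \<open>Compactness of the unit sphere makes the choice of \<open>t\<close> uniform in \<open>c\<close>, locally in \<open>x\<close>.\<close>
lemma qform_perturbation:
  fixes mP mQ :: "'x::topological_space \<Rightarrow> nat \<Rightarrow> nat \<Rightarrow> real"
  assumes N: "open N" "x0 \<in> N"
    and cont: "\<And>i j. i < n \<Longrightarrow> j < n \<Longrightarrow> continuous_on N (\<lambda>x. mP x i j)"
      "\<And>i j. i < n \<Longrightarrow> j < n \<Longrightarrow> continuous_on N (\<lambda>x. mQ x i j)"
    and pos: "\<And>x c i. x \<in> N \<Longrightarrow> i < n \<Longrightarrow> c i \<noteq> 0 \<Longrightarrow> 0 \<le> qform n (mP x) c"
      "\<And>x c i. x \<in> N \<Longrightarrow> i < n \<Longrightarrow> c i \<noteq> 0 \<Longrightarrow> qform n (mP x) c = 0 \<Longrightarrow> 0 < qform n (mQ x) c"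
  shows "\<exists>M t0. open M \<and> x0 \<in> M \<and> M \<subseteq> N \<and> 0 < t0 \<and>
    (\<forall>t x c i. 0 < t \<longrightarrow> t \<le> t0 \<longrightarrow> x \<in> M \<longrightarrow> i < n \<longrightarrow> c i \<noteq> 0 \<longrightarrow> 0 < qform n (mP x) c + t * qform n (mQ x) c)"
proof -
  define S where "S = {c :: nat \<Rightarrow> real. (\<forall>i\<ge>n. c i = 0) \<and> (\<Sum>i<n. (c i)\<^sup>2) = 1}"
  have S: "compact S" unfolding S_def by (rule compact_unit_sphere)
  have Sne: "\<exists>i<n. c i \<noteq> 0" if "c \<in> S" for c
  proof (rule ccontr)
    assume "\<not> ?thesis"
    then have "(\<Sum>i<n. (c i)\<^sup>2) = 0" by simp
    then show False using that by (simp add: S_def)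
  qed
  define p where "p = (\<lambda>z :: 'x \<times> (nat \<Rightarrow> real). qform n (mP (fst z)) (snd z))"
  define q where "q = (\<lambda>z :: 'x \<times> (nat \<Rightarrow> real). qform n (mQ (fst z)) (snd z))"
  have coord: "continuous_on T (\<lambda>z :: 'x \<times> (nat \<Rightarrow> real). snd z i)" for T i
    by (rule continuous_on_compose2[OF continuous_on_product_coordinates continuous_on_snd[OF continuous_on_id]]) auto
  have qc: "continuous_on (N \<times> UNIV) (\<lambda>z :: 'x \<times> (nat \<Rightarrow> real). qform n (m (fst z)) (snd z))"
    if "\<And>i j. i < n \<Longrightarrow> j < n \<Longrightarrow> continuous_on N (\<lambda>x. m x i j)" for m :: "'x \<Rightarrow> nat \<Rightarrow> nat \<Rightarrow> real"
    unfolding qform_def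
  proof (intro continuous_on_sum continuous_on_mult coord)
    fix i j assume "i \<in> {..<n}" "j \<in> {..<n}"
    then have "continuous_on N (\<lambda>x. m x i j)" using that by simp
    then show "continuous_on (N \<times> UNIV) (\<lambda>z :: 'x \<times> (nat \<Rightarrow> real). m (fst z) i j)"
      by (rule continuous_on_compose2[OF _ continuous_on_fst[OF continuous_on_id]]) auto
  qed
  have pc: "continuous_on (N \<times> UNIV) p" unfolding p_def by (rule qc[OF cont(1)])
  have qc: "continuous_on (N \<times> UNIV) q" unfolding q_def by (rule qc[OF cont(2)])
  have oN: "open (N \<times> (UNIV :: (nat \<Rightarrow> real) set))" by (rule open_Times[OF N(1) open_UNIV])
  have loc: "\<exists>M B \<tau>. open M \<and> x0 \<in> M \<and> M \<subseteq> N \<and> open B \<and> c \<in> B \<and> 0 < \<tau> \<and>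
      (\<forall>t x d. 0 < t \<longrightarrow> t \<le> \<tau> \<longrightarrow> x \<in> M \<longrightarrow> d \<in> B \<inter> S \<longrightarrow> 0 < p (x, d) + t * q (x, d))" if c: "c \<in> S" for c
  proof -
    obtain i where i: "i < n" "c i \<noteq> 0" using Sne[OF c] by blast
    have "\<exists>O' \<tau>. open O' \<and> (x0, c) \<in> O' \<and> O' \<subseteq> N \<times> UNIV \<and> 0 < \<tau> \<and>
      (\<forall>t x d. 0 < t \<longrightarrow> t \<le> \<tau> \<longrightarrow> (x, d) \<in> O' \<longrightarrow> d \<in> S \<longrightarrow> 0 < p (x, d) + t * q (x, d))"
    proof (cases "q (x0, c) > 0")
      case True
      let ?O = "(N \<times> UNIV) \<inter> q -` {0<..}"
      have "open ?O" by (rule continuous_open_preimage[OF qc oN]) auto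
      moreover have "0 < p (x, d) + t * q (x, d)" if "0 < t" "(x, d) \<in> ?O" "d \<in> S" for t x d
      proof -
        note dS = that(3)
        obtain j where "j < n" "d j \<noteq> 0" using Sne[OF dS] by blast
        then have "0 \<le> p (x, d)" using pos(1)[of x j d] that(2) by (simp add: p_def)
        moreover have "0 < t * q (x, d)" using that by simp
        ultimately show ?thesis by linarith
      qed
      ultimately show ?thesis using True N(2) by (intro exI[of _ ?O] exI[of _ 1]) auto
    next
      case False
      \<comment> \<open>Here \<open>q (x0, c)\<close> is not positive, so by hypothesis
        \<open>p (x0, c)\<close> is. Nearby, \<open>p\<close> stays above
        \<open>\<delta> / 2\<close> and \<open>q\<close> above \<open>- m\<close>; for
        \<open>t\<close> up to \<open>\<delta> / (4 * m)\<close> the perturbation costs at most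
        \<open>\<delta> / 4\<close>. Adding 1 makes \<open>m\<close> positive and \<open>- m\<close>
        a strict lower bound.\<close>
      define \<delta> where "\<delta> = p (x0, c)"
      have "\<delta> > 0"
        using pos[of x0 i c] N(2) i False by (fastforce simp: p_def q_def \<delta>_def)
      define m where "m = \<bar>q (x0, c)\<bar> + 1"
      have m: "m > 0" by (simp add: m_def add_pos_nonneg)
      let ?O = "((N \<times> UNIV) \<inter> p -` {\<delta>/2<..}) \<inter> ((N \<times> UNIV) \<inter> q -` {-m<..})"
      have "open ?O"
        by (rule open_Int; rule continuous_open_preimage[OF _ oN]) (auto intro: pc qc)
      moreover have "0 < p (x, d) + t * q (x, d)" if t: "0 < t" "t \<le> \<delta> / (4 * m)" and xd: "(x, d) \<in> ?O" for t x d
      proof -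
        have "t * (- m) \<le> t * q (x, d)" using t xd by (intro mult_left_mono) auto
        moreover have "t * m \<le> \<delta> / 4" using t(2) m by (simp add: field_simps)
        ultimately have "- (\<delta> / 4) \<le> t * q (x, d)" by simp
        moreover have "p (x, d) > \<delta> / 2" using xd by simp
        ultimately show ?thesis using \<open>\<delta> > 0\<close> by simp
      qed
      moreover have "(x0, c) \<in> ?O" using N(2) \<open>\<delta> > 0\<close> by (auto simp: \<delta>_def m_def)
      moreover have "0 < \<delta> / (4 * m)" using \<open>\<delta> > 0\<close> m by simp
      ultimately show ?thesis by (intro exI[of _ ?O] exI[of _ "\<delta> / (4 * m)"]) auto
    qed
    then obtain O' \<tau> where O': "open O'" "(x0, c) \<in> O'" "O' \<subseteq> N \<times> UNIV" "0 < \<tau>"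
      "\<forall>t x d. 0 < t \<longrightarrow> t \<le> \<tau> \<longrightarrow> (x, d) \<in> O' \<longrightarrow> d \<in> S \<longrightarrow> 0 < p (x, d) + t * q (x, d)" by blast
    obtain M B where MB': "open M" "open B" "(x0, c) \<in> M \<times> B" "M \<times> B \<subseteq> O'"
      by (rule open_prod_elim[OF O'(1,2)])
    then have MB: "open M" "open B" "x0 \<in> M" "c \<in> B" "M \<times> B \<subseteq> O'" by blast+
    have "M \<subseteq> N" using MB(4,5) O'(3) by blast
    then show ?thesis using MB O'(4,5) by (intro exI[of _ M] exI[of _ B] exI[of _ \<tau>]) blast
  qed
  then obtain M B \<tau> where MB: "\<And>c. c \<in> S \<Longrightarrow> open (M c) \<and> x0 \<in> M c \<and> M c \<subseteq> N \<and> open (B c) \<and> c \<in> B c \<and> 0 < \<tau> c \<and>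
      (\<forall>t x d. 0 < t \<longrightarrow> t \<le> \<tau> c \<longrightarrow> x \<in> M c \<longrightarrow> d \<in> B c \<inter> S \<longrightarrow> 0 < p (x, d) + t * q (x, d))"
    by metis
  obtain C where C: "C \<subseteq> S" "finite C" "S \<subseteq> (\<Union>c\<in>C. B c)"
    using compactE_image[OF S, of S B] MB by blast
  define M' where "M' = N \<inter> (\<Inter>c\<in>C. M c)"
  define t0 where "t0 = Min (insert 1 (\<tau> ` C))"
  have M': "open M'" "x0 \<in> M'" "M' \<subseteq> N"
    using C(1,2) MB N unfolding M'_def by (auto intro!: open_Int open_INT)
  have "0 < \<tau> c" if "c \<in> C" for c using MB C(1) that by blast
  then have t0: "0 < t0" unfolding t0_def using C(2) by (subst Min_gr_iff) auto
  have t0_le: "t0 \<le> \<tau> c" if "c \<in> C" for c unfolding t0_def using C(2) that by (intro Min_le) auto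
  have sphere: "0 < p (x, d) + t * q (x, d)" if t: "0 < t" "t \<le> t0" and x: "x \<in> M'" and d: "d \<in> S" for t x d
  proof -
    obtain c where c: "c \<in> C" "d \<in> B c" using C(3) d by blast
    have "x \<in> M c" "t \<le> \<tau> c" using x c t t0_le[OF c(1)] by (auto simp: M'_def)
    then show ?thesis using MB[of c] C(1) c t(1) d by blast
  qed
  have "0 < qform n (mP x) c + t * qform n (mQ x) c"
    if t: "0 < t" "t \<le> t0" and x: "x \<in> M'" and i: "i < n" "c i \<noteq> 0" for t x c i
  proof -
    define s where "s = sqrt (\<Sum>i<n. (c i)\<^sup>2)"
    have "(c i)\<^sup>2 \<le> (\<Sum>i<n. (c i)\<^sup>2)" by (rule member_le_sum) (use i in auto)
    moreover have "0 < (c i)\<^sup>2" using i by simp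
    ultimately have pos': "0 < (\<Sum>i<n. (c i)\<^sup>2)" by linarith
    then have s: "s > 0" "s\<^sup>2 = (\<Sum>i<n. (c i)\<^sup>2)" by (auto simp: s_def)
    define d where "d i = (if i < n then inverse s * c i else 0)" for i
    have "(\<Sum>i<n. (d i)\<^sup>2) = (inverse s)\<^sup>2 * (\<Sum>i<n. (c i)\<^sup>2)"
      by (simp add: d_def power_mult_distrib sum_distrib_left)
    also have "\<dots> = 1" using s by (simp add: power_inverse s(2)[symmetric])
    finally have "d \<in> S" by (simp add: S_def d_def)
    from sphere[OF t x this] have 0: "0 < qform n (mP x) d + t * qform n (mQ x) d" by (simp add: p_def q_def)
    have sc: "qform n m d = (inverse s)\<^sup>2 * qform n m c" for m
      using qform_cong[of n d "\<lambda>i. inverse s * c i" m] qform_scale[of n m "inverse s" c] by (simp add: d_def)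
    have "0 < (inverse s)\<^sup>2 * (qform n (mP x) c + t * qform n (mQ x) c)"
      using 0 unfolding sc by (simp add: algebra_simps)
    then show ?thesis using s(1) by (simp add: zero_less_mult_iff)
  qed
  then show ?thesis using M' t0 by (intro exI[of _ M'] exI[of _ t0]) blast
qed

section \<open>The almost complex structure in local frames\<close>

context bmfd
begin

context
  fixes J
  assumes J: "b_almost_complex A Z J"
begin

lemma J_fibre: "u \<in> b_fibre A Z x \<Longrightarrow> J x u \<in> b_fibre A Z x"
  using J unfolding b_almost_complex_def by blast

lemma J_square: "u \<in> b_fibre A Z x \<Longrightarrow> J x (J x u) = b_lincomb A Z x [-1] [u]"
  using J unfolding b_almost_complex_def by blast

lemma J_linear: "u \<in> b_fibre A Z x \<Longrightarrow> v \<in> b_fibre A Z x \<Longrightarrow>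
    J x (b_lincomb A Z x [a, b] [u, v]) = b_lincomb A Z x [a, b] [J x u, J x v]"
  using J unfolding b_almost_complex_def by blast

lemma J_linear_class:
  assumes V: "V \<in> bf" "V' \<in> bf" "J x (bcl x V) = bcl x V'" and W: "W \<in> bf" "W' \<in> bf" "J x (bcl x W) = bcl x W'"
  shows "J x (bcl x (\<lambda>q g. a * V q g + b * W q g)) = bcl x (\<lambda>q g. a * V' q g + b * W' q g)"
  using J_linear[OF b_fibreI[OF V(1)] b_fibreI[OF W(1)], of x a b]
  unfolding V(3) W(3) b_lincomb_class2[OF V(1) W(1)] b_lincomb_class2[OF V(2) W(2)] .

lemma J_zero: "J x (bcl x (\<lambda>q g. 0)) = bcl x (\<lambda>q g. 0)"
proof -
  obtain V' where V': "V' \<in> bf" "J x (bcl x (\<lambda>q g. 0)) = bcl x V'"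
    using b_fibreE[OF J_fibre[OF b_fibreI[OF bf_zero]]] by metis
  from J_linear_class[OF bf_zero V' bf_zero V', of 0 0] show ?thesis by simp
qed

lemma J_sum:
  assumes "finite I" "\<And>i. i \<in> I \<Longrightarrow> V i \<in> bf" "\<And>i. i \<in> I \<Longrightarrow> V' i \<in> bf" "\<And>i. i \<in> I \<Longrightarrow> J x (bcl x (V i)) = bcl x (V' i)"
  shows "J x (bcl x (\<lambda>q g. \<Sum>i\<in>I. c i * V i q g)) = bcl x (\<lambda>q g. \<Sum>i\<in>I. c i * V' i q g)"
  using assms
proof (induction I rule: finite_induct)
  case empty
  then show ?case using J_zero by simp
next
  case (insert i I)
  have "J x (bcl x (\<lambda>q g. c i * V i q g + 1 * (\<lambda>q g. \<Sum>i\<in>I. c i * V i q g) q g)) =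
      bcl x (\<lambda>q g. c i * V' i q g + 1 * (\<lambda>q g. \<Sum>i\<in>I. c i * V' i q g) q g)"
  proof (rule J_linear_class)
    show "(\<lambda>q g. \<Sum>i\<in>I. c i * V i q g) \<in> bf" "(\<lambda>q g. \<Sum>i\<in>I. c i * V' i q g) \<in> bf"
      by (rule bf_const_lincomb; use insert in simp)+
  qed (use insert in auto)
  then show ?case using insert.hyps by simp
qed

lemma J_frame:
  assumes lf: "local_frame N Es"
  shows "\<exists>a. (\<forall>i<mdim A. \<forall>k<mdim A. continuous_on N (a i k)) \<and>
    (\<forall>i<mdim A. \<forall>x\<in>N. J x (bcl x (Es i)) = bcl x (\<lambda>q g. \<Sum>k<mdim A. a i k x * Es k q g))"
proof -
  have "\<forall>i. \<exists>a. i < mdim A \<longrightarrow> (\<forall>k<mdim A. continuous_on N (a k)) \<and>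
      (\<forall>x\<in>N. J x (bcl x (Es i)) = bcl x (\<lambda>q g. \<Sum>k<mdim A. a k x * Es k q g))"
  proof
    fix i
    show "\<exists>a. i < mdim A \<longrightarrow> (\<forall>k<mdim A. continuous_on N (a k)) \<and>
        (\<forall>x\<in>N. J x (bcl x (Es i)) = bcl x (\<lambda>q g. \<Sum>k<mdim A. a k x * Es k q g))"
    proof (cases "i < mdim A")
      case True
      from J[unfolded b_almost_complex_def, THEN conjunct2, rule_format, OF local_frame_b_frame[OF lf] local_frame_bf[OF lf True]]
      show ?thesis unfolding frame_lincomb[OF lf] by blast
    qed simp
  qed
  from choice[OF this] show ?thesis by blast
qed

text \<open>Since \<open>J\<close> is only continuous, \<open>V'\<close> is not a section
  \<open>J V\<close> but any b-field representing its value at the single point \<open>x\<close>. In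
  a frame both forms become quadratic forms with continuous matrices, so
  \<open>qform_perturbation\<close> provides a bound for \<open>t\<close> near every point, and
  finitely many of these bounds suffice on a compact space.\<close>

lemma tame_perturbation:
  assumes comp: "compact (UNIV :: 'x set)" and P: "b_form P" and H: "b_form H"
    and pos: "\<And>x V V'. V \<in> bf \<Longrightarrow> V' \<in> bf \<Longrightarrow> J x (bcl x V) = bcl x V' \<Longrightarrow> bcl x V \<noteq> b_zero A Z x \<Longrightarrow>
      0 \<le> P V V' x \<and> (P V V' x = 0 \<longrightarrow> 0 < H V V' x)"
  obtains t where "\<And>x V V'. V \<in> bf \<Longrightarrow> V' \<in> bf \<Longrightarrow> J x (bcl x V) = bcl x V' \<Longrightarrow> bcl x V \<noteq> b_zero A Z x \<Longrightarrow>
      0 < P V V' x + t * H V V' x"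
proof -
  let ?n = "mdim A"
  have loc: "\<exists>M t0. open M \<and> x0 \<in> M \<and> 0 < t0 \<and> (\<forall>t x V V'. 0 < t \<longrightarrow> t \<le> t0 \<longrightarrow> x \<in> M \<longrightarrow> V \<in> bf \<longrightarrow> V' \<in> bf \<longrightarrow>
      J x (bcl x V) = bcl x V' \<longrightarrow> bcl x V \<noteq> b_zero A Z x \<longrightarrow> 0 < P V V' x + t * H V V' x)" for x0
  proof -
    obtain N Es where N: "x0 \<in> N" "local_frame N Es" by (rule ex_coordinates)
    note lf = N(2)
    have Eb: "Es i \<in> bf" if "i < ?n" for i by (rule local_frame_bf[OF lf that])
    obtain a where a: "(\<forall>i<?n. \<forall>k<?n. continuous_on N (a i k)) \<and>
        (\<forall>i<?n. \<forall>x\<in>N. J x (bcl x (Es i)) = bcl x (\<lambda>q g. \<Sum>k<?n. a i k x * Es k q g))"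
      using J_frame[OF lf] ..
    note ac = a[THEN conjunct1, rule_format] and aJ = a[THEN conjunct2, rule_format]
    define m where "m F x i j = (\<Sum>k<?n. a j k x * F (Es i) (Es k) x)" for F :: "'x vfield \<Rightarrow> 'x vfield \<Rightarrow> 'x \<Rightarrow> real" and x i j
    have mc: "continuous_on N (\<lambda>x. m F x i j)" if F: "b_form F" and ij: "i < ?n" "j < ?n" for F i j
      unfolding m_def
    proof (intro continuous_on_sum continuous_on_mult)
      fix k assume "k \<in> {..<?n}"
      then have k: "k < ?n" by simp
      show "continuous_on N (a j k)" by (rule ac[OF ij(2) k])
      show "continuous_on N (F (Es i) (Es k))"
        by (rule continuous_on_subset[OF smooth_fun_continuous[OF open_UNIV b_form_smooth[OF F Eb[OF ij(1)] Eb[OF k]]]]) simp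
    qed
    have bfE: "(\<lambda>q g. \<Sum>k<?n. c k * Es k q g) \<in> bf" for c by (rule bf_const_lincomb) (use Eb in auto)
    define JE where "JE x i = (\<lambda>q g. \<Sum>k<?n. a i k x * Es k q g)" for x i
    have JEb: "JE x i \<in> bf" for x i unfolding JE_def by (rule bfE)
    have Fq: "F V V' x = qform ?n (m F x) (\<lambda>i. coef N Es V i x)"
      if F: "b_form F" and x: "x \<in> N" and V: "V \<in> bf" "V' \<in> bf" "J x (bcl x V) = bcl x V'" for F x V V'
    proof -
      let ?c = "\<lambda>i. coef N Es V i x"
      have "bcl x V' = J x (bcl x (\<lambda>q g. \<Sum>i<?n. ?c i * Es i q g))"
        using V(3) class_frame_lincomb[OF lf x V(1), of ?c] by simp
      also have "\<dots> = bcl x (\<lambda>q g. \<Sum>i<?n. ?c i * JE x i q g)"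
        by (rule J_sum) (use Eb JEb aJ[OF _ x] in \<open>auto simp: JE_def\<close>)
      finally have V': "bcl x V' = bcl x (\<lambda>q g. \<Sum>i<?n. ?c i * JE x i q g)" .
      have JV: "(\<lambda>q g. \<Sum>i<?n. ?c i * JE x i q g) \<in> bf" by (rule bf_const_lincomb) (use JEb in auto)
      have "F V V' x = (\<Sum>i<?n. ?c i * F (Es i) V' x)" by (rule b_form_frame_left[OF F lf x V(2,1)])
      also have "\<dots> = (\<Sum>i<?n. \<Sum>j<?n. ?c i * ?c j * m F x i j)"
      proof (rule sum.cong[OF refl])
        fix i assume "i \<in> {..<?n}"
        then have i: "Es i \<in> bf" using Eb by simp
        have "F (Es i) V' x = F (Es i) (\<lambda>q g. \<Sum>j<?n. ?c j * JE x j q g) x"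
          by (rule b_form_class_cong[OF F i V(2) JV V'])
        also have "\<dots> = (\<Sum>j<?n. ?c j * F (Es i) (JE x j) x)"
          using b_form_sum[OF F i, of "{..<?n}" "\<lambda>j _. ?c j" "JE x"] JEb smooth_fun_const by simp
        also have "\<dots> = (\<Sum>j<?n. ?c j * m F x i j)"
          using b_form_sum[OF F i, of "{..<?n}" "\<lambda>k _. a _ k x" Es x] Eb smooth_fun_const
          by (simp add: JE_def m_def)
        finally show "?c i * F (Es i) V' x = (\<Sum>j<?n. ?c i * ?c j * m F x i j)"
          by (simp add: sum_distrib_left mult.assoc)
      qed
      finally show ?thesis by (simp add: qform_def)
    qed
    \<comment> \<open>Every nonzero coefficient vector comes from a section, which transfers the
      sign hypotheses on sections to the quadratic forms.\<close>
    have ex: "\<exists>V V'. V \<in> bf \<and> V' \<in> bf \<and> J x (bcl x V) = bcl x V' \<and> bcl x V \<noteq> b_zero A Z x \<and> (\<forall>i<?n. coef N Es V i x = c i)"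
      if x: "x \<in> N" and i: "i < ?n" "c i \<noteq> 0" for x c i
    proof -
      let ?V = "\<lambda>q g. \<Sum>k<?n. c k * Es k q g"
      obtain V' where V': "V' \<in> bf" "J x (bcl x ?V) = bcl x V'"
        by (rule b_fibreE[OF J_fibre[OF b_fibreI[OF bfE[of c], of x]]])
      have cV: "coef N Es ?V k x = c k" if "k < ?n" for k by (rule coef_frame_lincomb[OF lf x that])
      have "bcl x ?V \<noteq> b_zero A Z x"
      proof
        assume "bcl x ?V = b_zero A Z x"
        then have "coef N Es ?V i x = 0" using b_class_zero_iff[OF lf x bfE[of c]] i(1) by blast
        then show False using cV[OF i(1)] i(2) by simp
      qed
      then show ?thesis using bfE[of c] V' cV by blast
    qed
    have "\<exists>M t0. open M \<and> x0 \<in> M \<and> M \<subseteq> N \<and> 0 < t0 \<and> (\<forall>t x c i. 0 < t \<longrightarrow> t \<le> t0 \<longrightarrow> x \<in> M \<longrightarrow> i < ?n \<longrightarrow> c i \<noteq> 0 \<longrightarrow>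
        0 < qform ?n (m P x) c + t * qform ?n (m H x) c)"
    proof (rule qform_perturbation[OF local_frame_open[OF lf] N(1) mc[OF P] mc[OF H]])
      fix x i and c :: "nat \<Rightarrow> real" assume x: "x \<in> N" and i: "i < ?n" "c i \<noteq> 0"
      obtain V V' where V: "V \<in> bf" "V' \<in> bf" "J x (bcl x V) = bcl x V'" "bcl x V \<noteq> b_zero A Z x"
        "\<forall>i<?n. coef N Es V i x = c i" using ex[where x=x and c=c and i=i, OF x i] by blast
      have q: "F V V' x = qform ?n (m F x) c" if "b_form F" for F
        unfolding Fq[OF that x V(1-3)] by (rule qform_cong) (use V(5) in blast)
      show "0 \<le> qform ?n (m P x) c" "qform ?n (m P x) c = 0 \<Longrightarrow> 0 < qform ?n (m H x) c"
        using pos[OF V(1-4)] q[OF P] q[OF H] by auto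
    qed
    then obtain M t0 where M: "open M" "x0 \<in> M" "M \<subseteq> N" "0 < t0"
      "\<forall>t x c i. 0 < t \<longrightarrow> t \<le> t0 \<longrightarrow> x \<in> M \<longrightarrow> i < ?n \<longrightarrow> c i \<noteq> 0 \<longrightarrow> 0 < qform ?n (m P x) c + t * qform ?n (m H x) c"
      by blast
    have "0 < P V V' x + t * H V V' x" if t: "0 < t" "t \<le> t0" and x: "x \<in> M" and V: "V \<in> bf" "V' \<in> bf"
      "J x (bcl x V) = bcl x V'" "bcl x V \<noteq> b_zero A Z x" for t x V V'
    proof -
      have xN: "x \<in> N" using x M(3) by blast
      obtain i where "i < ?n" "coef N Es V i x \<noteq> 0" using b_class_zero_iff[OF lf xN V(1)] V(4) by blast
      then have "0 < qform ?n (m P x) (\<lambda>i. coef N Es V i x) + t * qform ?n (m H x) (\<lambda>i. coef N Es V i x)"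
        using M(5)[rule_format, OF t x, of i "\<lambda>i. coef N Es V i x"] by blast
      then show ?thesis unfolding Fq[OF P xN V(1-3)] Fq[OF H xN V(1-3)] .
    qed
    then show ?thesis using M by (intro exI[of _ M] exI[of _ t0]) blast
  qed
  then have "\<forall>y. \<exists>M t0. open M \<and> y \<in> M \<and> 0 < t0 \<and> (\<forall>t x V V'. 0 < t \<longrightarrow> t \<le> t0 \<longrightarrow> x \<in> M \<longrightarrow>
      V \<in> bf \<longrightarrow> V' \<in> bf \<longrightarrow> J x (bcl x V) = bcl x V' \<longrightarrow> bcl x V \<noteq> b_zero A Z x \<longrightarrow> 0 < P V V' x + t * H V V' x)" ..
  from choice[OF this] obtain M where "\<forall>y. \<exists>t0. open (M y) \<and> y \<in> M y \<and> 0 < t0 \<and> (\<forall>t x V V'. 0 < t \<longrightarrow> t \<le> t0 \<longrightarrow> x \<in> M y \<longrightarrow>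
      V \<in> bf \<longrightarrow> V' \<in> bf \<longrightarrow> J x (bcl x V) = bcl x V' \<longrightarrow> bcl x V \<noteq> b_zero A Z x \<longrightarrow> 0 < P V V' x + t * H V V' x)" ..
  from choice[OF this] obtain t0 where M: "\<forall>y. open (M y) \<and> y \<in> M y \<and> 0 < t0 y \<and> (\<forall>t x V V'. 0 < t \<longrightarrow> t \<le> t0 y \<longrightarrow> x \<in> M y \<longrightarrow>
      V \<in> bf \<longrightarrow> V' \<in> bf \<longrightarrow> J x (bcl x V) = bcl x V' \<longrightarrow> bcl x V \<noteq> b_zero A Z x \<longrightarrow> 0 < P V V' x + t * H V V' x)" ..
  note My = M[rule_format, THEN conjunct1] M[rule_format, THEN conjunct2, THEN conjunct1]
    M[rule_format, THEN conjunct2, THEN conjunct2, THEN conjunct1]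
  note Mpos = M[THEN spec, THEN conjunct2, THEN conjunct2, THEN conjunct2, rule_format]
  have "UNIV \<subseteq> (\<Union>y\<in>UNIV. M y)" using My(2) by auto
  from compactE_image[OF comp My(1) this] obtain C where C: "finite C" "UNIV \<subseteq> (\<Union>y\<in>C. M y)" by metis
  define t where "t = Min (insert 1 (t0 ` C))"
  have "0 < t0 y" for y by (rule My(3))
  then have t: "0 < t" unfolding t_def using C(1) by (subst Min_gr_iff) auto
  have t_le: "t \<le> t0 y" if "y \<in> C" for y unfolding t_def using C(1) that by (intro Min_le) auto
  show thesis
  proof (rule that[of t])
    fix x V V' assume V: "V \<in> bf" "V' \<in> bf" "J x (bcl x V) = bcl x V'" "bcl x V \<noteq> b_zero A Z x"
    obtain y where y: "y \<in> C" "x \<in> M y" using C(2) by blast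
    show "0 < P V V' x + t * H V V' x" by (rule Mpos[OF t t_le[OF y(1)] y(2) V])
  qed
qed

end

lemma b_form_add:
  assumes G: "b_form G" and H: "b_form H"
  shows "b_form (\<lambda>V W p. G V W p + t * H V W p)"
  unfolding b_form_def
proof (intro conjI ballI allI impI)
  show "G V W p + t * H V W p = - (G W V p + t * H W V p)" if "V \<in> bf" "W \<in> bf" for V W p
    using b_form_skew[OF G that, of p] b_form_skew[OF H that, of p] by (simp add: algebra_simps)
  show "G U (\<lambda>q g. h q * V q g + k q * W q g) p + t * H U (\<lambda>q g. h q * V q g + k q * W q g) p =
      h p * (G U V p + t * H U V p) + k p * (G U W p + t * H U W p)"
    if "U \<in> bf" "V \<in> bf" "W \<in> bf" "smooth_fun A UNIV h" "smooth_fun A UNIV k" for U V W h k p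
    unfolding b_form_linear[OF G that] b_form_linear[OF H that] by (simp add: algebra_simps)
  show "smooth_fun A UNIV (\<lambda>p. G V W p + t * H V W p)" if "V \<in> bf" "W \<in> bf" for V W
    by (rule smooth_fun_add[OF open_UNIV b_form_smooth[OF G that] smooth_fun_cmult[OF open_UNIV b_form_smooth[OF H that]]])
qed

lemma koszul2_add:
  assumes G: "b_form G" and H: "b_form H" and b: "U \<in> bf" "V \<in> bf" "W \<in> bf"
  shows "koszul2 A (\<lambda>V W p. G V W p + t * H V W p) U V W x = koszul2 A G U V W x + t * koszul2 A H U V W x"
proof -
  have d: "T x (\<lambda>p. G P Q p + t * H P Q p) = T x (G P Q) + t * T x (H P Q)" if "T \<in> bf" "P \<in> bf" "Q \<in> bf" for T P Q
    using tangent_linear[OF bf_tangent[OF that(1)] smooth_near_UNIV[OF b_form_smooth[OF G that(2,3)]]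
        smooth_near_UNIV[OF b_form_smooth[OF H that(2,3)]], of x 1 t] by simp
  show ?thesis unfolding koszul2_def d[OF b] d[OF b(2,1,3)] d[OF b(3,1,2)] by (simp add: algebra_simps)
qed

lemma dR_class_self:
  assumes "open W" "closed_two_form A W \<eta>"
  shows "\<eta> \<in> dR_class A W \<eta>"
proof -
  have "one_form A W (\<lambda>x v. 0)"
    unfolding one_form_def linear_on_tangent_def using smooth_fun_const[OF assms(1)] by simp
  moreover have "koszul1 A (\<lambda>V p. 0) U V x = 0" if "U \<in> vector_fields A W" "V \<in> vector_fields A W" "x \<in> W" for U V x
    unfolding koszul1_def using tangent_const[OF vector_fieldD[OF that(1,3)]] tangent_const[OF vector_fieldD[OF that(2,3)]] by simp
  ultimately show ?thesis unfolding dR_class_def cohomologous_def using assms(2) by fastforce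
qed

end

section \<open>From symplectic b-forms to log-symplectic structures\<close>

context bmfd
begin

section \<open>Cotangent vectors\<close>

lemma cotangent_linear:
  "\<alpha> \<in> cotangent_space A x \<Longrightarrow> v \<in> tangent_space A x \<Longrightarrow> w \<in> tangent_space A x \<Longrightarrow>
    \<alpha> (\<lambda>g. a * v g + b * w g) = a * \<alpha> v + b * \<alpha> w"
  unfolding cotangent_space_def linear_on_tangent_def by blast

lemma cotangent_sum:
  assumes \<alpha>: "\<alpha> \<in> cotangent_space A x" and "finite I" "\<And>i. i \<in> I \<Longrightarrow> v i \<in> tangent_space A x"
  shows "\<alpha> (\<lambda>g. \<Sum>i\<in>I. c i * v i g) = (\<Sum>i\<in>I. c i * \<alpha> (v i))"
  using assms(2,3)
proof (induction I rule: finite_induct)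
  case empty
  have t: "bf_zero_vec \<in> tangent_space A x" if "bf_zero_vec = (\<lambda>g. 0)" for bf_zero_vec
    using bf_tangent[OF bf_zero, of x] that by simp
  have "\<alpha> (\<lambda>g. 0 * (\<lambda>g. 0) g + 0 * (\<lambda>g. 0) g) = 0 * \<alpha> (\<lambda>g. 0) + 0 * \<alpha> (\<lambda>g. 0)"
    by (rule cotangent_linear[OF \<alpha> t[OF refl] t[OF refl]])
  then show ?case by simp
next
  case (insert i I)
  have "\<alpha> (\<lambda>g. c i * v i g + 1 * (\<lambda>g. \<Sum>i\<in>I. c i * v i g) g) = c i * \<alpha> (v i) + 1 * \<alpha> (\<lambda>g. \<Sum>i\<in>I. c i * v i g)"
    by (rule cotangent_linear[OF \<alpha> _ tangent_lincomb]) (use insert in auto)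
  then show ?case using insert by simp
qed

lemma cotangent_lincomb:
  assumes "\<alpha> \<in> cotangent_space A x" "\<beta> \<in> cotangent_space A x"
  shows "(\<lambda>v. a * \<alpha> v + b * \<beta> v) \<in> cotangent_space A x"
proof -
  have "a * \<alpha> (\<lambda>g. c * v g + d * w g) + b * \<beta> (\<lambda>g. c * v g + d * w g) =
      c * (a * \<alpha> v + b * \<beta> v) + d * (a * \<alpha> w + b * \<beta> w)"
    if "v \<in> tangent_space A x" "w \<in> tangent_space A x" for v w c d
    unfolding cotangent_linear[OF assms(1) that] cotangent_linear[OF assms(2) that] by (simp add: algebra_simps)
  then show ?thesis using assms unfolding cotangent_space_def linear_on_tangent_def by simp
qed

lemma d_fun_cotangent: "d_fun A g x \<in> cotangent_space A x"
proof -
  have "d_fun A g x (\<lambda>g. a * v g + b * w g) = a * d_fun A g x v + b * d_fun A g x w"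
    if "v \<in> tangent_space A x" "w \<in> tangent_space A x" for v w a b
    using that tangent_lincomb2[OF that] by (simp add: d_fun_def)
  then show ?thesis unfolding cotangent_space_def linear_on_tangent_def by (simp add: d_fun_def)
qed

lemma d_fun_apply: "v \<in> tangent_space A x \<Longrightarrow> d_fun A g x v = v g"
  by (simp add: d_fun_def)

context
  fixes G
  assumes G: "b_form G"
    and closed: "\<And>U V W x. U \<in> bf \<Longrightarrow> V \<in> bf \<Longrightarrow> W \<in> bf \<Longrightarrow> koszul2 A G U V W x = 0"
    and nondeg: "\<And>x V. V \<in> bf \<Longrightarrow> (\<And>W. W \<in> bf \<Longrightarrow> G V W x = 0) \<Longrightarrow> bcl x V = b_zero A Z x"
begin

lemma form_matrix_injective:
  assumes lf: "local_frame N Es" and p: "p \<in> N"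
    and zero: "\<And>i. i < mdim A \<Longrightarrow> (\<Sum>j<mdim A. G (Es j) (Es i) p * c j) = 0"
  shows "\<forall>j<mdim A. c j = 0"
proof -
  let ?V = "\<lambda>q g. \<Sum>j<mdim A. c j * Es j q g"
  have Eb: "Es i \<in> bf" if "i < mdim A" for i by (rule local_frame_bf[OF lf that])
  have V: "?V \<in> bf" by (rule bf_const_lincomb) (use Eb in auto)
  have VE: "G ?V (Es i) p = 0" if "i < mdim A" for i
    using b_form_frame_left[OF G lf p Eb[OF that] V] zero[OF that]
    by (simp add: coef_frame_lincomb[OF lf p] mult.commute)
  have "bcl p ?V = b_zero A Z p"
  proof (rule nondeg[OF V])
    fix W assume "W \<in> bf"
    then show "G ?V W p = 0" using b_form_frame[OF G lf p V] VE by simp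
  qed
  then show ?thesis unfolding b_class_zero_iff[OF lf p V] by (simp add: coef_frame_lincomb[OF lf p])
qed

text \<open>The inverse of the transposed Gram matrix: pairing a combination of the frame with
  \<open>Es i\<close> sums over the first argument of \<open>G\<close>. In this index order the
  matrix takes the components of a covector directly to the coefficients of the dual
  b-vector.\<close>

definition inv_matrix :: "(nat \<Rightarrow> 'x vfield) \<Rightarrow> 'x \<Rightarrow> nat \<Rightarrow> nat \<Rightarrow> real" where
  "inv_matrix Es p = (SOME N. (\<forall>i<mdim A. \<forall>k<mdim A. (\<Sum>j<mdim A. G (Es j) (Es i) p * N j k) = (if i = k then 1 else 0)) \<and>
    (\<forall>i<mdim A. \<forall>k<mdim A. (\<Sum>j<mdim A. N i j * G (Es k) (Es j) p) = (if i = k then 1 else 0)))"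

lemma inv_matrix:
  assumes lf: "local_frame N Es" and p: "p \<in> N" and ik: "i < mdim A" "k < mdim A"
  shows "(\<Sum>j<mdim A. G (Es j) (Es i) p * inv_matrix Es p j k) = (if i = k then 1 else 0)"
    "(\<Sum>j<mdim A. inv_matrix Es p i j * G (Es k) (Es j) p) = (if i = k then 1 else 0)"
proof -
  have "\<exists>N. (\<forall>i<mdim A. \<forall>k<mdim A. (\<Sum>j<mdim A. G (Es j) (Es i) p * N j k) = (if i = k then 1 else 0)) \<and>
    (\<forall>i<mdim A. \<forall>k<mdim A. (\<Sum>j<mdim A. N i j * G (Es k) (Es j) p) = (if i = k then 1 else 0))"
    by (rule ex_matrix_inverse) (rule form_matrix_injective[OF lf p])
  note e = someI_ex[OF this, folded inv_matrix_def]
  show "(\<Sum>j<mdim A. G (Es j) (Es i) p * inv_matrix Es p j k) = (if i = k then 1 else 0)"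
    by (rule e[THEN conjunct1, rule_format, OF ik])
  show "(\<Sum>j<mdim A. inv_matrix Es p i j * G (Es k) (Es j) p) = (if i = k then 1 else 0)"
    by (rule e[THEN conjunct2, rule_format, OF ik])
qed

lemma inv_matrix_smooth:
  assumes lf: "local_frame N Es" and jk: "j < mdim A" "k < mdim A"
  shows "smooth_fun A N (\<lambda>p. inv_matrix Es p j k)"
proof (rule smooth_solve[OF local_frame_open[OF lf], where n = "mdim A" and M = "\<lambda>i j. G (Es j) (Es i)"
      and b = "\<lambda>i p. if i = k then 1 else 0" and a = "\<lambda>j p. inv_matrix Es p j k"])
  show "smooth_fun A N (G (Es j) (Es i))" if "i < mdim A" "j < mdim A" for i j
    by (rule smooth_fun_subset[OF b_form_smooth[OF G local_frame_bf[OF lf that(2)] local_frame_bf[OF lf that(1)]] subset_UNIV])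
  show "smooth_fun A N (\<lambda>p. if i = k then 1 else 0)" for i
    by (rule smooth_fun_const[OF local_frame_open[OF lf]])
  show "(\<Sum>j<mdim A. G (Es j) (Es i) p * inv_matrix Es p j k) = (if i = k then 1 else 0)" if "p \<in> N" "i < mdim A" for p i
    by (rule inv_matrix(1)[OF lf that jk(2)])
  show "\<forall>j<mdim A. c j = 0" if "p \<in> N" "\<And>i. i < mdim A \<Longrightarrow> (\<Sum>j<mdim A. G (Es j) (Es i) p * c j) = 0" for p c
    by (rule form_matrix_injective[OF lf that])
qed (rule jk(1))

text \<open>The triple product of the transposed inverse, the matrix and the inverse is evaluated in
  two ways, using skewness of the middle factor in one of them.\<close>

lemma inv_matrix_skew:
  assumes lf: "local_frame N Es" and p: "p \<in> N" and ik: "i < mdim A" "k < mdim A"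
  shows "inv_matrix Es p k i = - inv_matrix Es p i k"
proof -
  let ?N = "inv_matrix Es p" and ?n = "mdim A"
  let ?M = "\<lambda>a j. G (Es j) (Es a) p"
  have sk: "?M a j = - ?M j a" if "a < ?n" "j < ?n" for a j
    by (rule b_form_skew[OF G local_frame_bf[OF lf that(2)] local_frame_bf[OF lf that(1)]])
  have "(\<Sum>a<?n. ?N a i * (\<Sum>j<?n. ?M a j * ?N j k)) = (\<Sum>a<?n. if a = k then ?N a i else 0)"
    by (intro sum.cong refl) (simp add: inv_matrix(1)[OF lf p _ ik(2)])
  then have 1: "(\<Sum>a<?n. ?N a i * (\<Sum>j<?n. ?M a j * ?N j k)) = ?N k i" using ik by simp
  have "(\<Sum>a<?n. ?N a i * (\<Sum>j<?n. ?M a j * ?N j k)) = (\<Sum>a<?n. \<Sum>j<?n. - (?N j k * (?M j a * ?N a i)))"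
  proof (subst sum_distrib_left, intro sum.cong refl)
    fix a j assume "a \<in> {..<?n}" "j \<in> {..<?n}"
    then have "?M a j = - ?M j a" by (intro sk) auto
    then show "?N a i * (?M a j * ?N j k) = - (?N j k * (?M j a * ?N a i))" by simp
  qed
  also have "\<dots> = (\<Sum>j<?n. \<Sum>a<?n. - (?N j k * (?M j a * ?N a i)))" by (rule sum.swap)
  also have "\<dots> = (\<Sum>j<?n. - (?N j k * (\<Sum>a<?n. ?M j a * ?N a i)))"
    by (simp add: sum_negf sum_distrib_left)
  also have "\<dots> = (\<Sum>j<?n. if j = i then - ?N j k else 0)"
    by (intro sum.cong refl) (simp add: inv_matrix(1)[OF lf p _ ik(1)])
  also have "\<dots> = - ?N i k" using ik by simp
  finally show ?thesis using 1 by simp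
qed

lemma inv_matrix_pf:
  assumes lf: "local_frame N Es" and p: "p \<in> N" and m: "mdim A = 2 * m"
  shows "pf m (inv_matrix Es p) \<noteq> 0"
proof (rule pf_nonzero)
  show "inv_matrix Es p j k = - inv_matrix Es p k j" if "j < 2 * m" "k < 2 * m" for j k
    by (rule inv_matrix_skew[OF lf p]) (use that m in auto)
  fix c assume z: "\<And>k. k < 2 * m \<Longrightarrow> (\<Sum>j<2 * m. c j * inv_matrix Es p j k) = 0"
  show "\<forall>j<2 * m. c j = 0"
  proof (intro allI impI)
    fix i assume i: "i < 2 * m"
    have "c i = (\<Sum>j<2 * m. if j = i then c j else 0)" using i by simp
    also have "\<dots> = (\<Sum>j<2 * m. c j * (if j = i then 1 else 0))" by (intro sum.cong) auto
    also have "\<dots> = (\<Sum>j<2 * m. c j * (\<Sum>k<2 * m. inv_matrix Es p j k * G (Es i) (Es k) p))"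
      using inv_matrix(2)[OF lf p] i m by (intro sum.cong refl) simp
    also have "\<dots> = (\<Sum>j<2 * m. \<Sum>k<2 * m. c j * inv_matrix Es p j k * G (Es i) (Es k) p)"
      by (simp add: sum_distrib_left mult.assoc)
    also have "\<dots> = (\<Sum>k<2 * m. \<Sum>j<2 * m. c j * inv_matrix Es p j k * G (Es i) (Es k) p)" by (rule sum.swap)
    also have "\<dots> = (\<Sum>k<2 * m. (\<Sum>j<2 * m. c j * inv_matrix Es p j k) * G (Es i) (Es k) p)"
      by (simp add: sum_distrib_right)
    also have "\<dots> = 0" using z by simp
    finally show "c i = 0" .
  qed
qed

text \<open>The b-vector at \<open>x\<close> that is dual, under \<open>G\<close>, to the pullback
  of \<open>\<alpha>\<close> by the anchor. The witness is a global section, of which only the class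
  at \<open>x\<close> is determined.\<close>

definition sharp :: "'x \<Rightarrow> ('x tvec \<Rightarrow> real) \<Rightarrow> 'x vfield" where
  "sharp x \<alpha> = (SOME V. V \<in> bf \<and> (\<forall>W\<in>bf. G V W x = \<alpha> (W x)))"

lemma frame_sharp:
  assumes lf: "local_frame N Es" and p: "p \<in> N" and \<alpha>: "\<alpha> \<in> cotangent_space A p"
  defines "V \<equiv> \<lambda>q g. \<Sum>j<mdim A. (\<Sum>k<mdim A. inv_matrix Es p j k * \<alpha> (Es k p)) * Es j q g"
  shows "V \<in> bf" "W \<in> bf \<Longrightarrow> G V W p = \<alpha> (W p)"
proof -
  let ?n = "mdim A"
  have Eb: "Es i \<in> bf" if "i < ?n" for i by (rule local_frame_bf[OF lf that])
  show V: "V \<in> bf" unfolding V_def by (rule bf_const_lincomb) (use Eb in auto)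
  have VE: "G V (Es i) p = \<alpha> (Es i p)" if i: "i < ?n" for i
  proof -
    have "G V (Es i) p = (\<Sum>j<?n. (\<Sum>k<?n. inv_matrix Es p j k * \<alpha> (Es k p)) * G (Es j) (Es i) p)"
      using b_form_frame_left[OF G lf p Eb[OF i] V] by (simp add: V_def coef_frame_lincomb[OF lf p])
    also have "\<dots> = (\<Sum>j<?n. \<Sum>k<?n. G (Es j) (Es i) p * inv_matrix Es p j k * \<alpha> (Es k p))"
      by (simp add: sum_distrib_right sum_distrib_left mult_ac)
    also have "\<dots> = (\<Sum>k<?n. \<Sum>j<?n. G (Es j) (Es i) p * inv_matrix Es p j k * \<alpha> (Es k p))" by (rule sum.swap)
    also have "\<dots> = (\<Sum>k<?n. (\<Sum>j<?n. G (Es j) (Es i) p * inv_matrix Es p j k) * \<alpha> (Es k p))"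
      by (simp add: sum_distrib_right)
    also have "\<dots> = (\<Sum>k<?n. if k = i then \<alpha> (Es k p) else 0)"
      by (intro sum.cong refl) (simp add: inv_matrix(1)[OF lf p i])
    finally show ?thesis using i by simp
  qed
  show "G V W p = \<alpha> (W p)" if W: "W \<in> bf"
  proof -
    have "W p = (\<lambda>g. \<Sum>i<?n. coef N Es W i p * Es i p g)"
      by (intro ext coef_props(2)[OF lf W p])
    then have "\<alpha> (W p) = \<alpha> (\<lambda>g. \<Sum>i<?n. coef N Es W i p * Es i p g)" by (rule arg_cong)
    also have "\<dots> = (\<Sum>i<?n. coef N Es W i p * \<alpha> (Es i p))"
      by (rule cotangent_sum[OF \<alpha>]) (use bf_tangent[OF Eb] in auto)
    also have "\<dots> = G V W p" unfolding b_form_frame[OF G lf p V W] using VE by simp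
    finally show ?thesis by simp
  qed
qed

lemma sharp:
  assumes \<alpha>: "\<alpha> \<in> cotangent_space A p"
  shows "sharp p \<alpha> \<in> bf" "W \<in> bf \<Longrightarrow> G (sharp p \<alpha>) W p = \<alpha> (W p)"
proof -
  obtain N Es where N: "p \<in> N" "local_frame N Es" by (rule ex_coordinates)
  have "\<exists>V. V \<in> bf \<and> (\<forall>W\<in>bf. G V W p = \<alpha> (W p))" using frame_sharp[OF N(2,1) \<alpha>] by blast
  from someI_ex[OF this, folded sharp_def]
  show "sharp p \<alpha> \<in> bf" "W \<in> bf \<Longrightarrow> G (sharp p \<alpha>) W p = \<alpha> (W p)" by blast+
qed

lemma sharp_unique:
  assumes \<alpha>: "\<alpha> \<in> cotangent_space A p" and V: "V \<in> bf" "\<And>W. W \<in> bf \<Longrightarrow> G V W p = \<alpha> (W p)"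
  shows "bcl p (sharp p \<alpha>) = bcl p V" "sharp p \<alpha> p = V p"
proof -
  let ?D = "\<lambda>q g. (\<lambda>_. 1) q * V q g + (\<lambda>_. - 1) q * sharp p \<alpha> q g"
  have D: "?D \<in> bf" by (rule bf_lincomb2) (auto intro: smooth_fun_const V sharp(1)[OF \<alpha>])
  have "bcl p ?D = b_zero A Z p"
  proof (rule nondeg[OF D])
    fix W assume W: "W \<in> bf"
    have "G W ?D p = 1 * G W V p + (- 1) * G W (sharp p \<alpha>) p"
      by (rule b_form_linear[OF G W V(1) sharp(1)[OF \<alpha>]]) (auto intro: smooth_fun_const)
    also have "\<dots> = 0"
      using V(2)[OF W] sharp(2)[OF \<alpha> W] b_form_skew[OF G W V(1), of p] b_form_skew[OF G W sharp(1)[OF \<alpha>], of p] by simp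
    finally show "G ?D W p = 0" using b_form_skew[OF G D W, of p] by simp
  qed
  moreover obtain N Es where N: "p \<in> N" "local_frame N Es" by (rule ex_coordinates)
  have c: "coef N Es ?D i p = coef N Es V i p - coef N Es (sharp p \<alpha>) i p" if "i < mdim A" for i
    using coef_const_lincomb[OF N(2) _ _ N(1) that, of "{0, 1 :: nat}" "\<lambda>i. if i = 0 then V else sharp p \<alpha>" "\<lambda>i. if i = 0 then 1 else - 1"]
      V(1) sharp(1)[OF \<alpha>] by simp
  ultimately show e: "bcl p (sharp p \<alpha>) = bcl p V"
    unfolding b_class_zero_iff[OF N(2,1) D] b_class_eq_iff[OF N(2) sharp(1)[OF \<alpha>] V(1) N(1)] by (simp add: c)
  show "sharp p \<alpha> p = V p"
    using anchor_class[OF V(1), of p] anchor_class[OF sharp(1)[OF \<alpha>], of p] e by simp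
qed

lemma sharp_value:
  assumes lf: "local_frame N Es" and p: "p \<in> N" and \<alpha>: "\<alpha> \<in> cotangent_space A p"
  shows "sharp p \<alpha> p = (\<lambda>g. \<Sum>j<mdim A. (\<Sum>k<mdim A. inv_matrix Es p j k * \<alpha> (Es k p)) * Es j p g)"
  by (rule sharp_unique(2)[OF \<alpha> frame_sharp[OF lf p \<alpha>]])

definition \<pi> :: "'x bivector" where
  "\<pi> x \<alpha> \<beta> = \<alpha> (sharp x \<beta> x)"

lemma \<pi>_skew:
  assumes "\<alpha> \<in> cotangent_space A x" "\<beta> \<in> cotangent_space A x"
  shows "\<pi> x \<alpha> \<beta> = - \<pi> x \<beta> \<alpha>"
  unfolding \<pi>_def
  using sharp(2)[OF assms(1) sharp(1)[OF assms(2)]] sharp(2)[OF assms(2) sharp(1)[OF assms(1)]]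
    b_form_skew[OF G sharp(1)[OF assms(1)] sharp(1)[OF assms(2)], of x] by simp

lemma \<pi>_frame:
  assumes lf: "local_frame N Es" and p: "p \<in> N" and \<alpha>: "\<alpha> \<in> cotangent_space A p" and \<beta>: "\<beta> \<in> cotangent_space A p"
  shows "\<pi> p \<alpha> \<beta> = (\<Sum>j<mdim A. \<Sum>k<mdim A. inv_matrix Es p j k * \<alpha> (Es j p) * \<beta> (Es k p))"
proof -
  have "\<pi> p \<alpha> \<beta> = (\<Sum>j<mdim A. (\<Sum>k<mdim A. inv_matrix Es p j k * \<beta> (Es k p)) * \<alpha> (Es j p))"
    unfolding \<pi>_def sharp_value[OF lf p \<beta>]
    by (rule cotangent_sum[OF \<alpha>]) (use bf_tangent local_frame_bf[OF lf] in auto)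
  then show ?thesis by (simp add: sum_distrib_right sum_distrib_left mult_ac)
qed

section \<open>Hamiltonian fields and the Jacobi identity\<close>

definition ham :: "('x \<Rightarrow> real) \<Rightarrow> 'x vfield" where
  "ham h p = sharp p (d_fun A h p) p"

definition ham_coef :: "(nat \<Rightarrow> 'x vfield) \<Rightarrow> ('x \<Rightarrow> real) \<Rightarrow> nat \<Rightarrow> 'x \<Rightarrow> real" where
  "ham_coef Es h j q = (\<Sum>k<mdim A. inv_matrix Es q j k * d_fun A h q (Es k q))"

lemma ham_near:
  assumes lf: "local_frame N Es" and h: "smooth_fun A UNIV h"
  shows "j < mdim A \<Longrightarrow> smooth_fun A N (ham_coef Es h j)"
    "q \<in> N \<Longrightarrow> ham h q = (\<lambda>g. \<Sum>j<mdim A. ham_coef Es h j q * Es j q g)"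
proof -
  have oN: "open N" by (rule local_frame_open[OF lf])
  have Eb: "Es i \<in> bf" if "i < mdim A" for i by (rule local_frame_bf[OF lf that])
  show "smooth_fun A N (ham_coef Es h j)" if j: "j < mdim A"
  proof -
    have "smooth_fun A N (\<lambda>q. \<Sum>k<mdim A. inv_matrix Es q j k * Es k q h)"
    proof (intro smooth_fun_sum smooth_fun_mult oN)
      fix k assume "k \<in> {..<mdim A}"
      then have k: "k < mdim A" by simp
      show "smooth_fun A N (\<lambda>q. inv_matrix Es q j k)" by (rule inv_matrix_smooth[OF lf j k])
      show "smooth_fun A N (\<lambda>q. Es k q h)" by (rule bf_smooth[OF Eb[OF k] oN smooth_fun_subset[OF h subset_UNIV]])
    qed
    moreover have "ham_coef Es h j = (\<lambda>q. \<Sum>k<mdim A. inv_matrix Es q j k * Es k q h)"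
      unfolding ham_coef_def by (intro ext sum.cong refl) (use d_fun_apply[OF bf_tangent[OF Eb]] in simp)
    ultimately show ?thesis by simp
  qed
  show "ham h q = (\<lambda>g. \<Sum>j<mdim A. ham_coef Es h j q * Es j q g)" if "q \<in> N"
    unfolding ham_def ham_coef_def by (rule sharp_value[OF lf that d_fun_cotangent])
qed

text \<open>Tangency to \<open>Z\<close> is pointwise, since the value at each point is that of some
  b-field. Smoothness comes from the frame formula, in which the inverse matrix is smooth.\<close>

lemma ham_bf:
  assumes h: "smooth_fun A UNIV h"
  shows "ham h \<in> bf"
proof (rule bfI)
  show "ham h \<in> vector_fields A UNIV"
  proof (rule vector_field_local)
    fix p
    obtain N Es where N: "p \<in> N" "local_frame N Es" by (rule ex_coordinates)
    define s where "s = ham_coef Es h"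
    note s = ham_near[OF N(2) h, folded s_def]
    have "(\<lambda>q g. \<Sum>j<mdim A. s j q * Es j q g) \<in> vector_fields A N"
    proof (rule vector_field_lincomb[OF local_frame_open[OF N(2)]])
      fix j assume "j \<in> {..<mdim A}"
      then have j: "j < mdim A" by simp
      show "smooth_fun A N (s j)" by (rule s(1)[OF j])
      show "Es j \<in> vector_fields A N"
        by (rule vector_fields_subset[OF bf_vector_field[OF local_frame_bf[OF N(2) j]] subset_UNIV])
    qed simp
    then show "\<exists>N V'. open N \<and> p \<in> N \<and> V' \<in> vector_fields A N \<and> (\<forall>q\<in>N. ham h q = V' q)"
      using s(2) N(1) local_frame_open[OF N(2)] by blast
  qed
  fix x g W assume x: "x \<in> Z" "smooth_near A x g" "open W" "x \<in> W" "\<And>p. p \<in> W \<Longrightarrow> p \<in> Z \<Longrightarrow> g p = 0"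
  show "ham h x g = 0" unfolding ham_def by (rule bf_vanish[OF sharp(1)[OF d_fun_cotangent] x])
qed

text \<open>\<open>ham h\<close> is assembled from values, and on \<open>Z\<close> equal values do
  not give equal classes. Its coefficients are therefore found on a whole neighbourhood, where
  smoothness makes them unique, and then compared at \<open>p\<close>.\<close>

lemma ham_class:
  assumes h: "smooth_fun A UNIV h"
  shows "bcl p (ham h) = bcl p (sharp p (d_fun A h p))"
proof -
  obtain N Es where N: "p \<in> N" "local_frame N Es" by (rule ex_coordinates)
  define s where "s = ham_coef Es h"
  note s = ham_near[OF N(2) h, folded s_def]
  have co: "coef N Es (ham h) j p = s j p" if "j < mdim A" for j
  proof (rule coef_unique[OF N(2) ham_bf[OF h] local_frame_open[OF N(2)] order_refl _ _ N(1) that])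
    show "continuous_on N (s j)" if "j < mdim A" for j
      by (rule smooth_fun_continuous[OF local_frame_open[OF N(2)] s(1)[OF that]])
    show "ham h q g = (\<Sum>j<mdim A. s j q * Es j q g)" if "q \<in> N" for q g using s(2)[OF that] by simp
  qed
  let ?V = "\<lambda>q g. \<Sum>j<mdim A. (\<Sum>k<mdim A. inv_matrix Es p j k * d_fun A h p (Es k p)) * Es j q g"
  note fs = frame_sharp[OF N(2,1) d_fun_cotangent[of h p]]
  have "bcl p (ham h) = bcl p ?V"
    unfolding b_class_eq_iff[OF N(2) ham_bf[OF h] fs(1) N(1)]
    using co by (simp add: s_def ham_coef_def coef_frame_lincomb[OF N(2,1)])
  also have "\<dots> = bcl p (sharp p (d_fun A h p))"
    by (rule sharp_unique(1)[OF d_fun_cotangent fs, symmetric])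
  finally show ?thesis .
qed

lemma ham_form:
  assumes h: "smooth_fun A UNIV h" and W: "W \<in> bf"
  shows "G (ham h) W p = W p h"
proof -
  have "G W (ham h) p = G W (sharp p (d_fun A h p)) p"
    by (rule b_form_class_cong[OF G W ham_bf[OF h] sharp(1)[OF d_fun_cotangent] ham_class[OF h]])
  then show ?thesis
    using b_form_skew[OF G W ham_bf[OF h], of p] b_form_skew[OF G W sharp(1)[OF d_fun_cotangent], of p h p]
      sharp(2)[OF d_fun_cotangent W, of p h] d_fun_apply[OF bf_tangent[OF W]] by simp
qed

lemma bracket_ham: "poisson_bracket A \<pi> g h = (\<lambda>x. ham h x g)"
  unfolding poisson_bracket_def \<pi>_def ham_def
  by (intro ext d_fun_apply bf_tangent sharp(1) d_fun_cotangent)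

lemma ham_skew:
  assumes "smooth_fun A UNIV g" "smooth_fun A UNIV h"
  shows "ham h x g = - ham g x h"
  using \<pi>_skew[OF d_fun_cotangent d_fun_cotangent, of x g h] bracket_ham[of g h] bracket_ham[of h g]
  unfolding poisson_bracket_def by metis

lemma ham_smooth:
  assumes "smooth_fun A UNIV g" "smooth_fun A UNIV h"
  shows "smooth_fun A UNIV (\<lambda>x. ham h x g)"
  by (rule bf_smooth[OF ham_bf[OF assms(2)] open_UNIV assms(1)])

lemma \<pi>_bivector: "bivector_field A \<pi>"
  unfolding bivector_field_def
proof (intro conjI allI ballI impI)
  show "\<pi> x \<alpha> \<beta> = - \<pi> x \<beta> \<alpha>" if "\<alpha> \<in> cotangent_space A x" "\<beta> \<in> cotangent_space A x" for x \<alpha> \<beta>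
    by (rule \<pi>_skew[OF that])
  show "\<pi> x \<alpha> (\<lambda>v. a * \<beta> v + b * \<gamma> v) = a * \<pi> x \<alpha> \<beta> + b * \<pi> x \<alpha> \<gamma>"
    if "\<alpha> \<in> cotangent_space A x" "\<beta> \<in> cotangent_space A x" "\<gamma> \<in> cotangent_space A x" for x \<alpha> \<beta> \<gamma> a b
    unfolding \<pi>_skew[OF that(1) cotangent_lincomb[OF that(2,3)]] \<pi>_skew[OF that(1,2)] \<pi>_skew[OF that(1,3)]
    by (simp add: \<pi>_def algebra_simps)
  show "smooth_fun A UNIV (\<lambda>x. \<pi> x (d_fun A g x) (d_fun A h x))" if "smooth_fun A UNIV g" "smooth_fun A UNIV h" for g h
    using ham_smooth[OF that] bracket_ham[of g h] unfolding poisson_bracket_def by metis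
qed

text \<open>Evaluate closedness on the Hamiltonian fields of \<open>g\<close>, \<open>h\<close>,
  \<open>k\<close>. All terms become iterated Hamiltonian derivatives: the three derivative terms
  give minus the Jacobi sum and the three bracket terms give twice this sum. Skewness is also needed
  under a further derivative, which is the claim \<open>neg\<close>.\<close>

lemma \<pi>_poisson: "poisson_bivector A \<pi>"
  unfolding poisson_bivector_def
proof (intro conjI allI impI \<pi>_bivector)
  fix g h k x assume g: "smooth_fun A UNIV g" and h: "smooth_fun A UNIV h" and k: "smooth_fun A UNIV k"
  note b = ham_bf[OF g] ham_bf[OF h] ham_bf[OF k]
  have neg: "ham a x (\<lambda>p. ham b p c) = - ham a x (\<lambda>p. ham c p b)"
    if "smooth_fun A UNIV a" "smooth_fun A UNIV b" "smooth_fun A UNIV c" for a b c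
  proof -
    have "(\<lambda>p. ham b p c) = (\<lambda>p. 0 * ham c p b + (- 1) * ham c p b)"
      using ham_skew[OF that(3,2)] by (intro ext) simp
    then have "ham a x (\<lambda>p. ham b p c) = ham a x (\<lambda>p. 0 * ham c p b + (- 1) * ham c p b)" by (rule arg_cong)
    also have "\<dots> = 0 * ham a x (\<lambda>p. ham c p b) + (- 1) * ham a x (\<lambda>p. ham c p b)"
      by (rule tangent_linear[OF bf_tangent[OF ham_bf[OF that(1)]] smooth_near_UNIV[OF ham_smooth[OF that(2,3)]]
            smooth_near_UNIV[OF ham_smooth[OF that(2,3)]]])
    finally show ?thesis by simp
  qed
  have GG: "G (ham a) (ham b) = (\<lambda>p. ham b p a)" if "smooth_fun A UNIV a" "smooth_fun A UNIV b" for a b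
    by (intro ext ham_form that ham_bf)
  have GB: "G (lie_bracket A P Q) (ham c) x = - (P x (\<lambda>p. Q p c) - Q x (\<lambda>p. P p c))"
    if P: "P \<in> bf" and Q: "Q \<in> bf" and c: "smooth_fun A UNIV c" for P Q c
    using b_form_skew[OF G bf_lie_bracket[OF P Q] ham_bf[OF c], where p = x]
      ham_form[OF c bf_lie_bracket[OF P Q], where p = x] lie_bracket_apply[OF smooth_near_UNIV[OF c, where x = x], where V = P and W = Q] by simp
  have K: "koszul2 A G (ham g) (ham h) (ham k) x = 0" by (rule closed[OF b])
  have J: "poisson_bracket A \<pi> a (poisson_bracket A \<pi> b c) x = - ham a x (\<lambda>p. ham c p b)"
    if "smooth_fun A UNIV a" "smooth_fun A UNIV b" "smooth_fun A UNIV c" for a b c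
  proof -
    note s = ham_smooth[OF that(2,3)]
    show ?thesis unfolding bracket_ham ham_skew[OF that(1) s] ..
  qed
  show "poisson_bracket A \<pi> g (poisson_bracket A \<pi> h k) x + poisson_bracket A \<pi> h (poisson_bracket A \<pi> k g) x +
      poisson_bracket A \<pi> k (poisson_bracket A \<pi> g h) x = 0"
    unfolding J[OF g h k] J[OF h k g] J[OF k g h]
    using K neg[OF h k g] neg[OF g h k] neg[OF k g h]
    unfolding koszul2_def GG[OF h k] GG[OF g k] GG[OF g h] GB[OF b(1,2) k] GB[OF b(1,3) h] GB[OF b(2,3) g]
    by simp
qed

section \<open>The zeros of the top power and transversality\<close>

lemma wedge_frame:
  assumes af: "adapted_frame U X D r N Es" and p: "p \<in> N" and m: "mdim A = 2 * m"
    and \<alpha>s: "length \<alpha>s = 2 * m" "set \<alpha>s \<subseteq> cotangent_space A p"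
  shows "wedge_power m (\<pi> p) \<alpha>s = r p * (det_nat (mdim A) (\<lambda>a j. (\<alpha>s ! a) (D j p)) * pf m (inv_matrix Es p))"
proof -
  note lf = adapted_frame_local_frame[OF af]
  note c = af[unfolded adapted_frame_def]
  have bc: "b_chart A Z U X D r" and NU: "N \<subseteq> U" using c by blast+
  have pU: "p \<in> U" using p NU by blast
  have \<alpha>: "\<alpha>s ! a \<in> cotangent_space A p" if "a < 2 * m" for a using \<alpha>s that by auto
  have "wedge_power m (\<pi> p) \<alpha>s = det_nat (2 * m) (\<lambda>a j. (\<alpha>s ! a) (Es j p)) * pf m (inv_matrix Es p)"
    by (rule wedge_power_eq_pf[OF \<alpha>s(1)]) (use \<pi>_frame[OF lf p \<alpha> \<alpha>] m in simp)
  also have "det_nat (2 * m) (\<lambda>a j. (\<alpha>s ! a) (Es j p)) = r p * det_nat (mdim A) (\<lambda>a j. (\<alpha>s ! a) (D j p))"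
  proof (cases "0 < mdim A")
    case True
    have e: "(\<alpha>s ! a) (Es j p) = (if j = 0 then r p else 1) * (\<alpha>s ! a) (D j p)" if "a < 2 * m" "j < 2 * m" for a j
    proof -
      have j: "j < mdim A" using that m by simp
      have "Es j p = (\<lambda>g. \<Sum>i\<in>{j}. (if j = 0 then r p else 1) * D i p g)"
        using c[THEN conjunct2, THEN conjunct2, THEN conjunct2, THEN conjunct2, rule_format, OF j p] by (intro ext) simp
      then have "(\<alpha>s ! a) (Es j p) = (\<alpha>s ! a) (\<lambda>g. \<Sum>i\<in>{j}. (if j = 0 then r p else 1) * D i p g)" by (rule arg_cong)
      also have "\<dots> = (\<Sum>i\<in>{j}. (if j = 0 then r p else 1) * (\<alpha>s ! a) (D i p))"
        by (rule cotangent_sum[OF \<alpha>[OF that(1)]]) (use b_chart_D[OF bc j pU] in auto)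
      finally show ?thesis by simp
    qed
    have "det_nat (2 * m) (\<lambda>a j. (\<alpha>s ! a) (Es j p)) = det_nat (2 * m) (\<lambda>a j. (if j = 0 then r p else 1) * (\<alpha>s ! a) (D j p))"
      unfolding det_nat_def
    proof (intro sum.cong refl arg_cong2[of _ _ _ _ "(*)"] prod.cong)
      fix s i assume "s \<in> {s. s permutes {..<2 * m}}" and i: "i \<in> {..<2 * m}"
      then have s: "s permutes {..<2 * m}" by simp
      show "(\<alpha>s ! i) (Es (s i) p) = (if s i = 0 then r p else 1) * (\<alpha>s ! i) (D (s i) p)"
        by (rule e) (use i permutes_in_image[OF s, of i] in auto)
    qed
    also have "\<dots> = r p * det_nat (2 * m) (\<lambda>a j. (\<alpha>s ! a) (D j p))"
      by (rule det_nat_scale_column) (use True m in simp)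
    finally show ?thesis by (simp add: m)
  next
    case False
    \<comment> \<open>In dimension 0 the chart misses \<open>Z\<close>, so \<open>r\<close> is 1 and
      both determinants are those of the empty matrix.\<close>
    then have "r = (\<lambda>_. 1)" using b_chart_cases[OF bc] by auto
    then show ?thesis using False m by (simp add: det_nat_def)
  qed
  finally show ?thesis by simp
qed

text \<open>On \<open>Z\<close> the factor \<open>r\<close> makes all values of the top power
  vanish. Off \<open>Z\<close> the differentials of the coordinates detect that it is nonzero: their
  determinant against the coordinate fields is 1 and the Pfaffian does not vanish.\<close>

lemma \<pi>_zeros:
  assumes m: "mdim A = 2 * m"
  shows "top_power_zeros A m \<pi> = Z"
proof (rule Set.set_eqI)
  fix x
  obtain U X D r N Es where N: "x \<in> N" "adapted_frame U X D r N Es" using ex_adapted_frame_at[of x] by blast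
  note lf = adapted_frame_local_frame[OF N(2)]
  have bc: "b_chart A Z U X D r" and xU: "x \<in> U" using N unfolding adapted_frame_def by blast+
  show "x \<in> top_power_zeros A m \<pi> \<longleftrightarrow> x \<in> Z"
  proof
    assume "x \<in> Z"
    then have "r x = 0" using b_chart_Z[OF bc xU] by blast
    then show "x \<in> top_power_zeros A m \<pi>"
      unfolding top_power_zeros_def using wedge_frame[OF N(2,1) m] by simp
  next
    assume x: "x \<in> top_power_zeros A m \<pi>"
    let ?\<alpha>s = "map (\<lambda>i. d_fun A (X i) x) [0..<mdim A]"
    have l: "length ?\<alpha>s = 2 * m" and s: "set ?\<alpha>s \<subseteq> cotangent_space A x" using m d_fun_cotangent by auto
    have "wedge_power m (\<pi> x) ?\<alpha>s = 0" using x l s unfolding top_power_zeros_def by blast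
    moreover have "det_nat (mdim A) (\<lambda>a j. (?\<alpha>s ! a) (D j x)) = det_nat (mdim A) (\<lambda>i j. if i = j then 1 else 0)"
      unfolding det_nat_def
    proof (intro sum.cong refl arg_cong2[of _ _ _ _ "(*)"] prod.cong)
      fix s i assume "s \<in> {s. s permutes {..<mdim A}}" and i: "i \<in> {..<mdim A}"
      then have s: "s permutes {..<mdim A}" by simp
      have si: "s i < mdim A" using permutes_in_image[OF s, of i] i by simp
      show "(?\<alpha>s ! i) (D (s i) x) = (if i = s i then 1 else 0)"
        using i si d_fun_apply[OF b_chart_D[OF bc si xU]] b_chart_DX[OF bc si _ xU, of i] by auto
    qed
    ultimately have "r x * pf m (inv_matrix Es x) = 0"
      using wedge_frame[OF N(2,1) m l s] by (simp add: det_nat_id)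
    then show "x \<in> Z" using inv_matrix_pf[OF lf N(1) m] b_chart_Z[OF bc xU] by simp
  qed
qed

lemma smooth_near_list:
  assumes "\<forall>g\<in>set gs. smooth_near A x g"
  shows "\<exists>M. open M \<and> x \<in> M \<and> (\<forall>g\<in>set gs. smooth_fun A M g)"
  using assms
proof (induction gs)
  case Nil
  then show ?case by auto
next
  case (Cons g gs)
  then obtain M where M: "open M" "x \<in> M" "\<forall>g\<in>set gs. smooth_fun A M g" by auto
  obtain S where S: "open S" "x \<in> S" "smooth_fun A S g" using Cons.prems unfolding smooth_near_def by auto
  have "\<forall>h\<in>set (g # gs). smooth_fun A (M \<inter> S) h"
    using smooth_fun_subset[of A M _ "M \<inter> S"] smooth_fun_subset[of A S _ "M \<inter> S"] M S by auto
  then show ?case using M S by (intro exI[of _ "M \<inter> S"]) auto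
qed

text \<open>A kernel vector of the matrix of partial derivatives is a linear relation between the
  differentials at \<open>x\<close>, and a basis expands the zero covector only trivially.\<close>

lemma cotangent_basis_det:
  assumes bc: "b_chart A Z U X D r" and x: "x \<in> U" and l: "length gs = mdim A"
    and cb: "cotangent_basis A x (map (\<lambda>g. d_fun A g x) gs)"
  shows "det_nat (mdim A) (\<lambda>a j. D j x (gs ! a)) \<noteq> 0"
proof -
  let ?n = "mdim A"
  have "det_nat ?n (\<lambda>j a. D j x (gs ! a)) \<noteq> 0"
  proof (rule det_nat_nonzero)
    fix c assume z: "\<And>j. j < ?n \<Longrightarrow> (\<Sum>a<?n. D j x (gs ! a) * c a) = 0"
    let ?\<alpha>s = "map (\<lambda>g. d_fun A g x) gs"
    have sum0: "(\<Sum>a<?n. c a * (?\<alpha>s ! a) v) = 0" for v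
    proof (cases "v \<in> tangent_space A x")
      case True
      have "(\<Sum>a<?n. c a * (?\<alpha>s ! a) v) = (\<Sum>a<?n. \<Sum>j<?n. c a * (v (X j) * D j x (gs ! a)))"
      proof (rule sum.cong[OF refl])
        fix a assume "a \<in> {..<?n}"
        then have "(?\<alpha>s ! a) v = v (gs ! a)" using l d_fun_apply[OF True] by simp
        also have "\<dots> = (\<Sum>j<?n. v (X j) * D j x (gs ! a))" by (rule b_chart_expand[OF bc x True])
        finally show "c a * (?\<alpha>s ! a) v = (\<Sum>j<?n. c a * (v (X j) * D j x (gs ! a)))" by (simp add: sum_distrib_left)
      qed
      also have "\<dots> = (\<Sum>j<?n. \<Sum>a<?n. c a * (v (X j) * D j x (gs ! a)))" by (rule sum.swap)
      also have "\<dots> = (\<Sum>j<?n. v (X j) * (\<Sum>a<?n. D j x (gs ! a) * c a))"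
        by (simp add: sum_distrib_left mult_ac)
      also have "\<dots> = 0" using z by simp
      finally show ?thesis .
    next
      case False
      then show ?thesis using l by (intro sum.neutral ballI) (simp add: d_fun_def)
    qed
    have zero: "(\<lambda>v. 0) \<in> cotangent_space A x" unfolding cotangent_space_def linear_on_tangent_def by simp
    have un: "\<exists>!cs. length cs = length ?\<alpha>s \<and> (\<lambda>v. 0) = (\<lambda>v. \<Sum>i<length ?\<alpha>s. cs ! i * (?\<alpha>s ! i) v)"
      using cb zero unfolding cotangent_basis_def by blast
    have "map c [0..<?n] = map (\<lambda>_. 0) [0..<?n]"
    proof (rule ex1_unique[OF un])
      show "length (map c [0..<?n]) = length ?\<alpha>s \<and> (\<lambda>v. 0) = (\<lambda>v. \<Sum>i<length ?\<alpha>s. map c [0..<?n] ! i * (?\<alpha>s ! i) v)"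
        using l sum0 by (auto intro!: ext)
      show "length (map (\<lambda>_. 0 :: real) [0..<?n]) = length ?\<alpha>s \<and>
          (\<lambda>v. 0) = (\<lambda>v. \<Sum>i<length ?\<alpha>s. map (\<lambda>_. 0) [0..<?n] ! i * (?\<alpha>s ! i) v)"
        using l by (auto intro!: ext)
    qed
    then show "\<forall>j<?n. c j = 0" by simp
  qed
  then show ?thesis using det_nat_transpose[of ?n "\<lambda>a j. D j x (gs ! a)"] by simp
qed

text \<open>Near \<open>x\<close> the section is \<open>r * K\<close> in the trivialisation given by
  the \<open>gs\<close>. Its derivative along the normal coordinate field at a zero of
  \<open>r\<close> is \<open>K x\<close>, a nonzero determinant times a nonzero Pfaffian.\<close>

lemma \<pi>_transverse:
  assumes m: "mdim A = 2 * m" and x: "x \<in> Z" and l: "length gs = 2 * m" and sm: "\<forall>g\<in>set gs. smooth_near A x g"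
    and cb: "cotangent_basis A x (map (\<lambda>g. d_fun A g x) gs)"
  shows "\<exists>v\<in>tangent_space A x. v (\<lambda>p. wedge_power m (\<pi> p) (map (\<lambda>g. d_fun A g p) gs)) \<noteq> 0"
proof -
  obtain U X D r N Es where N: "x \<in> N" "adapted_frame U X D r N Es" using ex_adapted_frame_at[of x] by blast
  note af = N(2) and lf = adapted_frame_local_frame[OF N(2)]
  have bc: "b_chart A Z U X D r" and NU: "N \<subseteq> U" and xU: "x \<in> U" using N unfolding adapted_frame_def by blast+
  have r: "0 < mdim A" "r = X 0" "r x = 0" using b_chart_cases[OF bc] b_chart_Z[OF bc xU] x xU by auto
  obtain M where M: "open M" "x \<in> M" "\<forall>g\<in>set gs. smooth_fun A M g" using smooth_near_list[OF sm] by blast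
  let ?S = "M \<inter> N"
  have S: "open ?S" "x \<in> ?S" "?S \<subseteq> U" using M N local_frame_open[OF lf] NU by auto
  define K where "K p = det_nat (mdim A) (\<lambda>a j. D j p (gs ! a)) * pf m (inv_matrix Es p)" for p
  have sK: "smooth_fun A ?S K"
    unfolding K_def
  proof (intro smooth_fun_mult smooth_fun_det_nat S(1))
    show "smooth_fun A ?S (\<lambda>p. D j p (gs ! a))" if "a < mdim A" "j < mdim A" for a j
    proof (rule b_chart_D_smooth[OF bc that(2) S(1,3)])
      show "smooth_fun A ?S (gs ! a)"
        by (rule smooth_fun_subset[of A M]) (use M(3) l m that(1) in auto)
    qed
    show "smooth_fun A ?S (\<lambda>p. pf m (inv_matrix Es p))"
      unfolding pf_def divide_inverse
    proof (intro smooth_fun_mult smooth_fun_const smooth_fun_sum smooth_fun_prod S(1))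
      fix s i assume "s \<in> {s. s permutes {..<2 * m}}" and i: "i \<in> {..<m}"
      then have s: "s permutes {..<2 * m}" by simp
      show "smooth_fun A ?S (\<lambda>p. inv_matrix Es p (s (2 * i)) (s (2 * i + 1)))"
        by (rule smooth_fun_subset[OF inv_matrix_smooth[OF lf]])
          (use permutes_in_image[OF s, of "2 * i"] permutes_in_image[OF s, of "2 * i + 1"] i m in auto)
    qed
  qed
  have eq: "wedge_power m (\<pi> p) (map (\<lambda>g. d_fun A g p) gs) = r p * K p" if p: "p \<in> ?S" for p
  proof -
    have "wedge_power m (\<pi> p) (map (\<lambda>g. d_fun A g p) gs) =
        r p * (det_nat (mdim A) (\<lambda>a j. (map (\<lambda>g. d_fun A g p) gs ! a) (D j p)) * pf m (inv_matrix Es p))"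
      by (rule wedge_frame[OF af _ m]) (use p l d_fun_cotangent in auto)
    also have "det_nat (mdim A) (\<lambda>a j. (map (\<lambda>g. d_fun A g p) gs ! a) (D j p)) = det_nat (mdim A) (\<lambda>a j. D j p (gs ! a))"
      unfolding det_nat_def
    proof (intro sum.cong refl arg_cong2[of _ _ _ _ "(*)"] prod.cong)
      fix s i assume "s \<in> {s. s permutes {..<mdim A}}" and i: "i \<in> {..<mdim A}"
      then have s: "s permutes {..<mdim A}" by simp
      have si: "s i < mdim A" using permutes_in_image[OF s, of i] i by simp
      have "p \<in> U" using p NU by blast
      from d_fun_apply[OF b_chart_D[OF bc si this]]
      show "(map (\<lambda>g. d_fun A g p) gs ! i) (D (s i) p) = D (s i) p (gs ! i)" using i l m by simp
    qed
    finally show ?thesis by (simp add: K_def)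
  qed
  note t = b_chart_D[OF bc r(1) xU]
  have nr: "smooth_near A x r" by (rule smooth_nearI[OF b_chart_open[OF bc] xU b_chart_r[OF bc]])
  have nK: "smooth_near A x K" by (rule smooth_nearI[OF S(1,2) sK])
  have "D 0 x (\<lambda>p. r p * K p) = D 0 x (\<lambda>p. wedge_power m (\<pi> p) (map (\<lambda>g. d_fun A g p) gs))"
    by (rule tangent_germ[OF t smooth_near_mult[OF nr nK] S(1,2)]) (simp add: eq)
  moreover have "D 0 x (\<lambda>p. r p * K p) = D 0 x r * K x + r x * D 0 x K" by (rule tangent_mult[OF t nr nK])
  moreover have "D 0 x r = 1" using b_chart_DX[OF bc r(1) r(1) xU] r(2) by simp
  moreover have "K x \<noteq> 0"
    unfolding K_def using cotangent_basis_det[OF bc xU _ cb] inv_matrix_pf[OF lf N(1) m] l m by simp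
  ultimately have "D 0 x (\<lambda>p. wedge_power m (\<pi> p) (map (\<lambda>g. d_fun A g p) gs)) \<noteq> 0" using r(3) by simp
  then show ?thesis using t by blast
qed

lemma admits_log_symplectic_of_form:
  assumes "even (mdim A)"
  shows "admits_log_symplectic A Z"
proof -
  obtain m where m: "mdim A = 2 * m" using assms by (elim evenE)
  have "log_symplectic A \<pi>"
    unfolding log_symplectic_def
  proof (intro conjI \<pi>_poisson exI[of _ m] m ballI allI impI)
    fix x gs assume "x \<in> top_power_zeros A m \<pi>" "length gs = 2 * m" "\<forall>g\<in>set gs. smooth_near A x g"
      "cotangent_basis A x (map (\<lambda>g. d_fun A g x) gs)"
    then show "\<exists>v\<in>tangent_space A x. v (\<lambda>p. wedge_power m (\<pi> p) (map (\<lambda>g. d_fun A g p) gs)) \<noteq> 0"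
      unfolding \<pi>_zeros[OF m] by (intro \<pi>_transverse[OF m])
  qed
  moreover have "top_power_zeros A (mdim A div 2) \<pi> = Z" using \<pi>_zeros[OF m] m by simp
  ultimately show ?thesis unfolding admits_log_symplectic_def by blast
qed

end

end

section \<open>The log-symplectic structure on the total space\<close>

context bmap
begin

text \<open>The tube lemma: \<open>f\<close> is a closed map, being continuous from a compact to a
  Hausdorff space, so the complement of the image of \<open>- W\<close> is open.\<close>

lemma compact_tube:
  assumes "compact (UNIV :: 'x set)" "open W" "f -` {y} \<subseteq> W"
  obtains T where "open T" "y \<in> T" "f -` T \<subseteq> W"
proof -
  have "compact (- W)"
    using compact_Int_closed[OF assms(1), of "- W"] assms(2) by (simp add: closed_Compl)
  moreover have "continuous_on (- W) f"
    using f_smooth continuous_on_subset unfolding smooth_map_def by blast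
  ultimately have "closed (f ` (- W))" by (intro compact_imp_closed compact_continuous_image)
  then show thesis using that[of "- (f ` (- W))"] assms(3) by auto
qed

theorem tame_log_symplectic:
  fixes J \<omega> c
  assumes compX: "compact (UNIV :: 'x set)" and compY: "compact (UNIV :: 'y set)"
    and J: "b_almost_complex A ZX J" and \<omega>: "b_symplectic B ZY \<omega>" and c: "c \<in> dR_H2 A UNIV"
    and tame: "form_map_tame A ZX B ZY \<omega> f J"
    and fib: "\<forall>y. \<exists>W \<eta>. open W \<and> f -` {y} \<subseteq> W \<and> closed_two_form A W \<eta> \<and>
           dR_class A W \<eta> = dR_restrict A W c \<and>
           (\<forall>x\<in>W. tames_on_kernel A ZX B ZY f (anchor_pullback \<eta>) J x)"
    and ev: "even (mdim A)"
  shows "admits_log_symplectic A ZX"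
proof -
  have \<omega>2: "b_two_form B ZY \<omega>" and \<omega>c: "b_closed B ZY \<omega>" using \<omega> by (auto simp: b_symplectic_def)
  note P = pull_b_form[OF \<omega>2 \<omega>c] and Pc = pull_closed[OF \<omega>2 \<omega>c]
  have "\<exists>\<gamma>. closed_two_form A UNIV \<gamma> \<and> c = dR_class A UNIV \<gamma>" using c by (auto simp: dR_H2_def)
  then obtain \<gamma> where \<gamma>': "closed_two_form A UNIV \<gamma> \<and> c = dR_class A UNIV \<gamma>" ..
  note \<gamma> = \<gamma>'[THEN conjunct1] \<gamma>'[THEN conjunct2]
  \<comment> \<open>All data attached to one point \<open>y\<close> in a single predicate, so that
    choice functions can be extracted one after the other.\<close>
  define Q where "Q y W \<eta> \<alpha> \<alpha>' \<longleftrightarrow> open W \<and> f -` {y} \<subseteq> W \<and> two_form A W \<eta> \<and> one_form A W \<alpha> \<and> one_form A UNIV \<alpha>' \<and>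
      (\<forall>U\<in>X.vf. \<forall>V\<in>X.vf. \<forall>x\<in>W. \<eta> x (U x) (V x) - \<gamma> x (U x) (V x) =
        koszul1 A (\<lambda>V p. \<alpha> p (V p)) U V x + koszul1 A (\<lambda>V p. \<alpha>' p (V p)) U V x) \<and>
      (\<forall>x\<in>W. tames_on_kernel A ZX B ZY f (anchor_pullback \<eta>) J x)"
    for y :: 'y and W :: "'x set" and \<eta> :: "'x form2" and \<alpha> \<alpha>' :: "'x form1"
  have "\<forall>y. \<exists>W \<eta> \<alpha> \<alpha>'. Q y W \<eta> \<alpha> \<alpha>'"
  proof
    fix y
    obtain W \<eta> where W: "open W" "f -` {y} \<subseteq> W" "closed_two_form A W \<eta>" "dR_class A W \<eta> = dR_restrict A W c"
      "\<forall>x\<in>W. tames_on_kernel A ZX B ZY f (anchor_pullback \<eta>) J x" using spec[OF fib, of y] by (elim exE conjE)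
    \<comment> \<open>A form lies in its own class, hence in the restriction of \<open>c\<close>.
      This means that it is cohomologous on \<open>W\<close> to some representative of
      \<open>c\<close>, which in turn differs from \<open>\<gamma>\<close> by the differential of a
      global one-form.\<close>
    have "\<eta> \<in> dR_restrict A W c" using X.dR_class_self[OF W(1,3)] W(4) by simp
    then obtain \<gamma>' where \<gamma>': "\<gamma>' \<in> c" "\<eta> \<in> dR_class A W \<gamma>'" unfolding dR_restrict_def by blast
    then have "cohomologous A W \<eta> \<gamma>'" "cohomologous A UNIV \<gamma>' \<gamma>" unfolding \<gamma>(2) dR_class_def by blast+
    then obtain \<alpha> \<alpha>' where \<alpha>: "one_form A W \<alpha>" "\<forall>U\<in>vector_fields A W. \<forall>V\<in>vector_fields A W. \<forall>x\<in>W.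
        \<eta> x (U x) (V x) - \<gamma>' x (U x) (V x) = koszul1 A (\<lambda>V p. \<alpha> p (V p)) U V x"
      and \<alpha>': "one_form A UNIV \<alpha>'" "\<forall>U\<in>X.vf. \<forall>V\<in>X.vf. \<forall>x\<in>UNIV.
        \<gamma>' x (U x) (V x) - \<gamma> x (U x) (V x) = koszul1 A (\<lambda>V p. \<alpha>' p (V p)) U V x"
      unfolding cohomologous_def by blast
    have "\<eta> x (U x) (V x) - \<gamma> x (U x) (V x) =
        koszul1 A (\<lambda>V p. \<alpha> p (V p)) U V x + koszul1 A (\<lambda>V p. \<alpha>' p (V p)) U V x"
      if "U \<in> X.vf" "V \<in> X.vf" "x \<in> W" for U V x
    proof -
      note UW = X.vector_fields_subset[OF that(1) subset_UNIV] X.vector_fields_subset[OF that(2) subset_UNIV]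
      show ?thesis
        using \<alpha>(2)[rule_format, OF UW that(3)] \<alpha>'(2)[rule_format, OF that(1,2) UNIV_I, of x] by linarith
    qed
    moreover have "two_form A W \<eta>" using W(3) by (simp add: closed_two_form_def)
    ultimately have "Q y W \<eta> \<alpha> \<alpha>'" unfolding Q_def using W(1,2,5) \<alpha>(1) \<alpha>'(1) by blast
    then show "\<exists>W \<eta> \<alpha> \<alpha>'. Q y W \<eta> \<alpha> \<alpha>'" by blast
  qed
  from choice[OF this] obtain W where "\<forall>y. \<exists>\<eta> \<alpha> \<alpha>'. Q y (W y) \<eta> \<alpha> \<alpha>'" ..
  from choice[OF this] obtain \<eta> where "\<forall>y. \<exists>\<alpha> \<alpha>'. Q y (W y) (\<eta> y) \<alpha> \<alpha>'" ..
  from choice[OF this] obtain \<alpha> where "\<forall>y. \<exists>\<alpha>'. Q y (W y) (\<eta> y) (\<alpha> y) \<alpha>'" ..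
  from choice[OF this] obtain \<alpha>' where Q: "\<forall>y. Q y (W y) (\<eta> y) (\<alpha> y) (\<alpha>' y)" ..
  note Qy = Q[rule_format, unfolded Q_def]
  define R where "R y \<rho> N K \<longleftrightarrow> smooth_fun B UNIV \<rho> \<and> (\<forall>z. 0 \<le> \<rho> z) \<and> open N \<and> y \<in> N \<and> (\<forall>z\<in>N. \<rho> z = 1) \<and>
      closed K \<and> f -` K \<subseteq> W y \<and> (\<forall>z. z \<notin> K \<longrightarrow> \<rho> z = 0)" for y and \<rho> :: "'y \<Rightarrow> real" and N K :: "'y set"
  have "\<forall>y. \<exists>\<rho> N K. R y \<rho> N K"
  proof
    fix y
    obtain T where T: "open T" "y \<in> T" "f -` T \<subseteq> W y"
      by (rule compact_tube[OF compX]) (use Qy[of y] in blast)+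
    obtain \<rho> N K where b: "smooth_fun B UNIV \<rho>" "\<And>p. 0 \<le> \<rho> p" "\<And>p. \<rho> p \<le> 1"
      "open N" "y \<in> N" "N \<subseteq> T" "\<And>p. p \<in> N \<Longrightarrow> \<rho> p = 1" "closed K" "K \<subseteq> T" "\<And>p. p \<notin> K \<Longrightarrow> \<rho> p = 0"
      by (rule Y.ex_bump[OF T(1,2)]) blast
    have "f -` K \<subseteq> W y" using b(9) T(3) by blast
    then have "R y \<rho> N K" unfolding R_def using b by blast
    then show "\<exists>\<rho> N K. R y \<rho> N K" by blast
  qed
  from choice[OF this] obtain \<rho> where "\<forall>y. \<exists>N K. R y (\<rho> y) N K" ..
  from choice[OF this] obtain N where "\<forall>y. \<exists>K. R y (\<rho> y) (N y) K" ..
  from choice[OF this] obtain K where R: "\<forall>y. R y (\<rho> y) (N y) (K y)" ..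
  note Ry = R[rule_format, unfolded R_def]
  obtain I where I: "finite I" "UNIV \<subseteq> (\<Union>y\<in>I. N y)"
  proof -
    have "open (N y)" "y \<in> N y" for y using Ry[of y] by blast+
    then show thesis using compactE_image[OF compY, of UNIV N] that by (metis UNIV_I UN_iff subsetI)
  qed
  define s where "s z = (\<Sum>y\<in>I. \<rho> y z)" for z
  have s: "s z > 0" for z
  proof -
    obtain y where y: "y \<in> I" "z \<in> N y" using I(2) by blast
    have "\<rho> y z \<le> s z" unfolding s_def by (rule member_le_sum[OF y(1) _ I(1)]) (use Ry in blast)
    moreover have "\<rho> y z = 1" using Ry[of y] y(2) by blast
    ultimately show ?thesis by simp
  qed
  \<comment> \<open>The bump functions normalised to a partition of unity; \<open>s\<close> is
    positive because each point lies in a set of the finite cover on which a bump function is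
    1.\<close>
  define \<sigma> where "\<sigma> y z = \<rho> y z / s z" for y z
  have \<sigma>s: "smooth_fun B UNIV (\<sigma> y)" for y
    unfolding \<sigma>_def s_def
  proof (rule Y.smooth_fun_divide[OF open_UNIV])
    show "(\<Sum>y\<in>I. \<rho> y p) \<noteq> 0" for p using s[of p] by (simp add: s_def)
    show "smooth_fun B UNIV (\<rho> y)" using Ry by blast
    show "smooth_fun B UNIV (\<lambda>p. \<Sum>y\<in>I. \<rho> y p)"
      by (rule Y.smooth_fun_sum[OF open_UNIV]) (use Ry in blast)
  qed
  have \<sigma>0: "0 \<le> \<sigma> y z" for y z using Ry[of y] s[of z] by (auto simp: \<sigma>_def)
  have \<sigma>1: "(\<Sum>y\<in>I. \<sigma> y z) = 1" for z
    using s[of z] by (simp add: \<sigma>_def sum_divide_distrib[symmetric] s_def[symmetric])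
  define r where "r y = (\<lambda>x. \<sigma> y (f x))" for y
  have "\<exists>H. X.b_form H \<and> (\<forall>U\<in>X.bf. \<forall>V\<in>X.bf. \<forall>W\<in>X.bf. \<forall>x. koszul2 A H U V W x = 0) \<and>
      (\<forall>U\<in>X.bf. \<forall>V\<in>X.bf. \<forall>x. (\<forall>i\<in>I. U x (r i) = 0) \<longrightarrow> (\<forall>i\<in>I. V x (r i) = 0) \<longrightarrow>
        H U V x = (\<Sum>i\<in>I. if x \<in> W i then r i x * \<eta> i x (U x) (V x) else 0))"
  proof (rule X.ex_glued_form[where I = I and r = r and W = W and K = "\<lambda>y. f -` K y" and \<gamma> = \<gamma> and \<eta> = \<eta> and \<alpha> = \<alpha> and \<alpha>' = \<alpha>'])
    show "smooth_fun A UNIV (r y)" for y using pullback[OF open_UNIV \<sigma>s[of y]] by (simp add: r_def)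
    show "closed (f -` K y)" for y
    proof -
      have "open (f -` (- K y))" by (rule f_open) (use Ry[of y] in auto)
      then show ?thesis by (simp add: vimage_Compl closed_def)
    qed
    show "r y x = 0" if "x \<notin> f -` K y" for y x using Ry[of y] that by (simp add: r_def \<sigma>_def)
  next
    fix H assume "X.b_form H" "\<And>U V W x. U \<in> X.bf \<Longrightarrow> V \<in> X.bf \<Longrightarrow> W \<in> X.bf \<Longrightarrow> koszul2 A H U V W x = 0"
      "\<And>U V x. U \<in> X.bf \<Longrightarrow> V \<in> X.bf \<Longrightarrow> (\<And>i. i \<in> I \<Longrightarrow> U x (r i) = 0) \<Longrightarrow> (\<And>i. i \<in> I \<Longrightarrow> V x (r i) = 0) \<Longrightarrow>
        H U V x = (\<Sum>i\<in>I. if x \<in> W i then r i x * \<eta> i x (U x) (V x) else 0)"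
    then show ?thesis by (intro exI[of _ H] conjI ballI allI impI) auto
  qed (use I(1) \<gamma>(1) \<sigma>1 Qy Ry in \<open>auto simp: r_def\<close>)
  then obtain H where H: "X.b_form H" "\<forall>U\<in>X.bf. \<forall>V\<in>X.bf. \<forall>W\<in>X.bf. \<forall>x. koszul2 A H U V W x = 0"
    "\<forall>U\<in>X.bf. \<forall>V\<in>X.bf. \<forall>x. (\<forall>i\<in>I. U x (r i) = 0) \<longrightarrow> (\<forall>i\<in>I. V x (r i) = 0) \<longrightarrow>
        H U V x = (\<Sum>i\<in>I. if x \<in> W i then r i x * \<eta> i x (U x) (V x) else 0)" by blast
  have ker0: "pull \<omega> V V' x = 0" and kerr: "V x (r y) = 0"
    if V: "V \<in> X.bf" and V': "V' \<in> X.bf" and z: "bd x (b_class A ZX x V) = b_zero B ZY (f x)" for V V' x y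
  proof -
    obtain S C D r0 M Es where M: "f x \<in> M" "Y.adapted_frame S C D r0 M Es" using Y.ex_adapted_frame_at[of "f x"] by blast
    note lf = af_frame[OF M(2)]
    have bf: "(\<lambda>q g. \<Sum>j<mdim B. pcoef M Es V j x * Es j q g) \<in> Y.bf"
      by (rule Y.bf_const_lincomb) (use Y.local_frame_bf[OF lf] in auto)
    have "pcoef M Es V j x = 0" if "j < mdim B" for j
      using z that unfolding bd_class[OF M(2,1) V] Y.b_class_zero_iff[OF lf M(1) bf]
      by (simp add: Y.coef_frame_lincomb[OF lf M(1)])
    then show "pull \<omega> V V' x = 0" unfolding pull_expand[OF \<omega>2 \<omega>c M(2,1) V V'] by simp
    have "differential B f x (V x) (\<sigma> y) = anchor (f x) (b_zero B ZY (f x)) (\<sigma> y)"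
      using bd_anchor[OF X.b_fibreI[OF V], of x] unfolding z X.anchor_class[OF V] by simp
    also have "\<dots> = 0" unfolding Y.b_zero_class Y.anchor_class[OF Y.bf_zero] ..
    finally show "V x (r y) = 0"
      using Y.smooth_near_UNIV[OF \<sigma>s[of y]] by (simp add: differential_def r_def)
  qed
  have pull_eq: "b_pullback A ZX B ZY f \<omega> x (b_class A ZX x V) (b_class A ZX x V') = pull \<omega> V V' x" for V V' x
    unfolding b_pullback_def b_differential_eq pull_def[OF \<omega>2 \<omega>c] ..
  have tame': "0 < pull \<omega> V V' x" if V: "V \<in> X.bf" "V' \<in> X.bf" "J x (b_class A ZX x V) = b_class A ZX x V'"
    and nz: "bd x (b_class A ZX x V) \<noteq> b_zero B ZY (f x)" for V V' x
  proof -
    have "b_class A ZX x V \<in> b_fibre A ZX x - b_kernel A ZX B ZY f x"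
      using X.b_fibreI[OF V(1)] nz by (simp add: b_kernel_def b_differential_eq)
    then have "0 < b_pullback A ZX B ZY f \<omega> x (b_class A ZX x V) (J x (b_class A ZX x V))"
      using tame unfolding form_map_tame_def by blast
    then show ?thesis unfolding V(3) pull_eq .
  qed
  \<comment> \<open>The kernel is invariant under \<open>J\<close>. Otherwise tameness at
    \<open>V'\<close> makes the pairing of \<open>V'\<close> with its image under \<open>J\<close>
    positive, but this image is represented by \<open>- V\<close>, which lies in the kernel and
    pairs to 0.\<close>
  have Jker: "bd x (b_class A ZX x V') = b_zero B ZY (f x)"
    if V: "V \<in> X.bf" "V' \<in> X.bf" "J x (b_class A ZX x V) = b_class A ZX x V'"
      and z: "bd x (b_class A ZX x V) = b_zero B ZY (f x)" for V V' x
  proof (rule ccontr)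
    assume nz: "bd x (b_class A ZX x V') \<noteq> b_zero B ZY (f x)"
    let ?mV = "\<lambda>q g. (\<lambda>_. - 1) q * V q g + (\<lambda>_. 0) q * V q g"
    have mV: "?mV \<in> X.bf" by (rule X.bf_lincomb2) (auto intro: X.smooth_fun_const V)
    have "J x (b_class A ZX x V') = b_class A ZX x (\<lambda>q g. - 1 * V q g)"
      using X.J_square[OF J X.b_fibreI[OF V(1)], of x] unfolding V(3) X.b_lincomb_class1[OF V(1)] .
    then have "J x (b_class A ZX x V') = b_class A ZX x ?mV" by simp
    from tame'[OF V(2) mV this nz] have "0 < pull \<omega> V' ?mV x" .
    also have "pull \<omega> V' ?mV x = - 1 * pull \<omega> V' V x + 0 * pull \<omega> V' V x"
      by (rule X.b_form_linear[OF P V(2,1,1)]) (auto intro: X.smooth_fun_const)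
    finally show False using X.b_form_skew[OF P V(2,1), of x] ker0[OF V(1,2) z] by simp
  qed
  have pos: "0 \<le> pull \<omega> V V' x \<and> (pull \<omega> V V' x = 0 \<longrightarrow> 0 < H V V' x)"
    if V: "V \<in> X.bf" "V' \<in> X.bf" "J x (b_class A ZX x V) = b_class A ZX x V'" and nz: "b_class A ZX x V \<noteq> b_zero A ZX x" for x V V'
  proof (cases "bd x (b_class A ZX x V) = b_zero B ZY (f x)")
    case False
    then show ?thesis using tame'[OF V] by auto
  next
    case True
    note z = True and z' = Jker[OF V True]
    have ker: "b_class A ZX x V \<in> b_kernel A ZX B ZY f x"
      using X.b_fibreI[OF V(1)] z by (simp add: b_kernel_def b_differential_eq)
    have "H V V' x = (\<Sum>i\<in>I. if x \<in> W i then r i x * \<eta> i x (V x) (V' x) else 0)"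
      using H(3) V(1,2) kerr[OF V(1,1) z] kerr[OF V(2,2) z'] by blast
    also have "\<dots> > 0"
    proof -
      have tm: "0 < \<eta> i x (V x) (V' x)" if "x \<in> W i" for i
      proof -
        have "tames_on_kernel A ZX B ZY f (anchor_pullback (\<eta> i)) J x" using Qy[of i] that by blast
        then have "0 < anchor_pullback (\<eta> i) x (b_class A ZX x V) (J x (b_class A ZX x V))"
          using ker nz unfolding tames_on_kernel_def by blast
        then show ?thesis
          unfolding V(3) anchor_pullback_def X.anchor_class[OF V(1)] X.anchor_class[OF V(2)] .
      qed
      have r0: "0 \<le> r i x" for i by (simp add: r_def \<sigma>0)
      obtain i where i: "i \<in> I" "r i x \<noteq> 0"
      proof -
        have "\<not> (\<forall>i\<in>I. r i x = 0)"
        proof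
          assume "\<forall>i\<in>I. r i x = 0"
          then have "(\<Sum>i\<in>I. \<sigma> i (f x)) = 0" by (simp add: r_def)
          then show False using \<sigma>1[of "f x"] by simp
        qed
        then show thesis using that by blast
      qed
      \<comment> \<open>A nonzero weight places \<open>x\<close> in \<open>W i\<close>, so the
        \<open>if\<close> does not discard the term that makes the sum positive.\<close>
      have "f x \<in> K i" using i(2) Ry[of i] by (auto simp: r_def \<sigma>_def)
      then have xi: "x \<in> W i" using Ry[of i] by blast
      show ?thesis
      proof (rule sum_pos2[OF I(1) i(1)])
        show "0 < (if x \<in> W i then r i x * \<eta> i x (V x) (V' x) else 0)"
          using xi tm[OF xi] r0[of i] i(2) by simp
        show "0 \<le> (if x \<in> W j then r j x * \<eta> j x (V x) (V' x) else 0)" for j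
          using tm[of j] r0[of j] by (simp add: less_imp_le)
      qed
    qed
    finally show ?thesis using ker0[OF V(1,2) z] by simp
  qed
  obtain t where t: "\<And>x V V'. V \<in> X.bf \<Longrightarrow> V' \<in> X.bf \<Longrightarrow> J x (b_class A ZX x V) = b_class A ZX x V' \<Longrightarrow>
      b_class A ZX x V \<noteq> b_zero A ZX x \<Longrightarrow> 0 < pull \<omega> V V' x + t * H V V' x"
    by (rule X.tame_perturbation[OF J compX P H(1) pos]) blast+
  let ?G = "\<lambda>V W p. pull \<omega> V W p + t * H V W p"
  show ?thesis
  proof (rule X.admits_log_symplectic_of_form[OF X.b_form_add[OF P H(1)] _ _ ev])
    show "koszul2 A ?G U V W x = 0" if "U \<in> X.bf" "V \<in> X.bf" "W \<in> X.bf" for U V W x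
      unfolding X.koszul2_add[OF P H(1) that] Pc[OF that] using H(2) that by simp
    \<comment> \<open>Nondegeneracy from taming: a nonzero class pairs positively with a
      representative of its image under \<open>J\<close>.\<close>
    show "b_class A ZX x V = b_zero A ZX x" if V: "V \<in> X.bf" and z: "\<And>W. W \<in> X.bf \<Longrightarrow> ?G V W x = 0" for x V
    proof (rule ccontr)
      assume nz: "b_class A ZX x V \<noteq> b_zero A ZX x"
      obtain V' where V': "V' \<in> X.bf" "J x (b_class A ZX x V) = b_class A ZX x V'"
        by (rule X.b_fibreE[OF X.J_fibre[OF J X.b_fibreI[OF V, of x]]])
      show False using t[OF V V' nz] z[OF V'(1)] by simp
    qed
  qed
qed

end

theorem theorem3p4:
  fixes A :: "('x::t2_space, 'e::real_inner) atlas"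
    and B :: "('y::t2_space, 'h::real_inner) atlas"
    and ZX :: "'x set" and ZY :: "'y set"
    and OrX :: "'x \<Rightarrow> 'x bvec list set" and OrY :: "'y \<Rightarrow> 'y bvec list set"
    and f :: "'x \<Rightarrow> 'y"
    and J :: "'x \<Rightarrow> 'x bvec \<Rightarrow> 'x bvec"
    and \<omega>Y :: "'y bform2"
    and c :: "'x form2 set"
  assumes "b_manifold A ZX" and "compact (UNIV :: 'x set)" and "connected (UNIV :: 'x set)"
    and "even (mdim A)" and "b_orientation A ZX OrX"
    and "b_manifold B ZY" and "compact (UNIV :: 'y set)" and "connected (UNIV :: 'y set)"
    and "even (mdim B)" and "b_orientation B ZY OrY"
    and "b_map A ZX B ZY f"
    and "b_almost_complex A ZX J" and "J_induces_orientation A ZX J OrX"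
    and "b_symplectic B ZY \<omega>Y" and "form_induces_orientation B ZY \<omega>Y OrY"
    and "c \<in> dR_H2 A UNIV"
    and "form_map_tame A ZX B ZY \<omega>Y f J"
    and "\<forall>y. \<exists>W \<eta>. open W \<and> f -` {y} \<subseteq> W \<and> closed_two_form A W \<eta> \<and>
           dR_class A W \<eta> = dR_restrict A W c \<and>
           (\<forall>x\<in>W. tames_on_kernel A ZX B ZY f (anchor_pullback \<eta>) J x)"
  shows "admits_log_symplectic A ZX"
proof -
  interpret bmap A ZX B ZY f
    by unfold_locales (fact assms)+
  show ?thesis by (rule tame_log_symplectic[OF assms(2,7,12,14,16,17,18,4)])
qed

end
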